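(* Let $\mathcal{A}$ be an abelian category with subcategories $\mathcal{W}$ and $\mathcal{V}$. Assume that $\mathcal{W}\perp\mathcal{W}$, $\mathcal{V}\perp\mathcal{V}$, $\mathcal{G}(\mathcal{W})\perp\mathcal{V}$ and $\mathcal{W}\perp\mathcal{G}(\mathcal{V})$. Assume that $\mathcal{W}$ is closed under kernels of epimorphisms and direct summands and that $\mathcal{V}$ is closed under cokernels of monomorphisms and direct summands. Assume also that $\mathrm{Ext}^{\geq1}_{\mathcal{W}\mathcal{A}}(\operatorname{res}\widehat{\mathcal{W}},\mathcal{V})=0=\mathrm{Ext}^{\geq1}_{\mathcal{A}\mathcal{V}}(\mathcal{W},\operatorname{cores}\widehat{\mathcal{V}})$. For all $M\in\operatorname{res}\widehat{\mathcal{G}(\mathcal{W})}$, all $N\in\operatorname{cores}\widehat{\mathcal{G}(\mathcal{V})}$ and all $n\geq1$, we have $$\widehat{\mathrm{Ext}}^n_{\mathcal{W}\mathcal{A}}(M,N)\cong\widehat{\mathrm{Ext}}^n_{\mathcal{A}\mathcal{V}}(M,N).$$ If, in addition, we have $\operatorname{res}\widehat{\mathcal{W}}=\operatorname{cores}\widehat{\mathcal{V}}$, then this isomorphism holds for all $n\in\mathbb{Z}$.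
   Context: "Subcategory" means full additive subcategory closed under isomorphisms. For subcategories (or objects) $\mathcal{X},\mathcal{Y}$ of $\mathcal{A}$, $\mathcal{X}\perp\mathcal{Y}$ means $\mathrm{Ext}^{\geq1}_{\mathcal{A}}(X,Y)=0$ for all $X\in\mathcal{X}$, $Y\in\mathcal{Y}$. Complexes are indexed homologically ($\partial_n^X\colon X_n\to X_{n-1}$); objects are viewed as complexes in degree $0$; morphisms of complexes are chain maps. The Hom-complex is $\mathrm{Hom}_{\mathcal{A}}(X,Y)_n=\prod_p\mathrm{Hom}_{\mathcal{A}}(X_p,Y_{p+n})$ with differential $\{f_p\}\mapsto\{\partial^Y_{p+n}f_p-(-1)^nf_{p-1}\partial^X_p\}$. A complex $Z$ is $\mathrm{Hom}_{\mathcal{A}}(\mathcal{X},-)$-exact (resp. $\mathrm{Hom}_{\mathcal{A}}(-,\mathcal{X})$-exact) if $\mathrm{Hom}_{\mathcal{A}}(X,Z)$ (resp. $\mathrm{Hom}_{\mathcal{A}}(Z,X)$) is exact for all $X\in\mathcal{X}$. An $\mathcal{X}$-resolution of $M$ is a complex $X$ of objects of $\mathcal{X}$ with $X_{-n}=0=\mathrm{H}_n(X)$ for $n>0$ and $\mathrm{H}_0(X)\cong M$, with the quasiisomorphism $X\to M$; it is proper if $\cdots\to X_1\to X_0\to M\to0$ is $\mathrm{Hom}_{\mathcal{A}}(\mathcal{X},-)$-exact. $\mathcal{X}\text{-}\mathrm{pd}(M)$ is the infimum of $\sup\{n\geq0\mid X_n\neq0\}$ over $\mathcal{X}$-resolutions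 of $M$, and $\operatorname{res}\widehat{\mathcal{X}}$ is the subcategory of objects with $\mathcal{X}\text{-}\mathrm{pd}(M)<\infty$. Dually, a $\mathcal{Y}$-coresolution of $N$ is a complex $Y$ of objects of $\mathcal{Y}$ with $Y_n=0=\mathrm{H}_{-n}(Y)$ for $n>0$ and $\mathrm{H}_0(Y)\cong N$, with the quasiisomorphism $N\to Y$; it is proper if $0\to N\to Y_0\to Y_{-1}\to\cdots$ is $\mathrm{Hom}_{\mathcal{A}}(-,\mathcal{Y})$-exact; $\mathcal{Y}\text{-}\mathrm{id}(N)$ is the infimum of the lengths of $\mathcal{Y}$-coresolutions, and $\operatorname{cores}\widehat{\mathcal{Y}}$ is the subcategory of objects with $\mathcal{Y}\text{-}\mathrm{id}(N)<\infty$. A totally $\mathcal{W}$-acyclic complex is an exact complex of objects of $\mathcal{W}$ that is $\mathrm{Hom}_{\mathcal{A}}(\mathcal{W},-)$-exact and $\mathrm{Hom}_{\mathcal{A}}(-,\mathcal{W})$-exact; $\mathcal{G}(\mathcal{W})$ is the subcategory of objects isomorphic to $\mathrm{Coker}(\partial_1^W)$ for such complexes $W$ (similarly $\mathcal{G}(\mathcal{V})$). Relative cohomology: if $M$ has a proper $\mathcal{W}$-resolution $W\to M$, $\mathrm{Ext}^n_{\mathcal{W}\mathcal{A}}(M,N)=\mathrm{H}_{-n}(\mathrm{Hom}_{\mathcal{A}}(W,N))$; if $N$ has a proper $\mathcal{V}$-coresolution $N\to V$, $\mathrm{Ext}^n_{\mathcal{A}\mathcal{V}}(M,N)=\mathrm{H}_{-n}(\mathrm{Hom}_{\mathcal{A}}(M,V))$.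 (When $\mathcal{W}\perp\mathcal{W}$, bounded $\mathcal{W}$-resolutions are proper, and dually for $\mathcal{V}$.) Vanishing such as $\mathrm{Ext}^{\geq1}_{\mathcal{W}\mathcal{A}}(\mathcal{X},\mathcal{Y})=0$ means vanishing for all $X\in\mathcal{X}$, $Y\in\mathcal{Y}$ and all degrees $\geq1$. Tate cohomology: a Tate $\mathcal{W}$-resolution of $M$ is a diagram of chain maps $T\xrightarrow{\alpha}W\xrightarrow{\gamma}M$ with $T$ totally $\mathcal{W}$-acyclic, $\gamma$ a proper $\mathcal{W}$-resolution and $\alpha_n$ an isomorphism for $n\gg0$; then $\widehat{\mathrm{Ext}}^n_{\mathcal{W}\mathcal{A}}(M,N)=\mathrm{H}_{-n}(\mathrm{Hom}_{\mathcal{A}}(T,N))$. A Tate $\mathcal{V}$-coresolution of $N$ is a diagram of chain maps $N\xrightarrow{\delta}V\xrightarrow{\beta}S$ with $S$ totally $\mathcal{V}$-acyclic, $\delta$ a proper $\mathcal{V}$-coresolution and $\beta_n$ an isomorphism for $n\ll0$; then $\widehat{\mathrm{Ext}}^n_{\mathcal{A}\mathcal{V}}(M,N)=\mathrm{H}_{-n}(\mathrm{Hom}_{\mathcal{A}}(M,S))$. These are independent of choices up to isomorphism; under the hypotheses, objects of $\operatorname{res}\widehat{\mathcal{G}(\mathcal{W})}$ (resp. $\operatorname{cores}\widehat{\mathcal{G}(\mathcal{V})}$) admit Tate $\mathcal{W}$-resolutions (resp. Tate $\mathcal{V}$-coresolutions). *)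

theory Defs
  imports "HOL-Algebra.Elementary_Groups" "HOL-Library.Extended_Nat"
begin

section \<open>Abelian categories\<close>

text \<open>Composition is written in the usual order: \<open>g \<cdot> f\<close> means first \<open>f\<close>, then \<open>g\<close>.
  \<open>Zer C A B\<close> is the zero morphism \<open>A \<rightarrow> B\<close>. Values of the operations outside their natural
  domain are irrelevant. A type of morphisms equipped with domains and codomains makes distinct
  hom-sets disjoint.\<close>

record ('o, 'm) cat =
  Obj  :: "'o set"
  Arr  :: "'m set"
  Dom  :: "'m \<Rightarrow> 'o"
  Cod  :: "'m \<Rightarrow> 'o"
  Idm  :: "'o \<Rightarrow> 'm"
  Comp :: "'m \<Rightarrow> 'm \<Rightarrow> 'm"  (infixl "\<cdot>\<index>" 70)
  Add  :: "'m \<Rightarrow> 'm \<Rightarrow> 'm"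
  Zer  :: "'o \<Rightarrow> 'o \<Rightarrow> 'm"

definition Hom :: "('o, 'm) cat \<Rightarrow> 'o \<Rightarrow> 'o \<Rightarrow> 'm set" where
  "Hom C A B = {f \<in> Arr C. Dom C f = A \<and> Cod C f = B}"

definition hom_group :: "('o, 'm) cat \<Rightarrow> 'o \<Rightarrow> 'o \<Rightarrow> 'm monoid" where
  "hom_group C A B = \<lparr>carrier = Hom C A B, mult = Add C, one = Zer C A B\<rparr>"

definition is_isomorphism :: "('o, 'm) cat \<Rightarrow> 'm \<Rightarrow> bool" where
  "is_isomorphism C f \<longleftrightarrow> f \<in> Arr C \<and>
     (\<exists>g \<in> Hom C (Cod C f) (Dom C f).
        g \<cdot>\<^bsub>C\<^esub> f = Idm C (Dom C f) \<and> f \<cdot>\<^bsub>C\<^esub> g = Idm C (Cod C f))"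

definition isomorphic :: "('o, 'm) cat \<Rightarrow> 'o \<Rightarrow> 'o \<Rightarrow> bool" where
  "isomorphic C A B \<longleftrightarrow> (\<exists>f \<in> Hom C A B. is_isomorphism C f)"

definition is_mono :: "('o, 'm) cat \<Rightarrow> 'm \<Rightarrow> bool" where
  "is_mono C f \<longleftrightarrow> f \<in> Arr C \<and>
     (\<forall>A. \<forall>g \<in> Hom C A (Dom C f). \<forall>h \<in> Hom C A (Dom C f).
        f \<cdot>\<^bsub>C\<^esub> g = f \<cdot>\<^bsub>C\<^esub> h \<longrightarrow> g = h)"

definition is_epi :: "('o, 'm) cat \<Rightarrow> 'm \<Rightarrow> bool" where
  "is_epi C f \<longleftrightarrow> f \<in> Arr C \<and>
     (\<forall>B. \<forall>g \<in> Hom C (Cod C f) B. \<forall>h \<in> Hom C (Cod C f) B.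
        g \<cdot>\<^bsub>C\<^esub> f = h \<cdot>\<^bsub>C\<^esub> f \<longrightarrow> g = h)"

definition is_kernel :: "('o, 'm) cat \<Rightarrow> 'm \<Rightarrow> 'm \<Rightarrow> bool" where
  "is_kernel C f k \<longleftrightarrow> f \<in> Arr C \<and> k \<in> Arr C \<and> Cod C k = Dom C f \<and>
     f \<cdot>\<^bsub>C\<^esub> k = Zer C (Dom C k) (Cod C f) \<and>
     (\<forall>A. \<forall>h \<in> Hom C A (Dom C f). f \<cdot>\<^bsub>C\<^esub> h = Zer C A (Cod C f) \<longrightarrow>
        (\<exists>!u. u \<in> Hom C A (Dom C k) \<and> k \<cdot>\<^bsub>C\<^esub> u = h))"

definition is_cokernel :: "('o, 'm) cat \<Rightarrow> 'm \<Rightarrow> 'm \<Rightarrow> bool" where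
  "is_cokernel C f q \<longleftrightarrow> f \<in> Arr C \<and> q \<in> Arr C \<and> Dom C q = Cod C f \<and>
     q \<cdot>\<^bsub>C\<^esub> f = Zer C (Dom C f) (Cod C q) \<and>
     (\<forall>B. \<forall>h \<in> Hom C (Cod C f) B. h \<cdot>\<^bsub>C\<^esub> f = Zer C (Dom C f) B \<longrightarrow>
        (\<exists>!u. u \<in> Hom C (Cod C q) B \<and> u \<cdot>\<^bsub>C\<^esub> q = h))"

definition is_zero_obj :: "('o, 'm) cat \<Rightarrow> 'o \<Rightarrow> bool" where
  "is_zero_obj C Z \<longleftrightarrow> Z \<in> Obj C \<and>
     (\<forall>A \<in> Obj C. (\<exists>!f. f \<in> Hom C Z A) \<and> (\<exists>!f. f \<in> Hom C A Z))"

definition zero_obj :: "('o, 'm) cat \<Rightarrow> 'o" where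
  "zero_obj C = (SOME Z. is_zero_obj C Z)"

definition is_biproduct :: "('o, 'm) cat \<Rightarrow> 'o \<Rightarrow> 'o \<Rightarrow> 'o \<Rightarrow> bool" where
  "is_biproduct C A B P \<longleftrightarrow>
     (\<exists>i \<in> Hom C A P. \<exists>j \<in> Hom C B P. \<exists>p \<in> Hom C P A. \<exists>q \<in> Hom C P B.
        p \<cdot>\<^bsub>C\<^esub> i = Idm C A \<and> q \<cdot>\<^bsub>C\<^esub> j = Idm C B \<and>
        p \<cdot>\<^bsub>C\<^esub> j = Zer C B A \<and> q \<cdot>\<^bsub>C\<^esub> i = Zer C A B \<and>
        Add C (i \<cdot>\<^bsub>C\<^esub> p) (j \<cdot>\<^bsub>C\<^esub> q) = Idm C P)"

locale category =
  fixes C :: "('o, 'm) cat" (structure)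
  assumes Dom_Obj: "f \<in> Arr C \<Longrightarrow> Dom C f \<in> Obj C"
    and Cod_Obj: "f \<in> Arr C \<Longrightarrow> Cod C f \<in> Obj C"
    and Idm_Hom: "A \<in> Obj C \<Longrightarrow> Idm C A \<in> Hom C A A"
    and Comp_Hom: "f \<in> Hom C A B \<Longrightarrow> g \<in> Hom C B D \<Longrightarrow> g \<cdot> f \<in> Hom C A D"
    and Comp_assoc: "f \<in> Hom C A B \<Longrightarrow> g \<in> Hom C B D \<Longrightarrow> h \<in> Hom C D E \<Longrightarrow>
      h \<cdot> (g \<cdot> f) = (h \<cdot> g) \<cdot> f"
    and Comp_Idm: "f \<in> Hom C A B \<Longrightarrow> f \<cdot> Idm C A = f"
    and Idm_Comp: "f \<in> Hom C A B \<Longrightarrow> Idm C B \<cdot> f = f"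

locale preadditive_category = category +
  assumes hom_comm_group: "A \<in> Obj C \<Longrightarrow> B \<in> Obj C \<Longrightarrow> comm_group (hom_group C A B)"
    and Comp_Add: "f \<in> Hom C A B \<Longrightarrow> g \<in> Hom C A B \<Longrightarrow> h \<in> Hom C B D \<Longrightarrow>
      h \<cdot> (Add C f g) = Add C (h \<cdot> f) (h \<cdot> g)"
    and Add_Comp: "f \<in> Hom C A B \<Longrightarrow> g \<in> Hom C B D \<Longrightarrow> h \<in> Hom C B D \<Longrightarrow>
      (Add C g h) \<cdot> f = Add C (g \<cdot> f) (h \<cdot> f)"

locale abelian_category = preadditive_category +
  assumes ex_zero_obj: "\<exists>Z. is_zero_obj C Z"
    and ex_biproduct: "A \<in> Obj C \<Longrightarrow> B \<in> Obj C \<Longrightarrow> \<exists>P. is_biproduct C A B P"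
    and ex_kernel: "f \<in> Arr C \<Longrightarrow> \<exists>k. is_kernel C f k"
    and ex_cokernel: "f \<in> Arr C \<Longrightarrow> \<exists>q. is_cokernel C f q"
    and mono_is_kernel: "is_mono C f \<Longrightarrow> \<exists>g. is_kernel C g f"
    and epi_is_cokernel: "is_epi C f \<Longrightarrow> \<exists>g. is_cokernel C g f"

section \<open>Subcategories\<close>

text \<open>A full subcategory is given by its set of objects.\<close>

definition subcategory :: "('o, 'm) cat \<Rightarrow> 'o set \<Rightarrow> bool" where
  "subcategory C \<X> \<longleftrightarrow> \<X> \<subseteq> Obj C \<and>
     (\<forall>A B. A \<in> \<X> \<and> isomorphic C A B \<longrightarrow> B \<in> \<X>) \<and>
     (\<forall>Z. is_zero_obj C Z \<longrightarrow> Z \<in> \<X>) \<and>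
     (\<forall>A B P. A \<in> \<X> \<and> B \<in> \<X> \<and> is_biproduct C A B P \<longrightarrow> P \<in> \<X>)"

definition closed_under_kernels_of_epis :: "('o, 'm) cat \<Rightarrow> 'o set \<Rightarrow> bool" where
  "closed_under_kernels_of_epis C \<X> \<longleftrightarrow>
     (\<forall>f k. is_epi C f \<and> Dom C f \<in> \<X> \<and> Cod C f \<in> \<X> \<and> is_kernel C f k \<longrightarrow> Dom C k \<in> \<X>)"

definition closed_under_cokernels_of_monos :: "('o, 'm) cat \<Rightarrow> 'o set \<Rightarrow> bool" where
  "closed_under_cokernels_of_monos C \<X> \<longleftrightarrow>
     (\<forall>f q. is_mono C f \<and> Dom C f \<in> \<X> \<and> Cod C f \<in> \<X> \<and> is_cokernel C f q \<longrightarrow> Cod C q \<in> \<X>)"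

definition closed_under_direct_summands :: "('o, 'm) cat \<Rightarrow> 'o set \<Rightarrow> bool" where
  "closed_under_direct_summands C \<X> \<longleftrightarrow>
     (\<forall>A \<in> Obj C. \<forall>B \<in> Obj C. \<forall>P \<in> \<X>. is_biproduct C A B P \<longrightarrow> A \<in> \<X>)"

section \<open>Complexes\<close>

text \<open>Homological indexing: \<open>bd X n : ob X n \<rightarrow> ob X (n - 1)\<close>.\<close>

record ('o, 'm) cplx =
  ob :: "int \<Rightarrow> 'o"
  bd :: "int \<Rightarrow> 'm"

definition is_complex :: "('o, 'm) cat \<Rightarrow> ('o, 'm) cplx \<Rightarrow> bool" where
  "is_complex C X \<longleftrightarrow>
     (\<forall>n. ob X n \<in> Obj C \<and> bd X n \<in> Hom C (ob X n) (ob X (n - 1)) \<and>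
        bd X (n - 1) \<cdot>\<^bsub>C\<^esub> bd X n = Zer C (ob X n) (ob X (n - 2)))"

definition conc :: "('o, 'm) cat \<Rightarrow> 'o \<Rightarrow> ('o, 'm) cplx" where
  "conc C M = (let Y = (\<lambda>n. if n = 0 then M else zero_obj C)
     in \<lparr>ob = Y, bd = (\<lambda>n. Zer C (Y n) (Y (n - 1)))\<rparr>)"

definition chain_map ::
  "('o, 'm) cat \<Rightarrow> ('o, 'm) cplx \<Rightarrow> ('o, 'm) cplx \<Rightarrow> (int \<Rightarrow> 'm) \<Rightarrow> bool" where
  "chain_map C X Y f \<longleftrightarrow> is_complex C X \<and> is_complex C Y \<and>
     (\<forall>n. f n \<in> Hom C (ob X n) (ob Y n) \<and>
        bd Y n \<cdot>\<^bsub>C\<^esub> f n = f (n - 1) \<cdot>\<^bsub>C\<^esub> bd X n)"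

text \<open>The homology \<open>H\<^sub>n(X)\<close> is the object \<open>Cod C q\<close>, where \<open>k\<close> is a kernel of the outgoing
  differential, \<open>b\<close> is the factorization of the incoming one through \<open>k\<close>, and \<open>q\<close> is a cokernel
  of \<open>b\<close>; it is determined up to isomorphism.\<close>

definition homology_data ::
  "('o, 'm) cat \<Rightarrow> ('o, 'm) cplx \<Rightarrow> int \<Rightarrow> 'm \<Rightarrow> 'm \<Rightarrow> 'm \<Rightarrow> bool" where
  "homology_data C X n k b q \<longleftrightarrow>
     is_kernel C (bd X n) k \<and>
     b \<in> Hom C (ob X (n + 1)) (Dom C k) \<and> k \<cdot>\<^bsub>C\<^esub> b = bd X (n + 1) \<and>
     is_cokernel C b q"

definition exact_complex :: "('o, 'm) cat \<Rightarrow> ('o, 'm) cplx \<Rightarrow> bool" where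
  "exact_complex C X \<longleftrightarrow> is_complex C X \<and>
     (\<forall>n. \<exists>k b q. homology_data C X n k b q \<and> is_zero_obj C (Cod C q))"

text \<open>Below, \<open>z\<close> and \<open>u\<close> are the maps induced by \<open>f\<close> on cycles and on homology.\<close>

definition quasi_iso ::
  "('o, 'm) cat \<Rightarrow> ('o, 'm) cplx \<Rightarrow> ('o, 'm) cplx \<Rightarrow> (int \<Rightarrow> 'm) \<Rightarrow> bool" where
  "quasi_iso C X Y f \<longleftrightarrow> chain_map C X Y f \<and>
     (\<forall>n. \<exists>k b q k' b' q'. homology_data C X n k b q \<and> homology_data C Y n k' b' q' \<and>
        (\<exists>z \<in> Hom C (Dom C k) (Dom C k'). \<exists>u \<in> Hom C (Cod C q) (Cod C q').
           k' \<cdot>\<^bsub>C\<^esub> z = f n \<cdot>\<^bsub>C\<^esub> k \<and> u \<cdot>\<^bsub>C\<^esub> q = q' \<cdot>\<^bsub>C\<^esub> z \<and> is_isomorphism C u))"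

section \<open>Vanishing of Yoneda Ext\<close>

text \<open>An \<open>n\<close>-extension \<open>0 \<rightarrow> Y \<rightarrow> E\<^sub>n\<^sub>-\<^sub>1 \<rightarrow> \<dots> \<rightarrow> E\<^sub>0 \<rightarrow> X \<rightarrow> 0\<close> (for \<open>n \<ge> 1\<close>) is an exact complex with
  \<open>X\<close> in degree \<open>-1\<close> and \<open>Y\<close> in degree \<open>n\<close>. The set \<open>yoneda_Ext C n X Y\<close> consists of the classes
  of \<open>n\<close>-extensions for the equivalence relation generated by the chain maps which are
  identities at both ends. It underlies the group \<open>Ext\<^sup>n(X, Y)\<close>, which is zero if and only if it
  has exactly one element.\<close>

definition extensions :: "('o, 'm) cat \<Rightarrow> nat \<Rightarrow> 'o \<Rightarrow> 'o \<Rightarrow> ('o, 'm) cplx set" where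
  "extensions C n X Y = {E. exact_complex C E \<and> ob E (-1) = X \<and> ob E (int n) = Y \<and>
     (\<forall>i. i < -1 \<or> i > int n \<longrightarrow> is_zero_obj C (ob E i))}"

definition extension_maps ::
  "('o, 'm) cat \<Rightarrow> nat \<Rightarrow> 'o \<Rightarrow> 'o \<Rightarrow> (('o, 'm) cplx \<times> ('o, 'm) cplx) set" where
  "extension_maps C n X Y =
     {(E, F). E \<in> extensions C n X Y \<and> F \<in> extensions C n X Y \<and>
        (\<exists>\<phi>. chain_map C E F \<phi> \<and> \<phi> (-1) = Idm C X \<and> \<phi> (int n) = Idm C Y)}"

definition yoneda_Ext :: "('o, 'm) cat \<Rightarrow> nat \<Rightarrow> 'o \<Rightarrow> 'o \<Rightarrow> ('o, 'm) cplx set set" where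
  "yoneda_Ext C n X Y =
     extensions C n X Y // ((extension_maps C n X Y \<union> (extension_maps C n X Y)\<inverse>)\<^sup>*)"

definition perp :: "('o, 'm) cat \<Rightarrow> 'o set \<Rightarrow> 'o set \<Rightarrow> bool" where
  "perp C \<X> \<Y> \<longleftrightarrow> (\<forall>X \<in> \<X>. \<forall>Y \<in> \<Y>. \<forall>n \<ge> 1. \<exists>e. yoneda_Ext C n X Y = {e})"

section \<open>Hom-complexes\<close>

text \<open>The degree \<open>n\<close> component is the product over all \<open>p\<close> of \<open>Hom(X\<^sub>p, Y\<^sub>p\<^sub>+\<^sub>n)\<close>.\<close>

definition hom_cplx ::
  "('o, 'm) cat \<Rightarrow> ('o, 'm) cplx \<Rightarrow> ('o, 'm) cplx \<Rightarrow> int \<Rightarrow> (int \<Rightarrow> 'm) monoid" where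
  "hom_cplx C X Y n =
     \<lparr>carrier = {f. \<forall>p. f p \<in> Hom C (ob X p) (ob Y (p + n))},
      mult = (\<lambda>f g p. Add C (f p) (g p)),
      one = (\<lambda>p. Zer C (ob X p) (ob Y (p + n)))\<rparr>"

text \<open>The second summand is \<open>- (-1)\<^sup>n f\<^sub>p\<^sub>-\<^sub>1 \<partial>\<^sub>p\<close>.\<close>

definition hom_diff ::
  "('o, 'm) cat \<Rightarrow> ('o, 'm) cplx \<Rightarrow> ('o, 'm) cplx \<Rightarrow> int \<Rightarrow> (int \<Rightarrow> 'm) \<Rightarrow> (int \<Rightarrow> 'm)" where
  "hom_diff C X Y n f = (\<lambda>p.
     Add C (bd Y (p + n) \<cdot>\<^bsub>C\<^esub> f p)
       (if even n
        then inv\<^bsub>hom_group C (ob X p) (ob Y (p + n - 1))\<^esub> (f (p - 1) \<cdot>\<^bsub>C\<^esub> bd X p)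
        else f (p - 1) \<cdot>\<^bsub>C\<^esub> bd X p))"

definition hom_cycles ::
  "('o, 'm) cat \<Rightarrow> ('o, 'm) cplx \<Rightarrow> ('o, 'm) cplx \<Rightarrow> int \<Rightarrow> (int \<Rightarrow> 'm) set" where
  "hom_cycles C X Y n = kernel (hom_cplx C X Y n) (hom_cplx C X Y (n - 1)) (hom_diff C X Y n)"

definition hom_boundaries ::
  "('o, 'm) cat \<Rightarrow> ('o, 'm) cplx \<Rightarrow> ('o, 'm) cplx \<Rightarrow> int \<Rightarrow> (int \<Rightarrow> 'm) set" where
  "hom_boundaries C X Y n = hom_diff C X Y (n + 1) ` carrier (hom_cplx C X Y (n + 1))"

definition hom_homology ::
  "('o, 'm) cat \<Rightarrow> ('o, 'm) cplx \<Rightarrow> ('o, 'm) cplx \<Rightarrow> int \<Rightarrow> (int \<Rightarrow> 'm) set monoid" where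
  "hom_homology C X Y n =
     (hom_cplx C X Y n)\<lparr>carrier := hom_cycles C X Y n\<rparr> Mod hom_boundaries C X Y n"

definition hom_exact :: "('o, 'm) cat \<Rightarrow> ('o, 'm) cplx \<Rightarrow> ('o, 'm) cplx \<Rightarrow> bool" where
  "hom_exact C X Y \<longleftrightarrow> (\<forall>n. hom_cycles C X Y n = hom_boundaries C X Y n)"

definition hom_from_exact :: "('o, 'm) cat \<Rightarrow> 'o set \<Rightarrow> ('o, 'm) cplx \<Rightarrow> bool" where
  "hom_from_exact C \<X> Z \<longleftrightarrow> (\<forall>X \<in> \<X>. hom_exact C (conc C X) Z)"

definition hom_into_exact :: "('o, 'm) cat \<Rightarrow> 'o set \<Rightarrow> ('o, 'm) cplx \<Rightarrow> bool" where
  "hom_into_exact C \<X> Z \<longleftrightarrow> (\<forall>X \<in> \<X>. hom_exact C Z (conc C X))"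

section \<open>Resolutions and coresolutions\<close>

text \<open>The quasiisomorphism encodes \<open>H\<^sub>n(P) = 0\<close> for \<open>n \<noteq> 0\<close> and \<open>H\<^sub>0(P) \<cong> M\<close>.\<close>

definition resolution ::
  "('o, 'm) cat \<Rightarrow> 'o set \<Rightarrow> 'o \<Rightarrow> ('o, 'm) cplx \<Rightarrow> (int \<Rightarrow> 'm) \<Rightarrow> bool" where
  "resolution C \<X> M P \<gamma> \<longleftrightarrow> is_complex C P \<and> (\<forall>n. ob P n \<in> \<X>) \<and>
     (\<forall>n < 0. is_zero_obj C (ob P n)) \<and> quasi_iso C P (conc C M) \<gamma>"

definition coresolution ::
  "('o, 'm) cat \<Rightarrow> 'o set \<Rightarrow> 'o \<Rightarrow> ('o, 'm) cplx \<Rightarrow> (int \<Rightarrow> 'm) \<Rightarrow> bool" where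
  "coresolution C \<Y> N Q \<delta> \<longleftrightarrow> is_complex C Q \<and> (\<forall>n. ob Q n \<in> \<Y>) \<and>
     (\<forall>n > 0. is_zero_obj C (ob Q n)) \<and> quasi_iso C (conc C N) Q \<delta>"

text \<open>\<open>\<dots> \<rightarrow> P\<^sub>1 \<rightarrow> P\<^sub>0 \<rightarrow> M \<rightarrow> 0\<close> with \<open>M\<close> in degree \<open>-1\<close>, and
  \<open>0 \<rightarrow> N \<rightarrow> Q\<^sub>0 \<rightarrow> Q\<^sub>-\<^sub>1 \<rightarrow> \<dots>\<close> with \<open>N\<close> in degree \<open>1\<close>.\<close>

definition augmented_res ::
  "('o, 'm) cat \<Rightarrow> 'o \<Rightarrow> ('o, 'm) cplx \<Rightarrow> (int \<Rightarrow> 'm) \<Rightarrow> ('o, 'm) cplx" where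
  "augmented_res C M P \<gamma> =
     (let X = (\<lambda>n. if n \<ge> 0 then ob P n else if n = -1 then M else zero_obj C)
      in \<lparr>ob = X,
          bd = (\<lambda>n. if n > 0 then bd P n else if n = 0 then \<gamma> 0 else Zer C (X n) (X (n - 1)))\<rparr>)"

definition augmented_cores ::
  "('o, 'm) cat \<Rightarrow> 'o \<Rightarrow> ('o, 'm) cplx \<Rightarrow> (int \<Rightarrow> 'm) \<Rightarrow> ('o, 'm) cplx" where
  "augmented_cores C N Q \<delta> =
     (let Y = (\<lambda>n. if n \<le> 0 then ob Q n else if n = 1 then N else zero_obj C)
      in \<lparr>ob = Y,
          bd = (\<lambda>n. if n \<le> 0 then bd Q n else if n = 1 then \<delta> 0 else Zer C (Y n) (Y (n - 1)))\<rparr>)"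

definition proper_resolution ::
  "('o, 'm) cat \<Rightarrow> 'o set \<Rightarrow> 'o \<Rightarrow> ('o, 'm) cplx \<Rightarrow> (int \<Rightarrow> 'm) \<Rightarrow> bool" where
  "proper_resolution C \<X> M P \<gamma> \<longleftrightarrow>
     resolution C \<X> M P \<gamma> \<and> hom_from_exact C \<X> (augmented_res C M P \<gamma>)"

definition proper_coresolution ::
  "('o, 'm) cat \<Rightarrow> 'o set \<Rightarrow> 'o \<Rightarrow> ('o, 'm) cplx \<Rightarrow> (int \<Rightarrow> 'm) \<Rightarrow> bool" where
  "proper_coresolution C \<Y> N Q \<delta> \<longleftrightarrow>
     coresolution C \<Y> N Q \<delta> \<and> hom_into_exact C \<Y> (augmented_cores C N Q \<delta>)"

text \<open>In \<^typ>\<open>enat\<close> the infimum of the empty set is \<open>\<infinity>\<close> and the supremum of the empty set is \<open>0\<close>.\<close>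

definition rel_pd :: "('o, 'm) cat \<Rightarrow> 'o set \<Rightarrow> 'o \<Rightarrow> enat" where
  "rel_pd C \<X> M = (INF P \<in> {P. \<exists>\<gamma>. resolution C \<X> M P \<gamma>}.
     SUP n \<in> {n. \<not> is_zero_obj C (ob P (int n))}. enat n)"

definition rel_id :: "('o, 'm) cat \<Rightarrow> 'o set \<Rightarrow> 'o \<Rightarrow> enat" where
  "rel_id C \<Y> N = (INF Q \<in> {Q. \<exists>\<delta>. coresolution C \<Y> N Q \<delta>}.
     SUP n \<in> {n. \<not> is_zero_obj C (ob Q (- int n))}. enat n)"

definition res_hat :: "('o, 'm) cat \<Rightarrow> 'o set \<Rightarrow> 'o set" where
  "res_hat C \<X> = {M \<in> Obj C. rel_pd C \<X> M < \<infinity>}"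

definition cores_hat :: "('o, 'm) cat \<Rightarrow> 'o set \<Rightarrow> 'o set" where
  "cores_hat C \<Y> = {N \<in> Obj C. rel_id C \<Y> N < \<infinity>}"

section \<open>Totally acyclic complexes\<close>

definition totally_acyclic :: "('o, 'm) cat \<Rightarrow> 'o set \<Rightarrow> ('o, 'm) cplx \<Rightarrow> bool" where
  "totally_acyclic C \<W> T \<longleftrightarrow> exact_complex C T \<and> (\<forall>n. ob T n \<in> \<W>) \<and>
     hom_from_exact C \<W> T \<and> hom_into_exact C \<W> T"

definition Gor :: "('o, 'm) cat \<Rightarrow> 'o set \<Rightarrow> 'o set" where
  "Gor C \<W> = {M \<in> Obj C. \<exists>T q. totally_acyclic C \<W> T \<and> is_cokernel C (bd T 1) q \<and>
     isomorphic C M (Cod C q)}"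

section \<open>Relative and Tate cohomology\<close>

text \<open>The relative Ext groups computed from a given proper resolution \<open>P\<close> of the first
  argument, or from a given proper coresolution \<open>Q\<close> of the second argument. The same formulas,
  applied to the totally acyclic complex of a Tate (co)resolution, give Tate cohomology.\<close>

definition Ext_res ::
  "('o, 'm) cat \<Rightarrow> ('o, 'm) cplx \<Rightarrow> 'o \<Rightarrow> int \<Rightarrow> (int \<Rightarrow> 'm) set monoid" where
  "Ext_res C P N n = hom_homology C P (conc C N) (- n)"

definition Ext_cores ::
  "('o, 'm) cat \<Rightarrow> 'o \<Rightarrow> ('o, 'm) cplx \<Rightarrow> int \<Rightarrow> (int \<Rightarrow> 'm) set monoid" where
  "Ext_cores C M Q n = hom_homology C (conc C M) Q (- n)"

text \<open>The groups do not depend on the choice of the proper (co)resolution up to isomorphism;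
  vanishing is stated for every choice.\<close>

definition Ext_WA_vanishes :: "('o, 'm) cat \<Rightarrow> 'o set \<Rightarrow> 'o set \<Rightarrow> 'o set \<Rightarrow> bool" where
  "Ext_WA_vanishes C \<W> \<X> \<Y> \<longleftrightarrow>
     (\<forall>X \<in> \<X>. \<forall>Y \<in> \<Y>. \<forall>P \<gamma>. proper_resolution C \<W> X P \<gamma> \<longrightarrow>
        (\<forall>n \<ge> 1. trivial_group (Ext_res C P Y n)))"

definition Ext_AV_vanishes :: "('o, 'm) cat \<Rightarrow> 'o set \<Rightarrow> 'o set \<Rightarrow> 'o set \<Rightarrow> bool" where
  "Ext_AV_vanishes C \<V> \<X> \<Y> \<longleftrightarrow>
     (\<forall>X \<in> \<X>. \<forall>Y \<in> \<Y>. \<forall>Q \<delta>. proper_coresolution C \<V> Y Q \<delta> \<longrightarrow>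
        (\<forall>n \<ge> 1. trivial_group (Ext_cores C X Q n)))"

definition tate_resolution ::
  "('o, 'm) cat \<Rightarrow> 'o set \<Rightarrow> 'o \<Rightarrow> ('o, 'm) cplx \<Rightarrow> (int \<Rightarrow> 'm) \<Rightarrow>
   ('o, 'm) cplx \<Rightarrow> (int \<Rightarrow> 'm) \<Rightarrow> bool" where
  "tate_resolution C \<W> M T \<alpha> P \<gamma> \<longleftrightarrow>
     totally_acyclic C \<W> T \<and> chain_map C T P \<alpha> \<and> proper_resolution C \<W> M P \<gamma> \<and>
     (\<exists>n0. \<forall>n \<ge> n0. is_isomorphism C (\<alpha> n))"

definition tate_coresolution ::
  "('o, 'm) cat \<Rightarrow> 'o set \<Rightarrow> 'o \<Rightarrow> ('o, 'm) cplx \<Rightarrow> (int \<Rightarrow> 'm) \<Rightarrow>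
   ('o, 'm) cplx \<Rightarrow> (int \<Rightarrow> 'm) \<Rightarrow> bool" where
  "tate_coresolution C \<V> N Q \<delta> S \<beta> \<longleftrightarrow>
     proper_coresolution C \<V> N Q \<delta> \<and> chain_map C Q S \<beta> \<and> totally_acyclic C \<V> S \<and>
     (\<exists>n0. \<forall>n \<le> n0. is_isomorphism C (\<beta> n))"

text \<open>\<open>tate_Ext_WA C \<W> M N n G\<close>: the group \<open>G\<close> is the \<open>n\<close>-th Tate cohomology of \<open>M\<close> and \<open>N\<close>
  computed from some Tate \<open>\<W>\<close>-resolution of \<open>M\<close>; similarly for coresolutions of \<open>N\<close>.\<close>

definition tate_Ext_WA ::
  "('o, 'm) cat \<Rightarrow> 'o set \<Rightarrow> 'o \<Rightarrow> 'o \<Rightarrow> int \<Rightarrow> (int \<Rightarrow> 'm) set monoid \<Rightarrow> bool" where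
  "tate_Ext_WA C \<W> M N n G \<longleftrightarrow>
     (\<exists>T \<alpha> P \<gamma>. tate_resolution C \<W> M T \<alpha> P \<gamma> \<and> G = Ext_res C T N n)"

definition tate_Ext_AV ::
  "('o, 'm) cat \<Rightarrow> 'o set \<Rightarrow> 'o \<Rightarrow> 'o \<Rightarrow> int \<Rightarrow> (int \<Rightarrow> 'm) set monoid \<Rightarrow> bool" where
  "tate_Ext_AV C \<V> M N n G \<longleftrightarrow>
     (\<exists>Q \<delta> S \<beta>. tate_coresolution C \<V> N Q \<delta> S \<beta> \<and> G = Ext_cores C M S n)"

end

theory Submission
  imports Defs
begin

text \<open>
  Write \<open>\<W>\<close>-resolutions and \<open>\<V>\<close>-coresolutions as augmented exact complexes. Since \<open>\<G>(\<W>) \<perp> \<V>\<close> and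
  \<open>\<W> \<perp> \<G>(\<V>)\<close>, the complex \<open>T\<close> is \<open>Hom(-, \<V>)\<close>-exact and \<open>S\<close> is \<open>Hom(\<W>, -)\<close>-exact; only the splitting of
  short exact sequences is needed. The augmented coresolution \<open>N \<rightarrow> Q\<close> is \<open>Hom(\<W>, -)\<close>-exact as well: the cone
  of \<open>\<beta>\<close>, with \<open>S\<close> cut off above degree \<open>1\<close>, is a proper \<open>\<V>\<close>-coresolution of an object \<open>L\<close> of
  \<open>cores_hat C \<V>\<close>, so the vanishing hypothesis applies to it, and a cycle of \<open>Hom(W, Q)\<close>, completed by a
  lift to \<open>S\<close>, is a cycle of \<open>Hom(W, cone)\<close>. Dually for \<open>P \<rightarrow> M\<close>.

  Dimension shifting along \<open>Q\<close> therefore identifies \<open>Hom(T, N)\<close>-cohomology with a group of bicycles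
  \<open>T\<^sub>i \<rightarrow> S\<^sub>j\<close>, for \<open>j\<close> so small that \<open>Q\<close> and \<open>S\<close> agree, and \<open>Hom(M, S)\<close>-cohomology with such a group for \<open>i\<close> so
  large that \<open>P\<close> and \<open>T\<close> agree. For the pair \<open>(T, S)\<close> both kinds of boundaries coincide and the group depends
  only on \<open>i - j\<close>.
\<close>

section \<open>Arithmetic of morphisms\<close>

text \<open>The vanishing hypotheses concern objects of finite length over \<open>\<V>\<close> or
  \<open>\<W>\<close>, while \<open>N\<close> and \<open>M\<close> have finite length only over
  Gorenstein objects. The kernel \<open>L\<close> of the first cone differential closes this gap: it
  maps onto \<open>N\<close>, the kernel being the object of cycles of \<open>S\<close> in degree 1,
  which lies in \<open>Gor C \<V>\<close>, and it has a bounded coresolution because the cone can be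
  cut off where \<open>\<beta>\<close> is invertible.

  Both \<open>T\<close> and \<open>S\<close> are unbounded in both directions, so they are compared
  one degree at a time instead of through a total complex: a bicycle \<open>u\<close> extends to
  \<open>g\<close> with \<open>u = g \<cdot> bd T i\<close>, and \<open>bd S j \<cdot> g\<close> is
  the next bicycle. Signs are never tracked in this process, since only the existence of an
  isomorphism is claimed.

  Chases are carried out on morphisms into an object, and equations are tested after composition
  with an epimorphism. Most statements on resolutions are those on coresolutions read in
  \<open>opcat C\<close>.\<close>

context category
begin

lemma Hom_iff: "f \<in> Hom C A B \<longleftrightarrow> f \<in> Arr C \<and> Dom C f = A \<and> Cod C f = B"
  by (auto simp: Hom_def)

lemma HomI [intro]: "f \<in> Arr C \<Longrightarrow> Dom C f = A \<Longrightarrow> Cod C f = B \<Longrightarrow> f \<in> Hom C A B"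
  by (simp add: Hom_iff)

text \<open>The intermediate object is expressed by \<open>Cod C f = Dom C g\<close>, so that
  rewriting can check composability; in \<open>Comp_Hom\<close> it would have to be guessed.\<close>

lemma Comp_typing [simp]:
  assumes "f \<in> Arr C" "g \<in> Arr C" "Cod C f = Dom C g"
  shows "g \<cdot> f \<in> Arr C" "Dom C (g \<cdot> f) = Dom C f" "Cod C (g \<cdot> f) = Cod C g"
  using Comp_Hom[of f "Dom C f" "Cod C f" g "Cod C g"] assms by (auto simp: Hom_iff)

lemma Comp_assoc_Arr [simp]:
  assumes "f \<in> Arr C" "g \<in> Arr C" "h \<in> Arr C" "Cod C f = Dom C g" "Cod C g = Dom C h"
  shows "(h \<cdot> g) \<cdot> f = h \<cdot> (g \<cdot> f)"
  using Comp_assoc[of f "Dom C f" "Cod C f" g "Cod C g" h "Cod C h"] assms by (auto simp: Hom_iff)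

lemma Idm_typing [simp]:
  assumes "A \<in> Obj C"
  shows "Idm C A \<in> Arr C" "Dom C (Idm C A) = A" "Cod C (Idm C A) = A"
  using Idm_Hom[OF assms] by (auto simp: Hom_iff)

lemma Comp_Idm_Arr [simp]: "f \<in> Arr C \<Longrightarrow> Dom C f = A \<Longrightarrow> f \<cdot> Idm C A = f"
  using Comp_Idm[of f A "Cod C f"] by (auto simp: Hom_iff)

lemma Idm_Comp_Arr [simp]: "f \<in> Arr C \<Longrightarrow> Cod C f = B \<Longrightarrow> Idm C B \<cdot> f = f"
  using Idm_Comp[of f "Dom C f" B] by (auto simp: Hom_iff)

declare Dom_Obj [simp] Cod_Obj [simp]

text \<open>Composites are kept right-nested, so \<open>g \<cdot> f\<close> is no subterm of
  \<open>g \<cdot> (f \<cdot> x)\<close>. This lemma carries a known relation across a further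
  factor on the right.\<close>

lemma Comp_extend:
  assumes "g \<cdot> f = k" "x \<in> Arr C" "f \<in> Arr C" "g \<in> Arr C" "Cod C x = Dom C f" "Cod C f = Dom C g"
  shows "g \<cdot> (f \<cdot> x) = k \<cdot> x"
  using assms Comp_assoc_Arr[of x f g] by simp

end

context preadditive_category
begin

text \<open>The hom-group is recovered from the morphism itself, so negation takes no object
  arguments; on well-typed morphisms it agrees with the inverse occurring in
  \<open>hom_diff\<close>.\<close>

definition Neg :: "'b \<Rightarrow> 'b" where
  "Neg f = inv\<^bsub>hom_group C (Dom C f) (Cod C f)\<^esub> f"

definition Sub :: "'b \<Rightarrow> 'b \<Rightarrow> 'b" where
  "Sub f g = Add C f (Neg g)"

lemma hom_group_sel [simp]:
  "carrier (hom_group C A B) = Hom C A B" "mult (hom_group C A B) = Add C"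
  "one (hom_group C A B) = Zer C A B"
  by (simp_all add: hom_group_def)

lemma Zer_typing [simp]:
  assumes "A \<in> Obj C" "B \<in> Obj C"
  shows "Zer C A B \<in> Arr C" "Dom C (Zer C A B) = A" "Cod C (Zer C A B) = B"
proof -
  interpret comm_group "hom_group C A B" by (rule hom_comm_group[OF assms])
  show "Zer C A B \<in> Arr C" "Dom C (Zer C A B) = A" "Cod C (Zer C A B) = B"
    using one_closed by (auto simp: Hom_iff)
qed

lemma Add_typing [simp]:
  assumes "f \<in> Arr C" "g \<in> Arr C" "Dom C g = Dom C f" "Cod C g = Cod C f"
  shows "Add C f g \<in> Arr C" "Dom C (Add C f g) = Dom C f" "Cod C (Add C f g) = Cod C f"
proof -
  interpret comm_group "hom_group C (Dom C f) (Cod C f)" by (rule hom_comm_group) (use assms in auto)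
  show "Add C f g \<in> Arr C" "Dom C (Add C f g) = Dom C f" "Cod C (Add C f g) = Cod C f"
    using m_closed[of f g] assms by (auto simp: Hom_iff)
qed

lemma Neg_typing [simp]:
  assumes "f \<in> Arr C"
  shows "Neg f \<in> Arr C" "Dom C (Neg f) = Dom C f" "Cod C (Neg f) = Cod C f"
proof -
  interpret comm_group "hom_group C (Dom C f) (Cod C f)" by (rule hom_comm_group) (use assms in auto)
  show "Neg f \<in> Arr C" "Dom C (Neg f) = Dom C f" "Cod C (Neg f) = Cod C f"
    using inv_closed[of f] assms by (auto simp: Hom_iff Neg_def)
qed

lemma Sub_typing [simp]:
  assumes "f \<in> Arr C" "g \<in> Arr C" "Dom C g = Dom C f" "Cod C g = Cod C f"
  shows "Sub f g \<in> Arr C" "Dom C (Sub f g) = Dom C f" "Cod C (Sub f g) = Cod C f"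
  using assms by (simp_all add: Sub_def)

lemma Add_assoc:
  assumes "f \<in> Arr C" "g \<in> Arr C" "h \<in> Arr C" "Dom C g = Dom C f" "Cod C g = Cod C f"
    "Dom C h = Dom C f" "Cod C h = Cod C f"
  shows "Add C (Add C f g) h = Add C f (Add C g h)"
proof -
  interpret comm_group "hom_group C (Dom C f) (Cod C f)" by (rule hom_comm_group) (use assms in auto)
  show ?thesis using m_assoc[of f g h] assms by (auto simp: Hom_iff)
qed

lemma Add_commute:
  assumes "f \<in> Arr C" "g \<in> Arr C" "Dom C g = Dom C f" "Cod C g = Cod C f"
  shows "Add C f g = Add C g f"
proof -
  interpret comm_group "hom_group C (Dom C f) (Cod C f)" by (rule hom_comm_group) (use assms in auto)
  show ?thesis using m_comm[of f g] assms by (auto simp: Hom_iff)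
qed

lemma Add_Zer [simp]:
  assumes "f \<in> Arr C" "Dom C f = A" "Cod C f = B"
  shows "Add C f (Zer C A B) = f" "Add C (Zer C A B) f = f"
proof -
  interpret comm_group "hom_group C A B" by (rule hom_comm_group) (use assms in auto)
  show "Add C f (Zer C A B) = f" "Add C (Zer C A B) f = f"
    using r_one[of f] l_one[of f] assms by (auto simp: Hom_iff)
qed

lemma Add_Neg [simp]:
  assumes "f \<in> Arr C"
  shows "Add C f (Neg f) = Zer C (Dom C f) (Cod C f)" "Add C (Neg f) f = Zer C (Dom C f) (Cod C f)"
proof -
  interpret comm_group "hom_group C (Dom C f) (Cod C f)" by (rule hom_comm_group) (use assms in auto)
  show "Add C f (Neg f) = Zer C (Dom C f) (Cod C f)" "Add C (Neg f) f = Zer C (Dom C f) (Cod C f)"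
    using r_inv[of f] l_inv[of f] assms by (auto simp: Hom_iff Neg_def)
qed

lemma Add_left_cancel:
  assumes "f \<in> Arr C" "g \<in> Arr C" "h \<in> Arr C" "Dom C g = Dom C f" "Cod C g = Cod C f"
    "Dom C h = Dom C f" "Cod C h = Cod C f"
  shows "Add C f g = Add C f h \<longleftrightarrow> g = h"
proof -
  interpret comm_group "hom_group C (Dom C f) (Cod C f)" by (rule hom_comm_group) (use assms in auto)
  show ?thesis using Units_l_cancel[of f g h] Units_eq assms by (auto simp: Hom_iff)
qed

lemma Neg_unique:
  assumes "f \<in> Arr C" "g \<in> Arr C" "Dom C g = Dom C f" "Cod C g = Cod C f"
    "Add C f g = Zer C (Dom C f) (Cod C f)"
  shows "g = Neg f"
  using assms Add_left_cancel[of f g "Neg f"] by simp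

lemma Neg_Neg [simp]: "f \<in> Arr C \<Longrightarrow> Neg (Neg f) = f"
  using Neg_unique[of "Neg f" f] by simp

lemma Neg_Zer [simp]: "A \<in> Obj C \<Longrightarrow> B \<in> Obj C \<Longrightarrow> Neg (Zer C A B) = Zer C A B"
  using Neg_unique[of "Zer C A B" "Zer C A B"] by simp

lemma Comp_Add_Arr [simp]:
  assumes "f \<in> Arr C" "g \<in> Arr C" "h \<in> Arr C" "Dom C g = Dom C f" "Cod C g = Cod C f"
    "Dom C h = Cod C f"
  shows "h \<cdot> Add C f g = Add C (h \<cdot> f) (h \<cdot> g)"
  using Comp_Add[of f "Dom C f" "Cod C f" g h "Cod C h"] assms by (auto simp: Hom_iff)

lemma Add_Comp_Arr [simp]:
  assumes "f \<in> Arr C" "g \<in> Arr C" "h \<in> Arr C" "Dom C h = Dom C g" "Cod C h = Cod C g"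
    "Dom C g = Cod C f"
  shows "Add C g h \<cdot> f = Add C (g \<cdot> f) (h \<cdot> f)"
  using Add_Comp[of f "Dom C f" "Cod C f" g "Cod C g" h] assms by (auto simp: Hom_iff)

lemma Add_self_Zer:
  assumes "f \<in> Arr C" "Add C f f = f"
  shows "f = Zer C (Dom C f) (Cod C f)"
  using assms Add_left_cancel[of f f "Zer C (Dom C f) (Cod C f)"] by simp

lemma Comp_Zer [simp]:
  assumes "A \<in> Obj C" "g \<in> Arr C" "Dom C g = B"
  shows "g \<cdot> Zer C A B = Zer C A (Cod C g)"
proof -
  have B: "B \<in> Obj C" using assms by auto
  have "Add C (g \<cdot> Zer C A B) (g \<cdot> Zer C A B) = g \<cdot> Add C (Zer C A B) (Zer C A B)"
    by (subst Comp_Add_Arr) (use assms B in simp_all)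
  also have "\<dots> = g \<cdot> Zer C A B" using assms B by simp
  finally show ?thesis using Add_self_Zer[of "g \<cdot> Zer C A B"] assms B by simp
qed

lemma Zer_Comp [simp]:
  assumes "B \<in> Obj C" "f \<in> Arr C" "Cod C f = A"
  shows "Zer C A B \<cdot> f = Zer C (Dom C f) B"
proof -
  have A: "A \<in> Obj C" using assms by auto
  have "Add C (Zer C A B \<cdot> f) (Zer C A B \<cdot> f) = Add C (Zer C A B) (Zer C A B) \<cdot> f"
    by (subst Add_Comp_Arr) (use assms A in simp_all)
  also have "\<dots> = Zer C A B \<cdot> f" using assms A by simp
  finally show ?thesis using Add_self_Zer[of "Zer C A B \<cdot> f"] assms A by simp
qed

lemma Comp_Neg [simp]:
  assumes "f \<in> Arr C" "g \<in> Arr C" "Cod C f = Dom C g"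
  shows "g \<cdot> Neg f = Neg (g \<cdot> f)"
proof -
  have "Add C (g \<cdot> f) (g \<cdot> Neg f) = g \<cdot> Add C f (Neg f)"
    by (subst Comp_Add_Arr) (use assms in simp_all)
  then show ?thesis using assms by (intro Neg_unique) simp_all
qed

lemma Neg_Comp [simp]:
  assumes "f \<in> Arr C" "g \<in> Arr C" "Cod C f = Dom C g"
  shows "Neg g \<cdot> f = Neg (g \<cdot> f)"
proof -
  have "Add C (g \<cdot> f) (Neg g \<cdot> f) = Add C g (Neg g) \<cdot> f"
    by (subst Add_Comp_Arr) (use assms in simp_all)
  then show ?thesis using assms by (intro Neg_unique) simp_all
qed

lemma Comp_Sub [simp]:
  assumes "f \<in> Arr C" "g \<in> Arr C" "h \<in> Arr C" "Dom C g = Dom C f" "Cod C g = Cod C f"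
    "Dom C h = Cod C f"
  shows "h \<cdot> Sub f g = Sub (h \<cdot> f) (h \<cdot> g)"
  using assms by (simp add: Sub_def)

lemma Sub_Comp [simp]:
  assumes "f \<in> Arr C" "g \<in> Arr C" "h \<in> Arr C" "Dom C h = Dom C g" "Cod C h = Cod C g"
    "Dom C g = Cod C f"
  shows "Sub g h \<cdot> f = Sub (g \<cdot> f) (h \<cdot> f)"
  using assms by (simp add: Sub_def)

lemma Sub_self [simp]: "f \<in> Arr C \<Longrightarrow> Sub f f = Zer C (Dom C f) (Cod C f)"
  by (simp add: Sub_def)

lemma Sub_Zer [simp]: "f \<in> Arr C \<Longrightarrow> Dom C f = A \<Longrightarrow> Cod C f = B \<Longrightarrow> Sub f (Zer C A B) = f"
  using Neg_Zer[of A B] by (auto simp add: Sub_def)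

lemma Add_Sub_cancel:
  assumes "f \<in> Arr C" "g \<in> Arr C" "Dom C g = Dom C f" "Cod C g = Cod C f"
  shows "Sub (Add C f g) g = f" "Add C (Sub f g) g = f"
  using assms by (simp_all add: Sub_def Add_assoc)

lemma Sub_eq_iff:
  assumes "f \<in> Arr C" "g \<in> Arr C" "h \<in> Arr C" "Dom C g = Dom C f" "Cod C g = Cod C f"
    "Dom C h = Dom C f" "Cod C h = Cod C f"
  shows "Sub f g = h \<longleftrightarrow> f = Add C h g"
proof -
  have "Add C (Sub f g) g = f" by (rule Add_Sub_cancel) (use assms in simp_all)
  moreover have "Sub (Add C h g) g = h" by (rule Add_Sub_cancel) (use assms in simp_all)
  ultimately show ?thesis by metis
qed

lemma Sub_eq_Zer_iff:
  assumes "f \<in> Arr C" "g \<in> Arr C" "Dom C f = A" "Cod C f = B" "Dom C g = A" "Cod C g = B"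
  shows "Sub f g = Zer C A B \<longleftrightarrow> f = g"
proof -
  have "A \<in> Obj C" "B \<in> Obj C" using assms by auto
  then have "Sub f g = Zer C A B \<longleftrightarrow> f = Add C (Zer C A B) g"
    by (intro Sub_eq_iff) (use assms in simp_all)
  also have "Add C (Zer C A B) g = g" using assms by simp
  finally show ?thesis .
qed

lemma Sub_Sub_cancel:
  assumes "f \<in> Arr C" "g \<in> Arr C" "Dom C g = Dom C f" "Cod C g = Cod C f"
  shows "Sub f (Sub f g) = g"
proof -
  have "f = Add C (Sub f g) g" using assms by (simp add: Add_Sub_cancel)
  also have "\<dots> = Add C g (Sub f g)" using assms by (intro Add_commute) simp_all
  finally show ?thesis using Sub_eq_iff[of f "Sub f g" g] assms by simp
qed

section \<open>Zero objects, epimorphisms, monomorphisms and kernels\<close>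

lemma zero_arr_Dom:
  assumes "is_zero_obj C (Dom C f)" "f \<in> Arr C"
  shows "f = Zer C (Dom C f) (Cod C f)"
proof -
  have "\<exists>!g. g \<in> Hom C (Dom C f) (Cod C f)"
    using assms by (simp add: is_zero_obj_def)
  moreover have "f \<in> Hom C (Dom C f) (Cod C f)" "Zer C (Dom C f) (Cod C f) \<in> Hom C (Dom C f) (Cod C f)"
    using assms by (auto simp: Hom_iff)
  ultimately show ?thesis by blast
qed

lemma zero_arr_Cod:
  assumes "is_zero_obj C (Cod C f)" "f \<in> Arr C"
  shows "f = Zer C (Dom C f) (Cod C f)"
proof -
  have "\<exists>!g. g \<in> Hom C (Dom C f) (Cod C f)"
    using assms by (simp add: is_zero_obj_def)
  moreover have "f \<in> Hom C (Dom C f) (Cod C f)" "Zer C (Dom C f) (Cod C f) \<in> Hom C (Dom C f) (Cod C f)"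
    using assms by (auto simp: Hom_iff)
  ultimately show ?thesis by blast
qed

text \<open>Two morphisms that agree after \<open>f\<close> have a difference killed by
  \<open>f\<close>; hom-sets being groups, cancellation only has to be tested against zero.\<close>

lemma is_epi_iff: "is_epi C f \<longleftrightarrow> f \<in> Arr C \<and>
  (\<forall>g. g \<in> Arr C \<longrightarrow> Dom C g = Cod C f \<longrightarrow> g \<cdot> f = Zer C (Dom C f) (Cod C g) \<longrightarrow>
     g = Zer C (Cod C f) (Cod C g))" (is "?L \<longleftrightarrow> ?R")
proof
  assume L: ?L
  have "g = Zer C (Cod C f) (Cod C g)" if "g \<in> Arr C" "Dom C g = Cod C f"
    "g \<cdot> f = Zer C (Dom C f) (Cod C g)" for g
  proof -
    have "g \<in> Hom C (Cod C f) (Cod C g)" "Zer C (Cod C f) (Cod C g) \<in> Hom C (Cod C f) (Cod C g)"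
      using L that by (auto simp: Hom_iff is_epi_def)
    moreover have "g \<cdot> f = Zer C (Cod C f) (Cod C g) \<cdot> f"
      using L that by (simp add: is_epi_def)
    ultimately show ?thesis using L unfolding is_epi_def by blast
  qed
  with L show ?R by (auto simp: is_epi_def)
next
  assume R: ?R
  show ?L unfolding is_epi_def
  proof (intro conjI allI ballI impI)
    show f: "f \<in> Arr C" using R by blast
    fix B g h
    assume "g \<in> Hom C (Cod C f) B" "h \<in> Hom C (Cod C f) B" and eq: "g \<cdot> f = h \<cdot> f"
    then have gh: "g \<in> Arr C" "h \<in> Arr C" "Dom C g = Cod C f" "Dom C h = Cod C f" "Cod C g = B" "Cod C h = B"
      by (auto simp: Hom_iff)
    then have B: "B \<in> Obj C" by auto
    have "Sub g h \<cdot> f = Zer C (Dom C f) (Cod C (Sub g h))"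
      using gh f eq by simp
    then have "Sub g h = Zer C (Cod C f) B"
      using R[THEN conjunct2, rule_format, of "Sub g h"] gh by simp
    then show "g = h" using Sub_eq_Zer_iff[of g h "Cod C f" B] gh by simp
  qed
qed

lemma epiD:
  assumes "is_epi C f" "g \<in> Arr C" "Dom C g = Cod C f" "g \<cdot> f = Zer C (Dom C f) (Cod C g)"
  shows "g = Zer C (Cod C f) (Cod C g)"
  using assms unfolding is_epi_iff by blast

lemma epiI:
  assumes "f \<in> Arr C" "\<And>g. g \<in> Arr C \<Longrightarrow> Dom C g = Cod C f \<Longrightarrow> g \<cdot> f = Zer C (Dom C f) (Cod C g) \<Longrightarrow>
    g = Zer C (Cod C f) (Cod C g)"
  shows "is_epi C f"
  using assms unfolding is_epi_iff by blast

lemma epi_cancel: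
  assumes "is_epi C f" "g \<in> Arr C" "h \<in> Arr C" "Dom C g = Cod C f" "Dom C h = Cod C f" "g \<cdot> f = h \<cdot> f"
  shows "g = h"
proof -
  have "Cod C (g \<cdot> f) = Cod C g" "Cod C (h \<cdot> f) = Cod C h"
    using assms(1-5) by (simp_all add: is_epi_def)
  then have "g \<in> Hom C (Cod C f) (Cod C g)" "h \<in> Hom C (Cod C f) (Cod C g)"
    using assms(2-6) by (auto simp: Hom_iff)
  then show ?thesis using assms(1,6) unfolding is_epi_def by blast
qed

lemma epi_Arr [simp]: "is_epi C f \<Longrightarrow> f \<in> Arr C"
  by (simp add: is_epi_def)

lemma mono_Arr [simp]: "is_mono C f \<Longrightarrow> f \<in> Arr C"
  by (simp add: is_mono_def)

lemma epi_Idm [simp]: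
  assumes A: "A \<in> Obj C"
  shows "is_epi C (Idm C A)"
proof (rule epiI)
  fix g assume g: "g \<in> Arr C" "Dom C g = Cod C (Idm C A)"
    "g \<cdot> Idm C A = Zer C (Dom C (Idm C A)) (Cod C g)"
  have "g \<cdot> Idm C A = g" using g(1,2) A by simp
  with g(3) show "g = Zer C (Cod C (Idm C A)) (Cod C g)" using A by simp
qed (use A in simp)

lemma epi_Comp:
  assumes "is_epi C f" "is_epi C g" "Dom C g = Cod C f"
  shows "is_epi C (g \<cdot> f)"
proof (rule epiI)
  have fg [simp]: "f \<in> Arr C" "g \<in> Arr C" using assms by auto
  then show "g \<cdot> f \<in> Arr C" using assms(3) by simp
  fix h assume "h \<in> Arr C" "Dom C h = Cod C (g \<cdot> f)" and eq: "h \<cdot> (g \<cdot> f) = Zer C (Dom C (g \<cdot> f)) (Cod C h)"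
  then have h: "h \<in> Arr C" "Dom C h = Cod C g" using assms(3) by simp_all
  have "(h \<cdot> g) \<cdot> f = Zer C (Dom C f) (Cod C (h \<cdot> g))"
    using eq h assms(3) by simp
  then have "h \<cdot> g = Zer C (Cod C f) (Cod C (h \<cdot> g))"
    by (rule epiD[OF assms(1), rotated 2]) (use h assms(3) in simp_all)
  then have "h \<cdot> g = Zer C (Dom C g) (Cod C h)" using h assms(3) by simp
  then show "h = Zer C (Cod C (g \<cdot> f)) (Cod C h)"
    using epiD[OF assms(2) h] assms(3) by simp
qed

lemma epi_of_Comp:
  assumes "is_epi C (g \<cdot> f)" "f \<in> Arr C" "g \<in> Arr C" "Dom C g = Cod C f"
  shows "is_epi C g"
proof (rule epiI)
  fix h assume h: "h \<in> Arr C" "Dom C h = Cod C g" and eq: "h \<cdot> g = Zer C (Dom C g) (Cod C h)"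
  have "h \<cdot> (g \<cdot> f) = (h \<cdot> g) \<cdot> f" using h assms(2-4) by simp
  also have "\<dots> = Zer C (Dom C f) (Cod C h)" unfolding eq using h assms(2-4) by simp
  finally have "h \<cdot> (g \<cdot> f) = Zer C (Dom C (g \<cdot> f)) (Cod C h)" using assms(2-4) by simp
  from epiD[OF assms(1) h(1) _ this] show "h = Zer C (Cod C g) (Cod C h)"
    using h assms(2-4) by simp
qed fact

lemma kernelD:
  assumes "is_kernel C f k"
  shows "f \<in> Arr C" "k \<in> Arr C" "Cod C k = Dom C f" "f \<cdot> k = Zer C (Dom C k) (Cod C f)"
  using assms by (auto simp: is_kernel_def)

lemma kernel_factor:
  assumes "is_kernel C f k" "h \<in> Arr C" "Cod C h = Dom C f" "f \<cdot> h = Zer C (Dom C h) (Cod C f)"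
  obtains u where "u \<in> Arr C" "Dom C u = Dom C h" "Cod C u = Dom C k" "k \<cdot> u = h"
  using assms unfolding is_kernel_def by (metis HomI Hom_iff)

lemma kernel_mono:
  assumes "is_kernel C f k"
  shows "is_mono C k"
  unfolding is_mono_def
proof (intro conjI allI ballI impI)
  note k = kernelD[OF assms]
  show "k \<in> Arr C" by fact
  fix A g h assume g: "g \<in> Hom C A (Dom C k)" and h: "h \<in> Hom C A (Dom C k)" and eq: "k \<cdot> g = k \<cdot> h"
  have "f \<cdot> (k \<cdot> g) = Zer C A (Cod C f)"
    using k g Comp_extend[OF k(4), of g] by (auto simp: Hom_iff)
  moreover have "k \<cdot> g \<in> Hom C A (Dom C f)" using k g by (auto simp: Hom_iff)
  ultimately show "g = h" using assms g h eq unfolding is_kernel_def by metis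
qed

lemma mono_cancel:
  assumes "is_mono C f" "g \<in> Arr C" "h \<in> Arr C" "Cod C g = Dom C f" "Cod C h = Dom C f" "f \<cdot> g = f \<cdot> h"
  shows "g = h"
proof -
  have "Dom C (f \<cdot> g) = Dom C g" "Dom C (f \<cdot> h) = Dom C h"
    using assms(1-5) by (simp_all add: is_mono_def)
  then have "g \<in> Hom C (Dom C g) (Dom C f)" "h \<in> Hom C (Dom C g) (Dom C f)"
    using assms(2-6) by (auto simp: Hom_iff)
  then show ?thesis using assms(1,6) unfolding is_mono_def by blast
qed

lemma monoD:
  assumes "is_mono C f" "g \<in> Arr C" "Cod C g = Dom C f" "f \<cdot> g = Zer C (Dom C g) (Cod C f)"
  shows "g = Zer C (Dom C g) (Dom C f)"
  by (rule mono_cancel[OF assms(1)]) (use assms in simp_all)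

end

section \<open>Duality\<close>

text \<open>Morphisms and their addition are kept and only source and target trade places. Thus the
  double opposite is \<open>C\<close> itself, and hom-groups agree literally, without transport
  along an isomorphism.\<close>

definition opcat :: "('o, 'm) cat \<Rightarrow> ('o, 'm) cat" where
  "opcat C = \<lparr>Obj = Obj C, Arr = Arr C, Dom = Cod C, Cod = Dom C, Idm = Idm C,
     Comp = (\<lambda>g f. f \<cdot>\<^bsub>C\<^esub> g), Add = Add C, Zer = (\<lambda>A B. Zer C B A)\<rparr>"

lemma opcat_sel [simp]:
  "Obj (opcat C) = Obj C" "Arr (opcat C) = Arr C" "Dom (opcat C) = Cod C" "Cod (opcat C) = Dom C"
  "Idm (opcat C) = Idm C" "g \<cdot>\<^bsub>opcat C\<^esub> f = f \<cdot>\<^bsub>C\<^esub> g" "Add (opcat C) = Add C"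
  "Zer (opcat C) A B = Zer C B A"
  by (simp_all add: opcat_def)

lemma opcat_opcat [simp]: "opcat (opcat C) = C"
  by (simp add: opcat_def)

lemma Hom_opcat [simp]: "Hom (opcat C) A B = Hom C B A"
  by (auto simp: Hom_def)

lemma hom_group_opcat [simp]: "hom_group (opcat C) A B = hom_group C B A"
  by (simp add: hom_group_def)

lemma is_mono_opcat [simp]: "is_mono (opcat C) f = is_epi C f"
  by (simp add: is_mono_def is_epi_def)

lemma is_epi_opcat [simp]: "is_epi (opcat C) f = is_mono C f"
  by (simp add: is_mono_def is_epi_def)

lemma is_kernel_opcat [simp]: "is_kernel (opcat C) f k = is_cokernel C f k"
  by (simp add: is_kernel_def is_cokernel_def)

lemma is_cokernel_opcat [simp]: "is_cokernel (opcat C) f k = is_kernel C f k"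
  by (simp add: is_kernel_def is_cokernel_def)

lemma is_zero_obj_opcat [simp]: "is_zero_obj (opcat C) Z = is_zero_obj C Z"
  by (auto simp add: is_zero_obj_def)

lemma zero_obj_opcat [simp]: "zero_obj (opcat C) = zero_obj C"
  by (simp add: zero_obj_def)

lemma is_biproduct_opcat_aux: "is_biproduct C A B P \<Longrightarrow> is_biproduct (opcat C) A B P"
proof -
  assume "is_biproduct C A B P"
  then obtain i j p q where "i \<in> Hom C A P" "j \<in> Hom C B P" "p \<in> Hom C P A" "q \<in> Hom C P B"
    "p \<cdot>\<^bsub>C\<^esub> i = Idm C A" "q \<cdot>\<^bsub>C\<^esub> j = Idm C B" "p \<cdot>\<^bsub>C\<^esub> j = Zer C B A" "q \<cdot>\<^bsub>C\<^esub> i = Zer C A B"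
    "Add C (i \<cdot>\<^bsub>C\<^esub> p) (j \<cdot>\<^bsub>C\<^esub> q) = Idm C P"
    unfolding is_biproduct_def by blast
  then show ?thesis
    unfolding is_biproduct_def
    by (intro bexI[of _ p] bexI[of _ q] bexI[of _ i] bexI[of _ j]) simp_all
qed

lemma is_biproduct_opcat [simp]: "is_biproduct (opcat C) A B P = is_biproduct C A B P"
  using is_biproduct_opcat_aux[of C] is_biproduct_opcat_aux[of "opcat C"] by auto

lemma is_isomorphism_opcat [simp]: "is_isomorphism (opcat C) f = is_isomorphism C f"
  by (auto simp add: is_isomorphism_def)

lemma isomorphic_opcat [simp]: "isomorphic (opcat C) A B = isomorphic C B A"
  by (auto simp add: isomorphic_def)

lemma (in abelian_category) abelian_opcat: "abelian_category (opcat C)"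
proof (intro abelian_category.intro preadditive_category.intro)
  show "category (opcat C)"
    by unfold_locales (auto simp: Hom_iff)
  show "preadditive_category_axioms (opcat C)"
    by (rule preadditive_category_axioms.intro) (simp_all add: hom_comm_group Hom_iff)
  show "abelian_category_axioms (opcat C)"
    by (rule abelian_category_axioms.intro) (simp_all add: ex_zero_obj ex_biproduct ex_kernel ex_cokernel mono_is_kernel epi_is_cokernel)
qed

section \<open>Exactness by generalised elements\<close>

lemma (in abelian_category) preadditive_opcat: "preadditive_category (opcat C)"
  using abelian_opcat by (simp add: abelian_category_def)

text \<open>Exactness for generalised elements: the epimorphism \<open>e\<close> plays the role of
  choosing a preimage of an actual element. Chases accumulate such covers, and an equation between
  morphisms is recovered by cancelling them.\<close>

definition exact_at :: "('o, 'm) cat \<Rightarrow> 'm \<Rightarrow> 'm \<Rightarrow> bool" where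
  "exact_at C f g \<longleftrightarrow> f \<in> Arr C \<and> g \<in> Arr C \<and> Cod C f = Dom C g \<and>
     g \<cdot>\<^bsub>C\<^esub> f = Zer C (Dom C f) (Cod C g) \<and>
     (\<forall>y \<in> Arr C. Cod C y = Dom C g \<longrightarrow> g \<cdot>\<^bsub>C\<^esub> y = Zer C (Dom C y) (Cod C g) \<longrightarrow>
        (\<exists>e x. is_epi C e \<and> Cod C e = Dom C y \<and> x \<in> Arr C \<and> Dom C x = Dom C e \<and> Cod C x = Dom C f \<and>
           f \<cdot>\<^bsub>C\<^esub> x = y \<cdot>\<^bsub>C\<^esub> e))"

context abelian_category
begin

lemmas cokernelD = preadditive_category.kernelD[OF preadditive_opcat, simplified]
lemmas cokernel_factor = preadditive_category.kernel_factor[OF preadditive_opcat, simplified]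
lemmas cokernel_epi = preadditive_category.kernel_mono[OF preadditive_opcat, simplified]
lemmas monoI = preadditive_category.epiI[OF preadditive_opcat, simplified]
lemmas mono_of_Comp = preadditive_category.epi_of_Comp[OF preadditive_opcat, simplified]

lemma biproductE:
  assumes "A \<in> Obj C" "B \<in> Obj C"
  obtains P i j p q where
    "P \<in> Obj C" "i \<in> Arr C" "j \<in> Arr C" "p \<in> Arr C" "q \<in> Arr C"
    "Dom C i = A" "Cod C i = P" "Dom C j = B" "Cod C j = P" "Dom C p = P" "Cod C p = A" "Dom C q = P" "Cod C q = B"
    "p \<cdot> i = Idm C A" "q \<cdot> j = Idm C B" "p \<cdot> j = Zer C B A" "q \<cdot> i = Zer C A B"
    "Add C (i \<cdot> p) (j \<cdot> q) = Idm C P" "is_biproduct C A B P"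
proof -
  obtain P where P: "is_biproduct C A B P" using ex_biproduct[OF assms] by blast
  then obtain i j p q where H: "i \<in> Hom C A P" "j \<in> Hom C B P" "p \<in> Hom C P A" "q \<in> Hom C P B"
    and E: "p \<cdot> i = Idm C A" "q \<cdot> j = Idm C B" "p \<cdot> j = Zer C B A" "q \<cdot> i = Zer C A B"
    "Add C (i \<cdot> p) (j \<cdot> q) = Idm C P"
    unfolding is_biproduct_def by blast
  have T: "i \<in> Arr C" "j \<in> Arr C" "p \<in> Arr C" "q \<in> Arr C"
    "Dom C i = A" "Cod C i = P" "Dom C j = B" "Cod C j = P" "Dom C p = P" "Cod C p = A" "Dom C q = P" "Cod C q = B"
    using H by (simp_all only: Hom_iff)
  have "P \<in> Obj C" using Dom_Obj[OF T(3)] T(9) by simp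
  show ?thesis by (rule that[of P i j p q]) (fact \<open>P \<in> Obj C\<close> T E P)+
qed

text \<open>In an abelian category \<open>e\<close> is the cokernel of some \<open>g\<close>, and
  \<open>kill\<close> applied to this \<open>g\<close> gives the factorization. Quantifying over all
  \<open>\<kappa>\<close> spares the user from exhibiting \<open>g\<close>.\<close>

lemma epi_factor:
  assumes e: "is_epi C e" and x: "x \<in> Arr C" "Dom C x = Dom C e"
    and kill: "\<And>\<kappa>. \<kappa> \<in> Arr C \<Longrightarrow> Cod C \<kappa> = Dom C e \<Longrightarrow> e \<cdot> \<kappa> = Zer C (Dom C \<kappa>) (Cod C e) \<Longrightarrow>
      x \<cdot> \<kappa> = Zer C (Dom C \<kappa>) (Cod C x)"
  obtains y where "y \<in> Arr C" "Dom C y = Cod C e" "Cod C y = Cod C x" "y \<cdot> e = x"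
proof -
  obtain g where g: "is_cokernel C g e" using epi_is_cokernel[OF e] by blast
  note gD = cokernelD[OF g]
  have "x \<cdot> g = Zer C (Dom C g) (Cod C x)" using kill[of g] gD by simp
  then show ?thesis using cokernel_factor[OF g, of x] gD x that by auto
qed

text \<open>Epimorphisms are stable under base change, which is what reasoning with covers rests on.
  The pullback is realised as the kernel of a difference map out of a biproduct.\<close>

lemma pullback_epi:
  assumes f: "is_epi C f" and g: "g \<in> Arr C" "Cod C g = Cod C f"
  obtains e x where "is_epi C e" "Cod C e = Dom C g" "x \<in> Arr C" "Dom C x = Dom C e"
    "Cod C x = Dom C f" "f \<cdot> x = g \<cdot> e"
proof -
  have fA [simp]: "f \<in> Arr C" using f by simp
  obtain P i j p q where P [simp]:
    "P \<in> Obj C" "i \<in> Arr C" "j \<in> Arr C" "p \<in> Arr C" "q \<in> Arr C"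
    "Dom C i = Dom C f" "Cod C i = P" "Dom C j = Dom C g" "Cod C j = P"
    "Dom C p = P" "Cod C p = Dom C f" "Dom C q = P" "Cod C q = Dom C g"
    "p \<cdot> i = Idm C (Dom C f)" "q \<cdot> j = Idm C (Dom C g)" "p \<cdot> j = Zer C (Dom C g) (Dom C f)"
    "q \<cdot> i = Zer C (Dom C f) (Dom C g)"
    by (rule biproductE[of "Dom C f" "Dom C g"]) (use g in simp_all)
  \<comment> \<open>\<open>w\<close> is epi because it restricts to \<open>f\<close> on the first
    summand; its kernel is the pullback, with projections \<open>p \<cdot> k\<close> and
    \<open>q \<cdot> k\<close>.\<close>
  define w where "w = Sub (f \<cdot> p) (g \<cdot> q)"
  have w [simp]: "w \<in> Arr C" "Dom C w = P" "Cod C w = Cod C f"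
    unfolding w_def using g by simp_all
  have wi: "w \<cdot> i = f" unfolding w_def using g by simp
  have wepi: "is_epi C w" by (rule epi_of_Comp[of _ i]) (simp_all add: wi f)
  obtain k where k: "is_kernel C w k" using ex_kernel[of w] by auto
  note kD [simp] = kernelD[OF k]
  have eq: "f \<cdot> (p \<cdot> k) = g \<cdot> (q \<cdot> k)"
  proof -
    have "Sub (f \<cdot> (p \<cdot> k)) (g \<cdot> (q \<cdot> k)) = w \<cdot> k" unfolding w_def using g by simp
    also have "\<dots> = Zer C (Dom C k) (Cod C f)" by simp
    finally show ?thesis using Sub_eq_Zer_iff[of "f \<cdot> (p \<cdot> k)" "g \<cdot> (q \<cdot> k)"] g by simp
  qed
  have "is_epi C (q \<cdot> k)"
  proof (rule epiI)
    show "q \<cdot> k \<in> Arr C" by simp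
    fix u assume "u \<in> Arr C" "Dom C u = Cod C (q \<cdot> k)" and z: "u \<cdot> (q \<cdot> k) = Zer C (Dom C (q \<cdot> k)) (Cod C u)"
    then have u [simp]: "u \<in> Arr C" "Dom C u = Dom C g" by simp_all
    have z': "u \<cdot> (q \<cdot> k) = Zer C (Dom C k) (Cod C u)" using z by simp
    \<comment> \<open>If \<open>u\<close> kills \<open>q \<cdot> k\<close>, then
      \<open>u \<cdot> q\<close> vanishes on the kernel of \<open>w\<close> and equals some
      \<open>v \<cdot> w\<close>. Restriction to the first summand shows that \<open>v\<close> kills
      the epi \<open>f\<close>, hence vanishes; restriction to the second then makes
      \<open>u\<close> vanish.\<close>
    have "\<exists>v. v \<in> Arr C \<and> Dom C v = Cod C w \<and> Cod C v = Cod C (u \<cdot> q) \<and> v \<cdot> w = u \<cdot> q"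
    proof (rule epi_factor[OF wepi, of "u \<cdot> q"])
      fix \<kappa> assume \<kappa>: "\<kappa> \<in> Arr C" "Cod C \<kappa> = Dom C w" "w \<cdot> \<kappa> = Zer C (Dom C \<kappa>) (Cod C w)"
      obtain t where t: "t \<in> Arr C" "Dom C t = Dom C \<kappa>" "Cod C t = Dom C k" "k \<cdot> t = \<kappa>"
        by (rule kernel_factor[OF k \<kappa>]) 
      have "u \<cdot> q \<cdot> \<kappa> = (u \<cdot> (q \<cdot> k)) \<cdot> t" unfolding t(4)[symmetric] using t(1-3) g by simp
      also have "\<dots> = Zer C (Dom C \<kappa>) (Cod C u)" unfolding z' using t(1-3) by simp
      finally show "u \<cdot> q \<cdot> \<kappa> = Zer C (Dom C \<kappa>) (Cod C (u \<cdot> q))" by simp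
    qed auto
    then obtain v where v: "v \<in> Arr C" "Dom C v = Cod C f" "Cod C v = Cod C u" "v \<cdot> w = u \<cdot> q" by auto
    have "v \<cdot> f = (v \<cdot> w) \<cdot> i" using v(1-3) wi by simp
    also have "\<dots> = Zer C (Dom C f) (Cod C v)" unfolding v(4) using v(1-3) g by simp
    finally have v0: "v = Zer C (Cod C f) (Cod C v)" by (rule epiD[OF f v(1,2)])
    have "u = (v \<cdot> w) \<cdot> j" unfolding v(4) using g by simp
    also have "\<dots> = Zer C (Cod C (q \<cdot> k)) (Cod C u)"
    proof -
      have "v \<cdot> w = Zer C P (Cod C v)" by (subst v0) (use v(1-3) in simp)
      then show ?thesis using v(1-3) g by simp
    qed
    finally show "u = Zer C (Cod C (q \<cdot> k)) (Cod C u)" .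
  qed
  then show ?thesis using that[of "q \<cdot> k" "p \<cdot> k"] eq by simp
qed

lemmas pushout_mono = abelian_category.pullback_epi[OF abelian_opcat, simplified]

lemma exact_atD:
  assumes "exact_at C f g"
  shows "f \<in> Arr C" "g \<in> Arr C" "Cod C f = Dom C g" "g \<cdot> f = Zer C (Dom C f) (Cod C g)"
  using assms by (auto simp: exact_at_def)

lemma exact_at_lift:
  assumes "exact_at C f g" "y \<in> Arr C" "Cod C y = Dom C g" "g \<cdot> y = Zer C (Dom C y) (Cod C g)"
  obtains e x where "is_epi C e" "Cod C e = Dom C y" "x \<in> Arr C" "Dom C x = Dom C e" "Cod C x = Dom C f"
    "f \<cdot> x = y \<cdot> e"
  using assms unfolding exact_at_def by metis

lemma exact_at_kernel:
  assumes k: "is_kernel C g k"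
  shows "exact_at C k g"
  unfolding exact_at_def
proof (intro conjI ballI impI)
  fix y assume "y \<in> Arr C" "Cod C y = Dom C g" "g \<cdot> y = Zer C (Dom C y) (Cod C g)"
  then obtain u where u: "u \<in> Arr C" "Dom C u = Dom C y" "Cod C u = Dom C k" "k \<cdot> u = y"
    by (rule kernel_factor[OF k])
  show "\<exists>e x. is_epi C e \<and> Cod C e = Dom C y \<and> x \<in> Arr C \<and> Dom C x = Dom C e \<and> Cod C x = Dom C k \<and>
           k \<cdot> x = y \<cdot> e"
    by (rule exI[of _ "Idm C (Dom C y)"], rule exI[of _ u]) (use u \<open>y \<in> Arr C\<close> in simp)
qed (use kernelD[OF k] in auto)

text \<open>Exactness provides a lift \<open>x\<close> over a cover \<open>e\<close> only. As
  \<open>f\<close> is mono, \<open>x\<close> vanishes on whatever \<open>e\<close> kills, so it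
  descends to a lift \<open>u\<close> defined on the source of \<open>h\<close> itself.\<close>

lemma exact_at_mono_kernel:
  assumes ex: "exact_at C f g" and mono: "is_mono C f"
  shows "is_kernel C g f"
  unfolding is_kernel_def
proof (intro conjI ballI allI impI)
  note D = exact_atD[OF ex]
  show "g \<in> Arr C" "f \<in> Arr C" "Cod C f = Dom C g" "g \<cdot> f = Zer C (Dom C f) (Cod C g)" by fact+
  fix A h assume "h \<in> Hom C A (Dom C g)" "g \<cdot> h = Zer C A (Cod C g)"
  then have h: "h \<in> Arr C" "Cod C h = Dom C g" "g \<cdot> h = Zer C (Dom C h) (Cod C g)" and A: "Dom C h = A"
    by (auto simp: Hom_iff)
  obtain e x where e: "is_epi C e" and [simp]: "Cod C e = Dom C h" "x \<in> Arr C" "Dom C x = Dom C e" "Cod C x = Dom C f"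
    and fx: "f \<cdot> x = h \<cdot> e"
    by (rule exact_at_lift[OF ex h])
  have [simp]: "e \<in> Arr C" using e by simp
  have "\<exists>u. u \<in> Arr C \<and> Dom C u = Cod C e \<and> Cod C u = Cod C x \<and> u \<cdot> e = x"
  proof (rule epi_factor[OF e, of x])
    fix \<kappa> assume \<kappa>: "\<kappa> \<in> Arr C" "Cod C \<kappa> = Dom C e" "e \<cdot> \<kappa> = Zer C (Dom C \<kappa>) (Cod C e)"
    have "f \<cdot> (x \<cdot> \<kappa>) = (f \<cdot> x) \<cdot> \<kappa>" using \<kappa> D by simp
    also have "\<dots> = Zer C (Dom C \<kappa>) (Cod C f)" unfolding fx using \<kappa> h D by simp
    finally show "x \<cdot> \<kappa> = Zer C (Dom C \<kappa>) (Cod C x)"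
      using monoD[OF mono, of "x \<cdot> \<kappa>"] \<kappa> by simp
  qed auto
  then obtain u where u: "u \<in> Arr C" "Dom C u = Dom C h" "Cod C u = Dom C f" "u \<cdot> e = x" by auto
  have "(f \<cdot> u) \<cdot> e = h \<cdot> e" using u(1-3) D fx unfolding u(4)[symmetric] by simp
  then have fu: "f \<cdot> u = h"
    by (rule epi_cancel[OF e, rotated -1]) (use u(1-3) D h in simp_all)
  show "\<exists>!u. u \<in> Hom C A (Dom C f) \<and> f \<cdot> u = h"
  proof (rule ex1I[of _ u])
    show "u \<in> Hom C A (Dom C f) \<and> f \<cdot> u = h" using u A fu by auto
    fix v assume "v \<in> Hom C A (Dom C f) \<and> f \<cdot> v = h"
    then show "v = u" using mono_cancel[OF mono, of v u] u fu by (auto simp: Hom_iff)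
  qed
qed

text \<open>Image factorization: exactness lifts \<open>k\<close> itself, the universal morphism
  killed by \<open>g\<close>, to \<open>f \<cdot> x = k \<cdot> e\<close>. Cancelling
  \<open>k\<close> leaves \<open>b \<cdot> x = e\<close>, so \<open>b\<close> is epi.\<close>

lemma mono_comp_epi_aux:
  assumes "exact_at C f g" "is_kernel C g k"
  obtains b where "is_epi C b" "Dom C b = Dom C f" "Cod C b = Dom C k" "k \<cdot> b = f"
proof -
  note D = exact_atD[OF assms(1)] kernelD[OF assms(2)]
  obtain b where b: "b \<in> Arr C" "Dom C b = Dom C f" "Cod C b = Dom C k" "k \<cdot> b = f"
    by (rule kernel_factor[OF assms(2) D(1,3,4)])
  obtain e x where e: "is_epi C e" "Cod C e = Dom C k" "x \<in> Arr C" "Dom C x = Dom C e" "Cod C x = Dom C f"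
    "f \<cdot> x = k \<cdot> e"
    by (rule exact_at_lift[OF assms(1), of k]) (use D in simp_all)
  have "k \<cdot> (b \<cdot> x) = (k \<cdot> b) \<cdot> x" using b(1-3) e(3-5) D by simp
  then have "k \<cdot> (b \<cdot> x) = k \<cdot> e" unfolding b(4) e(6) .
  then have "b \<cdot> x = e"
    by (rule mono_cancel[OF kernel_mono[OF assms(2)], rotated -1]) (use b e in simp_all)
  then have "is_epi C b" using epi_of_Comp[of b x] b e by simp
  then show ?thesis using that b by blast
qed

text \<open>The definition covers by epis only, so self-duality is not formal. Two factorizations
  are compared: \<open>f = k \<cdot> b\<close> with \<open>b\<close> epi, and
  \<open>g = m \<cdot> c\<close> with \<open>c\<close> the cokernel of \<open>k\<close> and
  \<open>m\<close> mono. A morphism \<open>h\<close> killing \<open>f\<close> kills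
  \<open>k\<close>, hence factors through \<open>c\<close>, and a pushout along \<open>m\<close>
  extends it.\<close>

lemma exact_at_opcat_aux:
  assumes ex: "exact_at C f g"
  shows "exact_at (opcat C) g f"
  unfolding exact_at_def
proof (intro conjI ballI impI; simp?)
  note D = exact_atD[OF ex]
  show "g \<in> Arr C" "f \<in> Arr C" "Dom C g = Cod C f" "g \<cdot> f = Zer C (Dom C f) (Cod C g)" using D by simp_all
  fix h assume h: "h \<in> Arr C" "Dom C h = Cod C f" "h \<cdot> f = Zer C (Dom C f) (Cod C h)"
  obtain k where k: "is_kernel C g k" using ex_kernel D by blast
  note kD = kernelD[OF k]
  obtain b where b: "is_epi C b" "Dom C b = Dom C f" "Cod C b = Dom C k" "k \<cdot> b = f"
    by (rule mono_comp_epi_aux[OF ex k])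
  have bA: "b \<in> Arr C" using b by simp
  have "(h \<cdot> k) \<cdot> b = h \<cdot> (k \<cdot> b)" using h(1,2) kD bA b(2,3) D by simp
  also have "\<dots> = Zer C (Dom C b) (Cod C (h \<cdot> k))"
    unfolding b(4) h(3) using h(1,2) kD bA b(2) D by simp
  finally have hk: "h \<cdot> k = Zer C (Dom C k) (Cod C h)"
    using epiD[OF b(1), of "h \<cdot> k"] h(1,2) kD b(2,3) D by simp
  obtain c where c: "is_cokernel C k c" using ex_cokernel kD by blast
  note cD = cokernelD[OF c]
  obtain m where m: "m \<in> Arr C" "Cod C m = Cod C g" "Dom C m = Cod C c" "m \<cdot> c = g"
    by (rule cokernel_factor[OF c D(2)]) (use kD cD in simp_all)
  \<comment> \<open>A \<open>y\<close> killed by \<open>m\<close> lifts along \<open>c\<close> to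
    some \<open>x\<close> over a cover; \<open>g\<close> kills \<open>x\<close>, so \<open>x\<close>
    comes from \<open>k\<close>, and then \<open>c \<cdot> x\<close> vanishes.\<close>
  have "is_mono C m"
  proof (rule monoI)
    fix y assume y: "y \<in> Arr C" "Cod C y = Dom C m" "m \<cdot> y = Zer C (Dom C y) (Cod C m)"
    obtain e x where e: "is_epi C e" "Cod C e = Dom C y" "x \<in> Arr C" "Dom C x = Dom C e" "Cod C x = Dom C c"
      and cx: "c \<cdot> x = y \<cdot> e"
      by (rule pullback_epi[OF cokernel_epi[OF c], of y]) (use y m in simp_all)
    have eA: "e \<in> Arr C" using e by simp
    have "(m \<cdot> c) \<cdot> x = m \<cdot> (c \<cdot> x)" using m(1-3) cD e by simp
    then have "g \<cdot> x = m \<cdot> (y \<cdot> e)" unfolding m(4) cx .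
    also have "\<dots> = (m \<cdot> y) \<cdot> e" using m(1-3) y(1,2) eA e(2) by simp
    also have "\<dots> = Zer C (Dom C x) (Cod C g)" unfolding y(3) using y(1,2) eA e(2,4) m(1,2) D(2) by simp
    finally have gx: "g \<cdot> x = Zer C (Dom C x) (Cod C g)" .
    obtain t where t: "t \<in> Arr C" "Dom C t = Dom C x" "Cod C t = Dom C k" "k \<cdot> t = x"
      by (rule kernel_factor[OF k e(3) _ gx]) (use e(5) cD kD in simp)
    have "(c \<cdot> k) \<cdot> t = c \<cdot> (k \<cdot> t)" using cD(1-3) kD t(1-3) by simp
    then have "y \<cdot> e = (c \<cdot> k) \<cdot> t" unfolding t(4) cx by simp
    also have "\<dots> = Zer C (Dom C e) (Cod C y)" unfolding cD(4) using cD(1,2) kD(2) t(1-3) e(4) y(1,2) m(3) by simp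
    finally show "y = Zer C (Dom C y) (Dom C m)"
      using epiD[OF e(1) y(1)] e(2) y by simp
  qed (use m in simp)
  obtain h' where h': "h' \<in> Arr C" "Cod C h' = Cod C h" "Dom C h' = Cod C c" "h' \<cdot> c = h"
    by (rule cokernel_factor[OF c h(1)]) (use kD hk h D in simp_all)
  obtain n z where nz: "is_mono C n" "Dom C n = Cod C h'" "z \<in> Arr C" "Cod C z = Cod C n" "Dom C z = Cod C m"
      and zm: "z \<cdot> m = n \<cdot> h'"
    by (rule pushout_mono[OF \<open>is_mono C m\<close>, of h']) (use m h' in simp_all)
  have nA: "n \<in> Arr C" using nz by simp
  have "(z \<cdot> m) \<cdot> c = z \<cdot> (m \<cdot> c)" using m(1-3) nz(3-5) cD by simp
  then have "z \<cdot> g = (n \<cdot> h') \<cdot> c" unfolding m(4) zm by simp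
  also have "\<dots> = n \<cdot> (h' \<cdot> c)" using nA nz(2) h'(1-3) cD by simp
  also have "\<dots> = n \<cdot> h" unfolding h'(4) ..
  finally show "\<exists>e. is_mono C e \<and> Dom C e = Cod C h \<and>
     (\<exists>x. x \<in> Arr C \<and> Cod C x = Cod C e \<and> Dom C x = Cod C g \<and> x \<cdot> g = e \<cdot> h)"
    using nz m h' by (intro exI[of _ n] conjI exI[of _ z]) simp_all
qed

lemma exact_at_opcat: "exact_at (opcat C) g f \<longleftrightarrow> exact_at C f g"
  using exact_at_opcat_aux abelian_category.exact_at_opcat_aux[OF abelian_opcat, of g f] by auto

lemma exact_at_cokernel: "is_cokernel C f q \<Longrightarrow> exact_at C f q"
  using abelian_category.exact_at_kernel[OF abelian_opcat, of f q] by (simp add: exact_at_opcat)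

lemma exact_at_epi_cokernel: "exact_at C f g \<Longrightarrow> is_epi C g \<Longrightarrow> is_cokernel C f g"
  using abelian_category.exact_at_mono_kernel[OF abelian_opcat, of g f] by (simp add: exact_at_opcat)

text \<open>A mono is the kernel of some \<open>g\<close>; since \<open>u\<close> is also epi, this
  \<open>g\<close> vanishes, so the identity of the codomain lifts through \<open>u\<close>. The
  right inverse so obtained is two-sided because \<open>u\<close> is mono.\<close>

lemma mono_epi_iso:
  assumes "is_mono C u" "is_epi C u"
  shows "is_isomorphism C u"
proof -
  obtain g where g: "is_kernel C g u" using mono_is_kernel[OF assms(1)] by blast
  note D = kernelD[OF g]
  have g0: "g = Zer C (Cod C u) (Cod C g)" by (rule epiD[OF assms(2)]) (use D in simp_all)
  have "g \<cdot> Idm C (Cod C u) = Zer C (Cod C u) (Cod C g)"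
    using D g0[symmetric] by simp
  then obtain v where v: "v \<in> Arr C" "Dom C v = Cod C u" "Cod C v = Dom C u" "u \<cdot> v = Idm C (Cod C u)"
    using kernel_factor[OF g, of "Idm C (Cod C u)"] D by (auto simp del: Comp_Idm_Arr)
  have "u \<cdot> (v \<cdot> u) = (u \<cdot> v) \<cdot> u" using D v(1-3) by simp
  also have "\<dots> = u \<cdot> Idm C (Dom C u)" unfolding v(4) using D by simp
  finally have "v \<cdot> u = Idm C (Dom C u)"
    by (rule mono_cancel[OF assms(1), rotated -1]) (use D v(1-3) in simp_all)
  then show ?thesis using v D unfolding is_isomorphism_def by (auto simp: Hom_iff)
qed

lemma iso_inverse:
  assumes "is_isomorphism C f"
  obtains g where "f \<in> Arr C" "g \<in> Arr C" "Dom C g = Cod C f" "Cod C g = Dom C f"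
    "g \<cdot> f = Idm C (Dom C f)" "f \<cdot> g = Idm C (Cod C f)"
  using assms unfolding is_isomorphism_def by (auto simp: Hom_iff)

lemma zero_objI:
  assumes A: "A \<in> Obj C" and id: "Idm C A = Zer C A A"
  shows "is_zero_obj C A"
  unfolding is_zero_obj_def
proof (intro conjI ballI)
  fix B assume B: "B \<in> Obj C"
  have "f = Zer C A B" if "f \<in> Hom C A B" for f
  proof -
    have "f = f \<cdot> Idm C A" using that by (simp add: Hom_iff)
    also have "\<dots> = Zer C A B" unfolding id using that A by (auto simp add: Hom_iff)
    finally show ?thesis .
  qed
  moreover have "Zer C A B \<in> Hom C A B" using A B by (auto simp: Hom_iff)
  ultimately show "\<exists>!f. f \<in> Hom C A B" by blast
  have "f = Zer C B A" if "f \<in> Hom C B A" for f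
  proof -
    have "f = Idm C A \<cdot> f" using that by (simp add: Hom_iff)
    also have "\<dots> = Zer C B A" unfolding id using that A by (auto simp add: Hom_iff)
    finally show ?thesis .
  qed
  moreover have "Zer C B A \<in> Hom C B A" using A B by (auto simp: Hom_iff)
  ultimately show "\<exists>!f. f \<in> Hom C B A" by blast
qed fact

lemma zero_obj_Obj [simp]: "is_zero_obj C Z \<Longrightarrow> Z \<in> Obj C"
  by (simp add: is_zero_obj_def)

lemma is_zero_obj_zero_obj [simp]: "is_zero_obj C (zero_obj C)"
  unfolding zero_obj_def using ex_zero_obj by (rule someI_ex)

end

section \<open>Complexes\<close>

text \<open>Differentials are indexed by their source, whence \<open>1 - n\<close>: the differential
  \<open>bd X (1 - n)\<close> ends in \<open>ob X (- n)\<close>, which is its source in the opposite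
  category.\<close>

definition opcx :: "('o, 'm) cplx \<Rightarrow> ('o, 'm) cplx" where
  "opcx X = \<lparr>ob = (\<lambda>n. ob X (- n)), bd = (\<lambda>n. bd X (1 - n))\<rparr>"

lemma opcx_sel [simp]: "ob (opcx X) n = ob X (- n)" "bd (opcx X) n = bd X (1 - n)"
  by (simp_all add: opcx_def)

lemma opcx_opcx [simp]: "opcx (opcx X) = X"
  by (simp add: opcx_def)

context abelian_category
begin

lemma complexD:
  assumes "is_complex C X"
  shows "ob X n \<in> Obj C" "bd X n \<in> Arr C" "Dom C (bd X n) = ob X n" "Cod C (bd X n) = ob X (n - 1)"
    "bd X (n - 1) \<cdot> bd X n = Zer C (ob X n) (ob X (n - 2))"
    "bd X n \<cdot> bd X (n + 1) = Zer C (ob X (n + 1)) (ob X (n - 1))"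
proof -
  have *: "ob X n \<in> Obj C \<and> bd X n \<in> Hom C (ob X n) (ob X (n - 1)) \<and>
        bd X (n - 1) \<cdot> bd X n = Zer C (ob X n) (ob X (n - 2))" for n
    using assms by (simp add: is_complex_def)
  show "ob X n \<in> Obj C" "bd X n \<in> Arr C" "Dom C (bd X n) = ob X n" "Cod C (bd X n) = ob X (n - 1)"
    "bd X (n - 1) \<cdot> bd X n = Zer C (ob X n) (ob X (n - 2))"
    using *[of n] by (auto simp: Hom_iff)
  show "bd X n \<cdot> bd X (n + 1) = Zer C (ob X (n + 1)) (ob X (n - 1))"
    using *[of "n + 1"] by simp
qed

lemma is_complex_opcx_aux:
  assumes "is_complex C X"
  shows "is_complex (opcat C) (opcx X)"
  unfolding is_complex_def
proof (intro allI conjI)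
  fix n
  note X = complexD[OF assms]
  show "ob (opcx X) n \<in> Obj (opcat C)" using X by simp
  show "bd (opcx X) n \<in> Hom (opcat C) (ob (opcx X) n) (ob (opcx X) (n - 1))"
    using X[of "1 - n"] by (auto simp: Hom_iff)
  have "1 - (n - 1) = 2 - n" "1 - n + 1 = 2 - n" "- (n - 2) = 2 - n" by simp_all
  then show "bd (opcx X) (n - 1) \<cdot>\<^bsub>opcat C\<^esub> bd (opcx X) n = Zer (opcat C) (ob (opcx X) n) (ob (opcx X) (n - 2))"
    using X(6)[of "1 - n"] by simp
qed

lemma is_complex_opcx: "is_complex (opcat C) (opcx X) \<longleftrightarrow> is_complex C X"
  using is_complex_opcx_aux[of X] abelian_category.is_complex_opcx_aux[OF abelian_opcat, of "opcx X"] by auto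

lemma chain_mapD:
  assumes "chain_map C X Y f"
  shows "is_complex C X" "is_complex C Y"
    "f n \<in> Arr C" "Dom C (f n) = ob X n" "Cod C (f n) = ob Y n" "bd Y n \<cdot> f n = f (n - 1) \<cdot> bd X n"
  using assms by (auto simp: chain_map_def Hom_iff)

lemma chain_map_opcx_aux:
  assumes "chain_map C X Y f"
  shows "chain_map (opcat C) (opcx Y) (opcx X) (\<lambda>n. f (- n))"
  unfolding chain_map_def
proof (intro allI conjI)
  note D = chain_mapD[OF assms]
  show "is_complex (opcat C) (opcx Y)" "is_complex (opcat C) (opcx X)" using D by (simp_all add: is_complex_opcx)
  fix n
  show "f (- n) \<in> Hom (opcat C) (ob (opcx Y) n) (ob (opcx X) n)" using D by (auto simp: Hom_iff)
  show "bd (opcx X) n \<cdot>\<^bsub>opcat C\<^esub> f (- n) = f (- (n - 1)) \<cdot>\<^bsub>opcat C\<^esub> bd (opcx Y) n"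
    using D(6)[of "1 - n"] by simp
qed

lemma chain_map_opcx: "chain_map (opcat C) (opcx Y) (opcx X) (\<lambda>n. f (- n)) \<longleftrightarrow> chain_map C X Y f"
  using chain_map_opcx_aux[of X Y f]
    abelian_category.chain_map_opcx_aux[OF abelian_opcat, of "opcx Y" "opcx X" "\<lambda>n. f (- n)"] by auto

section \<open>Homology and quasi-isomorphisms in terms of generalised elements\<close>

lemma homology_data_exists:
  assumes "is_complex C X"
  obtains k b q where "homology_data C X n k b q"
proof -
  note X = complexD[OF assms]
  obtain k where k: "is_kernel C (bd X n) k" using ex_kernel X by blast
  obtain b where b: "b \<in> Arr C" "Dom C b = ob X (n + 1)" "Cod C b = Dom C k" "k \<cdot> b = bd X (n + 1)"
    by (rule kernel_factor[OF k, of "bd X (n + 1)"]) (use X in simp_all)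
  obtain q where "is_cokernel C b q" using ex_cokernel b by blast
  then show ?thesis using that[of k b q] k b unfolding homology_data_def by (auto simp: Hom_iff)
qed

lemma homology_dataD:
  assumes X: "is_complex C X" and H: "homology_data C X n k b q"
  shows "is_kernel C (bd X n) k" "is_cokernel C b q"
    "k \<in> Arr C" "Cod C k = ob X n" "bd X n \<cdot> k = Zer C (Dom C k) (ob X (n - 1))" "is_mono C k"
    "b \<in> Arr C" "Dom C b = ob X (n + 1)" "Cod C b = Dom C k" "k \<cdot> b = bd X (n + 1)"
    "q \<in> Arr C" "Dom C q = Dom C k" "q \<cdot> b = Zer C (ob X (n + 1)) (Cod C q)" "is_epi C q"
proof -
  have H': "is_kernel C (bd X n) k" "b \<in> Hom C (ob X (n + 1)) (Dom C k)" "k \<cdot> b = bd X (n + 1)" "is_cokernel C b q"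
    using H by (auto simp: homology_data_def)
  show "is_kernel C (bd X n) k" "is_cokernel C b q" "k \<cdot> b = bd X (n + 1)" by fact+
  show b: "b \<in> Arr C" "Dom C b = ob X (n + 1)" "Cod C b = Dom C k" using H' by (auto simp: Hom_iff)
  show "k \<in> Arr C" "Cod C k = ob X n" "bd X n \<cdot> k = Zer C (Dom C k) (ob X (n - 1))" "is_mono C k"
    using kernelD[OF H'(1)] kernel_mono[OF H'(1)] complexD[OF X] by simp_all
  show "q \<in> Arr C" "Dom C q = Dom C k" "q \<cdot> b = Zer C (ob X (n + 1)) (Cod C q)" "is_epi C q"
    using cokernelD[OF H'(4)] cokernel_epi[OF H'(4)] b by simp_all
qed

text \<open>The homology object is the cokernel of \<open>b\<close>, so it is zero exactly when
  \<open>b\<close> is epi; and \<open>b\<close> is epi exactly when every cycle lifts through the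
  differential over a cover.\<close>

lemma exact_complex_iff:
  "exact_complex C X \<longleftrightarrow> is_complex C X \<and> (\<forall>n. exact_at C (bd X (n + 1)) (bd X n))"
proof (intro iffI conjI allI)
  assume "exact_complex C X"
  then show X: "is_complex C X" by (simp add: exact_complex_def)
  note XD = complexD[OF X]
  fix n
  obtain k b q where H: "homology_data C X n k b q" and z: "is_zero_obj C (Cod C q)"
    using \<open>exact_complex C X\<close> unfolding exact_complex_def by blast
  note D = homology_dataD[OF X H]
  have bepi: "is_epi C b"
  proof (rule epiI)
    fix u assume u: "u \<in> Arr C" "Dom C u = Cod C b" "u \<cdot> b = Zer C (Dom C b) (Cod C u)"
    obtain t where t: "t \<in> Arr C" "Cod C t = Cod C u" "Dom C t = Cod C q" "t \<cdot> q = u"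
      by (rule cokernel_factor[OF D(2) u])
    have t0: "t = Zer C (Cod C q) (Cod C t)" using zero_arr_Dom[of t] t z by simp
    have "t \<cdot> q = Zer C (Cod C b) (Cod C u)" by (subst t0) (use t(1-3) u(1) D(7,9,11,12) in simp)
    then show "u = Zer C (Cod C b) (Cod C u)" unfolding t(4) .
  qed fact
  show "exact_at C (bd X (n + 1)) (bd X n)"
    unfolding exact_at_def
  proof (intro conjI ballI impI)
    fix y assume y: "y \<in> Arr C" "Cod C y = Dom C (bd X n)" "bd X n \<cdot> y = Zer C (Dom C y) (Cod C (bd X n))"
    obtain y1 where y1: "y1 \<in> Arr C" "Dom C y1 = Dom C y" "Cod C y1 = Dom C k" "k \<cdot> y1 = y"
      by (rule kernel_factor[OF D(1) y])
    obtain e x where e: "is_epi C e" "Cod C e = Dom C y1" "x \<in> Arr C" "Dom C x = Dom C e" "Cod C x = Dom C b"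
      and bx: "b \<cdot> x = y1 \<cdot> e"
      by (rule pullback_epi[OF bepi, of y1]) (use y1 D(9) in simp_all)
    have eA: "e \<in> Arr C" using e by simp
    have "(k \<cdot> b) \<cdot> x = k \<cdot> (b \<cdot> x)" using D(3,7,9) e by simp
    also have "\<dots> = (k \<cdot> y1) \<cdot> e" unfolding bx using D(3) y1(1-3) e(2) eA by simp
    finally have "bd X (n + 1) \<cdot> x = y \<cdot> e" unfolding D(10) y1(4) .
    then show "\<exists>e x. is_epi C e \<and> Cod C e = Dom C y \<and> x \<in> Arr C \<and> Dom C x = Dom C e \<and>
       Cod C x = Dom C (bd X (n + 1)) \<and> bd X (n + 1) \<cdot> x = y \<cdot> e"
      using e y1(2) D(8) XD(3) by - (rule exI[of _ e], rule exI[of _ x], simp)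
  qed (use XD in simp_all)
next
  assume "is_complex C X \<and> (\<forall>n. exact_at C (bd X (n + 1)) (bd X n))"
  then have X: "is_complex C X" and ex: "\<And>n. exact_at C (bd X (n + 1)) (bd X n)" by auto
  note XD = complexD[OF X]
  have "\<exists>k b q. homology_data C X n k b q \<and> is_zero_obj C (Cod C q)" for n
  proof -
    obtain k b q where H: "homology_data C X n k b q" by (rule homology_data_exists[OF X])
    note D = homology_dataD[OF X H]
    obtain b' where b': "is_epi C b'" "Dom C b' = ob X (n + 1)" "Cod C b' = Dom C k" "k \<cdot> b' = bd X (n + 1)"
      using mono_comp_epi_aux[OF ex[of n] D(1)] XD(3) by metis
    have "b' = b" by (rule mono_cancel[OF D(6)]) (use b' D in auto)
    then have b: "is_epi C b" using b' by simp
    have q0: "q = Zer C (Cod C b) (Cod C q)"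
      by (rule epiD[OF b]) (use D in simp_all)
    have "Idm C (Cod C q) \<cdot> q = Zer C (Dom C q) (Cod C q)"
      using D(9,11,12) q0 by simp
    then have "Idm C (Cod C q) = Zer C (Cod C q) (Cod C q)"
      using epiD[OF D(14), of "Idm C (Cod C q)"] D(11) by simp
    then have "is_zero_obj C (Cod C q)" using zero_objI D(11) by simp
    then show ?thesis using H by blast
  qed
  then show "exact_complex C X" using X unfolding exact_complex_def by blast
qed

text \<open>\<open>exact_complex\<close> forms homology as a quotient of cycles, and its dual as a
  subobject of a cokernel. Going through \<open>exact_at\<close>, already known to be self-dual,
  avoids comparing the two.\<close>

lemma exact_complex_opcx: "exact_complex (opcat C) (opcx X) \<longleftrightarrow> exact_complex C X"
proof -
  have "(\<forall>n. exact_at (opcat C) (bd (opcx X) (n + 1)) (bd (opcx X) n)) \<longleftrightarrow>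
      (\<forall>n. exact_at C (bd X (1 - n)) (bd X (- n)))"
    by (simp add: exact_at_opcat)
  also have "\<dots> \<longleftrightarrow> (\<forall>n. exact_at C (bd X (n + 1)) (bd X n))"
  proof
    assume H: "\<forall>n. exact_at C (bd X (1 - n)) (bd X (- n))"
    show "\<forall>n. exact_at C (bd X (n + 1)) (bd X n)"
    proof
      fix n show "exact_at C (bd X (n + 1)) (bd X n)" using H[rule_format, of "- n"] by (simp add: add.commute)
    qed
  next
    assume H: "\<forall>n. exact_at C (bd X (n + 1)) (bd X n)"
    show "\<forall>n. exact_at C (bd X (1 - n)) (bd X (- n))"
    proof
      fix n show "exact_at C (bd X (1 - n)) (bd X (- n))" using H[rule_format, of "- n"] by simp
    qed
  qed
  finally show ?thesis
    by (simp add: exact_complex_iff abelian_category.exact_complex_iff[OF abelian_opcat] is_complex_opcx)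
qed

text \<open>Together with \<open>homology_surj\<close> this expresses that the induced map on
  homology is invertible by equations between morphisms, so that the chosen kernels and cokernels
  disappear.\<close>

definition homology_inj where
  "homology_inj X Y f n \<longleftrightarrow> (\<forall>x y. x \<in> Arr C \<longrightarrow> Cod C x = ob X n \<longrightarrow> bd X n \<cdot> x = Zer C (Dom C x) (ob X (n - 1)) \<longrightarrow>
     y \<in> Arr C \<longrightarrow> Dom C y = Dom C x \<longrightarrow> Cod C y = ob Y (n + 1) \<longrightarrow> f n \<cdot> x = bd Y (n + 1) \<cdot> y \<longrightarrow>
     (\<exists>e x'. is_epi C e \<and> Cod C e = Dom C x \<and> x' \<in> Arr C \<and> Dom C x' = Dom C e \<and> Cod C x' = ob X (n + 1) \<and>
        bd X (n + 1) \<cdot> x' = x \<cdot> e))"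

definition homology_surj where
  "homology_surj X Y f n \<longleftrightarrow> (\<forall>y. y \<in> Arr C \<longrightarrow> Cod C y = ob Y n \<longrightarrow> bd Y n \<cdot> y = Zer C (Dom C y) (ob Y (n - 1)) \<longrightarrow>
     (\<exists>e x y'. is_epi C e \<and> Cod C e = Dom C y \<and> x \<in> Arr C \<and> Dom C x = Dom C e \<and> Cod C x = ob X n \<and>
        bd X n \<cdot> x = Zer C (Dom C x) (ob X (n - 1)) \<and>
        y' \<in> Arr C \<and> Dom C y' = Dom C e \<and> Cod C y' = ob Y (n + 1) \<and>
        Sub (y \<cdot> e) (f n \<cdot> x) = bd Y (n + 1) \<cdot> y'))"

lemma quasi_isoD:
  assumes "quasi_iso C X Y f"
  shows "chain_map C X Y f" "homology_inj X Y f n" "homology_surj X Y f n"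
proof -
  show F: "chain_map C X Y f" using assms by (simp add: quasi_iso_def)
  note FD = chain_mapD[OF F]
  note XD = complexD[OF FD(1)] and YD = complexD[OF FD(2)]
  obtain k b q k' b' q' z u where H: "homology_data C X n k b q" and H': "homology_data C Y n k' b' q'"
    and zu: "z \<in> Hom C (Dom C k) (Dom C k')" "u \<in> Hom C (Cod C q) (Cod C q')"
    and eq: "k' \<cdot> z = f n \<cdot> k" "u \<cdot> q = q' \<cdot> z" and u: "is_isomorphism C u"
    using assms unfolding quasi_iso_def by meson
  note D = homology_dataD[OF FD(1) H] and D' = homology_dataD[OF FD(2) H']
  have z: "z \<in> Arr C" "Dom C z = Dom C k" "Cod C z = Dom C k'" and u1: "u \<in> Arr C" "Dom C u = Cod C q" "Cod C u = Cod C q'"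
    using zu by (auto simp: Hom_iff)
  obtain v where v: "v \<in> Arr C" "Dom C v = Cod C q'" "Cod C v = Cod C q"
    "v \<cdot> u = Idm C (Cod C q)" "u \<cdot> v = Idm C (Cod C q')"
    using iso_inverse[OF u] u1 by metis
  show "homology_inj X Y f n" unfolding homology_inj_def
  proof (intro allI impI)
    fix x y assume x: "x \<in> Arr C" "Cod C x = ob X n" "bd X n \<cdot> x = Zer C (Dom C x) (ob X (n - 1))"
      and y: "y \<in> Arr C" "Dom C y = Dom C x" "Cod C y = ob Y (n + 1)" and fx: "f n \<cdot> x = bd Y (n + 1) \<cdot> y"
    obtain x1 where x1: "x1 \<in> Arr C" "Dom C x1 = Dom C x" "Cod C x1 = Dom C k" "k \<cdot> x1 = x"
      by (rule kernel_factor[OF D(1) x(1)]) (use x XD in simp_all)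
    have "k' \<cdot> (z \<cdot> x1) = (k' \<cdot> z) \<cdot> x1" using z x1(1-3) D' by simp
    also have "\<dots> = f n \<cdot> (k \<cdot> x1)" unfolding eq using x1(1-3) D(3,4) FD by simp
    also have "\<dots> = (k' \<cdot> b') \<cdot> y" unfolding x1(4) fx D'(10) ..
    also have "\<dots> = k' \<cdot> (b' \<cdot> y)" using D'(3,7,8,9) y by simp
    finally have zx: "z \<cdot> x1 = b' \<cdot> y"
      by (rule mono_cancel[OF D'(6), rotated -1]) (use z x1(1-3) D'(3,7,8,9) y in simp_all)
    \<comment> \<open>The homology class of \<open>x1\<close> is \<open>q \<cdot> x1\<close>. Its
      image under \<open>u\<close> is the class of a boundary, hence zero, and the inverse
      \<open>v\<close> of \<open>u\<close> carries this back.\<close>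
    have "u \<cdot> (q \<cdot> x1) = (u \<cdot> q) \<cdot> x1" using u1 x1(1-3) D(11,12) by simp
    also have "\<dots> = q' \<cdot> (z \<cdot> x1)" unfolding eq using z x1(1-3) D'(11,12) by simp
    also have "\<dots> = (q' \<cdot> b') \<cdot> y" unfolding zx using D'(7,8,9,11,12) y by simp
    also have "\<dots> = Zer C (Dom C x) (Cod C q')" unfolding D'(13) using D'(11) y by simp
    finally have "v \<cdot> (u \<cdot> (q \<cdot> x1)) = Zer C (Dom C x) (Cod C q)" using v(1-3) x(1) by simp
    moreover have "v \<cdot> (u \<cdot> (q \<cdot> x1)) = (v \<cdot> u) \<cdot> (q \<cdot> x1)" using v(1-3) u1 x1(1-3) D(11,12) by simp
    ultimately have "q \<cdot> x1 = Zer C (Dom C x1) (Cod C q)"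
      unfolding v(4) using x1(1-3) D(11,12) by simp
    then obtain e x' where e: "is_epi C e" "Cod C e = Dom C x1" "x' \<in> Arr C" "Dom C x' = Dom C e" "Cod C x' = Dom C b"
      "b \<cdot> x' = x1 \<cdot> e"
      by (rule exact_at_lift[OF exact_at_cokernel[OF D(2)] x1(1), rotated]) (use x1 D(12) in simp_all)
    have eA: "e \<in> Arr C" using e by simp
    have "(k \<cdot> b) \<cdot> x' = k \<cdot> (b \<cdot> x')" using e(3-5) D(3,7,8,9) by simp
    also have "\<dots> = (k \<cdot> x1) \<cdot> e" unfolding e(6) using x1(1-3) eA e(2) D(3) by simp
    finally have "bd X (n + 1) \<cdot> x' = x \<cdot> e" unfolding D(10) x1(4) .
    then show "\<exists>e x'. is_epi C e \<and> Cod C e = Dom C x \<and> x' \<in> Arr C \<and> Dom C x' = Dom C e \<and> Cod C x' = ob X (n + 1) \<and>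
        bd X (n + 1) \<cdot> x' = x \<cdot> e"
      using e x1(2) D(8) by - (rule exI[of _ e], rule exI[of _ x'], simp)
  qed
  show "homology_surj X Y f n" unfolding homology_surj_def
  proof (intro allI impI)
    fix y assume y: "y \<in> Arr C" "Cod C y = ob Y n" "bd Y n \<cdot> y = Zer C (Dom C y) (ob Y (n - 1))"
    obtain y1 where y1: "y1 \<in> Arr C" "Dom C y1 = Dom C y" "Cod C y1 = Dom C k'" "k' \<cdot> y1 = y"
      by (rule kernel_factor[OF D'(1) y(1)]) (use y YD in simp_all)
    \<comment> \<open>\<open>h\<close> is the class of \<open>y\<close> transported back by the
      inverse of \<open>u\<close>. It has a representative \<open>x1\<close> over one cover, and the
      defect \<open>w\<close> between \<open>y\<close> and the image of \<open>x1\<close> is a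
      boundary over a second one.\<close>
    define h where "h = v \<cdot> (q' \<cdot> y1)"
    have h: "h \<in> Arr C" "Dom C h = Dom C y" "Cod C h = Cod C q"
      unfolding h_def using v(1-3) D'(11,12) y1(1-3) by simp_all
    have "u \<cdot> h = (u \<cdot> v) \<cdot> (q' \<cdot> y1)" unfolding h_def using u1 v(1-3) D'(11,12) y1(1-3) by simp
    then have uh: "u \<cdot> h = q' \<cdot> y1" unfolding v(5) using D'(11,12) y1(1-3) by simp
    obtain e x1 where e: "is_epi C e" "Cod C e = Dom C h" "x1 \<in> Arr C" "Dom C x1 = Dom C e" "Cod C x1 = Dom C q"
      and qx: "q \<cdot> x1 = h \<cdot> e"
      by (rule pullback_epi[OF D(14), of h]) (use h in simp_all)
    have eA: "e \<in> Arr C" using e by simp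
    define w where "w = Sub (y1 \<cdot> e) (z \<cdot> x1)"
    have w: "w \<in> Arr C" "Dom C w = Dom C e" "Cod C w = Dom C k'"
      unfolding w_def using eA e(2-5) y1(1-3) h z D(12) by simp_all
    have "q' \<cdot> (z \<cdot> x1) = (q' \<cdot> z) \<cdot> x1" using D'(11,12) z e(3-5) D(12) by simp
    also have "\<dots> = u \<cdot> (q \<cdot> x1)" unfolding eq(2)[symmetric] using u1 D(11) e(3-5) by simp
    also have "\<dots> = (u \<cdot> h) \<cdot> e" unfolding qx using u1 h eA e(2) by simp
    also have "\<dots> = q' \<cdot> (y1 \<cdot> e)" unfolding uh using D'(11,12) y1(1-3) h eA e(2) by simp
    finally have "q' \<cdot> w = Zer C (Dom C w) (Cod C q')"
      unfolding w_def using eA e(2-5) y1(1-3) h z D(12) D'(11,12) by simp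
    then obtain e2 y' where e2: "is_epi C e2" "Cod C e2 = Dom C w" "y' \<in> Arr C" "Dom C y' = Dom C e2" "Cod C y' = Dom C b'"
      and bw: "b' \<cdot> y' = w \<cdot> e2"
      by (rule exact_at_lift[OF exact_at_cokernel[OF D'(2)] w(1), rotated]) (use w D'(12) in simp_all)
    have e2A: "e2 \<in> Arr C" using e2 by simp
    have f1: "f n \<cdot> (k \<cdot> (x1 \<cdot> e2)) = k' \<cdot> (z \<cdot> (x1 \<cdot> e2))"
      using Comp_extend[OF eq(1), of "x1 \<cdot> e2"] z D(3,4,12) D'(3) FD(3-5) e(3-5) e2(2) e2A w(2) by simp
    have y1e: "k' \<cdot> (y1 \<cdot> (e \<cdot> e2)) = y \<cdot> (e \<cdot> e2)"
      by (rule Comp_extend[OF y1(4)]) (use e(2) eA e2A e2(2) w(2) y1(1-3) h(2) D'(3) in simp_all)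
    have "bd Y (n + 1) \<cdot> y' = k' \<cdot> (b' \<cdot> y')"
      by (rule Comp_extend[OF D'(10), symmetric]) (use e2(3-5) D'(3,7,9) in simp_all)
    also have "\<dots> = Sub (y \<cdot> (e \<cdot> e2)) (f n \<cdot> (k \<cdot> (x1 \<cdot> e2)))"
      unfolding bw w_def f1 y1e[symmetric] using e(2-5) eA e2A e2(2) w(2) y1(1-3) h(2) D'(3) z D(12) by simp
    finally have fin: "Sub (y \<cdot> (e \<cdot> e2)) (f n \<cdot> (k \<cdot> (x1 \<cdot> e2))) = bd Y (n + 1) \<cdot> y'" ..
    have "bd X n \<cdot> (k \<cdot> (x1 \<cdot> e2)) = Zer C (Dom C e2) (ob X (n - 1))"
      using Comp_extend[OF D(5), of "x1 \<cdot> e2"] XD D(3,4,12) e(3-5) e2(2) e2A w(2) by simp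
    then show "\<exists>e x y'. is_epi C e \<and> Cod C e = Dom C y \<and> x \<in> Arr C \<and> Dom C x = Dom C e \<and> Cod C x = ob X n \<and>
        bd X n \<cdot> x = Zer C (Dom C x) (ob X (n - 1)) \<and>
        y' \<in> Arr C \<and> Dom C y' = Dom C e \<and> Cod C y' = ob Y (n + 1) \<and>
        Sub (y \<cdot> e) (f n \<cdot> x) = bd Y (n + 1) \<cdot> y'"
      using fin epi_Comp[OF e2(1) e(1)] e e2(2-5) eA e2A w(2) h(2) D(3,4,12) D'(8)
      by - (rule exI[of _ "e \<cdot> e2"], rule exI[of _ "k \<cdot> (x1 \<cdot> e2)"], rule exI[of _ y'], simp)
  qed
qed

text \<open>The first condition makes the induced map \<open>u\<close> mono and the second makes it
  epi, which suffices in an abelian category.\<close>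

lemma quasi_isoI:
  assumes F: "chain_map C X Y f" and inj: "\<And>n. homology_inj X Y f n" and surj: "\<And>n. homology_surj X Y f n"
  shows "quasi_iso C X Y f"
  unfolding quasi_iso_def
proof (intro conjI allI)
  fix n
  note FD = chain_mapD[OF F]
  note XD = complexD[OF FD(1)] and YD = complexD[OF FD(2)]
  obtain k b q where H: "homology_data C X n k b q" by (rule homology_data_exists[OF FD(1)])
  obtain k' b' q' where H': "homology_data C Y n k' b' q'" by (rule homology_data_exists[OF FD(2)])
  note D = homology_dataD[OF FD(1) H] and D' = homology_dataD[OF FD(2) H']
  have "bd Y n \<cdot> (f n \<cdot> k) = f (n - 1) \<cdot> (bd X n \<cdot> k)"
    using Comp_extend[OF FD(6)[of n], of k] FD(3-5) XD(1-4) YD(1-4) D(3,4) by simp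
  also have "\<dots> = Zer C (Dom C k) (ob Y (n - 1))" unfolding D(5) using FD(3-5) D(3) by simp
  finally obtain z where z: "z \<in> Arr C" "Dom C z = Dom C k" "Cod C z = Dom C k'" and kz: "k' \<cdot> z = f n \<cdot> k"
    using kernel_factor[OF D'(1), of "f n \<cdot> k"] FD(3-5) D(3,4) YD(3,4) by auto
  have "k' \<cdot> (z \<cdot> b) = f n \<cdot> (k \<cdot> b)"
    using Comp_extend[OF kz, of b] FD(3-5) D(3,4,7,9) D'(3) z by simp
  also have "\<dots> = f (n + 1 - 1) \<cdot> bd X (n + 1)" unfolding D(10) by simp
  also have "\<dots> = (k' \<cdot> b') \<cdot> f (n + 1)" unfolding FD(6)[of "n + 1", symmetric] D'(10) ..
  also have "\<dots> = k' \<cdot> (b' \<cdot> f (n + 1))" using D'(3,7,8,9) FD(3-5) by simp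
  finally have zb: "z \<cdot> b = b' \<cdot> f (n + 1)"
    by (rule mono_cancel[OF D'(6), rotated -1]) (use z D(7,9) D'(7,8,9) FD(3-5) in simp_all)
  have "(q' \<cdot> z) \<cdot> b = (q' \<cdot> b') \<cdot> f (n + 1)"
    using z D(7,9) D'(7,8,9,11,12) FD(3-5) zb by simp
  also have "\<dots> = Zer C (ob X (n + 1)) (Cod C q')" unfolding D'(13) using D'(11) FD(3-5) by simp
  finally obtain u where u: "u \<in> Arr C" "Cod C u = Cod C q'" "Dom C u = Cod C q" and uq: "u \<cdot> q = q' \<cdot> z"
    using cokernel_factor[OF D(2), of "q' \<cdot> z"] z D(7-9) D'(11,12) by auto
  have "is_mono C u"
  proof (rule monoI)
    fix w assume w: "w \<in> Arr C" "Cod C w = Dom C u" "u \<cdot> w = Zer C (Dom C w) (Cod C u)"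
    obtain e x where e: "is_epi C e" "Cod C e = Dom C w" "x \<in> Arr C" "Dom C x = Dom C e" "Cod C x = Dom C q"
      and qx: "q \<cdot> x = w \<cdot> e"
      by (rule pullback_epi[OF D(14), of w]) (use w u in simp_all)
    have eA: "e \<in> Arr C" using e by simp
    have "q' \<cdot> (z \<cdot> x) = (u \<cdot> q) \<cdot> x" unfolding uq using D'(11,12) z e(3-5) D(12) by simp
    also have "\<dots> = u \<cdot> (w \<cdot> e)" unfolding qx[symmetric] using u D(11) e(3-5) by simp
    also have "\<dots> = (u \<cdot> w) \<cdot> e" using u w(1,2) e(2) eA by simp
    also have "\<dots> = Zer C (Dom C (z \<cdot> x)) (Cod C q')" unfolding w(3) using u e(2-5) eA z D(12) D'(11) by simp
    finally obtain e2 y where e2: "is_epi C e2" "Cod C e2 = Dom C (z \<cdot> x)" "y \<in> Arr C" "Dom C y = Dom C e2" "Cod C y = Dom C b'"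
      and bw: "b' \<cdot> y = (z \<cdot> x) \<cdot> e2"
      by (rule exact_at_lift[OF exact_at_cokernel[OF D'(2)], rotated 2]) (use z e D(12) D'(12) in simp_all)
    have e2A: "e2 \<in> Arr C" "Cod C e2 = Dom C x" using e2 z e D(12) by simp_all
    define x2 where "x2 = k \<cdot> (x \<cdot> e2)"
    have x2: "x2 \<in> Arr C" "Dom C x2 = Dom C e2" "Cod C x2 = ob X n"
      unfolding x2_def using D(3,4,12) e(3-5) e2A by simp_all
    have dx2: "bd X n \<cdot> x2 = Zer C (Dom C x2) (ob X (n - 1))"
      unfolding x2(2) unfolding x2_def using Comp_extend[OF D(5), of "x \<cdot> e2"] XD D(3,4,12) e(3-5) e2A by simp
    have "f n \<cdot> x2 = k' \<cdot> (z \<cdot> (x \<cdot> e2))"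
      unfolding x2_def using Comp_extend[OF kz, of "x \<cdot> e2"] FD(3-5) D(3,4,12) D'(3) z e(3-5) e2A by simp
    also have "\<dots> = k' \<cdot> (b' \<cdot> y)" unfolding bw using z e(3-5) D(12) e2A by simp
    also have "\<dots> = bd Y (n + 1) \<cdot> y"
      by (rule Comp_extend[OF D'(10)]) (use e2(3-5) D'(3,7,9) in simp_all)
    finally obtain e3 x' where e3: "is_epi C e3" "Cod C e3 = Dom C x2" "x' \<in> Arr C" "Dom C x' = Dom C e3"
        "Cod C x' = ob X (n + 1)" and dx': "bd X (n + 1) \<cdot> x' = x2 \<cdot> e3"
      using inj[of n, unfolded homology_inj_def, rule_format, OF x2(1,3) dx2 e2(3), unfolded x2(2), OF e2(4)]
        e2(5) D'(8) x2(2) by auto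
    have e3A: "e3 \<in> Arr C" "Cod C e3 = Dom C e2" using e3 x2 by simp_all
    have "k \<cdot> (b \<cdot> x') = bd X (n + 1) \<cdot> x'"
      by (rule Comp_extend[OF D(10)]) (use e3(3-5) D(3,7,8,9) in simp_all)
    also have "\<dots> = k \<cdot> (x \<cdot> (e2 \<cdot> e3))" unfolding dx' x2_def using D(3,12) e(3-5) e2A e3A by simp
    finally have bx: "b \<cdot> x' = x \<cdot> (e2 \<cdot> e3)"
      by (rule mono_cancel[OF D(6), rotated -1]) (use e3(3-5) D(3,7,8,9,12) e(3-5) e2A e3A in simp_all)
    have "w \<cdot> (e \<cdot> (e2 \<cdot> e3)) = q \<cdot> (x \<cdot> (e2 \<cdot> e3))"
      using Comp_extend[OF qx, of "e2 \<cdot> e3"] w(1,2) D(11,12) e(2-5) eA e2A e3A by simp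
    also have "\<dots> = (q \<cdot> b) \<cdot> x'" unfolding bx[symmetric] using D(7,8,9,11,12) e3(3-5) by simp
    also have "\<dots> = Zer C (Dom C (e \<cdot> (e2 \<cdot> e3))) (Cod C w)"
      unfolding D(13) using D(11) e3(3-5) w(2) u(3) e eA e2A e3A by simp
    finally have "w = Zer C (Cod C (e \<cdot> (e2 \<cdot> e3))) (Cod C w)"
      by (intro epiD[of "e \<cdot> (e2 \<cdot> e3)"] epi_Comp) (use e(1) e2(1) e3(1) w(1) e(2,4) eA e2A e3A in simp_all)
    then show "w = Zer C (Dom C w) (Dom C u)" using e(2,4) eA e2A e3A w(2) by simp
  qed fact
  moreover have "is_epi C u"
  proof (rule epiI)
    fix t assume t: "t \<in> Arr C" "Dom C t = Cod C u" "t \<cdot> u = Zer C (Dom C u) (Cod C t)"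
    \<comment> \<open>The surjectivity condition is applied to the universal cycle, the inclusion
      \<open>k'\<close> of all cycles.\<close>
    obtain e x y' where e: "is_epi C e" "Cod C e = Dom C k'" and x: "x \<in> Arr C" "Dom C x = Dom C e" "Cod C x = ob X n"
      "bd X n \<cdot> x = Zer C (Dom C x) (ob X (n - 1))"
      and y': "y' \<in> Arr C" "Dom C y' = Dom C e" "Cod C y' = ob Y (n + 1)"
      and eq: "Sub (k' \<cdot> e) (f n \<cdot> x) = bd Y (n + 1) \<cdot> y'"
      using surj[of n, unfolded homology_surj_def, rule_format, of k'] D'(3-5) by auto
    have eA: "e \<in> Arr C" using e by simp
    obtain x1 where x1: "x1 \<in> Arr C" "Dom C x1 = Dom C x" "Cod C x1 = Dom C k" "k \<cdot> x1 = x"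
      by (rule kernel_factor[OF D(1) x(1)]) (use x(2-4) XD(3,4) in simp_all)
    have fx: "f n \<cdot> x = k' \<cdot> (z \<cdot> x1)"
      unfolding x1(4)[symmetric] using Comp_extend[OF kz, of x1] FD(3-5) D(3,4) D'(3) z x1(1-3) by simp
    have by': "bd Y (n + 1) \<cdot> y' = k' \<cdot> (b' \<cdot> y')"
      by (rule Comp_extend[OF D'(10), symmetric]) (use y' D'(3,7,8,9) in simp_all)
    have "k' \<cdot> (Sub e (z \<cdot> x1)) = k' \<cdot> (b' \<cdot> y')"
      unfolding by'[symmetric] eq[symmetric] fx using D'(3) eA e(2) z x1(1-3) x(2) by simp
    then have ee: "Sub e (z \<cdot> x1) = b' \<cdot> y'"
      by (rule mono_cancel[OF D'(6), rotated -1]) (use D'(3,7,8,9) y' eA e(2) z x1(1-3) x(2) in simp_all)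
    have "q' \<cdot> Sub e (z \<cdot> x1) = (q' \<cdot> b') \<cdot> y'"
      unfolding ee using D'(7,8,9,11,12) y' by simp
    then have "Sub (q' \<cdot> e) (q' \<cdot> (z \<cdot> x1)) = Zer C (Dom C e) (Cod C q')"
      unfolding D'(13) using D'(11,12) y' eA e(2) z x1(1-3) x(2) by simp
    then have "q' \<cdot> e = q' \<cdot> (z \<cdot> x1)"
      using Sub_eq_Zer_iff[of "q' \<cdot> e" "q' \<cdot> (z \<cdot> x1)"] D'(11,12) eA e(2) z x1(1-3) x(2) by simp
    also have "\<dots> = u \<cdot> (q \<cdot> x1)"
      using Comp_extend[OF uq, of x1] u D(11,12) D'(11,12) z x1(1-3) by simp
    finally have qe: "q' \<cdot> e = u \<cdot> (q \<cdot> x1)" .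
    have "(t \<cdot> q') \<cdot> e = (t \<cdot> u) \<cdot> (q \<cdot> x1)"
      using t(1,2) u D(11,12) D'(11,12) eA e(2) x1(1-3) qe by simp
    also have "\<dots> = Zer C (Dom C e) (Cod C t)"
      unfolding t(3) using t(1,2) u D(11,12) x1(1-3) x(2) by simp
    finally have "t \<cdot> q' = Zer C (Cod C e) (Cod C t)"
      using epiD[OF e(1), of "t \<cdot> q'"] t(1,2) u D'(11,12) e(2) by simp
    then show "t = Zer C (Cod C u) (Cod C t)"
      using epiD[OF D'(14), of t] t(1,2) u e(2) D'(12) by simp
  qed fact
  ultimately have "is_isomorphism C u" by (rule mono_epi_iso)
  moreover have "z \<in> Hom C (Dom C k) (Dom C k')" "u \<in> Hom C (Cod C q) (Cod C q')" using z u by auto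
  ultimately show "\<exists>k b q k' b' q'. homology_data C X n k b q \<and> homology_data C Y n k' b' q' \<and>
        (\<exists>z \<in> Hom C (Dom C k) (Dom C k'). \<exists>u \<in> Hom C (Cod C q) (Cod C q').
           k' \<cdot> z = f n \<cdot> k \<and> u \<cdot> q = q' \<cdot> z \<and> is_isomorphism C u)"
    using H H' kz uq by blast
qed fact

end

section \<open>Resolutions as exact augmented complexes\<close>

lemma conc_sel [simp]:
  "ob (conc C M) n = (if n = 0 then M else zero_obj C)"
  "bd (conc C M) n = Zer C (ob (conc C M) n) (ob (conc C M) (n - 1))"
  by (simp_all add: conc_def Let_def)

lemma augmented_res_sel [simp]:
  "ob (augmented_res C M P \<gamma>) n = (if n \<ge> 0 then ob P n else if n = -1 then M else zero_obj C)"
  "bd (augmented_res C M P \<gamma>) n = (if n > 0 then bd P n else if n = 0 then \<gamma> 0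
     else Zer C (ob (augmented_res C M P \<gamma>) n) (ob (augmented_res C M P \<gamma>) (n - 1)))"
  by (simp_all add: augmented_res_def Let_def)

lemma augmented_cores_sel [simp]:
  "ob (augmented_cores C N Q \<delta>) n = (if n \<le> 0 then ob Q n else if n = 1 then N else zero_obj C)"
  "bd (augmented_cores C N Q \<delta>) n = (if n \<le> 0 then bd Q n else if n = 1 then \<delta> 0
     else Zer C (ob (augmented_cores C N Q \<delta>) n) (ob (augmented_cores C N Q \<delta>) (n - 1)))"
  by (simp_all add: augmented_cores_def Let_def)

lemma conc_opcat: "conc (opcat C) M = opcx (conc C M)"
  by (auto simp: conc_def opcx_def Let_def fun_eq_iff)

lemma augmented_res_opcat:
  "augmented_res (opcat C) N (opcx Q) (\<lambda>n. \<delta> (- n)) = opcx (augmented_cores C N Q \<delta>)"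
  by (auto simp: augmented_res_def augmented_cores_def opcx_def Let_def fun_eq_iff)

context abelian_category
begin

lemma conc_complex:
  assumes "M \<in> Obj C"
  shows "is_complex C (conc C M)"
  using assms unfolding is_complex_def by (auto simp: Hom_iff)

lemma exact_at_zero:
  assumes "f \<in> Arr C" "g \<in> Arr C" "Cod C f = Dom C g" "is_zero_obj C (Dom C g)"
  shows "exact_at C f g"
  unfolding exact_at_def
proof (intro conjI ballI impI)
  have "f = Zer C (Dom C f) (Dom C g)" using zero_arr_Cod[of f] assms by simp
  then have "g \<cdot> f = g \<cdot> Zer C (Dom C f) (Dom C g)" by simp
  then show "g \<cdot> f = Zer C (Dom C f) (Cod C g)" using assms by simp
  fix y assume y: "y \<in> Arr C" "Cod C y = Dom C g"
  have "y = Zer C (Dom C y) (Dom C g)" using zero_arr_Cod[of y] assms y by simp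
  then show "\<exists>e x. is_epi C e \<and> Cod C e = Dom C y \<and> x \<in> Arr C \<and> Dom C x = Dom C e \<and> Cod C x = Dom C f \<and>
           f \<cdot> x = y \<cdot> e"
    using assms y
    by - (rule exI[of _ "Idm C (Dom C y)"], rule exI[of _ "Zer C (Dom C y) (Dom C f)"], simp)
qed fact+

lemma exact_at_monoI:
  assumes "is_mono C g" "A \<in> Obj C"
  shows "exact_at C (Zer C A (Dom C g)) g"
  unfolding exact_at_def
proof (intro conjI ballI impI)
  fix y assume y: "y \<in> Arr C" "Cod C y = Dom C g" "g \<cdot> y = Zer C (Dom C y) (Cod C g)"
  have "y = Zer C (Dom C y) (Dom C g)" using monoD[OF assms(1) y] .
  then have "Zer C A (Dom C g) \<cdot> Zer C (Dom C y) A = y \<cdot> Idm C (Dom C y)"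
    using assms y(1,2) by simp
  then show "\<exists>e x. is_epi C e \<and> Cod C e = Dom C y \<and> x \<in> Arr C \<and> Dom C x = Dom C e \<and>
      Cod C x = Dom C (Zer C A (Dom C g)) \<and> Zer C A (Dom C g) \<cdot> x = y \<cdot> e"
    using assms y(1,2)
    by - (rule exI[of _ "Idm C (Dom C y)"], rule exI[of _ "Zer C (Dom C y) A"], simp)
qed (use assms in simp_all)

lemma zero_arr_CodE:
  assumes "is_zero_obj C B" "y \<in> Arr C" "Cod C y = B"
  obtains A where "A \<in> Obj C" "y = Zer C A B"
  using zero_arr_Cod[of y] assms Dom_Obj by blast

lemma mono_if_exact_at_zero:
  assumes "exact_at C f g" "is_zero_obj C (Dom C f)"
  shows "is_mono C g"
proof (rule monoI)
  note D = exact_atD[OF assms(1)]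
  show "g \<in> Arr C" using D by simp
  fix y assume y: "y \<in> Arr C" "Cod C y = Dom C g" "g \<cdot> y = Zer C (Dom C y) (Cod C g)"
  obtain e x where e: "is_epi C e" "Cod C e = Dom C y" "x \<in> Arr C" "Dom C x = Dom C e" "Cod C x = Dom C f"
    "f \<cdot> x = y \<cdot> e"
    by (rule exact_at_lift[OF assms(1) y])
  have f0: "f = Zer C (Dom C f) (Dom C g)" using zero_arr_Dom[of f] assms D by simp
  have "f \<cdot> x = Zer C (Dom C e) (Cod C y)"
    by (subst f0) (use D e(3-5) y in simp)
  then show "y = Zer C (Dom C y) (Dom C g)"
    using epiD[OF e(1) y(1)] e(2,6) y(2) by simp
qed

lemma mono_lift_of_exact:
  assumes "exact_at C f g" "is_mono C f" "y \<in> Arr C" "Cod C y = Dom C g" "g \<cdot> y = Zer C (Dom C y) (Cod C g)"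
  obtains u where "u \<in> Arr C" "Dom C u = Dom C y" "Cod C u = Dom C f" "f \<cdot> u = y"
  using kernel_factor[OF exact_at_mono_kernel[OF assms(1,2)] assms(3-5)] .

text \<open>The augmented complex sees only \<open>\<delta> 0\<close>, so the chain map condition
  stands beside its exactness. Surjectivity on homology gives exactness in degrees at most 0;
  injectivity in degree 0 makes \<open>\<delta> 0\<close> mono, which is exactness at
  \<open>N\<close>.\<close>

lemma coresolution_iff:
  "coresolution C \<Y> N Q \<delta> \<longleftrightarrow> (\<forall>n. ob Q n \<in> \<Y>) \<and> (\<forall>n > 0. is_zero_obj C (ob Q n)) \<and>
     chain_map C (conc C N) Q \<delta> \<and> exact_complex C (augmented_cores C N Q \<delta>)"
    (is "?L \<longleftrightarrow> ?R")
proof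
  assume L: ?L
  then have z: "\<And>n. n > 0 \<Longrightarrow> is_zero_obj C (ob Q n)" and q: "quasi_iso C (conc C N) Q \<delta>"
    by (auto simp: coresolution_def)
  let ?A = "augmented_cores C N Q \<delta>"
  note ch = quasi_isoD(1)[OF q]
  note Q = complexD[OF chain_mapD(2)[OF ch]] and D = chain_mapD(3-6)[OF ch]
  have N: "N \<in> Obj C" using complexD(1)[OF chain_mapD(1)[OF ch], of 0] by simp
  have zo: "zero_obj C \<in> Obj C" by simp
  have d0: "\<delta> 0 \<in> Arr C" "Dom C (\<delta> 0) = N" "Cod C (\<delta> 0) = ob Q 0" using D(1-3)[of 0] by simp_all
  have comp0: "bd Q 0 \<cdot> \<delta> 0 = Zer C N (ob Q (-1))"
    using D(4)[of 0] D(1-3)[of "-1"] N by simp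
  \<comment> \<open>If \<open>\<delta> 0\<close> kills \<open>x\<close>, the image of
    \<open>x\<close> is the boundary of the zero morphism into \<open>ob Q 1\<close>. Injectivity
    makes \<open>x\<close> a boundary in \<open>conc C N\<close>, hence zero, over a cover.\<close>
  have mono: "is_mono C (\<delta> 0)"
  proof (rule monoI)
    fix x assume x: "x \<in> Arr C" "Cod C x = Dom C (\<delta> 0)" "\<delta> 0 \<cdot> x = Zer C (Dom C x) (Cod C (\<delta> 0))"
    obtain e x' where e: "is_epi C e" "Cod C e = Dom C x" "x' \<in> Arr C" "Dom C x' = Dom C e" "Cod C x' = ob (conc C N) 1"
       "bd (conc C N) 1 \<cdot> x' = x \<cdot> e"
      using quasi_isoD(2)[OF q, of 0, unfolded homology_inj_def, rule_format, of x "Zer C (Dom C x) (ob Q 1)"]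
        x d0 Q[of 1] N by auto
    then have "x \<cdot> e = Zer C (Dom C e) (Cod C x)" using N d0 x(2) by simp
    then show "x = Zer C (Dom C x) (Dom C (\<delta> 0))" using epiD[OF e(1) x(1)] e(2) x(2) by simp
  qed fact
  have "is_complex C ?A" unfolding is_complex_def
  proof (intro allI conjI)
    fix n :: int
    show "ob ?A n \<in> Obj C" using Q N by simp
    show "bd ?A n \<in> Hom C (ob ?A n) (ob ?A (n - 1))" using Q N d0 by (auto simp: Hom_iff)
    consider "n \<le> 0" | "n = 1" | "n = 2" | "n > 2" by linarith
    then show "bd ?A (n - 1) \<cdot> bd ?A n = Zer C (ob ?A n) (ob ?A (n - 2))"
      by cases (use Q[of n] N d0 comp0 Q[of 0] in simp_all)
  qed
  moreover have "exact_at C (bd ?A (n + 1)) (bd ?A n)" for n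
  proof -
    consider "n < 0" | "n = 0" | "n = 1" | "n \<ge> 2" by linarith
    then show ?thesis
    proof cases
      case 1
      have "exact_at C (bd Q (n + 1)) (bd Q n)" unfolding exact_at_def
      proof (intro conjI ballI impI)
        fix y assume y: "y \<in> Arr C" "Cod C y = Dom C (bd Q n)" "bd Q n \<cdot> y = Zer C (Dom C y) (Cod C (bd Q n))"
        obtain e x y' where e: "is_epi C e" "Cod C e = Dom C y" "x \<in> Arr C" "Dom C x = Dom C e" "Cod C x = ob (conc C N) n"
            "y' \<in> Arr C" "Dom C y' = Dom C e" "Cod C y' = ob Q (n + 1)"
            "Sub (y \<cdot> e) (\<delta> n \<cdot> x) = bd Q (n + 1) \<cdot> y'"
          using quasi_isoD(3)[OF q, of n, unfolded homology_surj_def, rule_format, of y] y Q by auto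
        have eA: "e \<in> Arr C" using e by simp
        have "x = Zer C (Dom C e) (zero_obj C)" using zero_arr_Cod[of x] e 1 by simp
        then have "\<delta> n \<cdot> x = \<delta> n \<cdot> Zer C (Dom C e) (zero_obj C)" by simp
        also have "\<dots> = Zer C (Dom C e) (ob Q n)" using D(1-3)[of n] 1 eA by simp
        finally have "bd Q (n + 1) \<cdot> y' = y \<cdot> e" using e(9) eA e(2) y(1,2) Q by simp
        then show "\<exists>e x. is_epi C e \<and> Cod C e = Dom C y \<and> x \<in> Arr C \<and> Dom C x = Dom C e \<and>
            Cod C x = Dom C (bd Q (n + 1)) \<and> bd Q (n + 1) \<cdot> x = y \<cdot> e"
          using e(1,2,6-8) Q by - (rule exI[of _ e], rule exI[of _ y'], simp)
      qed (use Q in simp_all)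
      then show ?thesis using 1 by simp
    next
      case 2
      have "exact_at C (\<delta> 0) (bd Q 0)" unfolding exact_at_def
      proof (intro conjI ballI impI)
        fix y assume y: "y \<in> Arr C" "Cod C y = Dom C (bd Q 0)" "bd Q 0 \<cdot> y = Zer C (Dom C y) (Cod C (bd Q 0))"
        obtain e x y' where e: "is_epi C e" "Cod C e = Dom C y" "x \<in> Arr C" "Dom C x = Dom C e" "Cod C x = N"
            "y' \<in> Arr C" "Dom C y' = Dom C e" "Cod C y' = ob Q 1"
            "Sub (y \<cdot> e) (\<delta> 0 \<cdot> x) = bd Q 1 \<cdot> y'"
          using quasi_isoD(3)[OF q, of 0, unfolded homology_surj_def, rule_format, of y] y Q by auto
        have eA: "e \<in> Arr C" using e by simp
        \<comment> \<open>As \<open>ob Q 1\<close> is zero, the boundary correction supplied by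
          surjectivity vanishes, and \<open>y\<close> lifts to \<open>N\<close> without
          error.\<close>
        have "bd Q 1 = Zer C (ob Q 1) (ob Q 0)" using zero_arr_Dom[of "bd Q 1"] z[of 1] Q[of 1] by simp
        then have "bd Q 1 \<cdot> y' = Zer C (Dom C e) (ob Q 0)" using Q[of 0] e(6-8) by simp
        then have "y \<cdot> e = \<delta> 0 \<cdot> x"
          using e(9) Sub_eq_Zer_iff[of "y \<cdot> e" "\<delta> 0 \<cdot> x"] eA e(2-5) y(1,2) d0 Q by simp
        then show "\<exists>e x. is_epi C e \<and> Cod C e = Dom C y \<and> x \<in> Arr C \<and> Dom C x = Dom C e \<and>
            Cod C x = Dom C (\<delta> 0) \<and> \<delta> 0 \<cdot> x = y \<cdot> e"
          using e(1-5) d0 by - (rule exI[of _ e], rule exI[of _ x], simp)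
      qed (use Q[of 0] d0 comp0 in simp_all)
      then show ?thesis using 2 by simp
    next
      case 3
      then show ?thesis using exact_at_monoI[OF mono zo] d0 by simp
    next
      case 4
      then show ?thesis using N by (auto intro!: exact_at_zero)
    qed
  qed
  ultimately show ?R using L ch by (simp add: coresolution_def exact_complex_iff)
next
  assume R: ?R
  then have z: "\<And>n. n > 0 \<Longrightarrow> is_zero_obj C (ob Q n)" and ch: "chain_map C (conc C N) Q \<delta>"
    by auto
  let ?A = "augmented_cores C N Q \<delta>"
  have ex: "exact_at C (bd ?A (n + 1)) (bd ?A n)" for n using R by (simp add: exact_complex_iff)
  note Q = complexD[OF chain_mapD(2)[OF ch]] and D = chain_mapD(3-6)[OF ch]
  have N: "N \<in> Obj C" using complexD(1)[OF chain_mapD(1)[OF ch], of 0] by simp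
  have d0: "\<delta> 0 \<in> Arr C" "Dom C (\<delta> 0) = N" "Cod C (\<delta> 0) = ob Q 0" using D(1-3)[of 0] by simp_all
  have "quasi_iso C (conc C N) Q \<delta>"
  proof (rule quasi_isoI[OF ch])
    fix n
    show "homology_inj (conc C N) Q \<delta> n" unfolding homology_inj_def
    proof (intro allI impI)
      fix x y assume x: "x \<in> Arr C" "Cod C x = ob (conc C N) n"
        and y: "y \<in> Arr C" "Dom C y = Dom C x" "Cod C y = ob Q (n + 1)" "\<delta> n \<cdot> x = bd Q (n + 1) \<cdot> y"
      have "x = Zer C (Dom C x) (Cod C x)"
      proof (cases "n = 0")
        case True
        have mono: "is_mono C (\<delta> 0)" using mono_if_exact_at_zero[OF ex[of 1]] N by simp
        have "y = Zer C (Dom C x) (ob Q 1)" using zero_arr_Cod[of y] y z[of 1] True by simp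
        then have "bd Q 1 \<cdot> y = bd Q 1 \<cdot> Zer C (Dom C x) (ob Q 1)" by simp
        also have "\<dots> = Zer C (Dom C x) (ob Q 0)" using Q[of 1] x by simp
        finally have "\<delta> 0 \<cdot> x = Zer C (Dom C x) (ob Q 0)" using y True by simp
        then show ?thesis using monoD[OF mono, of x] x d0 True by simp
      next
        case False
        then show ?thesis using zero_arr_Cod[of x] x by simp
      qed
      then show "\<exists>e x'. is_epi C e \<and> Cod C e = Dom C x \<and> x' \<in> Arr C \<and> Dom C x' = Dom C e \<and>
          Cod C x' = ob (conc C N) (n + 1) \<and> bd (conc C N) (n + 1) \<cdot> x' = x \<cdot> e"
        using x N
        by - (rule exI[of _ "Idm C (Dom C x)"], rule exI[of _ "Zer C (Dom C x) (ob (conc C N) (n + 1))"], simp)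
    qed
    show "homology_surj (conc C N) Q \<delta> n" unfolding homology_surj_def
    proof (intro allI impI)
      fix y assume y: "y \<in> Arr C" "Cod C y = ob Q n" "bd Q n \<cdot> y = Zer C (Dom C y) (ob Q (n - 1))"
      consider "n > 0" | "n = 0" | "n < 0" by linarith
      then show "\<exists>e x y'. is_epi C e \<and> Cod C e = Dom C y \<and> x \<in> Arr C \<and> Dom C x = Dom C e \<and> Cod C x = ob (conc C N) n \<and>
         bd (conc C N) n \<cdot> x = Zer C (Dom C x) (ob (conc C N) (n - 1)) \<and>
         y' \<in> Arr C \<and> Dom C y' = Dom C e \<and> Cod C y' = ob Q (n + 1) \<and>
         Sub (y \<cdot> e) (\<delta> n \<cdot> x) = bd Q (n + 1) \<cdot> y'"
      proof cases
        case 1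
        then obtain A where "A \<in> Obj C" "y = Zer C A (ob Q n)"
          using zero_arr_CodE[OF z y(1,2)] by blast
        then show ?thesis using 1 D(1-3)[of n] Q N
          by - (rule exI[of _ "Idm C (Dom C y)"], rule exI[of _ "Zer C (Dom C y) (zero_obj C)"], rule exI[of _ "Zer C (Dom C y) (ob Q (n + 1))"], simp)
      next
        case 2
        obtain e x where e: "is_epi C e" "Cod C e = Dom C y" "x \<in> Arr C" "Dom C x = Dom C e" "Cod C x = N"
          "\<delta> 0 \<cdot> x = y \<cdot> e"
          by (rule exact_at_lift[OF ex[of 0], of y]) (use y 2 d0 Q in simp_all)
        have eA: "e \<in> Arr C" using e by simp
        show ?thesis using 2 e eA N d0 y(1,2) Q[of 1]
          by - (rule exI[of _ e], rule exI[of _ x], rule exI[of _ "Zer C (Dom C e) (ob Q 1)"], simp)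
      next
        case 3
        obtain e x where e: "is_epi C e" "Cod C e = Dom C y" "x \<in> Arr C" "Dom C x = Dom C e" "Cod C x = ob Q (n + 1)"
          "bd Q (n + 1) \<cdot> x = y \<cdot> e"
          by (rule exact_at_lift[OF ex[of n], of y]) (use y 3 d0 Q in simp_all)
        have eA: "e \<in> Arr C" using e by simp
        show ?thesis using 3 e eA N D(1-3)[of n] y(1,2) Q
          by - (rule exI[of _ e], rule exI[of _ "Zer C (Dom C e) (zero_obj C)"], rule exI[of _ x], simp)
      qed
    qed
  qed
  then show ?L using R ch by (simp add: coresolution_def chain_map_def)
qed

text \<open>This is proved directly and not by duality from \<open>coresolution_iff\<close>, because
  \<open>quasi_iso\<close> is not known to be invariant under reversal at this point. The two
  characterizations together yield the invariance for resolutions, in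
  \<open>resolution_opcat\<close>.\<close>

lemma resolution_iff:
  "resolution C \<X> M P \<gamma> \<longleftrightarrow> (\<forall>n. ob P n \<in> \<X>) \<and> (\<forall>n < 0. is_zero_obj C (ob P n)) \<and>
     chain_map C P (conc C M) \<gamma> \<and> exact_complex C (augmented_res C M P \<gamma>)"
    (is "?L \<longleftrightarrow> ?R")
proof
  assume L: ?L
  then have z: "\<And>n. n < 0 \<Longrightarrow> is_zero_obj C (ob P n)" and q: "quasi_iso C P (conc C M) \<gamma>"
    by (auto simp: resolution_def)
  let ?A = "augmented_res C M P \<gamma>"
  note ch = quasi_isoD(1)[OF q]
  note P = complexD[OF chain_mapD(1)[OF ch]] and D = chain_mapD(3-6)[OF ch]
  have M: "M \<in> Obj C" using complexD(1)[OF chain_mapD(2)[OF ch], of 0] by simp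
  have g0: "\<gamma> 0 \<in> Arr C" "Dom C (\<gamma> 0) = ob P 0" "Cod C (\<gamma> 0) = M" using D(1-3)[of 0] by simp_all
  have comp0: "\<gamma> 0 \<cdot> bd P 1 = Zer C (ob P 1) M"
    using D(4)[of 1] D(1-3)[of 1] M by simp
  have "is_complex C ?A" unfolding is_complex_def
  proof (intro allI conjI)
    fix n :: int
    show "ob ?A n \<in> Obj C" using P M by simp
    show "bd ?A n \<in> Hom C (ob ?A n) (ob ?A (n - 1))" using P M g0 by (auto simp: Hom_iff)
    consider "n > 1" | "n = 1" | "n = 0" | "n < 0" by linarith
    then show "bd ?A (n - 1) \<cdot> bd ?A n = Zer C (ob ?A n) (ob ?A (n - 2))"
      by cases (use P[of n] M g0 comp0 P[of 0] in simp_all)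
  qed
  moreover have "exact_at C (bd ?A (n + 1)) (bd ?A n)" for n
  proof -
    have lift: "\<exists>e x. is_epi C e \<and> Cod C e = Dom C y \<and> x \<in> Arr C \<and> Dom C x = Dom C e \<and>
            Cod C x = Dom C (bd P (n + 1)) \<and> bd P (n + 1) \<cdot> x = y \<cdot> e"
      if y: "y \<in> Arr C" "Cod C y = ob P n" "bd P n \<cdot> y = Zer C (Dom C y) (ob P (n - 1))"
        "\<gamma> n \<cdot> y = Zer C (Dom C y) (ob (conc C M) n)" for y
    proof -
      have "\<gamma> n \<cdot> y = bd (conc C M) (n + 1) \<cdot> Zer C (Dom C y) (ob (conc C M) (n + 1))"
        using y M by simp
      then obtain e x' where "is_epi C e" "Cod C e = Dom C y" "x' \<in> Arr C" "Dom C x' = Dom C e" "Cod C x' = ob P (n + 1)"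
          "bd P (n + 1) \<cdot> x' = y \<cdot> e"
        using quasi_isoD(2)[OF q, of n, unfolded homology_inj_def, rule_format,
            of y "Zer C (Dom C y) (ob (conc C M) (n + 1))"] y M by auto
      then show ?thesis using P by - (rule exI[of _ e], rule exI[of _ x'], simp)
    qed
    consider "n > 0" | "n = 0" | "n = -1" | "n < -1" by linarith
    then show ?thesis
    proof cases
      case 1
      have "exact_at C (bd P (n + 1)) (bd P n)" unfolding exact_at_def
      proof (intro conjI ballI impI)
        fix y assume y: "y \<in> Arr C" "Cod C y = Dom C (bd P n)" "bd P n \<cdot> y = Zer C (Dom C y) (Cod C (bd P n))"
        have "\<gamma> n \<cdot> y = Zer C (Dom C y) (ob (conc C M) n)"
          using zero_arr_Cod[of "\<gamma> n \<cdot> y"] D(1-3)[of n] P y 1 by simp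
        then show "\<exists>e x. is_epi C e \<and> Cod C e = Dom C y \<and> x \<in> Arr C \<and> Dom C x = Dom C e \<and>
            Cod C x = Dom C (bd P (n + 1)) \<and> bd P (n + 1) \<cdot> x = y \<cdot> e"
          using lift[of y] y P by simp
      qed (use P in simp_all)
      then show ?thesis using 1 by simp
    next
      case 2
      have "exact_at C (bd P 1) (\<gamma> 0)" unfolding exact_at_def
      proof (intro conjI ballI impI)
        fix y assume y: "y \<in> Arr C" "Cod C y = Dom C (\<gamma> 0)" "\<gamma> 0 \<cdot> y = Zer C (Dom C y) (Cod C (\<gamma> 0))"
        have "bd P 0 \<cdot> y = Zer C (Dom C y) (ob P (-1))"
          using zero_arr_Cod[of "bd P 0 \<cdot> y"] P[of 0] y g0 z[of "-1"] by simp
        then show "\<exists>e x. is_epi C e \<and> Cod C e = Dom C y \<and> x \<in> Arr C \<and> Dom C x = Dom C e \<and>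
            Cod C x = Dom C (bd P 1) \<and> bd P 1 \<cdot> x = y \<cdot> e"
          using lift[of y] y g0 P 2 by simp
      qed (use P[of 1] g0 comp0 in simp_all)
      then show ?thesis using 2 by simp
    next
      case 3
      have "exact_at C (\<gamma> 0) (Zer C M (zero_obj C))" unfolding exact_at_def
      proof (intro conjI ballI impI)
        fix y assume y: "y \<in> Arr C" "Cod C y = Dom C (Zer C M (zero_obj C))"
        obtain e x y' where e: "is_epi C e" "Cod C e = Dom C y" "x \<in> Arr C" "Dom C x = Dom C e" "Cod C x = ob P 0"
            "y' \<in> Arr C" "Dom C y' = Dom C e" "Cod C y' = zero_obj C"
            "Sub (y \<cdot> e) (\<gamma> 0 \<cdot> x) = bd (conc C M) 1 \<cdot> y'"
          using quasi_isoD(3)[OF q, of 0, unfolded homology_surj_def, rule_format, of y] y M by auto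
        have eA: "e \<in> Arr C" using e by simp
        have "Sub (y \<cdot> e) (\<gamma> 0 \<cdot> x) = Zer C (Dom C e) M"
          using e(6-9) M by simp
        then have "y \<cdot> e = \<gamma> 0 \<cdot> x"
          using Sub_eq_Zer_iff[of "y \<cdot> e" "\<gamma> 0 \<cdot> x"] eA e(2-5) y(1,2) g0 M by simp
        then show "\<exists>e x. is_epi C e \<and> Cod C e = Dom C y \<and> x \<in> Arr C \<and> Dom C x = Dom C e \<and>
            Cod C x = Dom C (\<gamma> 0) \<and> \<gamma> 0 \<cdot> x = y \<cdot> e"
          using e(1-5) g0 by - (rule exI[of _ e], rule exI[of _ x], simp)
      qed (use g0 M in simp_all)
      then show ?thesis using 3 by simp
    next
      case 4
      then show ?thesis using M by (auto intro!: exact_at_zero)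
    qed
  qed
  ultimately show ?R using L ch by (simp add: resolution_def exact_complex_iff)
next
  assume R: ?R
  then have z: "\<And>n. n < 0 \<Longrightarrow> is_zero_obj C (ob P n)" and ch: "chain_map C P (conc C M) \<gamma>"
    by auto
  let ?A = "augmented_res C M P \<gamma>"
  have ex: "exact_at C (bd ?A (n + 1)) (bd ?A n)" for n using R by (simp add: exact_complex_iff)
  note P = complexD[OF chain_mapD(1)[OF ch]] and D = chain_mapD(3-6)[OF ch]
  have M: "M \<in> Obj C" using complexD(1)[OF chain_mapD(2)[OF ch], of 0] by simp
  have g0: "\<gamma> 0 \<in> Arr C" "Dom C (\<gamma> 0) = ob P 0" "Cod C (\<gamma> 0) = M" using D(1-3)[of 0] by simp_all
  have "quasi_iso C P (conc C M) \<gamma>"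
  proof (rule quasi_isoI[OF ch])
    fix n
    show "homology_inj P (conc C M) \<gamma> n" unfolding homology_inj_def
    proof (intro allI impI)
      fix x y assume x: "x \<in> Arr C" "Cod C x = ob P n" "bd P n \<cdot> x = Zer C (Dom C x) (ob P (n - 1))"
        and y: "y \<in> Arr C" "Dom C y = Dom C x" "Cod C y = ob (conc C M) (n + 1)" "\<gamma> n \<cdot> x = bd (conc C M) (n + 1) \<cdot> y"
      consider "n > 0" | "n = 0" | "n < 0" by linarith
      then show "\<exists>e x'. is_epi C e \<and> Cod C e = Dom C x \<and> x' \<in> Arr C \<and> Dom C x' = Dom C e \<and>
          Cod C x' = ob P (n + 1) \<and> bd P (n + 1) \<cdot> x' = x \<cdot> e"
      proof cases
        case 1
        then show ?thesis
          using exact_at_lift[OF ex[of n], of x] x P by (simp; metis)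
      next
        case 2
        have "\<gamma> 0 \<cdot> x = Zer C (Dom C x) M" using y 2 M by simp
        then show ?thesis
          using exact_at_lift[OF ex[of n], of x] x(1,2) P g0 2 by (simp; metis)
      next
        case 3
        then obtain A where "A \<in> Obj C" "x = Zer C A (ob P n)"
          using zero_arr_CodE[OF z x(1,2)] by blast
        then show ?thesis using P
          by - (rule exI[of _ "Idm C (Dom C x)"], rule exI[of _ "Zer C (Dom C x) (ob P (n + 1))"], simp)
      qed
    qed
    show "homology_surj P (conc C M) \<gamma> n" unfolding homology_surj_def
    proof (intro allI impI)
      fix y assume y: "y \<in> Arr C" "Cod C y = ob (conc C M) n"
      show "\<exists>e x y'. is_epi C e \<and> Cod C e = Dom C y \<and> x \<in> Arr C \<and> Dom C x = Dom C e \<and> Cod C x = ob P n \<and>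
         bd P n \<cdot> x = Zer C (Dom C x) (ob P (n - 1)) \<and>
         y' \<in> Arr C \<and> Dom C y' = Dom C e \<and> Cod C y' = ob (conc C M) (n + 1) \<and>
         Sub (y \<cdot> e) (\<gamma> n \<cdot> x) = bd (conc C M) (n + 1) \<cdot> y'"
      proof (cases "n = 0")
        case True
        obtain e x where e: "is_epi C e" "Cod C e = Dom C y" "x \<in> Arr C" "Dom C x = Dom C e" "Cod C x = ob P 0"
          "\<gamma> 0 \<cdot> x = y \<cdot> e"
          by (rule exact_at_lift[OF ex[of "-1"], of y]) (use y True g0 M in simp_all)
        have eA: "e \<in> Arr C" using e by simp
        have "bd P 0 \<cdot> x = Zer C (Dom C e) (ob P (-1))"
          using zero_arr_Cod[of "bd P 0 \<cdot> x"] P[of 0] e(3-5) z[of "-1"] by simp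
        then show ?thesis using True e eA M y(1,2)
          by - (rule exI[of _ e], rule exI[of _ x], rule exI[of _ "Zer C (Dom C e) (zero_obj C)"], simp)
      next
        case False
        then obtain A where "A \<in> Obj C" "y = Zer C A (zero_obj C)"
          using zero_arr_CodE[of "zero_obj C" y] y by auto
        then show ?thesis using False D(1-3)[of n] P M
          by - (rule exI[of _ "Idm C (Dom C y)"], rule exI[of _ "Zer C (Dom C y) (ob P n)"], rule exI[of _ "Zer C (Dom C y) (ob (conc C M) (n + 1))"], simp)
      qed
    qed
  qed
  then show ?L using R ch by (simp add: resolution_def chain_map_def)
qed

lemma resolution_opcat:
  "resolution (opcat C) \<X> N (opcx Q) (\<lambda>n. \<delta> (- n)) \<longleftrightarrow> coresolution C \<X> N Q \<delta>"
proof -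
  have "(\<forall>n<0. is_zero_obj C (ob Q (- n))) \<longleftrightarrow> (\<forall>n>0. is_zero_obj C (ob Q n))"
    by (metis neg_0_less_iff_less neg_less_0_iff_less verit_minus_simplify(4))
  moreover have "(\<forall>n. ob Q (- n) \<in> \<X>) \<longleftrightarrow> (\<forall>n. ob Q n \<in> \<X>)"
    by (metis verit_minus_simplify(4))
  ultimately show ?thesis
    by (simp add: coresolution_iff abelian_category.resolution_iff[OF abelian_opcat] conc_opcat chain_map_opcx
        augmented_res_opcat exact_complex_opcx)
qed

lemma coresolution_opcat:
  "coresolution (opcat C) \<X> M (opcx P) (\<lambda>n. \<gamma> (- n)) \<longleftrightarrow> resolution C \<X> M P \<gamma>"
  using abelian_category.resolution_opcat[OF abelian_opcat, of \<X> M "opcx P" "\<lambda>n. \<gamma> (- n)"] by simp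

end

lemma SUP_enat_finite_iff: "(SUP n \<in> A. enat n) < \<infinity> \<longleftrightarrow> (\<exists>d. \<forall>n \<in> A. n \<le> d)"
proof
  assume "(SUP n \<in> A. enat n) < \<infinity>"
  then obtain d where d: "(SUP n \<in> A. enat n) = enat d" by (cases "SUP n \<in> A. enat n") auto
  have "n \<le> d" if "n \<in> A" for n
    using SUP_upper[of n A enat] that unfolding d by simp
  then show "\<exists>d. \<forall>n \<in> A. n \<le> d" by blast
next
  assume "\<exists>d. \<forall>n \<in> A. n \<le> d"
  then obtain d where "\<forall>n \<in> A. n \<le> d" by blast
  then have "(SUP n \<in> A. enat n) \<le> enat d" by (intro SUP_least) simp
  then show "(SUP n \<in> A. enat n) < \<infinity>" by (rule le_less_trans) simp
qed

lemma res_hat_iff: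
  "M \<in> res_hat C \<X> \<longleftrightarrow> M \<in> Obj C \<and>
     (\<exists>P \<gamma> d. resolution C \<X> M P \<gamma> \<and> (\<forall>n > d. is_zero_obj C (ob P (int n))))"
proof -
  have fin: "(SUP n \<in> {n. \<not> Z n}. enat n) < \<infinity> \<longleftrightarrow> (\<exists>d. \<forall>n > d. Z n)" for Z
    unfolding SUP_enat_finite_iff by (simp add: not_le[symmetric]) (metis leI)
  then show ?thesis
    unfolding res_hat_def rel_pd_def mem_Collect_eq INF_less_iff fin bex_simps by blast
qed

lemma cores_hat_iff:
  "N \<in> cores_hat C \<Y> \<longleftrightarrow> N \<in> Obj C \<and>
     (\<exists>Q \<delta> d. coresolution C \<Y> N Q \<delta> \<and> (\<forall>n > d. is_zero_obj C (ob Q (- int n))))"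
proof -
  have fin: "(SUP n \<in> {n. \<not> Z n}. enat n) < \<infinity> \<longleftrightarrow> (\<exists>d. \<forall>n > d. Z n)" for Z
    unfolding SUP_enat_finite_iff by (simp add: not_le[symmetric]) (metis leI)
  then show ?thesis
    unfolding cores_hat_def rel_id_def mem_Collect_eq INF_less_iff fin bex_simps by blast
qed

section \<open>Hom-exactness\<close>

text \<open>Exactness of \<open>Hom(X, Z)\<close> in a single degree, freed of families of morphisms
  and of signs. Degrees are kept separate because truncated complexes are exact in part of the range
  only.\<close>

definition from_ex :: "('o, 'm) cat \<Rightarrow> 'o \<Rightarrow> ('o, 'm) cplx \<Rightarrow> int \<Rightarrow> bool" where
  "from_ex C X Z n \<longleftrightarrow> (\<forall>u. u \<in> Arr C \<longrightarrow> Dom C u = X \<longrightarrow> Cod C u = ob Z n \<longrightarrow>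
     bd Z n \<cdot>\<^bsub>C\<^esub> u = Zer C X (ob Z (n - 1)) \<longrightarrow>
     (\<exists>g. g \<in> Arr C \<and> Dom C g = X \<and> Cod C g = ob Z (n + 1) \<and> bd Z (n + 1) \<cdot>\<^bsub>C\<^esub> g = u))"

definition into_ex :: "('o, 'm) cat \<Rightarrow> 'o \<Rightarrow> ('o, 'm) cplx \<Rightarrow> int \<Rightarrow> bool" where
  "into_ex C Y Z n \<longleftrightarrow> (\<forall>u. u \<in> Arr C \<longrightarrow> Cod C u = Y \<longrightarrow> Dom C u = ob Z n \<longrightarrow>
     u \<cdot>\<^bsub>C\<^esub> bd Z (n + 1) = Zer C (ob Z (n + 1)) Y \<longrightarrow>
     (\<exists>g. g \<in> Arr C \<and> Cod C g = Y \<and> Dom C g = ob Z (n - 1) \<and> g \<cdot>\<^bsub>C\<^esub> bd Z n = u))"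

lemma from_ex_opcat: "from_ex (opcat C) Y (opcx Z) n \<longleftrightarrow> into_ex C Y Z (- n)"
proof -
  have "- n + 1 = 1 - n" "- (n - 1) = 1 - n" "- n - 1 = - (n + 1)" "1 - (n + 1) = - n" by simp_all
  then show ?thesis by (simp add: from_ex_def into_ex_def)
qed

lemma into_ex_opcat: "into_ex (opcat C) X (opcx Z) n \<longleftrightarrow> from_ex C X Z (- n)"
  using from_ex_opcat[of "opcat C" X "opcx Z" "- n"] by simp

lemma from_exE:
  assumes "from_ex C X Z n" "u \<in> Arr C" "Dom C u = X" "Cod C u = ob Z n"
     "bd Z n \<cdot>\<^bsub>C\<^esub> u = Zer C X (ob Z (n - 1))"
  obtains g where "g \<in> Arr C" "Dom C g = X" "Cod C g = ob Z (n + 1)" "bd Z (n + 1) \<cdot>\<^bsub>C\<^esub> g = u"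
  using assms unfolding from_ex_def by blast

lemma into_exE:
  assumes "into_ex C Y Z n" "u \<in> Arr C" "Dom C u = ob Z n" "Cod C u = Y"
     "u \<cdot>\<^bsub>C\<^esub> bd Z (n + 1) = Zer C (ob Z (n + 1)) Y"
  obtains g where "g \<in> Arr C" "Dom C g = ob Z (n - 1)" "Cod C g = Y" "g \<cdot>\<^bsub>C\<^esub> bd Z n = u"
  using assms unfolding into_ex_def by blast

context abelian_category
begin

section \<open>Hom-complexes with one argument concentrated in degree 0\<close>

lemma hom_cplx_carrier:
  "f \<in> carrier (hom_cplx C X Y n) \<longleftrightarrow> (\<forall>p. f p \<in> Arr C \<and> Dom C (f p) = ob X p \<and> Cod C (f p) = ob Y (p + n))"
  by (simp add: hom_cplx_def Hom_iff)

lemma hom_cplx_one: "\<one>\<^bsub>hom_cplx C X Y n\<^esub> = (\<lambda>p. Zer C (ob X p) (ob Y (p + n)))"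
  by (simp add: hom_cplx_def)

text \<open>The differential of \<open>conc C X\<close> is zero, so the signed summand disappears,
  whatever the parity of \<open>n\<close>.\<close>

lemma hom_diff_from:
  assumes Z: "is_complex C Z" and X: "X \<in> Obj C" and f: "f \<in> carrier (hom_cplx C (conc C X) Z n)"
  shows "hom_diff C (conc C X) Z n f = (\<lambda>p. bd Z (p + n) \<cdot> f p)"
proof
  fix p
  note F = f[unfolded hom_cplx_carrier, rule_format] and ZD = complexD[OF Z]
  have cO: "ob (conc C X) q \<in> Obj C" for q using X by simp
  have i: "p - 1 + n = p + n - 1" by simp
  have t: "f (p - 1) \<cdot> bd (conc C X) p = Zer C (ob (conc C X) p) (ob Z (p + n - 1))"
    using F[of "p - 1"] cO[of p] cO[of "p - 1"] ZD unfolding conc_sel(2) i by simp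
  have n: "inv\<^bsub>hom_group C (ob (conc C X) p) (ob Z (p + n - 1))\<^esub> (Zer C (ob (conc C X) p) (ob Z (p + n - 1))) =
       Zer C (ob (conc C X) p) (ob Z (p + n - 1))"
    using Neg_Zer[of "ob (conc C X) p" "ob Z (p + n - 1)"] cO[of p] ZD unfolding Neg_def by simp
  show "hom_diff C (conc C X) Z n f p = bd Z (p + n) \<cdot> f p"
    unfolding hom_diff_def t n using F[of p] ZD cO[of p] by simp
qed

text \<open>Off degree 0 every component starts at a zero object, so the cycle condition is
  automatic there and \<open>f 0\<close> carries all the information.\<close>

lemma hom_cycles_from:
  assumes Z: "is_complex C Z" and X: "X \<in> Obj C"
  shows "f \<in> hom_cycles C (conc C X) Z n \<longleftrightarrow>
    f \<in> carrier (hom_cplx C (conc C X) Z n) \<and> bd Z n \<cdot> f 0 = Zer C X (ob Z (n - 1))"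
proof -
  have "bd Z (p + n) \<cdot> f p = Zer C (ob (conc C X) p) (ob Z (p + (n - 1)))"
    if f: "f \<in> carrier (hom_cplx C (conc C X) Z n)" and p: "p \<noteq> 0" for p
    using zero_arr_Dom[of "bd Z (p + n) \<cdot> f p"] f[unfolded hom_cplx_carrier, rule_format, of p] p
      complexD[OF Z] by (simp add: algebra_simps)
  then have "(\<lambda>p. bd Z (p + n) \<cdot> f p) = (\<lambda>p. Zer C (ob (conc C X) p) (ob Z (p + (n - 1)))) \<longleftrightarrow>
      bd Z n \<cdot> f 0 = Zer C X (ob Z (n - 1))"
    if "f \<in> carrier (hom_cplx C (conc C X) Z n)"
  proof (intro iffI)
    assume "(\<lambda>p. bd Z (p + n) \<cdot> f p) = (\<lambda>p. Zer C (ob (conc C X) p) (ob Z (p + (n - 1))))"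
    from fun_cong[OF this, of 0] show "bd Z n \<cdot> f 0 = Zer C X (ob Z (n - 1))" by simp
  next
    assume "bd Z n \<cdot> f 0 = Zer C X (ob Z (n - 1))"
    then have "bd Z (p + n) \<cdot> f p = Zer C (ob (conc C X) p) (ob Z (p + (n - 1)))" for p
      using \<open>\<And>p. f \<in> _ \<Longrightarrow> p \<noteq> 0 \<Longrightarrow> _ p\<close>[of p] that by (cases "p = 0") simp_all
    then show "(\<lambda>p. bd Z (p + n) \<cdot> f p) = (\<lambda>p. Zer C (ob (conc C X) p) (ob Z (p + (n - 1))))" by blast
  qed
  then show ?thesis
    unfolding hom_cycles_def kernel_def hom_cplx_one using hom_diff_from[OF Z X, of f n] by auto
qed

lemma hom_boundaries_from:
  assumes Z: "is_complex C Z" and X: "X \<in> Obj C"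
  shows "f \<in> hom_boundaries C (conc C X) Z n \<longleftrightarrow>
    f \<in> carrier (hom_cplx C (conc C X) Z n) \<and>
    (\<exists>g. g \<in> Arr C \<and> Dom C g = X \<and> Cod C g = ob Z (n + 1) \<and> bd Z (n + 1) \<cdot> g = f 0)" (is "?L \<longleftrightarrow> ?R")
proof
  note ZD = complexD[OF Z]
  assume ?L
  then obtain F where F: "F \<in> carrier (hom_cplx C (conc C X) Z (n + 1))" and f: "f = (\<lambda>p. bd Z (p + (n + 1)) \<cdot> F p)"
    unfolding hom_boundaries_def using hom_diff_from[OF Z X] by auto
  note FD = F[unfolded hom_cplx_carrier, rule_format]
  have "f \<in> carrier (hom_cplx C (conc C X) Z n)"
    unfolding hom_cplx_carrier f using FD ZD by (auto simp: algebra_simps)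
  moreover have "bd Z (n + 1) \<cdot> F 0 = f 0" unfolding f by simp
  ultimately show ?R using FD[of 0] by auto
next
  note ZD = complexD[OF Z]
  assume ?R
  then obtain g where f: "f \<in> carrier (hom_cplx C (conc C X) Z n)"
    and g: "g \<in> Arr C" "Dom C g = X" "Cod C g = ob Z (n + 1)" "bd Z (n + 1) \<cdot> g = f 0" by blast
  note fD = f[unfolded hom_cplx_carrier, rule_format]
  define F where "F p = (if p = 0 then g else Zer C (ob (conc C X) p) (ob Z (p + (n + 1))))" for p
  have F: "F \<in> carrier (hom_cplx C (conc C X) Z (n + 1))"
    unfolding hom_cplx_carrier F_def using g(1-3) ZD X by simp
  have "hom_diff C (conc C X) Z (n + 1) F = f"
    unfolding hom_diff_from[OF Z X F]
  proof
    fix p show "bd Z (p + (n + 1)) \<cdot> F p = f p"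
    proof (cases "p = 0")
      case True then show ?thesis using g by (simp add: F_def)
    next
      case False
      then have "f p = Zer C (zero_obj C) (ob Z (p + n))" using zero_arr_Dom[of "f p"] fD[of p] by simp
      then show ?thesis using False ZD by (simp add: F_def)
    qed
  qed
  then show ?L unfolding hom_boundaries_def using F by auto
qed

lemma hom_exact_from_iff:
  assumes Z: "is_complex C Z" and X: "X \<in> Obj C"
  shows "hom_cycles C (conc C X) Z n \<subseteq> hom_boundaries C (conc C X) Z n \<longleftrightarrow> from_ex C X Z n"
    "hom_boundaries C (conc C X) Z n \<subseteq> hom_cycles C (conc C X) Z n"
proof -
  note ZD = complexD[OF Z]
  show "hom_boundaries C (conc C X) Z n \<subseteq> hom_cycles C (conc C X) Z n"
  proof
    fix f assume "f \<in> hom_boundaries C (conc C X) Z n"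
    then obtain g where f: "f \<in> carrier (hom_cplx C (conc C X) Z n)"
      and g: "g \<in> Arr C" "Dom C g = X" "Cod C g = ob Z (n + 1)" and eq: "bd Z (n + 1) \<cdot> g = f 0"
      unfolding hom_boundaries_from[OF Z X] by blast
    have "bd Z n \<cdot> (bd Z (n + 1) \<cdot> g) = Zer C X (ob Z (n - 1))"
      using Comp_extend[OF ZD(6), of g n] ZD(1-4) g by simp
    then show "f \<in> hom_cycles C (conc C X) Z n" unfolding hom_cycles_from[OF Z X] eq using f by blast
  qed
  show "hom_cycles C (conc C X) Z n \<subseteq> hom_boundaries C (conc C X) Z n \<longleftrightarrow> from_ex C X Z n"
  proof
    assume sub: "hom_cycles C (conc C X) Z n \<subseteq> hom_boundaries C (conc C X) Z n"
    show "from_ex C X Z n" unfolding from_ex_def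
    proof (intro allI impI)
      fix u assume u: "u \<in> Arr C" "Dom C u = X" "Cod C u = ob Z n" "bd Z n \<cdot> u = Zer C X (ob Z (n - 1))"
      define F where "F p = (if p = 0 then u else Zer C (ob (conc C X) p) (ob Z (p + n)))" for p
      have "F \<in> hom_cycles C (conc C X) Z n"
        unfolding hom_cycles_from[OF Z X] hom_cplx_carrier F_def using u ZD X by simp
      then have "F \<in> hom_boundaries C (conc C X) Z n" using sub by blast
      then show "\<exists>g. g \<in> Arr C \<and> Dom C g = X \<and> Cod C g = ob Z (n + 1) \<and> bd Z (n + 1) \<cdot> g = u"
        unfolding hom_boundaries_from[OF Z X] by (simp add: F_def)
    qed
  next
    assume ex: "from_ex C X Z n"
    show "hom_cycles C (conc C X) Z n \<subseteq> hom_boundaries C (conc C X) Z n"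
    proof
      fix f assume f: "f \<in> hom_cycles C (conc C X) Z n"
      then have "f 0 \<in> Arr C" "Dom C (f 0) = X" "Cod C (f 0) = ob Z n" "bd Z n \<cdot> f 0 = Zer C X (ob Z (n - 1))"
        unfolding hom_cycles_from[OF Z X] hom_cplx_carrier by auto
      then show "f \<in> hom_boundaries C (conc C X) Z n"
        using f ex unfolding hom_boundaries_from[OF Z X] hom_cycles_from[OF Z X] from_ex_def by blast
    qed
  qed
qed

lemma hom_from_exact_iff:
  assumes "is_complex C Z" "\<X> \<subseteq> Obj C"
  shows "hom_from_exact C \<X> Z \<longleftrightarrow> (\<forall>X \<in> \<X>. \<forall>n. from_ex C X Z n)"
  unfolding hom_from_exact_def hom_exact_def using hom_exact_from_iff[OF assms(1)] assms(2) by blast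

lemma hom_diff_into:
  assumes X: "is_complex C X" and Y: "Y \<in> Obj C" and f: "f \<in> carrier (hom_cplx C X (conc C Y) n)"
  shows "hom_diff C X (conc C Y) n f = (\<lambda>p. if even n then Neg (f (p - 1) \<cdot> bd X p) else f (p - 1) \<cdot> bd X p)"
proof
  fix p
  note F = f[unfolded hom_cplx_carrier, rule_format] and XD = complexD[OF X]
  have cO: "ob (conc C Y) q \<in> Obj C" for q using Y by simp
  have i: "p - 1 + n = p + n - 1" by simp
  have t: "bd (conc C Y) (p + n) \<cdot> f p = Zer C (ob X p) (ob (conc C Y) (p + n - 1))"
    using F[of p] cO[of "p + n"] cO[of "p + n - 1"] XD unfolding conc_sel(2) by simp
  have g: "f (p - 1) \<cdot> bd X p \<in> Arr C" "Dom C (f (p - 1) \<cdot> bd X p) = ob X p"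
    "Cod C (f (p - 1) \<cdot> bd X p) = ob (conc C Y) (p + n - 1)"
    using F[of "p - 1"] XD unfolding i by simp_all
  have n: "inv\<^bsub>hom_group C (ob X p) (ob (conc C Y) (p + n - 1))\<^esub> (f (p - 1) \<cdot> bd X p) = Neg (f (p - 1) \<cdot> bd X p)"
    unfolding Neg_def g ..
  show "hom_diff C X (conc C Y) n f p = (if even n then Neg (f (p - 1) \<cdot> bd X p) else f (p - 1) \<cdot> bd X p)"
    unfolding hom_diff_def t n using g by (simp del: conc_sel)
qed

text \<open>Only the component ending in degree 0 of \<open>conc C Y\<close> matters, that is
  \<open>p = - n\<close>; it is composed with the differential arriving there, whose source has
  degree \<open>1 - n\<close>. The sign in \<open>hom_diff\<close> does not affect
  vanishing.\<close>

lemma hom_cycles_into: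
  assumes X: "is_complex C X" and Y: "Y \<in> Obj C"
  shows "f \<in> hom_cycles C X (conc C Y) n \<longleftrightarrow>
    f \<in> carrier (hom_cplx C X (conc C Y) n) \<and> f (- n) \<cdot> bd X (1 - n) = Zer C (ob X (1 - n)) Y"
proof (cases "f \<in> carrier (hom_cplx C X (conc C Y) n)")
  case f: True
  note F = f[unfolded hom_cplx_carrier, rule_format] and XD = complexD[OF X]
  have cO: "ob (conc C Y) q \<in> Obj C" for q using Y by simp
  have i: "p - 1 + n = p + (n - 1)" for p by simp
  have g: "f (p - 1) \<cdot> bd X p \<in> Arr C" "Dom C (f (p - 1) \<cdot> bd X p) = ob X p"
    "Cod C (f (p - 1) \<cdot> bd X p) = ob (conc C Y) (p + (n - 1))" for p
    using F[of "p - 1"] XD unfolding i by simp_all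
  have neg: "Neg (f (p - 1) \<cdot> bd X p) = Zer C (ob X p) (ob (conc C Y) (p + (n - 1))) \<longleftrightarrow>
      f (p - 1) \<cdot> bd X p = Zer C (ob X p) (ob (conc C Y) (p + (n - 1)))" for p
    using Neg_Neg[OF g(1)[of p]] Neg_Zer[of "ob X p" "ob (conc C Y) (p + (n - 1))"] XD(1) cO by metis
  have out: "f (p - 1) \<cdot> bd X p = Zer C (ob X p) (ob (conc C Y) (p + (n - 1)))" if "p \<noteq> 1 - n" for p
    using zero_arr_Cod[OF _ g(1)[of p]] g(2,3)[of p] that by simp
  have "f \<in> hom_cycles C X (conc C Y) n \<longleftrightarrow>
     (\<forall>p. f (p - 1) \<cdot> bd X p = Zer C (ob X p) (ob (conc C Y) (p + (n - 1))))"
    unfolding hom_cycles_def kernel_def hom_cplx_one mem_Collect_eq hom_diff_from[OF X Y] fun_eq_iff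
      hom_diff_into[OF X Y f] using f neg by (simp del: conc_sel)
  also have "\<dots> \<longleftrightarrow> f (1 - n - 1) \<cdot> bd X (1 - n) = Zer C (ob X (1 - n)) (ob (conc C Y) (1 - n + (n - 1)))"
    using out by metis
  finally show ?thesis using f by simp
qed (simp add: hom_cycles_def kernel_def)

lemma hom_boundaries_into:
  assumes X: "is_complex C X" and Y: "Y \<in> Obj C"
  shows "f \<in> hom_boundaries C X (conc C Y) n \<longleftrightarrow>
    f \<in> carrier (hom_cplx C X (conc C Y) n) \<and>
    (\<exists>g. g \<in> Arr C \<and> Cod C g = Y \<and> Dom C g = ob X (- n - 1) \<and> g \<cdot> bd X (- n) = f (- n))" (is "?L \<longleftrightarrow> ?R")
proof
  note XD = complexD[OF X]
  assume ?L
  then obtain F where F: "F \<in> carrier (hom_cplx C X (conc C Y) (n + 1))"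
    and f: "f = (\<lambda>p. if even (n + 1) then Neg (F (p - 1) \<cdot> bd X p) else F (p - 1) \<cdot> bd X p)"
    unfolding hom_boundaries_def using hom_diff_into[OF X Y] by auto
  note FD = F[unfolded hom_cplx_carrier, rule_format]
  have i: "p - 1 + (n + 1) = p + n" for p by simp
  have g: "F (p - 1) \<cdot> bd X p \<in> Arr C" "Dom C (F (p - 1) \<cdot> bd X p) = ob X p"
    "Cod C (F (p - 1) \<cdot> bd X p) = ob (conc C Y) (p + n)" for p
    using FD[of "p - 1"] XD unfolding i by simp_all
  have "f \<in> carrier (hom_cplx C X (conc C Y) n)"
    unfolding hom_cplx_carrier f using g by (simp del: conc_sel)
  \<comment> \<open>The sign of the differential is absorbed into the preimage.\<close>
  moreover define G where "G = (if even (n + 1) then Neg (F (- n - 1)) else F (- n - 1))"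
  have "G \<in> Arr C \<and> Cod C G = Y \<and> Dom C G = ob X (- n - 1)"
    unfolding G_def using FD[of "- n - 1"] by simp
  moreover have "G \<cdot> bd X (- n) = f (- n)" unfolding f G_def using FD[of "- n - 1"] XD by simp
  ultimately show ?R by blast
next
  note XD = complexD[OF X]
  assume ?R
  then obtain g where f: "f \<in> carrier (hom_cplx C X (conc C Y) n)"
    and g: "g \<in> Arr C" "Cod C g = Y" "Dom C g = ob X (- n - 1)" "g \<cdot> bd X (- n) = f (- n)" by blast
  note fD = f[unfolded hom_cplx_carrier, rule_format]
  have cO: "ob (conc C Y) q \<in> Obj C" for q using Y by simp
  define F where "F p = (if p = - n - 1 then (if even (n + 1) then Neg g else g)
      else Zer C (ob X p) (ob (conc C Y) (p + (n + 1))))" for p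
  have F: "F \<in> carrier (hom_cplx C X (conc C Y) (n + 1))"
    unfolding hom_cplx_carrier F_def using g(1-3) XD cO by (auto simp del: conc_sel) (simp_all)
  have "hom_diff C X (conc C Y) (n + 1) F = f"
    unfolding hom_diff_into[OF X Y F]
  proof
    fix p show "(if even (n + 1) then Neg (F (p - 1) \<cdot> bd X p) else F (p - 1) \<cdot> bd X p) = f p"
    proof (cases "p = - n")
      case True then show ?thesis using g XD fD[of "- n"] by (simp add: F_def)
    next
      case False
      have "f p = Zer C (ob X p) (zero_obj C)" using zero_arr_Cod[of "f p"] fD[of p] False by simp
      moreover have "F (p - 1) = Zer C (ob X (p - 1)) (zero_obj C)" using False by (simp add: F_def)
      ultimately show ?thesis using XD by simp
    qed
  qed
  then show ?L unfolding hom_boundaries_def using F by auto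
qed

lemma hom_exact_into_iff:
  assumes X: "is_complex C X" and Y: "Y \<in> Obj C"
  shows "hom_cycles C X (conc C Y) n \<subseteq> hom_boundaries C X (conc C Y) n \<longleftrightarrow> into_ex C Y X (- n)"
    "hom_boundaries C X (conc C Y) n \<subseteq> hom_cycles C X (conc C Y) n"
proof -
  note XD = complexD[OF X]
  show "hom_boundaries C X (conc C Y) n \<subseteq> hom_cycles C X (conc C Y) n"
  proof
    fix f assume "f \<in> hom_boundaries C X (conc C Y) n"
    then obtain g where f: "f \<in> carrier (hom_cplx C X (conc C Y) n)"
      and g: "g \<in> Arr C" "Cod C g = Y" "Dom C g = ob X (- n - 1)" and eq: "g \<cdot> bd X (- n) = f (- n)"
      unfolding hom_boundaries_into[OF X Y] by blast
    have "(g \<cdot> bd X (- n)) \<cdot> bd X (1 - n) = g \<cdot> (bd X (- n) \<cdot> bd X (- n + 1))"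
      using XD(1-4) g by simp
    also have "\<dots> = Zer C (ob X (1 - n)) Y" unfolding XD(6) using XD(1-4) g by simp
    finally show "f \<in> hom_cycles C X (conc C Y) n" unfolding hom_cycles_into[OF X Y] eq using f by blast
  qed
  show "hom_cycles C X (conc C Y) n \<subseteq> hom_boundaries C X (conc C Y) n \<longleftrightarrow> into_ex C Y X (- n)"
  proof
    assume sub: "hom_cycles C X (conc C Y) n \<subseteq> hom_boundaries C X (conc C Y) n"
    show "into_ex C Y X (- n)" unfolding into_ex_def
    proof (intro allI impI)
      fix u assume u: "u \<in> Arr C" "Cod C u = Y" "Dom C u = ob X (- n)"
        "u \<cdot> bd X (- n + 1) = Zer C (ob X (- n + 1)) Y"
      have cO: "ob (conc C Y) q \<in> Obj C" for q using Y by simp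
      define F where "F p = (if p = - n then u else Zer C (ob X p) (ob (conc C Y) (p + n)))" for p
      have "F \<in> carrier (hom_cplx C X (conc C Y) n)"
        unfolding hom_cplx_carrier F_def using u(1-3) XD cO by (auto simp del: conc_sel) (simp_all)
      then have "F \<in> hom_cycles C X (conc C Y) n"
        unfolding hom_cycles_into[OF X Y] using u(4) by (simp add: F_def)
      then have "F \<in> hom_boundaries C X (conc C Y) n" using sub by blast
      then show "\<exists>g. g \<in> Arr C \<and> Cod C g = Y \<and> Dom C g = ob X (- n - 1) \<and> g \<cdot> bd X (- n) = u"
        unfolding hom_boundaries_into[OF X Y] by (simp add: F_def)
    qed
  next
    assume ex: "into_ex C Y X (- n)"
    show "hom_cycles C X (conc C Y) n \<subseteq> hom_boundaries C X (conc C Y) n"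
    proof
      fix f assume f: "f \<in> hom_cycles C X (conc C Y) n"
      then have "f (- n) \<in> Arr C" "Cod C (f (- n)) = Y" "Dom C (f (- n)) = ob X (- n)"
        "f (- n) \<cdot> bd X (- n + 1) = Zer C (ob X (- n + 1)) Y"
        unfolding hom_cycles_into[OF X Y] hom_cplx_carrier by auto
      then show "f \<in> hom_boundaries C X (conc C Y) n"
        using f ex unfolding hom_boundaries_into[OF X Y] hom_cycles_into[OF X Y] into_ex_def by blast
    qed
  qed
qed

lemma hom_into_exact_iff:
  assumes "is_complex C Z" "\<X> \<subseteq> Obj C"
  shows "hom_into_exact C \<X> Z \<longleftrightarrow> (\<forall>X \<in> \<X>. \<forall>n. into_ex C X Z n)"
proof -
  have "(\<forall>n. into_ex C X Z (- n)) \<longleftrightarrow> (\<forall>n. into_ex C X Z n)" for X by (metis minus_minus)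
  then show ?thesis
    unfolding hom_into_exact_def hom_exact_def using hom_exact_into_iff[OF assms(1)] assms(2) by blast
qed

text \<open>Triviality leaves \<open>H\<close> as the only coset, and every \<open>x\<close> lies in
  its own coset because \<open>H\<close> contains the identity.\<close>

lemma trivial_Mod_subset:
  assumes "trivial_group (G Mod H)" "\<one>\<^bsub>G\<^esub> \<in> H" "\<And>x. x \<in> carrier G \<Longrightarrow> \<one>\<^bsub>G\<^esub> \<otimes>\<^bsub>G\<^esub> x = x"
  shows "carrier G \<subseteq> H"
proof
  fix x assume x: "x \<in> carrier G"
  have "H #>\<^bsub>G\<^esub> x \<in> carrier (G Mod H)" using x by (auto simp: FactGroup_def RCOSETS_def)
  then have "H #>\<^bsub>G\<^esub> x = H" using assms(1) by (simp add: trivial_group_def FactGroup_def)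
  moreover have "\<one>\<^bsub>G\<^esub> \<otimes>\<^bsub>G\<^esub> x \<in> H #>\<^bsub>G\<^esub> x" using assms(2) by (auto simp: r_coset_def)
  ultimately show "x \<in> H" using assms(3)[OF x] by simp
qed

lemma hom_cplx_one_mult:
  assumes "f \<in> carrier (hom_cplx C X Y n)"
  shows "\<one>\<^bsub>hom_cplx C X Y n\<^esub> \<otimes>\<^bsub>hom_cplx C X Y n\<^esub> f = f"
  using assms unfolding hom_cplx_carrier by (simp add: hom_cplx_def fun_eq_iff)

lemma Ext_cores_trivialD:
  assumes "trivial_group (Ext_cores C X Q n)" "is_complex C Q" "X \<in> Obj C"
  shows "from_ex C X Q (- n)"
proof -
  have cO: "ob (conc C X) q \<in> Obj C" for q using assms by simp
  note QD = complexD[OF assms(2)]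
  have "\<one>\<^bsub>hom_cplx C (conc C X) Q (- n)\<^esub> \<in> carrier (hom_cplx C (conc C X) Q (- n))"
    unfolding hom_cplx_carrier hom_cplx_one using cO QD by (simp del: conc_sel)
  moreover have "bd Q (- n + 1) \<cdot> Zer C X (ob Q (- n + 1)) = \<one>\<^bsub>hom_cplx C (conc C X) Q (- n)\<^esub> 0"
    unfolding hom_cplx_one using assms(3) QD by simp
  ultimately have "\<one>\<^bsub>hom_cplx C (conc C X) Q (- n)\<^esub> \<in> hom_boundaries C (conc C X) Q (- n)"
    unfolding hom_boundaries_from[OF assms(2,3)] using assms(3) QD(1)
    by (intro conjI exI[of _ "Zer C X (ob Q (- n + 1))"]) (simp_all del: conc_sel)
  moreover have "x \<in> carrier (hom_cplx C (conc C X) Q (- n))" if "x \<in> hom_cycles C (conc C X) Q (- n)" for x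
    using that by (simp add: hom_cycles_def kernel_def)
  ultimately have "hom_cycles C (conc C X) Q (- n) \<subseteq> hom_boundaries C (conc C X) Q (- n)"
    using trivial_Mod_subset[OF assms(1)[unfolded Ext_cores_def hom_homology_def]] hom_cplx_one_mult by simp
  then show ?thesis using hom_exact_from_iff[OF assms(2,3)] by simp
qed

lemma Ext_res_trivialD:
  assumes "trivial_group (Ext_res C P Y n)" "is_complex C P" "Y \<in> Obj C"
  shows "into_ex C Y P n"
proof -
  have cO: "ob (conc C Y) q \<in> Obj C" for q using assms by simp
  note PD = complexD[OF assms(2)]
  have "\<one>\<^bsub>hom_cplx C P (conc C Y) (- n)\<^esub> \<in> carrier (hom_cplx C P (conc C Y) (- n))"
    unfolding hom_cplx_carrier hom_cplx_one using cO PD by (simp del: conc_sel)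
  moreover have "Zer C (ob P (n - 1)) Y \<cdot> bd P n = \<one>\<^bsub>hom_cplx C P (conc C Y) (- n)\<^esub> n"
    unfolding hom_cplx_one using assms(3) PD by simp
  ultimately have "\<one>\<^bsub>hom_cplx C P (conc C Y) (- n)\<^esub> \<in> hom_boundaries C P (conc C Y) (- n)"
    unfolding hom_boundaries_into[OF assms(2,3)] using assms(3) PD(1)
    by (intro conjI exI[of _ "Zer C (ob P (n - 1)) Y"]) (simp_all del: conc_sel)
  moreover have "x \<in> carrier (hom_cplx C P (conc C Y) (- n))" if "x \<in> hom_cycles C P (conc C Y) (- n)" for x
    using that by (simp add: hom_cycles_def kernel_def)
  ultimately have "hom_cycles C P (conc C Y) (- n) \<subseteq> hom_boundaries C P (conc C Y) (- n)"
    using trivial_Mod_subset[OF assms(1)[unfolded Ext_res_def hom_homology_def]] hom_cplx_one_mult by simp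
  then show ?thesis using hom_exact_into_iff(1)[OF assms(2,3), of "- n"] by simp
qed

end

section \<open>Splitting of extensions\<close>

definition ext1_split :: "('o, 'm) cat \<Rightarrow> 'o \<Rightarrow> 'o \<Rightarrow> bool" where
  "ext1_split C X Y \<longleftrightarrow> (\<forall>i p. exact_at C i p \<longrightarrow> is_mono C i \<longrightarrow> is_epi C p \<longrightarrow> Dom C i = Y \<longrightarrow> Cod C p = X \<longrightarrow>
     (\<exists>s. s \<in> Arr C \<and> Dom C s = X \<and> Cod C s = Dom C p \<and> p \<cdot>\<^bsub>C\<^esub> s = Idm C X))"

text \<open>The degrees are those of \<open>extensions C 1\<close>, with the quotient in degree -1
  and the subobject in degree 1, so that a short exact sequence represents a class in
  \<open>yoneda_Ext C 1\<close>.\<close>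

definition extension_cplx :: "('o, 'm) cat \<Rightarrow> 'm \<Rightarrow> 'm \<Rightarrow> ('o, 'm) cplx" where
  "extension_cplx C i p = (let E = (\<lambda>n. if n = -1 then Cod C p else if n = 0 then Dom C p else if n = 1 then Dom C i else zero_obj C)
     in \<lparr>ob = E, bd = (\<lambda>n. if n = 1 then i else if n = 0 then p else Zer C (E n) (E (n - 1)))\<rparr>)"

lemma extension_cplx_sel [simp]:
  "ob (extension_cplx C i p) n =
     (if n = -1 then Cod C p else if n = 0 then Dom C p else if n = 1 then Dom C i else zero_obj C)"
  "bd (extension_cplx C i p) n = (if n = 1 then i else if n = 0 then p
     else Zer C (ob (extension_cplx C i p) n) (ob (extension_cplx C i p) (n - 1)))"
  by (simp_all add: extension_cplx_def Let_def)

context abelian_category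
begin

text \<open>The identity minus \<open>s \<cdot> p\<close> is killed by \<open>p\<close> and
  therefore factors through \<open>i\<close>; the factor is the retraction.\<close>

lemma section_to_retraction:
  assumes ex: "exact_at C i p" "is_mono C i"
    and s: "s \<in> Arr C" "Dom C s = Cod C p" "Cod C s = Dom C p" "p \<cdot> s = Idm C (Cod C p)"
  obtains r where "r \<in> Arr C" "Dom C r = Dom C p" "Cod C r = Dom C i" "r \<cdot> i = Idm C (Dom C i)"
proof -
  note D = exact_atD[OF ex(1)]
  define t where "t = Sub (Idm C (Dom C p)) (s \<cdot> p)"
  have t: "t \<in> Arr C" "Dom C t = Dom C p" "Cod C t = Dom C p" unfolding t_def using D s(1-3) by simp_all
  have "p \<cdot> (s \<cdot> p) = p" using Comp_extend[OF s(4), of p] D s(1-3) by simp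
  then have "p \<cdot> t = Zer C (Dom C t) (Cod C p)" unfolding t(2) unfolding t_def using D s(1-3) by simp
  then obtain r where r: "r \<in> Arr C" "Dom C r = Dom C t" "Cod C r = Dom C i" "i \<cdot> r = t"
    by (rule mono_lift_of_exact[OF ex t(1,3)])
  have "s \<cdot> (p \<cdot> i) = Zer C (Dom C i) (Dom C p)" unfolding D(4) using D(1,2) s(1-3) by simp
  then have "t \<cdot> i = i" unfolding t_def using D s(1-3) by simp
  then have "i \<cdot> (r \<cdot> i) = i \<cdot> Idm C (Dom C i)" using Comp_extend[OF r(4), of i] r(1-3) t D by simp
  then have "r \<cdot> i = Idm C (Dom C i)"
    by (rule mono_cancel[OF ex(2), rotated -1]) (use r(1-3) t D in simp_all)
  then show ?thesis using that r t by simp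
qed

lemmas retraction_to_section =
  abelian_category.section_to_retraction[OF abelian_opcat, simplified, unfolded exact_at_opcat]

text \<open>\<open>ext1_split\<close> provides a section, whereas splitting in the opposite category
  requires a retraction; \<open>section_to_retraction\<close> converts one into the other.\<close>

lemma ext1_split_opcat: "ext1_split C X Y \<Longrightarrow> ext1_split (opcat C) Y X"
  unfolding ext1_split_def
proof (intro allI impI; simp add: exact_at_opcat)
  fix i p
  assume S: "\<forall>i p. exact_at C i p \<longrightarrow> is_mono C i \<longrightarrow> is_epi C p \<longrightarrow> Dom C i = Y \<longrightarrow> Cod C p = X \<longrightarrow>
     (\<exists>s. s \<in> Arr C \<and> Dom C s = X \<and> Cod C s = Dom C p \<and> p \<cdot> s = Idm C X)"
    and H: "exact_at C p i" "is_epi C i" "is_mono C p" "Cod C i = X" "Dom C p = Y"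
  then obtain s where "s \<in> Arr C" "Dom C s = Cod C i" "Cod C s = Dom C i" "i \<cdot> s = Idm C (Cod C i)" by auto
  then obtain r where "r \<in> Arr C" "Dom C r = Dom C i" "Cod C r = Dom C p" "r \<cdot> p = Idm C (Dom C p)"
    by (rule section_to_retraction[OF H(1,3)])
  then show "\<exists>s. s \<in> Arr C \<and> Cod C s = Y \<and> Dom C s = Cod C p \<and> s \<cdot> p = Idm C Y"
    using H exact_atD[OF H(1)] by (intro exI[of _ r]) simp
qed

lemma extension_cplx_extension:
  assumes ex: "exact_at C i p" and i: "is_mono C i" and p: "is_epi C p"
  shows "extension_cplx C i p \<in> extensions C 1 (Cod C p) (Dom C i)"
proof -
  note D = exact_atD[OF ex]
  let ?E = "extension_cplx C i p"
  have zo: "zero_obj C \<in> Obj C" by simp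
  have "is_complex C ?E" unfolding is_complex_def
  proof (intro allI conjI)
    fix n :: int
    show "ob ?E n \<in> Obj C" using D by simp
    show "bd ?E n \<in> Hom C (ob ?E n) (ob ?E (n - 1))" using D by (auto simp: Hom_iff)
    consider "n > 2" | "n = 2" | "n = 1" | "n = 0" | "n < 0" by linarith
    then show "bd ?E (n - 1) \<cdot> bd ?E n = Zer C (ob ?E n) (ob ?E (n - 2))"
      by cases (use D in simp_all)
  qed
  moreover have "exact_at C (bd ?E (n + 1)) (bd ?E n)" for n
  proof -
    consider "n > 1" | "n = 1" | "n = 0" | "n = -1" | "n < -1" by linarith
    then show ?thesis
    proof cases
      case 2
      then show ?thesis using exact_at_monoI[OF i zo] D by simp
    next
      case 3
      then show ?thesis using ex by simp
    next
      case 4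
      have "exact_at C p (Zer C (Cod C p) (zero_obj C))"
        using abelian_category.exact_at_monoI[OF abelian_opcat, of p "zero_obj C"] p by (simp add: exact_at_opcat)
      then show ?thesis using 4 by simp
    qed (use D in \<open>auto intro!: exact_at_zero\<close>)
  qed
  ultimately have "exact_complex C ?E" by (simp add: exact_complex_iff)
  then show ?thesis unfolding extensions_def by auto
qed

text \<open>Along a map of extensions that is the identity at both ends, sections are pushed forward
  and retractions are pulled back. Either of them means splitting, so splitting is invariant under
  the equivalence relation generated by such maps. As there is a single class, every extension
  shares it with the biproduct.\<close>

lemma perp_ext1_split:
  assumes perp: "perp C \<X> \<Y>" and XY: "X \<in> \<X>" "Y \<in> \<Y>" "X \<in> Obj C" "Y \<in> Obj C"
  shows "ext1_split C X Y"
  unfolding ext1_split_def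
proof (intro allI impI)
  fix i p assume ip: "exact_at C i p" "is_mono C i" "is_epi C p" "Dom C i = Y" "Cod C p = X"
  let ?S = "\<lambda>E. \<exists>s. s \<in> Arr C \<and> Dom C s = X \<and> Cod C s = ob E 0 \<and> bd E 0 \<cdot> s = Idm C X"
  let ?R = "\<lambda>E. \<exists>r. r \<in> Arr C \<and> Dom C r = ob E 0 \<and> Cod C r = Y \<and> r \<cdot> bd E 1 = Idm C Y"
  have E: "is_complex C E \<and> exact_at C (bd E 1) (bd E 0) \<and> is_mono C (bd E 1) \<and> is_epi C (bd E 0) \<and>
      ob E (-1) = X \<and> ob E 1 = Y" if "E \<in> extensions C 1 X Y" for E
  proof -
    have c: "is_complex C E" and ex: "\<And>n. exact_at C (bd E (n + 1)) (bd E n)" and ob: "ob E (-1) = X" "ob E 1 = Y"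
      and z: "is_zero_obj C (ob E 2)" "is_zero_obj C (ob E (-2))"
      using that by (auto simp: extensions_def exact_complex_iff)
    note ED = complexD[OF c]
    have "is_mono C (bd E 1)" using mono_if_exact_at_zero[OF ex[of 1]] ED z by simp
    moreover have "is_epi C (bd E 0)"
      using abelian_category.mono_if_exact_at_zero[OF abelian_opcat, of "bd E (-1)" "bd E 0"] ex[of "-1"] ED z
      by (simp add: exact_at_opcat)
    ultimately show ?thesis using c ex[of 0] ob by simp
  qed
  have SR: "?S E \<longleftrightarrow> ?R E" if "E \<in> extensions C 1 X Y" for E
  proof -
    have c: "is_complex C E" and ex: "exact_at C (bd E 1) (bd E 0)" "is_mono C (bd E 1)" "is_epi C (bd E 0)"
      and ob: "ob E (-1) = X" "ob E 1 = Y" using E[OF that] by auto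
    note ED = complexD[OF c]
    show ?thesis
    proof
      assume "?S E"
      then obtain s where "s \<in> Arr C" "Dom C s = Cod C (bd E 0)" "Cod C s = Dom C (bd E 0)"
        "bd E 0 \<cdot> s = Idm C (Cod C (bd E 0))" using ED(3,4)[of 0] ob by auto
      from section_to_retraction[OF ex(1,2) this] show "?R E" using ED(3,4) ob by metis
    next
      assume "?R E"
      then obtain r where "r \<in> Arr C" "Cod C r = Dom C (bd E 1)" "Dom C r = Cod C (bd E 1)"
        "r \<cdot> bd E 1 = Idm C (Dom C (bd E 1))" using ED(3,4)[of 1] ob by auto
      from retraction_to_section[OF ex(1,3) this] have
        "\<exists>s. s \<in> Arr C \<and> Cod C s = Cod C (bd E 1) \<and> Dom C s = Cod C (bd E 0) \<and> bd E 0 \<cdot> s = Idm C (Cod C (bd E 0))" 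
        by metis
      then show "?S E" using ED(3,4)[of 0] ED(3,4)[of 1] ob by auto
    qed
  qed
  have map: "?S E \<longleftrightarrow> ?S F" if EF: "(E, F) \<in> extension_maps C 1 X Y" for E F
  proof -
    obtain \<phi> where EF: "E \<in> extensions C 1 X Y" "F \<in> extensions C 1 X Y" and ch: "chain_map C E F \<phi>"
      and id: "\<phi> (-1) = Idm C X" "\<phi> 1 = Idm C Y"
      using EF unfolding extension_maps_def by auto
    note D = chain_mapD(3-6)[OF ch]
    note ED = complexD[OF chain_mapD(1)[OF ch]] and FD = complexD[OF chain_mapD(2)[OF ch]]
    have ob: "ob E (-1) = X" "ob E 1 = Y" "ob F (-1) = X" "ob F 1 = Y" using E EF by blast+
    have "?S F" if S: "?S E"
    proof -
      obtain s where s: "s \<in> Arr C" "Dom C s = X" "Cod C s = ob E 0" "bd E 0 \<cdot> s = Idm C X" using S by blast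
      have "bd F 0 \<cdot> (\<phi> 0 \<cdot> s) = (\<phi> (-1) \<cdot> bd E 0) \<cdot> s"
        using Comp_extend[OF D(4)[of 0], of s] D(1-3) ED(1-4) FD(1-4) s(1-3) by simp
      also have "\<dots> = Idm C X" unfolding id using ED(2-4)[of 0] s ob by simp
      finally show ?thesis using s(1-3) D(1-3)[of 0] by (intro exI[of _ "\<phi> 0 \<cdot> s"]) simp
    qed
    moreover have "?R E" if R: "?R F"
    proof -
      obtain r where r: "r \<in> Arr C" "Dom C r = ob F 0" "Cod C r = Y" "r \<cdot> bd F 1 = Idm C Y" using R by blast
      have "(r \<cdot> \<phi> 0) \<cdot> bd E 1 = r \<cdot> (\<phi> (1 - 1) \<cdot> bd E 1)"
        using D(1-3)[of 0] ED(1-4)[of 1] r(1-3) by simp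
      also have "\<dots> = (r \<cdot> bd F 1) \<cdot> \<phi> 1" unfolding D(4)[of 1, symmetric] using D(1-3)[of 1] FD(1-4)[of 1] r(1-3) by simp
      also have "\<dots> = Idm C Y" unfolding r(4) id using XY by simp
      finally show ?thesis using r(1-3) D(1-3)[of 0] by (intro exI[of _ "r \<cdot> \<phi> 0"]) simp
    qed
    ultimately show ?thesis using SR EF by blast
  qed
  let ?rel = "(extension_maps C 1 X Y \<union> (extension_maps C 1 X Y)\<inverse>)\<^sup>*"
  have rel: "?S E \<longleftrightarrow> ?S F" if "(E, F) \<in> ?rel" for E F
    using that by (induction rule: rtrancl_induct) (use map in blast)+
  \<comment> \<open>The biproduct is the reference extension, split by \<open>b\<close>.\<close>
  obtain P a b c d where P: "P \<in> Obj C" "a \<in> Arr C" "b \<in> Arr C" "c \<in> Arr C" "d \<in> Arr C"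
    "Dom C a = Y" "Cod C a = P" "Dom C b = X" "Cod C b = P" "Dom C c = P" "Cod C c = Y" "Dom C d = P" "Cod C d = X"
    and ids: "c \<cdot> a = Idm C Y" "d \<cdot> b = Idm C X"
    and zer: "c \<cdot> b = Zer C X Y" "d \<cdot> a = Zer C Y X"
    and sum: "Add C (a \<cdot> c) (b \<cdot> d) = Idm C P"
    by (rule biproductE[OF XY(4,3)])
  have da: "exact_at C a d" unfolding exact_at_def
  proof (intro conjI ballI impI)
    fix y assume y: "y \<in> Arr C" "Cod C y = Dom C d" "d \<cdot> y = Zer C (Dom C y) (Cod C d)"
    have "y = Add C (a \<cdot> c) (b \<cdot> d) \<cdot> y" unfolding sum using P y by simp
    also have "\<dots> = Add C (a \<cdot> (c \<cdot> y)) (b \<cdot> (d \<cdot> y))" using P y(1,2) by simp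
    also have "\<dots> = a \<cdot> (c \<cdot> y)" unfolding y(3) using P y(1,2) XY by simp
    finally have "a \<cdot> (c \<cdot> y) = y \<cdot> Idm C (Dom C y)" using y(1) by simp
    then show "\<exists>e x. is_epi C e \<and> Cod C e = Dom C y \<and> x \<in> Arr C \<and> Dom C x = Dom C e \<and> Cod C x = Dom C a \<and>
           a \<cdot> x = y \<cdot> e"
      using P y(1,2) by - (rule exI[of _ "Idm C (Dom C y)"], rule exI[of _ "c \<cdot> y"], simp)
  qed (use P zer in simp_all)
  have "is_mono C a" "is_epi C d"
    using mono_of_Comp[of c a] epi_of_Comp[of d b] P ids XY
      preadditive_category.epi_Idm[OF preadditive_opcat, of Y] by simp_all
  then have 1: "extension_cplx C a d \<in> extensions C 1 X Y" using extension_cplx_extension[OF da] P by simp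
  have 2: "extension_cplx C i p \<in> extensions C 1 X Y" using extension_cplx_extension[OF ip(1-3)] ip by simp
  obtain e where e: "yoneda_Ext C 1 X Y = {e}"
    using perp[unfolded perp_def, rule_format, OF XY(1,2), of 1] by auto
  have "?rel `` {extension_cplx C a d} \<in> yoneda_Ext C 1 X Y" "?rel `` {extension_cplx C i p} \<in> yoneda_Ext C 1 X Y"
    unfolding yoneda_Ext_def by (rule quotientI, fact)+
  then have "?rel `` {extension_cplx C a d} = ?rel `` {extension_cplx C i p}" unfolding e by (simp only: singleton_iff)
  moreover have "extension_cplx C i p \<in> ?rel `` {extension_cplx C i p}" by (rule ImageI) simp_all
  ultimately have "extension_cplx C i p \<in> ?rel `` {extension_cplx C a d}" by (simp only:)
  then have "(extension_cplx C a d, extension_cplx C i p) \<in> ?rel" by (simp only: Image_singleton_iff)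
  then have "?S (extension_cplx C a d) \<longleftrightarrow> ?S (extension_cplx C i p)" by (rule rel)
  moreover have "?S (extension_cplx C a d)" using P ids by auto
  ultimately show "\<exists>s. s \<in> Arr C \<and> Dom C s = X \<and> Cod C s = Dom C p \<and> p \<cdot> s = Idm C X" by simp
qed

text \<open>The extension is constructed on the pushout of \<open>m\<close> and \<open>u\<close>, whose projection to \<open>Cod C q\<close> splits.\<close>

lemma extend_along_mono:
  assumes ex: "exact_at C m q" and m: "is_mono C m" and q: "is_epi C q"
    and split: "ext1_split C (Cod C q) (Cod C u)" and u: "u \<in> Arr C" "Dom C u = Dom C m"
  obtains g where "g \<in> Arr C" "Dom C g = Cod C m" "Cod C g = Cod C u" "g \<cdot> m = u"
proof -
  note D = exact_atD[OF ex]
  obtain P j l a b where P: "P \<in> Obj C" "j \<in> Arr C" "l \<in> Arr C" "a \<in> Arr C" "b \<in> Arr C"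
    "Dom C j = Dom C q" "Cod C j = P" "Dom C l = Cod C u" "Cod C l = P" "Dom C a = P" "Cod C a = Dom C q"
    "Dom C b = P" "Cod C b = Cod C u"
    and ids: "a \<cdot> j = Idm C (Dom C q)" "b \<cdot> l = Idm C (Cod C u)"
    and zer: "a \<cdot> l = Zer C (Cod C u) (Dom C q)" "b \<cdot> j = Zer C (Dom C q) (Cod C u)"
    and sum: "Add C (j \<cdot> a) (l \<cdot> b) = Idm C P"
    by (rule biproductE[of "Dom C q" "Cod C u"]) (use D u in simp_all)
  have aj: "a \<cdot> (j \<cdot> x) = x" if "x \<in> Arr C" "Cod C x = Dom C q" for x
    using Comp_extend[OF ids(1), of x] that P by simp
  have al: "a \<cdot> (l \<cdot> x) = Zer C (Dom C x) (Dom C q)" if "x \<in> Arr C" "Cod C x = Cod C u" for x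
    using Comp_extend[OF zer(1), of x] that P D by simp
  \<comment> \<open>The cokernel \<open>c\<close> of \<open>w\<close> identifies
    \<open>j \<cdot> m\<close> with \<open>l \<cdot> u\<close>, so its target is the pushout. Below,
    \<open>i\<close> is the map from the codomain of \<open>u\<close> and \<open>p\<close> the
    projection induced by \<open>q\<close>.\<close>
  define w where "w = Sub (j \<cdot> m) (l \<cdot> u)"
  have w: "w \<in> Arr C" "Dom C w = Dom C m" "Cod C w = P" unfolding w_def using P D u by simp_all
  have aw: "a \<cdot> w = m" unfolding w_def using P D u aj al by simp
  obtain c where c: "is_cokernel C w c" using ex_cokernel w by blast
  note cD = cokernelD[OF c]
  have jm: "c \<cdot> (j \<cdot> m) = c \<cdot> (l \<cdot> u)"
  proof -
    have "Sub (c \<cdot> (j \<cdot> m)) (c \<cdot> (l \<cdot> u)) = c \<cdot> w"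
      unfolding w_def using P D u cD(1-3) w by simp
    then have "Sub (c \<cdot> (j \<cdot> m)) (c \<cdot> (l \<cdot> u)) = Zer C (Dom C m) (Cod C c)" using cD(4) w by simp
    then show ?thesis using Sub_eq_Zer_iff[of "c \<cdot> (j \<cdot> m)" "c \<cdot> (l \<cdot> u)"] P D u cD(1-3) w by simp
  qed
  have "(q \<cdot> a) \<cdot> w = Zer C (Dom C w) (Cod C (q \<cdot> a))" using P D w aw by simp
  then obtain p where p: "p \<in> Arr C" "Cod C p = Cod C q" "Dom C p = Cod C c" "p \<cdot> c = q \<cdot> a"
    using cokernel_factor[OF c, of "q \<cdot> a"] P D w by auto
  define i where "i = c \<cdot> l"
  have i: "i \<in> Arr C" "Dom C i = Cod C u" "Cod C i = Dom C p" unfolding i_def using P cD(1-3) w p by simp_all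
  have pc: "p \<cdot> (c \<cdot> x) = q \<cdot> (a \<cdot> x)" if "x \<in> Arr C" "Cod C x = P" for x
    using Comp_extend[OF p(4), of x] that P D cD(1-3) p(1-3) w by simp
  have pi: "p \<cdot> i = Zer C (Dom C i) (Cod C p)"
    using pc[of l] zer P D i unfolding i_def by simp (use p u in simp)
  have imono: "is_mono C i"
  proof (rule monoI)
    fix y assume y: "y \<in> Arr C" "Cod C y = Dom C i" "i \<cdot> y = Zer C (Dom C y) (Cod C i)"
    have yu: "Cod C y = Cod C u" using y i by simp
    have "c \<cdot> (l \<cdot> y) = Zer C (Dom C y) (Cod C c)"
      using y(1,3) yu P cD(1-3) w i(3) p(3) unfolding i_def by simp
    then obtain e z where e: "is_epi C e" "Cod C e = Dom C (l \<cdot> y)" "z \<in> Arr C" "Dom C z = Dom C e" "Cod C z = Dom C w"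
      and wz: "w \<cdot> z = (l \<cdot> y) \<cdot> e"
      using exact_at_lift[OF exact_at_cokernel[OF c], of "l \<cdot> y"] y(1) yu P cD w by auto
    have eA: "e \<in> Arr C" "Cod C e = Dom C y" using e y(1) yu P by simp_all
    \<comment> \<open>The first component of \<open>w \<cdot> z\<close> is
      \<open>m \<cdot> z\<close>, which vanishes because \<open>l\<close> lands in the second
      summand. So \<open>z\<close> vanishes, and the second component then forces \<open>y\<close>
      to vanish.\<close>
    have "m \<cdot> z = a \<cdot> (w \<cdot> z)" using Comp_extend[OF aw, of z] e(3-5) w P by simp
    also have "\<dots> = a \<cdot> (l \<cdot> (y \<cdot> e))" unfolding wz using P y(1) yu eA by simp
    also have "\<dots> = Zer C (Dom C e) (Dom C q)" using al[of "y \<cdot> e"] y(1) yu eA by simp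
    finally have z0: "z = Zer C (Dom C e) (Dom C m)"
      using monoD[OF m, of z] e(3-5) w D by simp
    have "l \<cdot> (y \<cdot> e) = w \<cdot> z" unfolding wz using P y(1) yu eA by simp
    also have "\<dots> = Zer C (Dom C e) P" unfolding z0 using w D eA by simp
    finally have "b \<cdot> (l \<cdot> (y \<cdot> e)) = Zer C (Dom C e) (Cod C u)" using P eA by simp
    then have "y \<cdot> e = Zer C (Dom C e) (Cod C y)"
      using Comp_extend[OF ids(2), of "y \<cdot> e"] P y(1) yu eA by simp
    then show "y = Zer C (Dom C y) (Dom C i)" using epiD[OF e(1) y(1)] eA y(2) by simp
  qed (use i in simp)
  have pepi: "is_epi C p"
  proof (rule epi_of_Comp[of _ "c \<cdot> j"])
    show "is_epi C (p \<cdot> (c \<cdot> j))" using pc[of j] ids P D q by simp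
  qed (use P cD(1-3) w p in simp_all)
  have exip: "exact_at C i p" unfolding exact_at_def
  proof (intro conjI ballI impI)
    fix y assume y: "y \<in> Arr C" "Cod C y = Dom C p" "p \<cdot> y = Zer C (Dom C y) (Cod C p)"
    obtain e x where e: "is_epi C e" "Cod C e = Dom C y" "x \<in> Arr C" "Dom C x = Dom C e" "Cod C x = Dom C c"
      and cx: "c \<cdot> x = y \<cdot> e"
      by (rule pullback_epi[OF cokernel_epi[OF c], of y]) (use y p in simp_all)
    have eA: "e \<in> Arr C" using e by simp
    have xP: "Cod C x = P" using e cD w by simp
    have "q \<cdot> (a \<cdot> x) = p \<cdot> (y \<cdot> e)" using pc[of x] e xP cx by simp
    also have "\<dots> = (p \<cdot> y) \<cdot> e" using p y(1,2) eA e(2) by simp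
    also have "\<dots> = Zer C (Dom C (a \<cdot> x)) (Cod C q)" unfolding y(3) using p D eA e(2-4) xP P by simp
    finally obtain e2 z where e2: "is_epi C e2" "Cod C e2 = Dom C (a \<cdot> x)" "z \<in> Arr C" "Dom C z = Dom C e2" "Cod C z = Dom C m"
      and mz: "m \<cdot> z = (a \<cdot> x) \<cdot> e2"
      by (rule exact_at_lift[OF ex, rotated 2]) (use e xP P in simp_all)
    have e2A: "e2 \<in> Arr C" "Cod C e2 = Dom C e" using e2 e xP P by simp_all
    \<comment> \<open>The representative \<open>x\<close> of \<open>y\<close> has components
      \<open>m \<cdot> z\<close> and \<open>b \<cdot> (x \<cdot> e2)\<close> over the cover. In the
      pushout the former can be traded for \<open>u \<cdot> z\<close>, so \<open>y\<close> comes
      from \<open>t\<close> through \<open>i\<close>.\<close>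
    define t where "t = Add C (u \<cdot> z) (b \<cdot> (x \<cdot> e2))"
    have t: "t \<in> Arr C" "Dom C t = Dom C e2" "Cod C t = Cod C u"
      unfolding t_def using u e2(3-5) e2A P e xP by simp_all
    have "x \<cdot> e2 = Add C (j \<cdot> a) (l \<cdot> b) \<cdot> (x \<cdot> e2)" unfolding sum using e(3,4) xP e2A by simp
    also have "\<dots> = Add C (j \<cdot> ((a \<cdot> x) \<cdot> e2)) (l \<cdot> (b \<cdot> (x \<cdot> e2)))" using P e(3,4) xP e2A by simp
    finally have xe: "x \<cdot> e2 = Add C (j \<cdot> (m \<cdot> z)) (l \<cdot> (b \<cdot> (x \<cdot> e2)))" unfolding mz .
    have cj: "c \<cdot> (j \<cdot> (m \<cdot> z)) = c \<cdot> (l \<cdot> (u \<cdot> z))"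
      using Comp_extend[OF jm, of z] e2(3-5) P D u cD(1-3) w by simp
    have "y \<cdot> (e \<cdot> e2) = c \<cdot> (x \<cdot> e2)" using Comp_extend[OF cx, of e2] y(1) eA e(2-5) e2A cD(1-3) by simp
    also have "\<dots> = Add C (c \<cdot> (j \<cdot> (m \<cdot> z))) (c \<cdot> (l \<cdot> (b \<cdot> (x \<cdot> e2))))"
      by (subst xe) (use P e(3,4) xP e2A e2(3-5) D cD(1-3) w in simp)
    also have "\<dots> = i \<cdot> t" unfolding cj t_def i_def using P e(3,4) xP e2A e2(3-5) u cD(1-3) w by simp
    finally have "i \<cdot> t = y \<cdot> (e \<cdot> e2)" ..
    then show "\<exists>e x. is_epi C e \<and> Cod C e = Dom C y \<and> x \<in> Arr C \<and> Dom C x = Dom C e \<and> Cod C x = Dom C i \<and>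
           i \<cdot> x = y \<cdot> e"
      using epi_Comp[OF e2(1) e(1)] e2A eA e(2) t i
      by - (rule exI[of _ "e \<cdot> e2"], rule exI[of _ t], simp)
  qed (use i p pi in simp_all)
  obtain s where s: "s \<in> Arr C" "Dom C s = Cod C p" "Cod C s = Dom C p" "p \<cdot> s = Idm C (Cod C p)"
    using split exip imono pepi i p unfolding ext1_split_def by metis
  obtain r where r: "r \<in> Arr C" "Dom C r = Dom C p" "Cod C r = Dom C i" "r \<cdot> i = Idm C (Dom C i)"
    by (rule section_to_retraction[OF exip imono s])
  \<comment> \<open>Following the map \<open>c \<cdot> j\<close> into the pushout by the retraction
    \<open>r\<close> gives the desired extension of \<open>u\<close>.\<close>
  have "(r \<cdot> (c \<cdot> j)) \<cdot> m = r \<cdot> (c \<cdot> (j \<cdot> m))" using r(1-3) p P cD(1-3) w D by simp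
  also have "\<dots> = (r \<cdot> i) \<cdot> u" unfolding jm i_def using r(1-3) p P cD(1-3) w u by simp
  also have "\<dots> = u" unfolding r(4) using i u by simp
  finally show ?thesis using that[of "r \<cdot> (c \<cdot> j)"] r(1-3) p P cD(1-3) w D i by simp
qed

text \<open>By exactness a \<open>u\<close> that kills \<open>bd T (n + 1)\<close> factors through
  the image of \<open>bd T n\<close>. This image is a subobject of \<open>ob T (n - 1)\<close> with
  quotient \<open>Cod C q\<close>, so the splitting hypothesis extends the factor along the
  inclusion \<open>m\<close>.\<close>

lemma acyclic_into_ex:
  assumes T: "exact_complex C T" and split: "\<And>q. is_cokernel C (bd T n) q \<Longrightarrow> ext1_split C (Cod C q) Y"
  shows "into_ex C Y T n"
  unfolding into_ex_def
proof (intro allI impI)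
  fix u assume u: "u \<in> Arr C" "Cod C u = Y" "Dom C u = ob T n" "u \<cdot> bd T (n + 1) = Zer C (ob T (n + 1)) Y"
  have c: "is_complex C T" and ex: "exact_at C (bd T (n + 1)) (bd T n)"
    using T by (auto simp: exact_complex_iff)
  note TD = complexD[OF c]
  obtain q where q: "is_cokernel C (bd T n) q" using ex_cokernel TD by blast
  note qD = cokernelD[OF q]
  obtain m where m: "is_kernel C q m" using ex_kernel qD by blast
  note mD = kernelD[OF m]
  obtain e where e: "is_epi C e" "Dom C e = ob T n" "Cod C e = Dom C m" "m \<cdot> e = bd T n"
    using mono_comp_epi_aux[OF exact_at_cokernel[OF q] m] TD(3) by metis
  have eA: "e \<in> Arr C" using e by simp
  obtain v where v: "v \<in> Arr C" "Dom C v = Cod C e" "Cod C v = Cod C u" "v \<cdot> e = u"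
  proof (rule epi_factor[OF e(1) u(1)])
    fix \<kappa> assume \<kappa>: "\<kappa> \<in> Arr C" "Cod C \<kappa> = Dom C e" "e \<cdot> \<kappa> = Zer C (Dom C \<kappa>) (Cod C e)"
    have "bd T n \<cdot> \<kappa> = m \<cdot> (e \<cdot> \<kappa>)" by (rule Comp_extend[OF e(4), symmetric]) (use \<kappa> eA e(3) mD in simp_all)
    also have "\<dots> = Zer C (Dom C \<kappa>) (Cod C (bd T n))" unfolding \<kappa>(3) using \<kappa>(1) e(3) mD qD by simp
    finally obtain e2 x where e2: "is_epi C e2" "Cod C e2 = Dom C \<kappa>" "x \<in> Arr C" "Dom C x = Dom C e2"
      "Cod C x = Dom C (bd T (n + 1))" and x: "bd T (n + 1) \<cdot> x = \<kappa> \<cdot> e2"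
      by (rule exact_at_lift[OF ex, rotated 2]) (use \<kappa> e(2) TD in simp_all)
    have e2A: "e2 \<in> Arr C" using e2 by simp
    have "(u \<cdot> \<kappa>) \<cdot> e2 = u \<cdot> (bd T (n + 1) \<cdot> x)" unfolding x using u(1,3) \<kappa>(1,2) e(2) e2A e2(2) by simp
    also have "\<dots> = Zer C (Dom C e2) (Cod C (u \<cdot> \<kappa>))"
      using Comp_extend[OF u(4), of x] e2(3-5) u(1-3) TD(1-4) \<kappa>(1,2) e(2) by simp (use u in auto)
    finally show "u \<cdot> \<kappa> = Zer C (Dom C \<kappa>) (Cod C u)"
      using epiD[OF e2(1), of "u \<cdot> \<kappa>"] u(1,3) \<kappa>(1,2) e(2) e2(2) by simp
  qed (use u e in simp_all)
  obtain g where g: "g \<in> Arr C" "Dom C g = Cod C m" "Cod C g = Cod C v" "g \<cdot> m = v"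
    by (rule extend_along_mono[OF exact_at_kernel[OF m] kernel_mono[OF m] cokernel_epi[OF q], of v])
      (use split[OF q] v e u in simp_all)
  have "g \<cdot> bd T n = (g \<cdot> m) \<cdot> e" unfolding e(4)[symmetric] using g(1-3) mD eA e(3) by simp
  then have "g \<cdot> bd T n = u" unfolding g(4) v(4) .
  then show "\<exists>g. g \<in> Arr C \<and> Cod C g = Y \<and> Dom C g = ob T (n - 1) \<and> g \<cdot> bd T n = u"
    using g(1-3) v u(2) mD qD TD(4) by (intro exI[of _ g]) simp
qed

text \<open>Dually, a cycle has to be lifted along the epi from \<open>ob S (n + 1)\<close> onto the
  image of \<open>bd S (n + 1)\<close>. The obstruction is an extension of \<open>X\<close> by the
  kernel of that differential, whence the index \<open>n + 1\<close>.\<close>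

lemma acyclic_from_ex:
  assumes S: "exact_complex C S" and split: "\<And>k. is_kernel C (bd S (n + 1)) k \<Longrightarrow> ext1_split C X (Dom C k)"
  shows "from_ex C X S n"
proof -
  have "into_ex (opcat C) X (opcx S) (- n)"
    by (rule abelian_category.acyclic_into_ex[OF abelian_opcat])
      (use S split in \<open>simp_all add: exact_complex_opcx ext1_split_opcat add.commute\<close>)
  then show ?thesis by (simp add: into_ex_opcat)
qed

end

section \<open>Totally acyclic complexes and Tate resolutions\<close>

text \<open>A mere reindexing, with no sign on the differential. It moves any differential of
  \<open>T\<close> into degree 1, where \<open>Gor\<close> reads off its objects.\<close>

definition shift :: "int \<Rightarrow> ('o, 'm) cplx \<Rightarrow> ('o, 'm) cplx" where
  "shift k T = \<lparr>ob = (\<lambda>n. ob T (n + k)), bd = (\<lambda>n. bd T (n + k))\<rparr>"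

lemma shift_sel [simp]: "ob (shift k T) n = ob T (n + k)" "bd (shift k T) n = bd T (n + k)"
  by (simp_all add: shift_def)

lemma from_ex_shift: "from_ex C X (shift k T) n \<longleftrightarrow> from_ex C X T (n + k)"
  by (simp add: from_ex_def algebra_simps)

lemma into_ex_shift: "into_ex C X (shift k T) n \<longleftrightarrow> into_ex C X T (n + k)"
  by (simp add: into_ex_def algebra_simps)

context abelian_category
begin

lemma totally_acyclic_iff:
  assumes "\<W> \<subseteq> Obj C"
  shows "totally_acyclic C \<W> T \<longleftrightarrow> exact_complex C T \<and> (\<forall>n. ob T n \<in> \<W>) \<and>
    (\<forall>X \<in> \<W>. \<forall>n. from_ex C X T n) \<and> (\<forall>X \<in> \<W>. \<forall>n. into_ex C X T n)"
  unfolding totally_acyclic_def exact_complex_def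
  using hom_from_exact_iff[OF _ assms, of T] hom_into_exact_iff[OF _ assms, of T] by blast

lemma totally_acyclic_shift:
  assumes W: "\<W> \<subseteq> Obj C" and T: "totally_acyclic C \<W> T"
  shows "totally_acyclic C \<W> (shift k T)"
proof -
  have c: "is_complex C T" and ex: "\<And>n. exact_at C (bd T (n + 1)) (bd T n)"
    using T unfolding totally_acyclic_def exact_complex_iff by auto
  note TD = complexD[OF c]
  have "is_complex C (shift k T)" unfolding is_complex_def
  proof (intro allI conjI)
    fix n
    have *: "n - 1 + k = n + k - 1" "n - 2 + k = n + k - 2" by simp_all
    show "bd (shift k T) n \<in> Hom C (ob (shift k T) n) (ob (shift k T) (n - 1))"
      "bd (shift k T) (n - 1) \<cdot> bd (shift k T) n = Zer C (ob (shift k T) n) (ob (shift k T) (n - 2))"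
      unfolding shift_sel * using TD(2-5)[of "n + k"] by (auto simp: Hom_iff)
  qed (use TD in simp)
  moreover have "exact_at C (bd (shift k T) (n + 1)) (bd (shift k T) n)" for n
    using ex[of "n + k"] by (simp add: algebra_simps)
  ultimately have "exact_complex C (shift k T)" by (simp add: exact_complex_iff)
  then show ?thesis using T unfolding totally_acyclic_iff[OF W] from_ex_shift into_ex_shift shift_sel by blast
qed

lemma Gor_cokernel:
  assumes W: "\<W> \<subseteq> Obj C" and T: "totally_acyclic C \<W> T" and q: "is_cokernel C (bd T n) q"
  shows "Cod C q \<in> Gor C \<W>"
proof -
  have O: "Cod C q \<in> Obj C" using cokernelD[OF q] by simp
  have "isomorphic C (Cod C q) (Cod C q)"
    unfolding isomorphic_def is_isomorphism_def using O
    by (intro bexI[of _ "Idm C (Cod C q)"] conjI) (auto intro!: bexI[of _ "Idm C (Cod C q)"])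
  moreover have "is_cokernel C (bd (shift (n - 1) T) 1) q" using q by simp
  ultimately show ?thesis unfolding Gor_def using O totally_acyclic_shift[OF W T] by blast
qed

text \<open>In an exact complex kernels are cokernels: writing
  \<open>bd T (n + 1) = k \<cdot> b\<close>, the epi \<open>b\<close> is a cokernel of
  \<open>bd T (n + 2)\<close>, and \<open>Gor_cokernel\<close> applies.\<close>

lemma Gor_kernel:
  assumes W: "\<W> \<subseteq> Obj C" and T: "totally_acyclic C \<W> T" and k: "is_kernel C (bd T n) k"
  shows "Dom C k \<in> Gor C \<W>"
proof -
  have c: "is_complex C T" and ex: "\<And>n. exact_at C (bd T (n + 1)) (bd T n)"
    using T unfolding totally_acyclic_def exact_complex_iff by auto
  note TD = complexD[OF c]
  define l where "l = n + 1"
  have kD: "k \<in> Arr C" "Cod C k = ob T (l - 1)" using kernelD[OF k] TD by (simp_all add: l_def)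
  obtain b where b: "is_epi C b" "Dom C b = ob T l" "Cod C b = Dom C k" and kb: "k \<cdot> b = bd T l"
    using mono_comp_epi_aux[OF ex k] TD(3) unfolding l_def by metis
  have bA: "b \<in> Arr C" using b by simp
  have "exact_at C (bd T (l + 1)) b" unfolding exact_at_def
  proof (intro conjI ballI impI)
    have "k \<cdot> (b \<cdot> bd T (l + 1)) = Zer C (ob T (l + 1)) (ob T (l - 1))"
      using Comp_extend[OF kb, of "bd T (l + 1)"] TD(2-4) TD(6)[of l] b bA kD by simp
    then have "b \<cdot> bd T (l + 1) = Zer C (ob T (l + 1)) (Dom C k)"
      using monoD[OF kernel_mono[OF k], of "b \<cdot> bd T (l + 1)"] TD(2-4) b bA kD by simp
    then show "b \<cdot> bd T (l + 1) = Zer C (Dom C (bd T (l + 1))) (Cod C b)" using TD(3) b by simp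
    fix y assume y: "y \<in> Arr C" "Cod C y = Dom C b" "b \<cdot> y = Zer C (Dom C y) (Cod C b)"
    have "bd T l \<cdot> y = Zer C (Dom C y) (Cod C (bd T l))"
      using Comp_extend[OF kb, of y] y b bA kD TD by simp
    then show "\<exists>e x. is_epi C e \<and> Cod C e = Dom C y \<and> x \<in> Arr C \<and> Dom C x = Dom C e \<and>
        Cod C x = Dom C (bd T (l + 1)) \<and> bd T (l + 1) \<cdot> x = y \<cdot> e"
      using ex[of l] y(1,2) b TD(3) unfolding exact_at_def by simp
  qed (use TD b bA in simp_all)
  then have "is_cokernel C (bd T (l + 1)) b" using b(1) by (rule exact_at_epi_cokernel)
  from Gor_cokernel[OF W T this] show ?thesis using b by simp
qed

lemma Gor_subset: "Gor C \<W> \<subseteq> Obj C"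
  by (auto simp: Gor_def)

text \<open>Every cokernel of a differential of \<open>T\<close> lies in \<open>Gor C \<W>\<close>,
  so perpendicularity supplies the splittings that \<open>acyclic_into_ex\<close> asks for.\<close>

lemma totally_acyclic_into_ex:
  assumes "\<W> \<subseteq> Obj C" "totally_acyclic C \<W> T" "perp C (Gor C \<W>) \<V>" "Y \<in> \<V>" "\<V> \<subseteq> Obj C"
  shows "into_ex C Y T n"
proof (rule acyclic_into_ex)
  show "exact_complex C T" using assms by (simp add: totally_acyclic_def)
  fix q assume "is_cokernel C (bd T n) q"
  then have "Cod C q \<in> Gor C \<W>" by (rule Gor_cokernel[OF assms(1,2)])
  then show "ext1_split C (Cod C q) Y"
    using perp_ext1_split[OF assms(3)] assms(4,5) Gor_subset by blast
qed

lemma totally_acyclic_from_ex: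
  assumes "\<V> \<subseteq> Obj C" "totally_acyclic C \<V> S" "perp C \<W> (Gor C \<V>)" "X \<in> \<W>" "\<W> \<subseteq> Obj C"
  shows "from_ex C X S n"
proof (rule acyclic_from_ex)
  show "exact_complex C S" using assms by (simp add: totally_acyclic_def)
  fix k assume "is_kernel C (bd S (n + 1)) k"
  then have "Dom C k \<in> Gor C \<V>" by (rule Gor_kernel[OF assms(1,2)])
  then show "ext1_split C X (Dom C k)"
    using perp_ext1_split[OF assms(3)] assms(4,5) Gor_subset by blast
qed

text \<open>Reversal of arrows reverses \<open>isomorphic\<close>; symmetry is what lets a
  subcategory remain closed under isomorphisms in \<open>opcat C\<close>.\<close>

lemma isomorphic_sym:
  assumes "isomorphic C B A"
  shows "isomorphic C A B"
proof -
  obtain f where f: "f \<in> Hom C B A" "is_isomorphism C f" using assms unfolding isomorphic_def by blast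
  then obtain g where g: "g \<in> Arr C" "Dom C g = Cod C f" "Cod C g = Dom C f"
    "g \<cdot> f = Idm C (Dom C f)" "f \<cdot> g = Idm C (Cod C f)" using iso_inverse by metis
  then have "is_isomorphism C g" "g \<in> Hom C A B"
    using f unfolding is_isomorphism_def by (auto simp: Hom_iff intro!: bexI[of _ f])
  then show ?thesis unfolding isomorphic_def by blast
qed

lemma subcategory_opcat: "subcategory C \<X> \<Longrightarrow> subcategory (opcat C) \<X>"
  unfolding subcategory_def isomorphic_opcat is_zero_obj_opcat is_biproduct_opcat opcat_sel
  using isomorphic_sym by metis

lemma totally_acyclic_opcx:
  assumes W: "\<W> \<subseteq> Obj C" and "totally_acyclic C \<W> T"
  shows "totally_acyclic (opcat C) \<W> (opcx T)"
proof -
  have W': "\<W> \<subseteq> Obj (opcat C)" using W by simp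
  show ?thesis
    using assms(2)
    unfolding totally_acyclic_iff[OF W] abelian_category.totally_acyclic_iff[OF abelian_opcat W']
      exact_complex_opcx from_ex_opcat into_ex_opcat opcx_sel by blast
qed

lemma augmented_cores_complex: "coresolution C \<Y> N Q \<delta> \<Longrightarrow> is_complex C (augmented_cores C N Q \<delta>)"
  by (simp add: coresolution_iff exact_complex_def)

lemma augmented_res_complex: "resolution C \<Y> N Q \<delta> \<Longrightarrow> is_complex C (augmented_res C N Q \<delta>)"
  by (simp add: resolution_iff exact_complex_def)

lemma proper_coresolution_iff:
  assumes "\<Y> \<subseteq> Obj C"
  shows "proper_coresolution C \<Y> N Q \<delta> \<longleftrightarrow>
    coresolution C \<Y> N Q \<delta> \<and> (\<forall>Y \<in> \<Y>. \<forall>n. into_ex C Y (augmented_cores C N Q \<delta>) n)"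
  unfolding proper_coresolution_def using hom_into_exact_iff[OF augmented_cores_complex assms] by blast

lemma proper_resolution_iff:
  assumes "\<X> \<subseteq> Obj C"
  shows "proper_resolution C \<X> M P \<gamma> \<longleftrightarrow>
    resolution C \<X> M P \<gamma> \<and> (\<forall>X \<in> \<X>. \<forall>n. from_ex C X (augmented_res C M P \<gamma>) n)"
  unfolding proper_resolution_def using hom_from_exact_iff[OF augmented_res_complex assms] by blast

lemma augmented_cores_opcat:
  "augmented_cores (opcat C) M (opcx P) (\<lambda>n. \<gamma> (- n)) = opcx (augmented_res C M P \<gamma>)"
  using arg_cong[OF augmented_res_opcat[of "opcat C" M "opcx P" "\<lambda>n. \<gamma> (- n)"], of opcx]
  unfolding opcat_opcat opcx_opcx minus_minus by (rule sym)

lemma proper_coresolution_opcat: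
  assumes "\<X> \<subseteq> Obj C"
  shows "proper_coresolution (opcat C) \<X> M (opcx P) (\<lambda>n. \<gamma> (- n)) \<longleftrightarrow> proper_resolution C \<X> M P \<gamma>"
proof -
  have neg: "(\<forall>n. from_ex C X Z (- n)) \<longleftrightarrow> (\<forall>n. from_ex C X Z n)" for X Z
  proof
    assume "\<forall>n. from_ex C X Z (- n)"
    then have "from_ex C X Z (- (- n))" for n by blast
    then show "\<forall>n. from_ex C X Z n" by (simp only: minus_minus) blast
  qed blast
  have X: "\<X> \<subseteq> Obj (opcat C)" using assms by simp
  show ?thesis
    unfolding abelian_category.proper_coresolution_iff[OF abelian_opcat X]
      proper_resolution_iff[OF assms] coresolution_opcat augmented_cores_opcat into_ex_opcat neg ..
qed

lemma tate_coresolution_opcat: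
  assumes W: "\<W> \<subseteq> Obj C" and T: "tate_resolution C \<W> M T \<alpha> P \<gamma>"
  shows "tate_coresolution (opcat C) \<W> M (opcx P) (\<lambda>n. \<gamma> (- n)) (opcx T) (\<lambda>n. \<alpha> (- n))"
proof -
  obtain n0 where n0: "\<forall>n \<ge> n0. is_isomorphism C (\<alpha> n)" using T unfolding tate_resolution_def by blast
  then have "\<forall>n \<le> - n0. is_isomorphism C (\<alpha> (- n))" by simp
  then show ?thesis
    using T unfolding tate_resolution_def tate_coresolution_def
    by (auto simp: proper_coresolution_opcat[OF W] totally_acyclic_opcx[OF W] chain_map_opcx)
qed

lemma cores_hat_opcat: "L \<in> cores_hat (opcat C) \<W> \<Longrightarrow> L \<in> res_hat C \<W>"
proof -
  assume "L \<in> cores_hat (opcat C) \<W>"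
  then obtain Q \<delta> d where L: "L \<in> Obj C" and Q: "coresolution (opcat C) \<W> L Q \<delta>"
    "\<forall>n > d. is_zero_obj C (ob Q (- int n))" unfolding cores_hat_iff by auto
  have "resolution C \<W> L (opcx Q) (\<lambda>n. \<delta> (- n))"
    using coresolution_opcat[of \<W> L "opcx Q" "\<lambda>n. \<delta> (- n)"] Q by simp
  moreover have "\<forall>n > d. is_zero_obj C (ob (opcx Q) (int n))" using Q(2) by simp
  ultimately show ?thesis unfolding res_hat_iff using L by blast
qed

text \<open>A tool for coresolutions built by hand: \<open>\<iota>\<close> is the only datum of the
  augmentation, its other components being the forced morphisms out of the zero object.\<close>

lemma coresolutionI:
  assumes Q: "is_complex C Q" "\<And>n. ob Q n \<in> \<Y>" "\<And>n. n > 0 \<Longrightarrow> is_zero_obj C (ob Q n)"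
    and \<iota>: "exact_at C \<iota> (bd Q 0)" "is_mono C \<iota>"
    and ex: "\<And>n. n < 0 \<Longrightarrow> exact_at C (bd Q (n + 1)) (bd Q n)"
  shows "coresolution C \<Y> (Dom C \<iota>) Q
    (\<lambda>n. if n = 0 then \<iota> else Zer C (zero_obj C) (ob Q n))" (is "coresolution C \<Y> ?N Q ?\<delta>")
  unfolding coresolution_iff
proof (intro conjI allI impI)
  note QD = complexD[OF Q(1)] and D = exact_atD[OF \<iota>(1)]
  have N: "?N \<in> Obj C" using D by simp
  have zo: "zero_obj C \<in> Obj C" by simp
  show "ob Q n \<in> \<Y>" for n by fact
  show "is_zero_obj C (ob Q n)" if "n > 0" for n using Q(3)[OF that] .
  show "chain_map C (conc C ?N) Q ?\<delta>" unfolding chain_map_def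
  proof (intro conjI allI)
    fix n
    show "?\<delta> n \<in> Hom C (ob (conc C ?N) n) (ob Q n)" using D QD by (auto simp: Hom_iff)
    show "bd Q n \<cdot> ?\<delta> n = ?\<delta> (n - 1) \<cdot> bd (conc C ?N) n"
      using D QD N by (cases "n = 0"; cases "n = 1") simp_all
  qed (use Q conc_complex[OF N] in simp_all)
  let ?A = "augmented_cores C ?N Q ?\<delta>"
  have "is_complex C ?A" unfolding is_complex_def
  proof (intro allI conjI)
    fix n :: int
    show "ob ?A n \<in> Obj C" using QD N by simp
    show "bd ?A n \<in> Hom C (ob ?A n) (ob ?A (n - 1))" using QD N D by (auto simp: Hom_iff)
    consider "n \<le> 0" | "n = 1" | "n = 2" | "n > 2" by linarith
    then show "bd ?A (n - 1) \<cdot> bd ?A n = Zer C (ob ?A n) (ob ?A (n - 2))"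
      by cases (use QD[of n] N D QD[of 0] in simp_all)
  qed
  moreover have "exact_at C (bd ?A (n + 1)) (bd ?A n)" for n
  proof -
    consider "n < 0" | "n = 0" | "n = 1" | "n \<ge> 2" by linarith
    then show ?thesis
    proof cases
      case 1 then show ?thesis using ex[OF 1] by simp
    next
      case 2 then show ?thesis using \<iota> by simp
    next
      case 3 then show ?thesis using exact_at_monoI[OF \<iota>(2) zo] D by simp
    next
      case 4 then show ?thesis using N by (auto intro!: exact_at_zero)
    qed
  qed
  ultimately show "exact_complex C ?A" by (simp add: exact_complex_iff)
qed

end

section \<open>The cone of a Tate coresolution\<close>

text \<open>\<open>P n\<close> is the biproduct of \<open>ob S (n + 1)\<close> and \<open>ob Q n\<close>, and \<open>d\<close> is the differential
  \<open>(s, q) \<mapsto> (\<beta> q - \<partial> s, \<partial> q)\<close> of a shifted mapping cone of \<open>\<beta>\<close>.\<close>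

locale tate_cone = abelian_category C for C :: "('o, 'm) cat" (structure) +
  fixes \<V> :: "'o set" and N :: 'o and Q S :: "('o, 'm) cplx" and \<delta> \<beta> :: "int \<Rightarrow> 'm"
    and P :: "int \<Rightarrow> 'o" and i j p r :: "int \<Rightarrow> 'm"
  assumes V: "\<V> \<subseteq> Obj C" and zeroV: "is_zero_obj C Z \<Longrightarrow> Z \<in> \<V>"
    and res: "coresolution C \<V> N Q \<delta>"
    and QV: "Y \<in> \<V> \<Longrightarrow> into_ex C Y (augmented_cores C N Q \<delta>) n"
    and chain: "chain_map C Q S \<beta>" and acyc: "exact_complex C S"
    and obS: "ob S n \<in> \<V>" and SV: "Y \<in> \<V> \<Longrightarrow> into_ex C Y S n"
    and PV: "P n \<in> \<V>"
    and P_typing [simp]: "i n \<in> Arr C" "j n \<in> Arr C" "p n \<in> Arr C" "r n \<in> Arr C"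
      "Dom C (i n) = ob S (n + 1)" "Cod C (i n) = P n" "Dom C (j n) = ob Q n" "Cod C (j n) = P n"
      "Dom C (p n) = P n" "Cod C (p n) = ob S (n + 1)" "Dom C (r n) = P n" "Cod C (r n) = ob Q n"
    and P_ids [simp]: "p n \<cdot> i n = Idm C (ob S (n + 1))" "r n \<cdot> j n = Idm C (ob Q n)"
      "p n \<cdot> j n = Zer C (ob Q n) (ob S (n + 1))" "r n \<cdot> i n = Zer C (ob S (n + 1)) (ob Q n)"
      "Add C (i n \<cdot> p n) (j n \<cdot> r n) = Idm C (P n)"
begin

lemma P_Obj [simp]: "P n \<in> Obj C" using PV V by blast

lemmas QD = complexD[OF chain_mapD(1)[OF chain]]
lemmas SD = complexD[OF chain_mapD(2)[OF chain]]
lemmas \<beta>D = chain_mapD(3-6)[OF chain]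

declare QD(1-4) [simp] SD(1-4) [simp] \<beta>D(1-3) [simp]

lemma Q_sq:
  assumes "x \<in> Arr C" "Cod C x = ob Q (n + 1)"
  shows "bd Q n \<cdot> (bd Q (n + 1) \<cdot> x) = Zer C (Dom C x) (ob Q (n - 1))"
  using Comp_extend[OF QD(6)[of n], of x] assms by simp

lemma S_sq:
  assumes "x \<in> Arr C" "Cod C x = ob S (n + 1)"
  shows "bd S n \<cdot> (bd S (n + 1) \<cdot> x) = Zer C (Dom C x) (ob S (n - 1))"
  using Comp_extend[OF SD(6)[of n], of x] assms by simp

lemma \<beta>_comm:
  assumes "x \<in> Arr C" "Cod C x = ob Q n"
  shows "bd S n \<cdot> (\<beta> n \<cdot> x) = \<beta> (n - 1) \<cdot> (bd Q n \<cdot> x)"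
  using Comp_extend[OF \<beta>D(4)[of n], of x] assms by simp

lemma exQ: "n < 0 \<Longrightarrow> exact_at C (bd Q (n + 1)) (bd Q n)"
  and ex\<nu>: "exact_at C (\<delta> 0) (bd Q 0)" and mono\<nu>: "is_mono C (\<delta> 0)"
  and \<nu>D [simp]: "\<delta> 0 \<in> Arr C" "Dom C (\<delta> 0) = N" "Cod C (\<delta> 0) = ob Q 0"
proof -
  have ch: "chain_map C (conc C N) Q \<delta>"
    and ex: "\<And>n. exact_at C (bd (augmented_cores C N Q \<delta>) (n + 1)) (bd (augmented_cores C N Q \<delta>) n)"
    using res by (auto simp: coresolution_iff exact_complex_iff)
  show D: "\<delta> 0 \<in> Arr C" "Dom C (\<delta> 0) = N" "Cod C (\<delta> 0) = ob Q 0"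
    using chain_mapD(3-5)[OF ch, of 0] by simp_all
  have "N \<in> Obj C" using D by auto
  show "n < 0 \<Longrightarrow> exact_at C (bd Q (n + 1)) (bd Q n)" using ex[of n] by simp
  show "exact_at C (\<delta> 0) (bd Q 0)" using ex[of 0] by simp
  show "is_mono C (\<delta> 0)" using mono_if_exact_at_zero[OF ex[of 1]] D \<open>N \<in> Obj C\<close> by simp
qed

lemma exS: "exact_at C (bd S (n + 1)) (bd S n)"
  using acyc by (simp add: exact_complex_iff)

lemma P_comp [simp]:
  assumes "x \<in> Arr C"
  shows "Cod C x = ob S (n + 1) \<Longrightarrow> p n \<cdot> (i n \<cdot> x) = x"
    "Cod C x = ob Q n \<Longrightarrow> r n \<cdot> (j n \<cdot> x) = x"
    "Cod C x = ob Q n \<Longrightarrow> p n \<cdot> (j n \<cdot> x) = Zer C (Dom C x) (ob S (n + 1))"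
    "Cod C x = ob S (n + 1) \<Longrightarrow> r n \<cdot> (i n \<cdot> x) = Zer C (Dom C x) (ob Q n)"
  using Comp_extend[OF P_ids(1)[of n], of x] Comp_extend[OF P_ids(2)[of n], of x]
    Comp_extend[OF P_ids(3)[of n], of x] Comp_extend[OF P_ids(4)[of n], of x] assms by simp_all

lemma P_sum:
  assumes "x \<in> Arr C" "Cod C x = P n"
  shows "Add C (i n \<cdot> (p n \<cdot> x)) (j n \<cdot> (r n \<cdot> x)) = x"
proof -
  have "Add C (i n \<cdot> (p n \<cdot> x)) (j n \<cdot> (r n \<cdot> x)) = Add C (i n \<cdot> p n) (j n \<cdot> r n) \<cdot> x"
    by (subst Add_Comp_Arr) (use assms in simp_all)
  then show ?thesis using assms by simp
qed

lemma P_eqI: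
  assumes "x \<in> Arr C" "Cod C x = P n" "y \<in> Arr C" "Cod C y = P n"
    "p n \<cdot> x = p n \<cdot> y" "r n \<cdot> x = r n \<cdot> y"
  shows "x = y"
  using P_sum[OF assms(1,2)] P_sum[OF assms(3,4)] unfolding assms(5,6) by simp

lemma P_eqI':
  assumes "x \<in> Arr C" "Dom C x = P n" "y \<in> Arr C" "Dom C y = P n" "Cod C x = Cod C y"
    "x \<cdot> i n = y \<cdot> i n" "x \<cdot> j n = y \<cdot> j n"
  shows "x = y"
proof -
  have "z = Add C ((z \<cdot> i n) \<cdot> p n) ((z \<cdot> j n) \<cdot> r n)" if "z \<in> Arr C" "Dom C z = P n" for z
  proof -
    have "z = z \<cdot> Add C (i n \<cdot> p n) (j n \<cdot> r n)" using that by simp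
    also have "\<dots> = Add C (z \<cdot> (i n \<cdot> p n)) (z \<cdot> (j n \<cdot> r n))"
      by (rule Comp_Add_Arr) (use that in simp_all)
    finally show ?thesis using that by simp
  qed
  from this[OF assms(1,2)] this[OF assms(3,4)] show ?thesis unfolding assms(6,7) by simp
qed

section \<open>The differential of the cone, on components\<close>

definition pair :: "int \<Rightarrow> 'm \<Rightarrow> 'm \<Rightarrow> 'm" where
  "pair n s q = Add C (i n \<cdot> s) (j n \<cdot> q)"

lemma pair [simp]:
  assumes "s \<in> Arr C" "q \<in> Arr C" "Dom C q = Dom C s" "Cod C s = ob S (n + 1)" "Cod C q = ob Q n"
  shows "pair n s q \<in> Arr C" "Dom C (pair n s q) = Dom C s" "Cod C (pair n s q) = P n"
    "p n \<cdot> pair n s q = s" "r n \<cdot> pair n s q = q"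
  using assms unfolding pair_def by simp_all

definition d :: "int \<Rightarrow> 'm" where
  "d n = pair (n - 1) (Sub (\<beta> n \<cdot> r n) (bd S (n + 1) \<cdot> p n)) (bd Q n \<cdot> r n)"

lemma d_typing [simp]: "d n \<in> Arr C" "Dom C (d n) = P n" "Cod C (d n) = P (n - 1)"
  unfolding d_def by simp_all

lemma d_comp:
  assumes "x \<in> Arr C" "Cod C x = P n"
  shows "p (n - 1) \<cdot> (d n \<cdot> x) = Sub (\<beta> n \<cdot> (r n \<cdot> x)) (bd S (n + 1) \<cdot> (p n \<cdot> x))"
    "r (n - 1) \<cdot> (d n \<cdot> x) = bd Q n \<cdot> (r n \<cdot> x)"
proof -
  have a: "p (n - 1) \<cdot> d n = Sub (\<beta> n \<cdot> r n) (bd S (n + 1) \<cdot> p n)" "r (n - 1) \<cdot> d n = bd Q n \<cdot> r n"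
    unfolding d_def by simp_all
  show "p (n - 1) \<cdot> (d n \<cdot> x) = Sub (\<beta> n \<cdot> (r n \<cdot> x)) (bd S (n + 1) \<cdot> (p n \<cdot> x))"
    using Comp_extend[OF a(1), of x] assms by simp
  show "r (n - 1) \<cdot> (d n \<cdot> x) = bd Q n \<cdot> (r n \<cdot> x)"
    using Comp_extend[OF a(2), of x] assms by simp
qed

lemma d_eq_iff:
  assumes "x \<in> Arr C" "Cod C x = P n" "y \<in> Arr C" "Cod C y = P (n - 1)"
  shows "d n \<cdot> x = y \<longleftrightarrow>
    Sub (\<beta> n \<cdot> (r n \<cdot> x)) (bd S (n + 1) \<cdot> (p n \<cdot> x)) = p (n - 1) \<cdot> y \<and> bd Q n \<cdot> (r n \<cdot> x) = r (n - 1) \<cdot> y"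
  using d_comp[OF assms(1,2)] P_eqI[of "d n \<cdot> x" "n - 1" y] assms by auto

text \<open>The two components of \<open>d\<close> can be tested separately: cone cycles are cycles
  of \<open>Q\<close> equipped with a lift of their image along the differential of
  \<open>S\<close>, and in this form they are produced below.\<close>

lemma d_zero_iff:
  assumes "x \<in> Arr C" "Cod C x = P n"
  shows "d n \<cdot> x = Zer C (Dom C x) (P (n - 1)) \<longleftrightarrow>
    \<beta> n \<cdot> (r n \<cdot> x) = bd S (n + 1) \<cdot> (p n \<cdot> x) \<and> bd Q n \<cdot> (r n \<cdot> x) = Zer C (Dom C x) (ob Q (n - 1))"
proof -
  have x: "Dom C x \<in> Obj C" using assms by simp
  show ?thesis
    using d_eq_iff[of x n "Zer C (Dom C x) (P (n - 1))"]
      Sub_eq_Zer_iff[of "\<beta> n \<cdot> (r n \<cdot> x)" "bd S (n + 1) \<cdot> (p n \<cdot> x)" "Dom C x" "ob S n"] assms x by simp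
qed

lemma d_sq': "d (n - 1) \<cdot> d n = Zer C (P n) (P (n - 2))"
proof -
  note c = d_comp[of "Idm C (P n)" n, simplified]
  have "\<beta> (n - 1) \<cdot> (r (n - 1) \<cdot> d n) = bd S n \<cdot> (p (n - 1) \<cdot> d n)"
  proof -
    have "bd S n \<cdot> (p (n - 1) \<cdot> d n) = Sub (bd S n \<cdot> (\<beta> n \<cdot> r n)) (bd S n \<cdot> (bd S (n + 1) \<cdot> p n))"
      unfolding c by (rule Comp_Sub) simp_all
    also have "\<dots> = \<beta> (n - 1) \<cdot> (bd Q n \<cdot> r n)"
      using \<beta>_comm[of "r n" n] S_sq[of "p n" n] by simp
    finally show ?thesis unfolding c by simp
  qed
  moreover have "bd Q (n - 1) \<cdot> (r (n - 1) \<cdot> d n) = Zer C (P n) (ob Q (n - 2))"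
    unfolding c using Q_sq[of "r n" "n - 1"] by simp
  ultimately show ?thesis using d_zero_iff[of "d n" "n - 1"] by simp
qed

lemma d_sq: "d n \<cdot> d (n + 1) = Zer C (P (n + 1)) (P (n - 1))"
  using d_sq'[of "n + 1"] by simp

text \<open>Below degree 0 both \<open>Q\<close> and \<open>S\<close> are exact. The
  \<open>Q\<close> component of a cycle \<open>y\<close> is lifted to \<open>q1\<close> first; the
  discrepancy \<open>t\<close> between the image of \<open>q1\<close> under \<open>\<beta>\<close>
  and the \<open>S\<close> component of \<open>y\<close> is then a cycle of \<open>S\<close>, which
  is lifted in turn.\<close>

lemma d_exact:
  assumes "n < 0"
  shows "exact_at C (d (n + 1)) (d n)"
  unfolding exact_at_def
proof (intro conjI ballI impI)
  fix y assume "y \<in> Arr C" "Cod C y = Dom C (d n)" "d n \<cdot> y = Zer C (Dom C y) (Cod C (d n))"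
  then have y: "y \<in> Arr C" "Cod C y = P n" and y0: "\<beta> n \<cdot> (r n \<cdot> y) = bd S (n + 1) \<cdot> (p n \<cdot> y)"
    "bd Q n \<cdot> (r n \<cdot> y) = Zer C (Dom C y) (ob Q (n - 1))"
    using d_zero_iff[of y n] by simp_all
  obtain e1 q1 where e1: "is_epi C e1" "Cod C e1 = Dom C y" "q1 \<in> Arr C" "Dom C q1 = Dom C e1" "Cod C q1 = ob Q (n + 1)"
    and q1: "bd Q (n + 1) \<cdot> q1 = (r n \<cdot> y) \<cdot> e1"
    using exact_at_lift[OF exQ[OF assms], of "r n \<cdot> y"] y y0(2) by auto
  have e1A: "e1 \<in> Arr C" using e1 by simp
  define t where "t = Sub (\<beta> (n + 1) \<cdot> q1) (p n \<cdot> (y \<cdot> e1))"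
  have t: "t \<in> Arr C" "Dom C t = Dom C e1" "Cod C t = ob S (n + 1)"
    unfolding t_def using e1 e1A y by simp_all
  have "bd S (n + 1) \<cdot> (\<beta> (n + 1) \<cdot> q1) = \<beta> n \<cdot> (r n \<cdot> (y \<cdot> e1))"
    using \<beta>_comm[of q1 "n + 1"] e1(2-5) e1A q1 y by simp
  moreover have "bd S (n + 1) \<cdot> (p n \<cdot> (y \<cdot> e1)) = \<beta> n \<cdot> (r n \<cdot> (y \<cdot> e1))"
    using arg_cong[OF y0(1), of "\<lambda>z. z \<cdot> e1"] e1A e1(2) y by simp
  ultimately have "bd S (n + 1) \<cdot> t = Zer C (Dom C t) (ob S n)"
    unfolding t_def using e1(2-5) e1A y by simp
  then obtain e2 s where e2: "is_epi C e2" "Cod C e2 = Dom C e1" "s \<in> Arr C" "Dom C s = Dom C e2" "Cod C s = ob S (n + 1 + 1)"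
    and s: "bd S (n + 1 + 1) \<cdot> s = t \<cdot> e2"
    using exact_at_lift[OF exS[of "n + 1"], of t] t by auto
  have e2A: "e2 \<in> Arr C" using e2 by simp
  define x where "x = pair (n + 1) s (q1 \<cdot> e2)"
  have x: "x \<in> Arr C" "Dom C x = Dom C e2" "Cod C x = P (n + 1)" "p (n + 1) \<cdot> x = s" "r (n + 1) \<cdot> x = q1 \<cdot> e2"
    unfolding x_def using e2 e2A e1 by simp_all
  have "d (n + 1) \<cdot> x = y \<cdot> (e1 \<cdot> e2)"
  proof (subst d_eq_iff)
    have "Sub (\<beta> (n + 1) \<cdot> (q1 \<cdot> e2)) (bd S (n + 1 + 1) \<cdot> s) = Sub (\<beta> (n + 1) \<cdot> q1) t \<cdot> e2"
      unfolding s using e1(2-5) e2A e2(2) t by simp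
    also have "\<dots> = (p n \<cdot> (y \<cdot> e1)) \<cdot> e2"
      unfolding t_def by (subst Sub_Sub_cancel) (use e1 e1A y in simp_all)
    finally have 1: "Sub (\<beta> (n + 1) \<cdot> (q1 \<cdot> e2)) (bd S (n + 1 + 1) \<cdot> s) = p n \<cdot> (y \<cdot> (e1 \<cdot> e2))"
      using e1(2) e1A e2A e2(2) y by simp
    have 2: "bd Q (n + 1) \<cdot> (q1 \<cdot> e2) = r n \<cdot> (y \<cdot> (e1 \<cdot> e2))"
      using Comp_extend[OF q1, of e2] e1(2-5) e1A e2A e2(2) y by simp
    show "Sub (\<beta> (n + 1) \<cdot> (r (n + 1) \<cdot> x)) (bd S (n + 1 + 1) \<cdot> (p (n + 1) \<cdot> x)) = p (n + 1 - 1) \<cdot> (y \<cdot> (e1 \<cdot> e2)) \<and>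
        bd Q (n + 1) \<cdot> (r (n + 1) \<cdot> x) = r (n + 1 - 1) \<cdot> (y \<cdot> (e1 \<cdot> e2))"
      using 1 2 unfolding x by simp
  qed (use x y e1(2) e1A e2A e2(2) in simp_all)
  then show "\<exists>e x. is_epi C e \<and> Cod C e = Dom C y \<and> x \<in> Arr C \<and> Dom C x = Dom C e \<and>
      Cod C x = Dom C (d (n + 1)) \<and> d (n + 1) \<cdot> x = y \<cdot> e"
    using epi_Comp[OF e2(1) e1(1)] e1(2) e1A e2A e2(2) x(1-3)
    by - (rule exI[of _ "e1 \<cdot> e2"], rule exI[of _ x], simp)
qed (use d_sq in simp_all)

text \<open>The cone without its terms above degree 0. Since \<open>P n\<close> contains
  \<open>ob S (n + 1)\<close>, this retains \<open>S\<close> up to degree 1; the object it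
  coresolves is the kernel of \<open>d 0\<close>.\<close>

definition E :: "('o, 'm) cplx" where
  "E = \<lparr>ob = (\<lambda>n. if n \<le> 0 then P n else zero_obj C),
        bd = (\<lambda>n. if n \<le> 0 then d n else if n = 1 then Zer C (zero_obj C) (P 0) else Zer C (zero_obj C) (zero_obj C))\<rparr>"

lemma E_sel [simp]:
  "ob E n = (if n \<le> 0 then P n else zero_obj C)"
  "bd E n = (if n \<le> 0 then d n else if n = 1 then Zer C (zero_obj C) (P 0) else Zer C (zero_obj C) (zero_obj C))"
  by (simp_all add: E_def)

lemma E_complex: "is_complex C E"
  unfolding is_complex_def
proof (intro allI conjI)
  fix n :: int
  show "ob E n \<in> Obj C" by simp
  show "bd E n \<in> Hom C (ob E n) (ob E (n - 1))" by (auto simp: Hom_iff)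
  consider "n \<le> 0" | "n = 1" | "n = 2" | "n > 2" by linarith
  then show "bd E (n - 1) \<cdot> bd E n = Zer C (ob E n) (ob E (n - 2))"
    by cases (use d_sq'[of n] in simp_all)
qed

end

locale tate_cone_kernel = tate_cone +
  fixes \<iota>
  assumes \<iota>: "is_kernel C (d 0) \<iota>"
begin

abbreviation L where "L \<equiv> Dom C \<iota>"

definition \<epsilon> :: "int \<Rightarrow> 'b" where "\<epsilon> n = (if n = 0 then \<iota> else Zer C (zero_obj C) (ob E n))"

lemma \<iota>D [simp]: "\<iota> \<in> Arr C" "Cod C \<iota> = P 0" "d 0 \<cdot> \<iota> = Zer C L (P (-1))"
  using kernelD[OF \<iota>] by simp_all

lemma E_coresolution: "coresolution C \<V> L E \<epsilon>"
proof -
  have "coresolution C \<V> L E (\<lambda>n. if n = 0 then \<iota> else Zer C (zero_obj C) (ob E n))"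
    by (rule coresolutionI)
      (use E_complex PV zeroV exact_at_kernel[OF \<iota>] kernel_mono[OF \<iota>] d_exact in simp_all)
  then show ?thesis unfolding \<epsilon>_def .
qed

lemma kernel_lift:
  assumes "x \<in> Arr C" "Cod C x = ob S 1" "y \<in> Arr C" "Cod C y = ob Q 0" "Dom C y = Dom C x"
    "\<beta> 0 \<cdot> y = bd S 1 \<cdot> x" "bd Q 0 \<cdot> y = Zer C (Dom C x) (ob Q (-1))"
  obtains t where "t \<in> Arr C" "Dom C t = Dom C x" "Cod C t = L" "\<iota> \<cdot> t = pair 0 x y"
proof -
  have "d 0 \<cdot> pair 0 x y = Zer C (Dom C x) (P (-1))"
    using d_zero_iff[of "pair 0 x y" 0] assms by simp
  then show ?thesis using kernel_factor[OF \<iota>, of "pair 0 x y"] assms that by auto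
qed

text \<open>An element of \<open>L\<close> is an element of \<open>N\<close> with a lift to
  \<open>ob S 1\<close> of its image in \<open>ob S 0\<close>. Such lifts exist over a cover by
  exactness of \<open>S\<close>, so \<open>L\<close> maps onto \<open>N\<close>; the statement keeps
  both components at hand.\<close>

lemma cover_N:
  assumes "y \<in> Arr C" "Cod C y = N"
  obtains e x t where "is_epi C e" "Cod C e = Dom C y" "x \<in> Arr C" "Dom C x = Dom C e" "Cod C x = ob S 1"
    "bd S 1 \<cdot> x = \<beta> 0 \<cdot> (\<delta> 0 \<cdot> (y \<cdot> e))"
    "t \<in> Arr C" "Dom C t = Dom C e" "Cod C t = L" "\<iota> \<cdot> t = pair 0 x (\<delta> 0 \<cdot> (y \<cdot> e))"
proof -
  have d\<nu>: "bd Q 0 \<cdot> (\<delta> 0 \<cdot> z) = Zer C (Dom C z) (ob Q (-1))" if "z \<in> Arr C" "Cod C z = N" for z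
    using Comp_extend[OF exact_atD(4)[OF ex\<nu>], of z] that by simp
  have "bd S 0 \<cdot> (\<beta> 0 \<cdot> (\<delta> 0 \<cdot> y)) = Zer C (Dom C y) (ob S (-1))"
    using \<beta>_comm[of "\<delta> 0 \<cdot> y" 0] d\<nu>[OF assms] assms by simp
  then obtain e x where e: "is_epi C e" "Cod C e = Dom C y" "x \<in> Arr C" "Dom C x = Dom C e" "Cod C x = ob S 1"
    "bd S 1 \<cdot> x = (\<beta> 0 \<cdot> (\<delta> 0 \<cdot> y)) \<cdot> e"
    using exact_at_lift[OF exS[of 0], of "\<beta> 0 \<cdot> (\<delta> 0 \<cdot> y)"] assms by auto
  have eA: "e \<in> Arr C" using e by simp
  have x: "bd S 1 \<cdot> x = \<beta> 0 \<cdot> (\<delta> 0 \<cdot> (y \<cdot> e))" using e(6) eA e(2) assms by simp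
  obtain t where "t \<in> Arr C" "Dom C t = Dom C x" "Cod C t = L" "\<iota> \<cdot> t = pair 0 x (\<delta> 0 \<cdot> (y \<cdot> e))"
    using kernel_lift[of x "\<delta> 0 \<cdot> (y \<cdot> e)"] e(2-5) x d\<nu>[of "y \<cdot> e"] eA assms by auto
  then show ?thesis using that[OF e(1-5) x] e(4) by simp
qed

text \<open>The augmented complex of \<open>E\<close> is an extension of that of \<open>Q\<close> by
  a truncation of \<open>S\<close>, which ends with the image of \<open>bd S 2\<close>. Accordingly
  the part of \<open>u\<close> on \<open>S\<close> is extended first, by \<open>SV\<close>; what
  remains descends to the augmented complex of \<open>Q\<close>, where \<open>QV\<close>
  applies.\<close>

lemma E_into_ex:
  assumes Y: "Y \<in> \<V>"
  shows "into_ex C Y (augmented_cores C L E \<epsilon>) n"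
  unfolding into_ex_def
proof (intro allI impI)
  let ?A = "augmented_cores C L E \<epsilon>" and ?Q = "augmented_cores C N Q \<delta>"
  have YO: "Y \<in> Obj C" using Y V by blast
  fix u assume u: "u \<in> Arr C" "Cod C u = Y" "Dom C u = ob ?A n" "u \<cdot> bd ?A (n + 1) = Zer C (ob ?A (n + 1)) Y"
  have di: "d m \<cdot> (i m \<cdot> x) = Neg (i (m - 1) \<cdot> (bd S (m + 1) \<cdot> x))" if "x \<in> Arr C" "Cod C x = ob S (m + 1)" for m x
    by (subst d_eq_iff) (use that in \<open>simp_all add: Sub_def\<close>)
  have dj: "d m \<cdot> j m = pair (m - 1) (\<beta> m) (bd Q m)" for m
    by (subst d_eq_iff) simp_all
  have i0: "d 0 \<cdot> (i 0 \<cdot> bd S 2) = Zer C (ob S 2) (P (-1))"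
    using di[of "bd S 2" 0] SD(6)[of 1] by simp
  \<comment> \<open>\<open>\<kappa>\<close> covers the kernel of the projection from
    \<open>L\<close> to \<open>N\<close>, that is, the elements of \<open>L\<close> whose
    \<open>Q\<close> component vanishes.\<close>
  obtain \<kappa> where \<kappa>: "\<kappa> \<in> Arr C" "Dom C \<kappa> = ob S 2" "Cod C \<kappa> = L" "\<iota> \<cdot> \<kappa> = i 0 \<cdot> bd S 2"
    using kernel_factor[OF \<iota>, of "i 0 \<cdot> bd S 2"] i0 by auto
  consider "n \<le> 0" | "n = 1" | "n \<ge> 2" by linarith
  then show "\<exists>g. g \<in> Arr C \<and> Cod C g = Y \<and> Dom C g = ob ?A (n - 1) \<and> g \<cdot> bd ?A n = u"
  proof cases
    case 1
    have uP: "Dom C u = P n" using u 1 by simp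
    define a b where "a = u \<cdot> i n" and "b = u \<cdot> j n"
    have ab: "a \<in> Arr C" "Dom C a = ob S (n + 1)" "Cod C a = Y" "b \<in> Arr C" "Dom C b = ob Q n" "Cod C b = Y"
      unfolding a_def b_def using u uP by simp_all
    \<comment> \<open>In degree 0 the incoming map is \<open>\<iota>\<close> and not a cone
      differential, so the relation is read off through \<open>\<kappa>\<close>; in lower degrees it
      is the restriction of \<open>u \<cdot> d (n + 1)\<close> to the summand from
      \<open>S\<close>.\<close>
    have aS: "a \<cdot> bd S (n + 1 + 1) = Zer C (ob S (n + 1 + 1)) Y"
    proof (cases "n = 0")
      case True
      have "u \<cdot> (i 0 \<cdot> bd S 2) = (u \<cdot> \<iota>) \<cdot> \<kappa>" unfolding \<kappa>(4)[symmetric] using u uP True \<kappa>(1-3) by simp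
      also have "\<dots> = Zer C (ob S 2) Y" using u(4) True \<kappa>(1-3) YO by (simp add: \<epsilon>_def)
      finally show ?thesis unfolding a_def using True u(1) uP by simp
    next
      case False
      define l where "l = n + 1"
      have l: "n + 1 = l" "l - 1 = n" by (simp_all add: l_def)
      have "u \<cdot> d l = Zer C (P l) Y" using u(4) False 1 unfolding l(1)[symmetric] by simp
      then have "u \<cdot> (d l \<cdot> i l) = Zer C (ob S (l + 1)) Y"
        using Comp_extend[of u "d l" _ "i l"] u(1) uP YO l(2) by simp
      moreover have "d l \<cdot> i l = Neg (i n \<cdot> bd S (l + 1))"
        using di[of "Idm C (ob S (l + 1))" l] l(2) by simp
      ultimately have z: "Neg (a \<cdot> bd S (l + 1)) = Zer C (ob S (l + 1)) Y"
        unfolding a_def using u(1) uP l(1) by simp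
      have "a \<cdot> bd S (l + 1) = Neg (Neg (a \<cdot> bd S (l + 1)))" using ab l(1) by (intro Neg_Neg[symmetric]) simp
      also have "\<dots> = Zer C (ob S (l + 1)) Y" unfolding z using YO by simp
      finally show ?thesis unfolding l(1) .
    qed
    obtain c where c: "c \<in> Arr C" "Dom C c = ob S n" "Cod C c = Y" and ca: "c \<cdot> bd S (n + 1) = a"
      using into_exE[OF SV[OF Y, of "n + 1"] ab(1-3) aS] by auto
    have cx: "c \<cdot> (bd S (n + 1) \<cdot> x) = a \<cdot> x" if "x \<in> Arr C" "Cod C x = ob S (n + 1)" for x
      using Comp_extend[OF ca, of x] that c by simp
    \<comment> \<open>The map \<open>g\<close> to be found must be the negative of \<open>c\<close>
      on the summand from \<open>S\<close>, and after \<open>d n\<close> this contributes the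
      negative of \<open>c \<cdot> \<beta> n\<close> on \<open>Q\<close>. So \<open>f\<close> is
      what the \<open>Q\<close> part of \<open>g\<close> has to produce.\<close>
    define f where "f = Add C b (c \<cdot> \<beta> n)"
    have f: "f \<in> Arr C" "Dom C f = ob Q n" "Cod C f = Y" unfolding f_def using ab c by simp_all
    have usum: "u \<cdot> pair n s q = Add C (a \<cdot> s) (b \<cdot> q)"
      if "s \<in> Arr C" "q \<in> Arr C" "Dom C q = Dom C s" "Cod C s = ob S (n + 1)" "Cod C q = ob Q n" for s q
      unfolding pair_def a_def b_def using that u(1) uP by simp
    have fQ: "f \<cdot> bd ?Q (n + 1) = Zer C (ob ?Q (n + 1)) Y"
    proof (cases "n = 0")
      case True
      have NO: "N \<in> Obj C" using Dom_Obj[OF \<nu>D(1)] by simp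
      \<comment> \<open>The identity of \<open>N\<close> serves as its universal element; the
        relation is checked on the cover \<open>e\<close>, where this element comes from
        \<open>L\<close>.\<close>
      obtain e x t where e: "is_epi C e" "Cod C e = Dom C (Idm C N)" "x \<in> Arr C" "Dom C x = Dom C e" "Cod C x = ob S 1"
        "bd S 1 \<cdot> x = \<beta> 0 \<cdot> (\<delta> 0 \<cdot> (Idm C N \<cdot> e))" and
        t: "t \<in> Arr C" "Dom C t = Dom C e" "Cod C t = L" "\<iota> \<cdot> t = pair 0 x (\<delta> 0 \<cdot> (Idm C N \<cdot> e))"
        by (rule cover_N[of "Idm C N"]) (use NO in auto)
      have eA: "e \<in> Arr C" "Cod C e = N" "Idm C N \<cdot> e = e" using e NO by simp_all
      have "Add C (a \<cdot> x) (b \<cdot> (\<delta> 0 \<cdot> e)) = u \<cdot> (\<iota> \<cdot> t)"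
        unfolding t(4) eA(3) using usum[of x "\<delta> 0 \<cdot> e"] True e(3-5) eA by simp
      also have "\<dots> = (u \<cdot> \<iota>) \<cdot> t" using u(1) uP True t(1-3) by simp
      also have "\<dots> = Zer C (Dom C e) Y" using u(4) True t(1-3) YO by (simp add: \<epsilon>_def)
      finally have z: "Add C (a \<cdot> x) (b \<cdot> (\<delta> 0 \<cdot> e)) = Zer C (Dom C e) Y" .
      have "c \<cdot> (\<beta> 0 \<cdot> (\<delta> 0 \<cdot> e)) = a \<cdot> x" using e(6) cx[of x] True e(3-5) eA by simp
      then have "(f \<cdot> \<delta> 0) \<cdot> e = Add C (b \<cdot> (\<delta> 0 \<cdot> e)) (a \<cdot> x)"
        unfolding f_def using ab c True eA by simp
      also have "\<dots> = Zer C (Dom C e) Y"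
        using z Add_commute[of "b \<cdot> (\<delta> 0 \<cdot> e)" "a \<cdot> x"] ab True e(3-5) eA by simp
      finally have "f \<cdot> \<delta> 0 = Zer C N Y" using epiD[OF e(1), of "f \<cdot> \<delta> 0"] f True eA by simp
      then show ?thesis using True by simp
    next
      case False
      have "u \<cdot> d (n + 1) = Zer C (P (n + 1)) Y" using u(4) False 1 by simp
      then have "u \<cdot> (d (n + 1) \<cdot> j (n + 1)) = Zer C (ob Q (n + 1)) Y"
        using Comp_extend[of u "d (n + 1)" _ "j (n + 1)"] u(1) uP YO by simp
      moreover have "d (n + 1) \<cdot> j (n + 1) = pair n (\<beta> (n + 1)) (bd Q (n + 1))"
        using dj[of "n + 1"] by simp
      ultimately have z: "Add C (a \<cdot> \<beta> (n + 1)) (b \<cdot> bd Q (n + 1)) = Zer C (ob Q (n + 1)) Y"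
        using usum[of "\<beta> (n + 1)" "bd Q (n + 1)"] by simp
      have "c \<cdot> (\<beta> n \<cdot> bd Q (n + 1)) = a \<cdot> \<beta> (n + 1)"
        using \<beta>D(4)[of "n + 1"] cx[of "\<beta> (n + 1)"] by simp
      then have "f \<cdot> bd Q (n + 1) = Add C (b \<cdot> bd Q (n + 1)) (a \<cdot> \<beta> (n + 1))"
        unfolding f_def using ab c by simp
      also have "\<dots> = Zer C (ob Q (n + 1)) Y"
        using z Add_commute[of "b \<cdot> bd Q (n + 1)" "a \<cdot> \<beta> (n + 1)"] ab by simp
      finally show ?thesis using False 1 by simp
    qed
    obtain g2 where g2: "g2 \<in> Arr C" "Dom C g2 = ob Q (n - 1)" "Cod C g2 = Y" and g2f: "g2 \<cdot> bd Q n = f"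
      using into_exE[OF QV[OF Y, of n] f(1) _ f(3) fQ] f(2) 1 by auto
    define g where "g = Add C (Neg (c \<cdot> p (n - 1))) (g2 \<cdot> r (n - 1))"
    have g: "g \<in> Arr C" "Dom C g = P (n - 1)" "Cod C g = Y" unfolding g_def using c g2 by simp_all
    have gd: "g \<cdot> (d n \<cdot> x) = Add C (Neg (c \<cdot> (p (n - 1) \<cdot> (d n \<cdot> x)))) (g2 \<cdot> (r (n - 1) \<cdot> (d n \<cdot> x)))"
      if "x \<in> Arr C" "Cod C x = P n" for x
      unfolding g_def using that c g2 by simp
    have "(g \<cdot> d n) \<cdot> i n = u \<cdot> i n"
      using gd[of "i n"] d_comp[of "i n" n] g c g2 ca ab YO unfolding a_def[symmetric] by (simp add: Sub_def)
    moreover have "(g \<cdot> d n) \<cdot> j n = u \<cdot> j n"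
    proof -
      have "(g \<cdot> d n) \<cdot> j n = Add C (Neg (c \<cdot> \<beta> n)) f"
        using gd[of "j n"] d_comp[of "j n" n] g c g2 g2f by simp
      also have "\<dots> = Add C f (Neg (c \<cdot> \<beta> n))" by (rule Add_commute) (use c f in simp_all)
      also have "\<dots> = b" unfolding f_def using Add_Sub_cancel(1)[of b "c \<cdot> \<beta> n"] ab c unfolding Sub_def by simp
      finally show ?thesis unfolding b_def .
    qed
    ultimately have "g \<cdot> d n = u" using P_eqI'[of "g \<cdot> d n" n u] g u(1,2) uP by simp
    then show ?thesis using g 1 by auto
  next
    case 2
    have uL: "Dom C u = L" using u 2 by simp
    have "\<kappa> \<cdot> bd S 3 = Zer C (ob S 3) L"
    proof (rule mono_cancel[OF kernel_mono[OF \<iota>]])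
      have "\<iota> \<cdot> (\<kappa> \<cdot> bd S 3) = i 0 \<cdot> (bd S 2 \<cdot> bd S 3)" using Comp_extend[OF \<kappa>(4), of "bd S 3"] \<kappa>(1-3) by simp
      also have "\<dots> = Zer C (ob S 3) (P 0)" using SD(6)[of 2] by simp
      finally show "\<iota> \<cdot> (\<kappa> \<cdot> bd S 3) = \<iota> \<cdot> Zer C (ob S 3) L" by simp
    qed (use \<kappa> in simp_all)
    then have "(u \<cdot> \<kappa>) \<cdot> bd S (2 + 1) = Zer C (ob S (2 + 1)) Y" using u(1,2) uL \<kappa>(1-3) by simp
    then obtain a where a: "a \<in> Arr C" "Dom C a = ob S 1" "Cod C a = Y" and a2: "a \<cdot> bd S 2 = u \<cdot> \<kappa>"
      using into_exE[OF SV[OF Y, of 2], of "u \<cdot> \<kappa>"] u(1,2) uL \<kappa>(1-3) by auto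
    \<comment> \<open>Subtracting \<open>a\<close>, applied to the \<open>S\<close> component, makes
      \<open>u\<close> vanish on \<open>\<kappa>\<close> and hence descend to
      \<open>N\<close>.\<close>
    define f where "f = Sub u (a \<cdot> (p 0 \<cdot> \<iota>))"
    have f: "f \<in> Arr C" "Dom C f = L" "Cod C f = Y" unfolding f_def using u(1,2) uL a by simp_all
    have "p 0 \<cdot> (\<iota> \<cdot> \<kappa>) = bd S 2" unfolding \<kappa>(4) by simp
    then have f\<kappa>: "f \<cdot> \<kappa> = Zer C (ob S 2) Y" unfolding f_def using u(1,2) uL a a2 \<kappa>(1-3) by simp
    have \<iota>0: "\<beta> 0 \<cdot> (r 0 \<cdot> \<iota>) = bd S 1 \<cdot> (p 0 \<cdot> \<iota>)" "bd Q 0 \<cdot> (r 0 \<cdot> \<iota>) = Zer C L (ob Q (-1))"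
      using d_zero_iff[of \<iota> 0] by simp_all
    obtain \<rho> where \<rho>: "\<rho> \<in> Arr C" "Dom C \<rho> = L" "Cod C \<rho> = N" and \<nu>\<rho>: "\<delta> 0 \<cdot> \<rho> = r 0 \<cdot> \<iota>"
      using mono_lift_of_exact[OF ex\<nu> mono\<nu>, of "r 0 \<cdot> \<iota>"] \<iota>0(2) by auto
    have \<rho>epi: "is_epi C \<rho>"
    proof -
      have NO: "N \<in> Obj C" using Dom_Obj[OF \<nu>D(1)] by simp
      obtain e x t where e: "is_epi C e" "Cod C e = Dom C (Idm C N)" "x \<in> Arr C" "Dom C x = Dom C e" "Cod C x = ob S 1"
        and t: "t \<in> Arr C" "Dom C t = Dom C e" "Cod C t = L" "\<iota> \<cdot> t = pair 0 x (\<delta> 0 \<cdot> (Idm C N \<cdot> e))"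
        by (rule cover_N[of "Idm C N"]) (use NO in auto)
      have eA: "e \<in> Arr C" "Cod C e = N" "Idm C N \<cdot> e = e" using e NO by simp_all
      have "\<delta> 0 \<cdot> (\<rho> \<cdot> t) = r 0 \<cdot> (\<iota> \<cdot> t)" using Comp_extend[OF \<nu>\<rho>, of t] \<rho> t(1-3) by simp
      also have "\<dots> = \<delta> 0 \<cdot> e" unfolding t(4) eA(3) using e(3-5) eA by simp
      finally have "\<rho> \<cdot> t = e" by (rule mono_cancel[OF mono\<nu>, rotated -1]) (use \<rho> t(1-3) eA in simp_all)
      then show ?thesis using epi_of_Comp[of \<rho> t] e(1) \<rho> t(1-3) by simp
    qed
    obtain v where v: "v \<in> Arr C" "Dom C v = N" "Cod C v = Y" "v \<cdot> \<rho> = f"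
    proof -
      \<comment> \<open>An element \<open>k\<close> of \<open>L\<close> killed by
        \<open>\<rho>\<close> has zero \<open>Q\<close> component, so its \<open>S\<close> component
        is a cycle, hence a boundary over a cover. Thus \<open>k\<close> comes from
        \<open>\<kappa>\<close> there, and \<open>f\<close> kills it.\<close>
      have "\<exists>v. v \<in> Arr C \<and> Dom C v = Cod C \<rho> \<and> Cod C v = Cod C f \<and> v \<cdot> \<rho> = f"
      proof (rule epi_factor[OF \<rho>epi, of f])
        fix k assume k: "k \<in> Arr C" "Cod C k = Dom C \<rho>" "\<rho> \<cdot> k = Zer C (Dom C k) (Cod C \<rho>)"
        have kL: "Cod C k = L" using k \<rho> by simp
        have "r 0 \<cdot> (\<iota> \<cdot> k) = \<delta> 0 \<cdot> (\<rho> \<cdot> k)" using Comp_extend[OF \<nu>\<rho>, of k] \<rho> k(1) kL by simp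
        then have rk: "r 0 \<cdot> (\<iota> \<cdot> k) = Zer C (Dom C k) (ob Q 0)" unfolding k(3) using \<rho> k(1) by simp
        have "bd S 1 \<cdot> (p 0 \<cdot> (\<iota> \<cdot> k)) = \<beta> 0 \<cdot> (r 0 \<cdot> (\<iota> \<cdot> k))"
          using arg_cong[OF \<iota>0(1), of "\<lambda>z. z \<cdot> k"] k(1) kL by simp
        then have "bd S 1 \<cdot> (p 0 \<cdot> (\<iota> \<cdot> k)) = Zer C (Dom C k) (ob S 0)" unfolding rk using k(1) by simp
        then obtain e y where e: "is_epi C e" "Cod C e = Dom C k" "y \<in> Arr C" "Dom C y = Dom C e" "Cod C y = ob S 2"
          and y: "bd S 2 \<cdot> y = (p 0 \<cdot> (\<iota> \<cdot> k)) \<cdot> e"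
          using exact_at_lift[OF exS[of 1], of "p 0 \<cdot> (\<iota> \<cdot> k)"] k(1) kL by auto
        have eA: "e \<in> Arr C" using e by simp
        have "k \<cdot> e = \<kappa> \<cdot> y"
        proof (rule mono_cancel[OF kernel_mono[OF \<iota>]])
          have re: "r 0 \<cdot> (\<iota> \<cdot> (k \<cdot> e)) = Zer C (Dom C e) (ob Q 0)"
            using arg_cong[OF rk, of "\<lambda>z. z \<cdot> e"] k(1) kL eA e(2) by simp
          have "\<iota> \<cdot> (\<kappa> \<cdot> y) = i 0 \<cdot> (bd S 2 \<cdot> y)" using Comp_extend[OF \<kappa>(4), of y] \<kappa>(1-3) e(3-5) by simp
          then have "\<iota> \<cdot> (\<kappa> \<cdot> y) = i 0 \<cdot> (p 0 \<cdot> (\<iota> \<cdot> (k \<cdot> e)))" unfolding y using k(1) kL eA e(2) by simp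
          moreover have "\<iota> \<cdot> (k \<cdot> e) = i 0 \<cdot> (p 0 \<cdot> (\<iota> \<cdot> (k \<cdot> e)))"
            by (rule P_eqI[of _ 0]) (use k(1) kL eA e(2) re in simp_all)
          ultimately show "\<iota> \<cdot> (k \<cdot> e) = \<iota> \<cdot> (\<kappa> \<cdot> y)" by simp
        qed (use k(1) kL eA e \<kappa> in simp_all)
        then have "(f \<cdot> k) \<cdot> e = (f \<cdot> \<kappa>) \<cdot> y" using f k(1) kL eA e(2-5) \<kappa>(1-3) by simp
        also have "\<dots> = Zer C (Dom C e) Y" unfolding f\<kappa> using e(3-5) YO by simp
        finally show "f \<cdot> k = Zer C (Dom C k) (Cod C f)" using epiD[OF e(1), of "f \<cdot> k"] f k(1) kL e(2) by simp
      qed (use f \<rho> in auto)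
      then show ?thesis using that \<rho> f by auto
    qed
    have "v \<cdot> bd ?Q (1 + 1) = Zer C (ob ?Q (1 + 1)) Y" using v(1-3) by simp
    then obtain g2 where g2: "g2 \<in> Arr C" "Dom C g2 = ob Q 0" "Cod C g2 = Y" and g2v: "g2 \<cdot> \<delta> 0 = v"
      using into_exE[OF QV[OF Y, of 1] v(1) _ v(3)] v(2) by auto
    define g where "g = Add C (a \<cdot> p 0) (g2 \<cdot> r 0)"
    have g: "g \<in> Arr C" "Dom C g = P 0" "Cod C g = Y" unfolding g_def using a g2 by simp_all
    have "g2 \<cdot> (r 0 \<cdot> \<iota>) = v \<cdot> \<rho>" unfolding \<nu>\<rho>[symmetric] using Comp_extend[OF g2v, of \<rho>] g2 \<rho> by simp
    then have "g \<cdot> \<iota> = Add C (a \<cdot> (p 0 \<cdot> \<iota>)) f" unfolding g_def v(4) using a g2 by simp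
    also have "\<dots> = Add C f (a \<cdot> (p 0 \<cdot> \<iota>))" by (rule Add_commute) (use a f in simp_all)
    also have "\<dots> = u" unfolding f_def by (rule Add_Sub_cancel) (use a u(1,2) uL in simp_all)
    finally show ?thesis using g 2 by (auto simp: \<epsilon>_def)
  next
    case 3
    have "u = Zer C (zero_obj C) Y" using zero_arr_Dom[of u] u 3 by simp
    moreover have "ob ?A (n - 1) \<in> Obj C" using 3 by simp
    ultimately show ?thesis using 3 YO by (intro exI[of _ "Zer C (ob ?A (n - 1)) Y"]) simp
  qed
qed

text \<open>\<open>E' m\<close> truncates \<open>E\<close> in a degree \<open>m\<close> where \<open>\<beta> m\<close> is invertible, so that the kernel of \<open>d m\<close> is \<open>ob S (m + 1)\<close>.\<close>

definition E' :: "int \<Rightarrow> ('a, 'b) cplx" where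
  "E' m = (let X = (\<lambda>n. if n > 0 \<or> n < m then zero_obj C else if n = m then ob S (m + 1) else P n) in
     \<lparr>ob = X, bd = (\<lambda>n. if n > 0 \<or> n \<le> m then Zer C (X n) (X (n - 1)) else if n = m + 1 then p m \<cdot> d n else d n)\<rparr>)"

lemma E'_sel [simp]:
  "ob (E' m) n = (if n > 0 \<or> n < m then zero_obj C else if n = m then ob S (m + 1) else P n)"
  "bd (E' m) n = (if n > 0 \<or> n \<le> m then Zer C (ob (E' m) n) (ob (E' m) (n - 1))
     else if n = m + 1 then p m \<cdot> d n else d n)"
  by (simp_all add: E'_def Let_def)

text \<open>A cone cycle in degree \<open>m\<close> is determined by its \<open>S\<close> component
  \<open>s\<close>, because its \<open>Q\<close> component must be the preimage of
  \<open>bd S (m + 1) \<cdot> s\<close> under \<open>\<beta> m\<close>. Invertibility in degree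
  \<open>m - 1\<close> ensures that this preimage is a cycle, so every \<open>s\<close> occurs.
  Hence \<open>p m\<close> identifies the kernel of \<open>d m\<close> with
  \<open>ob S (m + 1)\<close>, and the coresolution may end there.\<close>

lemma L_cores_hat:
  assumes m: "m < 0" and iso: "is_isomorphism C (\<beta> m)" and mono: "is_isomorphism C (\<beta> (m - 1))"
  shows "L \<in> cores_hat C \<V>"
proof -
  obtain b where b: "b \<in> Arr C" "Dom C b = ob S m" "Cod C b = ob Q m" "b \<cdot> \<beta> m = Idm C (ob Q m)" "\<beta> m \<cdot> b = Idm C (ob S m)"
    using iso_inverse[OF iso] by (metis \<beta>D(2,3))
  obtain b' where b': "b' \<in> Arr C" "Dom C b' = ob S (m - 1)" "Cod C b' = ob Q (m - 1)" "b' \<cdot> \<beta> (m - 1) = Idm C (ob Q (m - 1))"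
    using iso_inverse[OF mono] by (metis \<beta>D(2,3))
  have \<beta>x: "b \<cdot> (\<beta> m \<cdot> x) = x" if "x \<in> Arr C" "Cod C x = ob Q m" for x
    using Comp_extend[OF b(4), of x] that b by simp
  have \<beta>x': "b' \<cdot> (\<beta> (m - 1) \<cdot> x) = x" if "x \<in> Arr C" "Cod C x = ob Q (m - 1)" for x
    using Comp_extend[OF b'(4), of x] that b' by simp
  have kill: "x = Zer C (Dom C x) (P m)" if x: "x \<in> Arr C" "Cod C x = P m" "d m \<cdot> x = Zer C (Dom C x) (P (m - 1))"
    "p m \<cdot> x = Zer C (Dom C x) (ob S (m + 1))" for x
  proof (rule P_eqI[of _ m])
    have xO: "Dom C x \<in> Obj C" using x(1) by simp
    then show "Zer C (Dom C x) (P m) \<in> Arr C" "Cod C (Zer C (Dom C x) (P m)) = P m"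
      "p m \<cdot> x = p m \<cdot> Zer C (Dom C x) (P m)" using x by simp_all
    have "\<beta> m \<cdot> (r m \<cdot> x) = Zer C (Dom C x) (ob S m)"
      using d_zero_iff[OF x(1,2)] x(3,4) xO by simp
    then have "b \<cdot> (\<beta> m \<cdot> (r m \<cdot> x)) = Zer C (Dom C x) (ob Q m)" using b(1-3) xO by simp
    then show "r m \<cdot> x = r m \<cdot> Zer C (Dom C x) (P m)" using \<beta>x[of "r m \<cdot> x"] x xO by simp
  qed (use x in simp_all)
  have ddx: "d m \<cdot> (d (m + 1) \<cdot> x) = Zer C (Dom C x) (P (m - 1))" if "x \<in> Arr C" "Cod C x = P (m + 1)" for x
    using Comp_extend[OF d_sq[of m], of x] that by simp
  have ex1: "exact_at C f (p m \<cdot> d (m + 1))" if ex: "exact_at C f (d (m + 1))" for f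
    unfolding exact_at_def
  proof (intro conjI ballI impI)
    note D = exact_atD[OF ex]
    show "f \<in> Arr C" "Cod C f = Dom C (p m \<cdot> d (m + 1))" using D by simp_all
    show "(p m \<cdot> d (m + 1)) \<cdot> f = Zer C (Dom C f) (Cod C (p m \<cdot> d (m + 1)))" using D by simp
    fix y assume "y \<in> Arr C" "Cod C y = Dom C (p m \<cdot> d (m + 1))"
      "(p m \<cdot> d (m + 1)) \<cdot> y = Zer C (Dom C y) (Cod C (p m \<cdot> d (m + 1)))"
    then have y: "y \<in> Arr C" "Cod C y = P (m + 1)" "p m \<cdot> (d (m + 1) \<cdot> y) = Zer C (Dom C y) (ob S (m + 1))" by simp_all
    then have "d (m + 1) \<cdot> y = Zer C (Dom C y) (P m)"
      using kill[of "d (m + 1) \<cdot> y"] ddx[of y] by simp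
    then show "\<exists>e x. is_epi C e \<and> Cod C e = Dom C y \<and> x \<in> Arr C \<and> Dom C x = Dom C e \<and> Cod C x = Dom C f \<and>
           f \<cdot> x = y \<cdot> e"
      using ex y unfolding exact_at_def by simp
  qed simp_all
  have ex2: "exact_at C (p m \<cdot> d (m + 1)) (Zer C (ob S (m + 1)) (zero_obj C))" unfolding exact_at_def
  proof (intro conjI ballI impI)
    fix s assume "s \<in> Arr C" "Cod C s = Dom C (Zer C (ob S (m + 1)) (zero_obj C))"
    then have s: "s \<in> Arr C" "Cod C s = ob S (m + 1)" by simp_all
    \<comment> \<open>This is the only possible \<open>Q\<close> component of a cycle over
      \<open>s\<close>.\<close>
    define q where "q = b \<cdot> (bd S (m + 1) \<cdot> s)"
    have q: "q \<in> Arr C" "Dom C q = Dom C s" "Cod C q = ob Q m" unfolding q_def using s b(1-3) by simp_all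
    have \<beta>q: "\<beta> m \<cdot> q = bd S (m + 1) \<cdot> s"
      unfolding q_def using Comp_extend[OF b(5), of "bd S (m + 1) \<cdot> s"] b(1-3) s by simp
    have "\<beta> (m - 1) \<cdot> (bd Q m \<cdot> q) = Zer C (Dom C s) (ob S (m - 1))"
      using \<beta>_comm[of q m] \<beta>q S_sq[of s m] q s by simp
    then have "b' \<cdot> (\<beta> (m - 1) \<cdot> (bd Q m \<cdot> q)) = Zer C (Dom C s) (ob Q (m - 1))" using b'(1-3) s by simp
    then have "bd Q m \<cdot> q = Zer C (Dom C s) (ob Q (m - 1))" using \<beta>x'[of "bd Q m \<cdot> q"] q by simp
    then have "d m \<cdot> pair m s q = Zer C (Dom C s) (P (m - 1))" using d_zero_iff[of "pair m s q" m] \<beta>q q s by simp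
    then obtain e x where e: "is_epi C e" "Cod C e = Dom C s" "x \<in> Arr C" "Dom C x = Dom C e" "Cod C x = P (m + 1)"
      and x: "d (m + 1) \<cdot> x = pair m s q \<cdot> e"
      using exact_at_lift[OF d_exact[OF m], of "pair m s q"] q s by auto
    have "(p m \<cdot> d (m + 1)) \<cdot> x = p m \<cdot> (pair m s q \<cdot> e)" using e(3-5) x by simp
    also have "\<dots> = (p m \<cdot> pair m s q) \<cdot> e" by (rule Comp_assoc_Arr[symmetric]) (use e(1,2) q s in simp_all)
    also have "\<dots> = s \<cdot> e" using q s by simp
    finally show "\<exists>e x. is_epi C e \<and> Cod C e = Dom C s \<and> x \<in> Arr C \<and> Dom C x = Dom C e \<and>
        Cod C x = Dom C (p m \<cdot> d (m + 1)) \<and> (p m \<cdot> d (m + 1)) \<cdot> x = s \<cdot> e"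
      using e by - (rule exI[of _ e], rule exI[of _ x], simp)
  qed simp_all
  have "is_complex C (E' m)" unfolding is_complex_def
  proof (intro allI conjI)
    fix n :: int
    show "ob (E' m) n \<in> Obj C" by simp
    show "bd (E' m) n \<in> Hom C (ob (E' m) n) (ob (E' m) (n - 1))" using m by (auto simp: Hom_iff)
    consider "n > 0" | "n \<le> m" | "n = m + 1" "n \<le> 0" | "n = m + 2" "n \<le> 0" | "n > m + 2" "n \<le> 0" by linarith
    then show "bd (E' m) (n - 1) \<cdot> bd (E' m) n = Zer C (ob (E' m) n) (ob (E' m) (n - 2))"
    proof cases
      case 1
      have "bd (E' m) (n - 1) \<in> Arr C" "Dom C (bd (E' m) (n - 1)) = ob (E' m) (n - 1)" "Cod C (bd (E' m) (n - 1)) = ob (E' m) (n - 2)"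
        using m by auto
      moreover have "bd (E' m) n = Zer C (ob (E' m) n) (ob (E' m) (n - 1))" "ob (E' m) n \<in> Obj C"
        unfolding E'_sel(2)[of m n] using 1 by simp_all
      ultimately show ?thesis by (simp del: E'_sel)
    next
      case 4
      then show ?thesis using d_sq'[of "m + 2"] by simp
    next
      case 5
      then show ?thesis using d_sq'[of n] by simp
    qed (use m in simp_all)
  qed
  moreover have "exact_at C \<iota> (bd (E' m) 0)"
    using exact_at_kernel[OF \<iota>] ex1[of \<iota>] m by (cases "m = -1") simp_all
  moreover have "exact_at C (bd (E' m) (n + 1)) (bd (E' m) n)" if n: "n < 0" for n
  proof -
    consider "n > m + 1" | "n = m + 1" | "n = m" | "n < m" by linarith
    then show ?thesis
    proof cases
      case 1 then show ?thesis using n d_exact[OF n] by simp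
    next
      case 2 then show ?thesis using n d_exact[OF n] ex1 by simp
    next
      case 3 then show ?thesis using n ex2 by simp
    next
      case 4 then show ?thesis using n by (auto intro!: exact_at_zero)
    qed
  qed
  ultimately have "coresolution C \<V> L (E' m)
    (\<lambda>n. if n = 0 then \<iota> else Zer C (zero_obj C) (ob (E' m) n))"
    by (intro coresolutionI kernel_mono[OF \<iota>]) (use PV zeroV obS in simp_all)
  \<comment> \<open>Coresolution degree \<open>k\<close> is homological degree \<open>- k\<close>,
    which lies below \<open>m\<close> as soon as \<open>k\<close> exceeds
    \<open>- m\<close>.\<close>
  moreover have "\<forall>n > nat (- m). is_zero_obj C (ob (E' m) (- int n))" by auto
  moreover have "L \<in> Obj C" by simp
  ultimately show ?thesis unfolding cores_hat_iff by blast
qed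

text \<open>The condition on \<open>E\<close> is confined to negative degrees, the range in which
  the vanishing hypothesis speaks. In degrees 0 and 1 left exactness of Hom is enough, as
  \<open>\<delta> 0\<close> is a kernel of \<open>bd Q 0\<close>.\<close>

lemma hom_exact_descends:
  assumes W: "W \<in> Obj C" and E: "\<And>n. n < 0 \<Longrightarrow> from_ex C W E n" and S: "\<And>n. from_ex C W S n"
  shows "from_ex C W (augmented_cores C N Q \<delta>) n"
  unfolding from_ex_def
proof (intro allI impI)
  let ?Q = "augmented_cores C N Q \<delta>"
  have NO: "N \<in> Obj C" using Dom_Obj[OF \<nu>D(1)] by simp
  fix u assume u: "u \<in> Arr C" "Dom C u = W" "Cod C u = ob ?Q n" "bd ?Q n \<cdot> u = Zer C W (ob ?Q (n - 1))"
  consider "n < 0" | "n = 0" | "n = 1" | "n \<ge> 2" by linarith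
  then show "\<exists>g. g \<in> Arr C \<and> Dom C g = W \<and> Cod C g = ob ?Q (n + 1) \<and> bd ?Q (n + 1) \<cdot> g = u"
  proof cases
    case 1
    have u': "Cod C u = ob Q n" "bd Q n \<cdot> u = Zer C W (ob Q (n - 1))" using u 1 by simp_all
    have "bd S n \<cdot> (\<beta> n \<cdot> u) = Zer C W (ob S (n - 1))" using \<beta>_comm[OF u(1) u'(1)] u' W by simp
    then obtain s where s: "s \<in> Arr C" "Dom C s = W" "Cod C s = ob S (n + 1)" "bd S (n + 1) \<cdot> s = \<beta> n \<cdot> u"
      using from_exE[OF S[of n], of "\<beta> n \<cdot> u"] u(1,2) u' by auto
    have "d n \<cdot> pair n s u = Zer C W (P (n - 1))"
      using d_zero_iff[of "pair n s u" n] s u(1,2) u' by simp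
    then obtain x where x: "x \<in> Arr C" "Dom C x = W" "Cod C x = P (n + 1)" "d (n + 1) \<cdot> x = pair n s u"
      using from_exE[OF E[OF 1], of "pair n s u"] s u(1,2) u' 1 by auto
    have "bd Q (n + 1) \<cdot> (r (n + 1) \<cdot> x) = u"
      using d_comp(2)[of x "n + 1"] x s u(1,2) u' by simp
    then show ?thesis using x 1 by (intro exI[of _ "r (n + 1) \<cdot> x"]) simp
  next
    case 2
    then show ?thesis using mono_lift_of_exact[OF ex\<nu> mono\<nu>, of u] u by auto
  next
    case 3
    then have "u = Zer C W N" using monoD[OF mono\<nu>, of u] u by simp
    then show ?thesis using 3 W NO by (intro exI[of _ "Zer C W (zero_obj C)"]) simp
  next
    case 4
    then have "u = Zer C W (zero_obj C)" using zero_arr_Cod[of u] u by simp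
    then show ?thesis using 4 W by (intro exI[of _ "Zer C W (zero_obj C)"]) simp
  qed
qed

end

context abelian_category
begin

text \<open>The vanishing hypothesis is stated through \<open>from_ex\<close> instead of
  \<open>Ext_AV_vanishes\<close>, so that the lemma can be applied in \<open>opcat C\<close>, where
  it stems from vanishing for \<open>\<W>\<close>-resolutions.\<close>

lemma tate_coresolution_from_exact:
  assumes sub: "subcategory C \<V>" and W: "\<W> \<subseteq> Obj C"
    and vanish: "\<And>X L Q \<delta> n. X \<in> \<W> \<Longrightarrow> L \<in> cores_hat C \<V> \<Longrightarrow> proper_coresolution C \<V> L Q \<delta> \<Longrightarrow> 1 \<le> n \<Longrightarrow>
      from_ex C X Q (- n)"
    and tate: "tate_coresolution C \<V> N Q \<delta> S \<beta>"
    and S: "\<And>X n. X \<in> \<W> \<Longrightarrow> from_ex C X S n" and X: "X \<in> \<W>"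
  shows "from_ex C X (augmented_cores C N Q \<delta>) n"
proof -
  have V: "\<V> \<subseteq> Obj C" and z: "\<And>Z. is_zero_obj C Z \<Longrightarrow> Z \<in> \<V>"
    and bip: "\<And>A B P. A \<in> \<V> \<Longrightarrow> B \<in> \<V> \<Longrightarrow> is_biproduct C A B P \<Longrightarrow> P \<in> \<V>"
    using sub unfolding subcategory_def by blast+
  have proper: "proper_coresolution C \<V> N Q \<delta>" and ch: "chain_map C Q S \<beta>" and ta: "totally_acyclic C \<V> S"
    using tate by (auto simp: tate_coresolution_def)
  obtain n0 where n0: "\<And>n. n \<le> n0 \<Longrightarrow> is_isomorphism C (\<beta> n)" using tate by (auto simp: tate_coresolution_def)
  have res: "coresolution C \<V> N Q \<delta>" and QV: "\<And>Y n. Y \<in> \<V> \<Longrightarrow> into_ex C Y (augmented_cores C N Q \<delta>) n"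
    using proper by (auto simp: proper_coresolution_iff[OF V])
  have ex: "exact_complex C S" and obS: "\<And>n. ob S n \<in> \<V>" and SV: "\<And>Y n. Y \<in> \<V> \<Longrightarrow> into_ex C Y S n"
    using ta unfolding totally_acyclic_iff[OF V] by blast+
  have obQ: "\<And>n. ob Q n \<in> \<V>" using res by (simp add: coresolution_def)
  \<comment> \<open>The biproduct data of one degree, collected so that choice yields the five
    families required by the locale.\<close>
  define \<Phi> where "\<Phi> n P i j p r \<longleftrightarrow> P \<in> \<V> \<and> i \<in> Arr C \<and> j \<in> Arr C \<and> p \<in> Arr C \<and> r \<in> Arr C \<and>
      Dom C i = ob S (n + 1) \<and> Cod C i = P \<and> Dom C j = ob Q n \<and> Cod C j = P \<and>
      Dom C p = P \<and> Cod C p = ob S (n + 1) \<and> Dom C r = P \<and> Cod C r = ob Q n \<and>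
      p \<cdot> i = Idm C (ob S (n + 1)) \<and> r \<cdot> j = Idm C (ob Q n) \<and>
      p \<cdot> j = Zer C (ob Q n) (ob S (n + 1)) \<and> r \<cdot> i = Zer C (ob S (n + 1)) (ob Q n) \<and>
      Add C (i \<cdot> p) (j \<cdot> r) = Idm C P" for n P i j p r
  have "\<exists>P i j p r. \<Phi> n P i j p r" for n
  proof -
    have "ob S (n + 1) \<in> Obj C" "ob Q n \<in> Obj C" using V obS obQ by blast+
    from biproductE[OF this] obtain P i j p r where
      "P \<in> Obj C" "i \<in> Arr C" "j \<in> Arr C" "p \<in> Arr C" "r \<in> Arr C"
      "Dom C i = ob S (n + 1)" "Cod C i = P" "Dom C j = ob Q n" "Cod C j = P"
      "Dom C p = P" "Cod C p = ob S (n + 1)" "Dom C r = P" "Cod C r = ob Q n"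
      "p \<cdot> i = Idm C (ob S (n + 1))" "r \<cdot> j = Idm C (ob Q n)"
      "p \<cdot> j = Zer C (ob Q n) (ob S (n + 1))" "r \<cdot> i = Zer C (ob S (n + 1)) (ob Q n)"
      "Add C (i \<cdot> p) (j \<cdot> r) = Idm C P" "is_biproduct C (ob S (n + 1)) (ob Q n) P" .
    moreover from this have "P \<in> \<V>" using bip obS obQ by blast
    ultimately have "\<Phi> n P i j p r" unfolding \<Phi>_def by blast
    then show ?thesis by blast
  qed
  then have "\<forall>n. \<exists>P i j p r. \<Phi> n P i j p r" by blast
  from choice[OF this] obtain P where "\<forall>n. \<exists>i j p r. \<Phi> n (P n) i j p r" by blast
  from choice[OF this] obtain i where "\<forall>n. \<exists>j p r. \<Phi> n (P n) (i n) j p r" by blast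
  from choice[OF this] obtain j where "\<forall>n. \<exists>p r. \<Phi> n (P n) (i n) (j n) p r" by blast
  from choice[OF this] obtain p where "\<forall>n. \<exists>r. \<Phi> n (P n) (i n) (j n) (p n) r" by blast
  from choice[OF this] obtain r where \<Phi>: "\<forall>n. \<Phi> n (P n) (i n) (j n) (p n) (r n)" by blast
  interpret tate_cone C \<V> N Q S \<delta> \<beta> P i j p r
    by unfold_locales (use V z res QV ch ex obS SV \<Phi> in \<open>auto simp: \<Phi>_def\<close>)
  obtain \<iota> where "is_kernel C (d 0) \<iota>" using ex_kernel[of "d 0"] by auto
  then interpret tate_cone_kernel C \<V> N Q S \<delta> \<beta> P i j p r \<iota> by unfold_locales
  \<comment> \<open>Both \<open>m\<close> and \<open>m - 1\<close> lie in the range where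
    \<open>\<beta>\<close> is invertible, and \<open>m\<close> is negative as the truncation
    requires.\<close>
  define m where "m = min n0 (-1)"
  have "L \<in> cores_hat C \<V>" by (rule L_cores_hat[of m]) (simp_all add: m_def n0)
  moreover have "proper_coresolution C \<V> L E \<epsilon>"
    unfolding proper_coresolution_iff[OF V] using E_coresolution E_into_ex by blast
  ultimately have "from_ex C X E n" if "n < 0" for n using vanish[OF X, of L E \<epsilon> "- n"] that by simp
  then show ?thesis using hom_exact_descends S[OF X] X W by blast
qed

lemma tate_resolution_into_exact:
  assumes sub: "subcategory C \<W>" and V: "\<V> \<subseteq> Obj C"
    and vanish: "\<And>Y L P \<gamma> n. Y \<in> \<V> \<Longrightarrow> L \<in> res_hat C \<W> \<Longrightarrow> proper_resolution C \<W> L P \<gamma> \<Longrightarrow> 1 \<le> n \<Longrightarrow>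
      into_ex C Y P n"
    and tate: "tate_resolution C \<W> M T \<alpha> P \<gamma>"
    and T: "\<And>Y n. Y \<in> \<V> \<Longrightarrow> into_ex C Y T n" and Y: "Y \<in> \<V>"
  shows "into_ex C Y (augmented_res C M P \<gamma>) n"
proof -
  have W: "\<W> \<subseteq> Obj C" using sub unfolding subcategory_def by blast
  have "from_ex (opcat C) Y (augmented_cores (opcat C) M (opcx P) (\<lambda>n. \<gamma> (- n))) (- n)"
  proof (rule abelian_category.tate_coresolution_from_exact[OF abelian_opcat subcategory_opcat[OF sub] _ _
        tate_coresolution_opcat[OF W tate] _ Y])
    fix X L Q \<delta> and n :: int
    assume "X \<in> \<V>" "L \<in> cores_hat (opcat C) \<W>" "proper_coresolution (opcat C) \<W> L Q \<delta>" "1 \<le> n"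
    moreover from this have "proper_resolution C \<W> L (opcx Q) (\<lambda>n. \<delta> (- n))"
      using proper_coresolution_opcat[OF W, of L "opcx Q" "\<lambda>n. \<delta> (- n)"] by simp
    ultimately have "into_ex C X (opcx Q) n" using vanish cores_hat_opcat by blast
    then show "from_ex (opcat C) X Q (- n)" using from_ex_opcat[of C X "opcx Q" "- n"] by simp
  qed (use V T in \<open>simp_all add: from_ex_opcat\<close>)
  then show ?thesis by (simp add: augmented_cores_opcat from_ex_opcat)
qed

end

section \<open>Isomorphisms of subquotients\<close>

text \<open>The graph of the isomorphism is induced by an additive correspondence \<open>R\<close> that is total on both sides.\<close>

lemma subquotient_iso:
  assumes A: "comm_group A" "subgroup Z A" "subgroup B A" "B \<subseteq> Z"
    and A': "comm_group A'" "subgroup Z' A'" "subgroup B' A'" "B' \<subseteq> Z'"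
    and dom: "\<And>x y. R x y \<Longrightarrow> x \<in> Z \<and> y \<in> Z'"
    and mult: "\<And>x y x' y'. R x y \<Longrightarrow> R x' y' \<Longrightarrow> R (x \<otimes>\<^bsub>A\<^esub> x') (y \<otimes>\<^bsub>A'\<^esub> y')"
    and total: "\<And>x. x \<in> Z \<Longrightarrow> \<exists>y. R x y" and total': "\<And>y. y \<in> Z' \<Longrightarrow> \<exists>x. R x y"
    and B: "\<And>x y. R x y \<Longrightarrow> x \<in> B \<longleftrightarrow> y \<in> B'"
  shows "A\<lparr>carrier := Z\<rparr> Mod B \<cong> A'\<lparr>carrier := Z'\<rparr> Mod B'"
proof -
  let ?G = "A\<lparr>carrier := Z\<rparr>" and ?H = "A'\<lparr>carrier := Z'\<rparr>"
  interpret A: comm_group A by fact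
  interpret A': comm_group A' by fact
  interpret G: group ?G by (rule subgroup.subgroup_is_group[OF A(2) A.is_group])
  interpret H: group ?H by (rule subgroup.subgroup_is_group[OF A'(2) A'.is_group])
  have Hc: "comm_group ?H"
    by (rule H.group_comm_groupI) (use subgroup.mem_carrier[OF A'(2)] A'.m_comm in simp)
  have subB': "subgroup B' ?H" by (rule A'.subgroup_incl[OF A'(3,2,4)])
  interpret N: normal B' ?H by (rule comm_group.subgroup_imp_normal[OF Hc subB'])
  interpret HB: group "?H Mod B'" by (rule N.factorgroup_is_group)
  have coset_eq: "B' #>\<^bsub>?H\<^esub> y = B' #>\<^bsub>?H\<^esub> y'" if xy: "R x y" and xy': "R x y'" for x y y'
  proof -
    have x: "x \<in> Z" and y: "y \<in> Z'" and y': "y' \<in> Z'" using dom[OF xy] dom[OF xy'] by auto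
    have "inv\<^bsub>A\<^esub> x \<in> Z" using subgroup.m_inv_closed[OF A(2) x] .
    \<comment> \<open>\<open>R\<close> is only known to respect products, so a partner
      \<open>w\<close> of the inverse of \<open>x\<close> is taken from totality. The products of
      \<open>y\<close> and of \<open>y'\<close> with \<open>w\<close> are then partners of the
      identity, hence lie in \<open>B'\<close>, and so \<open>y\<close> and \<open>y'\<close> differ
      by an element of \<open>B'\<close>.\<close>
    then obtain w where w: "R (inv\<^bsub>A\<^esub> x) w" using total by blast
    have wZ: "w \<in> Z'" using dom[OF w] by simp
    have xA: "x \<in> carrier A" using subgroup.mem_carrier[OF A(2) x] .
    have 1: "\<one>\<^bsub>A\<^esub> \<in> B" by (rule subgroup.one_closed[OF A(3)])
    have yw: "y \<otimes>\<^bsub>A'\<^esub> w \<in> B'" using B[OF mult[OF xy w]] 1 xA by simp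
    have yw': "y' \<otimes>\<^bsub>A'\<^esub> w \<in> B'" using B[OF mult[OF xy' w]] 1 xA by simp
    have c: "y \<in> carrier A'" "y' \<in> carrier A'" "w \<in> carrier A'"
      using subgroup.mem_carrier[OF A'(2)] y y' wZ by auto
    have "(y' \<otimes>\<^bsub>A'\<^esub> w) \<otimes>\<^bsub>A'\<^esub> inv\<^bsub>A'\<^esub> (y \<otimes>\<^bsub>A'\<^esub> w) \<in> B'"
      using subgroup.m_closed[OF A'(3) yw' subgroup.m_inv_closed[OF A'(3) yw]] .
    moreover have "y' = ((y' \<otimes>\<^bsub>A'\<^esub> w) \<otimes>\<^bsub>A'\<^esub> inv\<^bsub>A'\<^esub> (y \<otimes>\<^bsub>A'\<^esub> w)) \<otimes>\<^bsub>A'\<^esub> y"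
    proof -
      have "inv\<^bsub>A'\<^esub> (y \<otimes>\<^bsub>A'\<^esub> w) \<otimes>\<^bsub>A'\<^esub> y = inv\<^bsub>A'\<^esub> w"
        using c by (simp add: A'.inv_mult_group A'.m_assoc)
      moreover have "((y' \<otimes>\<^bsub>A'\<^esub> w) \<otimes>\<^bsub>A'\<^esub> inv\<^bsub>A'\<^esub> (y \<otimes>\<^bsub>A'\<^esub> w)) \<otimes>\<^bsub>A'\<^esub> y =
          y' \<otimes>\<^bsub>A'\<^esub> (w \<otimes>\<^bsub>A'\<^esub> (inv\<^bsub>A'\<^esub> (y \<otimes>\<^bsub>A'\<^esub> w) \<otimes>\<^bsub>A'\<^esub> y))"
        using c by (simp only: A'.m_assoc A'.m_closed A'.inv_closed)
      ultimately show ?thesis using c by simp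
    qed
    ultimately have "y' \<in> B' #>\<^bsub>?H\<^esub> y" unfolding r_coset_def by auto
    then show ?thesis using H.repr_independence[of y' B' y] y subB' by simp
  qed
  define h where "h x = B' #>\<^bsub>?H\<^esub> (SOME y. R x y)" for x
  have h: "h x = B' #>\<^bsub>?H\<^esub> y" if "R x y" for x y
    unfolding h_def using coset_eq[OF _ that] someI[of "R x", OF that] by blast
  have hc: "h x \<in> carrier (?H Mod B')" if xZ: "x \<in> Z" for x
  proof -
    obtain y where y: "R x y" using total[OF xZ] by blast
    then show ?thesis using h[OF y] dom[OF y] by (auto simp: FactGroup_def RCOSETS_def)
  qed
  have hom: "h \<in> hom ?G (?H Mod B')"
  proof (rule homI)
    fix x x' assume "x \<in> carrier ?G" "x' \<in> carrier ?G"
    then obtain y y' where y: "R x y" "R x' y'" using total[of x] total[of x'] by auto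
    have "h (x \<otimes>\<^bsub>?G\<^esub> x') = B' #>\<^bsub>?H\<^esub> (y \<otimes>\<^bsub>?H\<^esub> y')" using h[OF mult[OF y]] by simp
    also have "\<dots> = (B' #>\<^bsub>?H\<^esub> y) <#>\<^bsub>?H\<^esub> (B' #>\<^bsub>?H\<^esub> y')"
      using N.rcos_sum[of y y'] dom[OF y(1)] dom[OF y(2)] by simp
    finally show "h (x \<otimes>\<^bsub>?G\<^esub> x') = h x \<otimes>\<^bsub>?H Mod B'\<^esub> h x'" using h[OF y(1)] h[OF y(2)] by (simp add: FactGroup_def)
  qed (use hc in simp)
  interpret h: group_hom ?G "?H Mod B'" h by unfold_locales (rule hom)
  have "h ` carrier ?G = carrier (?H Mod B')"
  proof (intro equalityI subsetI)
    fix X assume "X \<in> carrier (?H Mod B')"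
    then obtain y where y: "y \<in> Z'" "X = B' #>\<^bsub>?H\<^esub> y" by (auto simp: FactGroup_def RCOSETS_def)
    then obtain x where "R x y" using total' by blast
    then show "X \<in> h ` carrier ?G" using h dom y by (intro image_eqI[of _ _ x]) auto
  qed (use hc in auto)
  then have "?G Mod kernel ?G (?H Mod B') h \<cong> ?H Mod B'" by (rule h.FactGroup_iso)
  moreover have "kernel ?G (?H Mod B') h = B"
  proof -
    have "h x = B' \<longleftrightarrow> x \<in> B" if xZ: "x \<in> Z" for x
    proof -
      obtain y where y: "R x y" using total[OF xZ] by blast
      have "y \<in> carrier ?H" using dom[OF y] by simp
      then have "B' #>\<^bsub>?H\<^esub> y = B' \<longleftrightarrow> y \<in> B'" using H.coset_join1 H.coset_join2 subB' by blast
      then show ?thesis using h[OF y] B[OF y] by simp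
    qed
    then show ?thesis unfolding kernel_def using A(4) by (auto simp: FactGroup_def)
  qed
  ultimately show ?thesis by simp
qed

text \<open>The group \<open>bihom C X Y i j\<close> is the cohomology of \<open>Hom(X, Z)\<close> in degree \<open>i\<close>, where \<open>Z\<close> is the kernel of
  \<open>bd Y j\<close>; passing to the opposite category takes the boundaries on the side of \<open>Y\<close> instead.\<close>

definition bicycles :: "('o, 'm) cat \<Rightarrow> ('o, 'm) cplx \<Rightarrow> ('o, 'm) cplx \<Rightarrow> int \<Rightarrow> int \<Rightarrow> 'm set" where
  "bicycles C X Y i j = {u \<in> Arr C. Dom C u = ob X i \<and> Cod C u = ob Y j \<and>
     u \<cdot>\<^bsub>C\<^esub> bd X (i + 1) = Zer C (ob X (i + 1)) (ob Y j) \<and> bd Y j \<cdot>\<^bsub>C\<^esub> u = Zer C (ob X i) (ob Y (j - 1))}"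

definition biboundaries :: "('o, 'm) cat \<Rightarrow> ('o, 'm) cplx \<Rightarrow> ('o, 'm) cplx \<Rightarrow> int \<Rightarrow> int \<Rightarrow> 'm set" where
  "biboundaries C X Y i j = {v \<cdot>\<^bsub>C\<^esub> bd X i | v. v \<in> Arr C \<and> Dom C v = ob X (i - 1) \<and> Cod C v = ob Y j \<and>
     bd Y j \<cdot>\<^bsub>C\<^esub> v = Zer C (ob X (i - 1)) (ob Y (j - 1))}"

definition bihom :: "('o, 'm) cat \<Rightarrow> ('o, 'm) cplx \<Rightarrow> ('o, 'm) cplx \<Rightarrow> int \<Rightarrow> int \<Rightarrow> 'm set monoid" where
  "bihom C X Y i j = (hom_group C (ob X i) (ob Y j))\<lparr>carrier := bicycles C X Y i j\<rparr> Mod biboundaries C X Y i j"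

context abelian_category
begin

lemma hom_subgroupI:
  assumes O: "A \<in> Obj C" "B \<in> Obj C" and H: "\<And>f. f \<in> H \<Longrightarrow> f \<in> Arr C \<and> Dom C f = A \<and> Cod C f = B"
    and z: "Zer C A B \<in> H" and add: "\<And>f g. f \<in> H \<Longrightarrow> g \<in> H \<Longrightarrow> Add C f g \<in> H" and neg: "\<And>f. f \<in> H \<Longrightarrow> Neg f \<in> H"
  shows "subgroup H (hom_group C A B)"
proof -
  interpret comm_group "hom_group C A B" by (rule hom_comm_group[OF O])
  show ?thesis
  proof (rule subgroupI)
    show "H \<subseteq> carrier (hom_group C A B)" using H by (auto simp: Hom_iff)
    show "H \<noteq> {}" using z by blast
    show "inv\<^bsub>hom_group C A B\<^esub> a \<in> H" if "a \<in> H" for a using neg[OF that] H[OF that] by (simp add: Neg_def)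
  qed (use add in simp)
qed

lemma bicycles_subgroup:
  assumes "is_complex C X" "is_complex C Y"
  shows "subgroup (bicycles C X Y i j) (hom_group C (ob X i) (ob Y j))"
proof -
  note XD [simp] = complexD(1-4)[OF assms(1)] and YD [simp] = complexD(1-4)[OF assms(2)]
  show ?thesis by (rule hom_subgroupI) (auto simp: bicycles_def)
qed

lemma biboundaries_subgroup:
  assumes "is_complex C X" "is_complex C Y"
  shows "subgroup (biboundaries C X Y i j) (hom_group C (ob X i) (ob Y j))" "biboundaries C X Y i j \<subseteq> bicycles C X Y i j"
proof -
  note XD [simp] = complexD(1-4)[OF assms(1)] and YD [simp] = complexD(1-4)[OF assms(2)]
  show "subgroup (biboundaries C X Y i j) (hom_group C (ob X i) (ob Y j))"
  proof (rule hom_subgroupI)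
    show "Zer C (ob X i) (ob Y j) \<in> biboundaries C X Y i j"
      unfolding biboundaries_def by (rule CollectI, rule exI[of _ "Zer C (ob X (i - 1)) (ob Y j)"]) simp
    fix f g assume "f \<in> biboundaries C X Y i j" 
    then obtain v where v: "f = v \<cdot> bd X i" "v \<in> Arr C" "Dom C v = ob X (i - 1)" "Cod C v = ob Y j"
      "bd Y j \<cdot> v = Zer C (ob X (i - 1)) (ob Y (j - 1))" unfolding biboundaries_def by blast
    show "f \<in> Arr C \<and> Dom C f = ob X i \<and> Cod C f = ob Y j" using v by simp
    show "Neg f \<in> biboundaries C X Y i j"
      unfolding biboundaries_def using v by (intro CollectI exI[of _ "Neg v"]) simp
    assume "g \<in> biboundaries C X Y i j" 
    then obtain w where w: "g = w \<cdot> bd X i" "w \<in> Arr C" "Dom C w = ob X (i - 1)" "Cod C w = ob Y j"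
      "bd Y j \<cdot> w = Zer C (ob X (i - 1)) (ob Y (j - 1))" unfolding biboundaries_def by blast
    show "Add C f g \<in> biboundaries C X Y i j"
      unfolding biboundaries_def using v w by (intro CollectI exI[of _ "Add C v w"]) simp
  qed simp_all
  show "biboundaries C X Y i j \<subseteq> bicycles C X Y i j"
  proof
    fix f assume "f \<in> biboundaries C X Y i j" 
    then obtain v where v: "f = v \<cdot> bd X i" "v \<in> Arr C" "Dom C v = ob X (i - 1)" "Cod C v = ob Y j"
      "bd Y j \<cdot> v = Zer C (ob X (i - 1)) (ob Y (j - 1))" unfolding biboundaries_def by blast
    have "bd Y j \<cdot> f = Zer C (ob X i) (ob Y (j - 1))"
      using Comp_extend[OF v(5), of "bd X i"] v(1-4) by simp
    moreover have "f \<cdot> bd X (i + 1) = Zer C (ob X (i + 1)) (ob Y j)"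
      using complexD(6)[OF assms(1), of i] v(1-4) by simp
    ultimately show "f \<in> bicycles C X Y i j" unfolding bicycles_def using v(1-4) by simp
  qed
qed

lemma bihom_group:
  assumes "is_complex C X" "is_complex C Y"
  shows "group (bihom C X Y i j)"
proof -
  interpret A: comm_group "hom_group C (ob X i) (ob Y j)"
    by (rule hom_comm_group) (use complexD assms in auto)
  let ?H = "(hom_group C (ob X i) (ob Y j))\<lparr>carrier := bicycles C X Y i j\<rparr>"
  note Z = bicycles_subgroup[OF assms] and B = biboundaries_subgroup[OF assms]
  interpret H: group ?H by (rule subgroup.subgroup_is_group[OF Z A.is_group])
  have "comm_group ?H"
    by (rule H.group_comm_groupI) (use subgroup.mem_carrier[OF Z] A.m_comm in simp)
  then have "normal (biboundaries C X Y i j) ?H"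
    using comm_group.subgroup_imp_normal A.subgroup_incl[OF B(1) Z B(2)] by blast
  then show ?thesis unfolding bihom_def by (rule normal.factorgroup_is_group)
qed

lemma bihom_iso:
  assumes "is_complex C X" "is_complex C Y" "is_complex C X'" "is_complex C Y'"
    and "\<And>x y. R x y \<Longrightarrow> x \<in> bicycles C X Y i j \<and> y \<in> bicycles C X' Y' i' j'"
    and "\<And>x y x' y'. R x y \<Longrightarrow> R x' y' \<Longrightarrow> R (Add C x x') (Add C y y')"
    and "\<And>x. x \<in> bicycles C X Y i j \<Longrightarrow> \<exists>y. R x y" and "\<And>y. y \<in> bicycles C X' Y' i' j' \<Longrightarrow> \<exists>x. R x y"
    and "\<And>x y. R x y \<Longrightarrow> x \<in> biboundaries C X Y i j \<longleftrightarrow> y \<in> biboundaries C X' Y' i' j'"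
  shows "bihom C X Y i j \<cong> bihom C X' Y' i' j'"
  unfolding bihom_def
  by (rule subquotient_iso[of _ _ _ _ _ _ R])
    (use assms in \<open>simp_all add: hom_comm_group complexD bicycles_subgroup biboundaries_subgroup\<close>)

lemma bicyclesD:
  assumes "u \<in> bicycles C X Y i j"
  shows "u \<in> Arr C" "Dom C u = ob X i" "Cod C u = ob Y j"
     "u \<cdot> bd X (i + 1) = Zer C (ob X (i + 1)) (ob Y j)" "bd Y j \<cdot> u = Zer C (ob X i) (ob Y (j - 1))"
  using assms by (auto simp: bicycles_def)

lemma bicycles_Add:
  assumes "is_complex C X" "is_complex C Y" "u \<in> bicycles C X Y i j" "v \<in> bicycles C X Y i j"
  shows "Add C u v \<in> bicycles C X Y i j"
  using subgroup.m_closed[OF bicycles_subgroup[OF assms(1,2)] assms(3,4)] by simp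

text \<open>The map \<open>g\<close> through which \<open>u\<close> and \<open>u'\<close> are
  related is not unique, so the shift is a correspondence. Exactness in degree \<open>i\<close> and
  lifting from \<open>ob X (i - 1)\<close> make it total on both sides; the two conditions one
  degree lower in \<open>X\<close> match the boundaries.\<close>

lemma bihom_shift:
  assumes X: "is_complex C X" and Y: "is_complex C Y"
    and into: "into_ex C (ob Y j) X i" "into_ex C (ob Y j) X (i - 1)"
    and lift: "from_ex C (ob X (i - 1)) Y (j - 1)" "from_ex C (ob X (i - 2)) Y (j - 1)"
  shows "bihom C X Y i j \<cong> bihom C X Y (i - 1) (j - 1)"
proof -
  note XD [simp] = complexD(1-4)[OF X] and YD [simp] = complexD(1-4)[OF Y]
  define R where "R u u' \<longleftrightarrow> u \<in> bicycles C X Y i j \<and> u' \<in> bicycles C X Y (i - 1) (j - 1) \<and>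
     (\<exists>g. g \<in> Arr C \<and> Dom C g = ob X (i - 1) \<and> Cod C g = ob Y j \<and> g \<cdot> bd X i = u \<and> bd Y j \<cdot> g = u')" for u u'
  show ?thesis
  proof (rule bihom_iso[OF X Y X Y, of R])
    show "R x y \<Longrightarrow> x \<in> bicycles C X Y i j \<and> y \<in> bicycles C X Y (i - 1) (j - 1)" for x y
      by (simp add: R_def)
    show "R (Add C x x') (Add C y y')" if xy: "R x y" "R x' y'" for x y x' y'
    proof -
      obtain g where g: "g \<in> Arr C" "Dom C g = ob X (i - 1)" "Cod C g = ob Y j" "g \<cdot> bd X i = x" "bd Y j \<cdot> g = y"
        using xy(1) unfolding R_def by blast
      obtain g' where g': "g' \<in> Arr C" "Dom C g' = ob X (i - 1)" "Cod C g' = ob Y j" "g' \<cdot> bd X i = x'" "bd Y j \<cdot> g' = y'"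
        using xy(2) unfolding R_def by blast
      show ?thesis unfolding R_def
        using xy bicycles_Add[OF X Y] g g' unfolding R_def by (intro conjI exI[of _ "Add C g g'"]) auto
    qed
    show "\<exists>u'. R u u'" if u: "u \<in> bicycles C X Y i j" for u
    proof -
      note uD = bicyclesD[OF u]
      obtain g where g: "g \<in> Arr C" "Dom C g = ob X (i - 1)" "Cod C g = ob Y j" "g \<cdot> bd X i = u"
        by (rule into_exE[OF into(1) uD(1-4)])
      have "(bd Y j \<cdot> g) \<cdot> bd X i = Zer C (ob X i) (ob Y (j - 1))"
        using uD(5) g by simp
      moreover have "bd Y (j - 1) \<cdot> (bd Y j \<cdot> g) = Zer C (ob X (i - 1)) (ob Y (j - 2))"
        using Comp_extend[OF complexD(5)[OF Y, of j], of g] g by simp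
      ultimately have "bd Y j \<cdot> g \<in> bicycles C X Y (i - 1) (j - 1)" using g by (simp add: bicycles_def)
      then show ?thesis using u g unfolding R_def by blast
    qed
    show "\<exists>u. R u u'" if u': "u' \<in> bicycles C X Y (i - 1) (j - 1)" for u'
    proof -
      note uD = bicyclesD[OF u']
      obtain g where g: "g \<in> Arr C" "Dom C g = ob X (i - 1)" "Cod C g = ob Y j" "bd Y j \<cdot> g = u'"
        using from_exE[OF lift(1) uD(1-3,5)] by auto
      have "bd Y j \<cdot> (g \<cdot> bd X i) = Zer C (ob X i) (ob Y (j - 1))"
        using Comp_extend[OF g(4), of "bd X i"] uD(4) g by simp
      moreover have "(g \<cdot> bd X i) \<cdot> bd X (i + 1) = Zer C (ob X (i + 1)) (ob Y j)"
        using complexD(6)[OF X, of i] g by simp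
      ultimately have "g \<cdot> bd X i \<in> bicycles C X Y i j" using g by (simp add: bicycles_def)
      then show ?thesis using u' g unfolding R_def by blast
    qed
    show "u \<in> biboundaries C X Y i j \<longleftrightarrow> u' \<in> biboundaries C X Y (i - 1) (j - 1)" if R: "R u u'" for u u'
    proof -
      obtain g where g: "g \<in> Arr C" "Dom C g = ob X (i - 1)" "Cod C g = ob Y j" "g \<cdot> bd X i = u" "bd Y j \<cdot> g = u'"
        using R unfolding R_def by blast
      show ?thesis
      proof
        assume "u \<in> biboundaries C X Y i j"
        then obtain v where v: "u = v \<cdot> bd X i" "v \<in> Arr C" "Dom C v = ob X (i - 1)" "Cod C v = ob Y j"
          "bd Y j \<cdot> v = Zer C (ob X (i - 1)) (ob Y (j - 1))" unfolding biboundaries_def by blast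
        \<comment> \<open>Both \<open>g\<close> and \<open>v\<close> extend \<open>u\<close>, so
          their difference extends one step further, to \<open>k\<close>. As \<open>bd Y j\<close>
          kills \<open>v\<close>, subtracting it does not change \<open>u'\<close>.\<close>
        have "Sub g v \<cdot> bd X (i - 1 + 1) = Zer C (ob X (i - 1 + 1)) (ob Y j)"
          using g v by simp
        then obtain k where k: "k \<in> Arr C" "Dom C k = ob X (i - 1 - 1)" "Cod C k = ob Y j" "k \<cdot> bd X (i - 1) = Sub g v"
          using into_exE[OF into(2), of "Sub g v"] g v by auto
        have "u' = bd Y j \<cdot> Sub g v" using g v bicyclesD(1-3)[of u' X Y "i - 1" "j - 1"] R by (simp add: R_def)
        also have "\<dots> = (bd Y j \<cdot> k) \<cdot> bd X (i - 1)" unfolding k(4)[symmetric] using k(1-3) by simp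
        finally have "u' = (bd Y j \<cdot> k) \<cdot> bd X (i - 1)" .
        moreover have "bd Y (j - 1) \<cdot> (bd Y j \<cdot> k) = Zer C (ob X (i - 1 - 1)) (ob Y (j - 1 - 1))"
          using Comp_extend[OF complexD(5)[OF Y, of j], of k] k(1-3) by simp
        ultimately show "u' \<in> biboundaries C X Y (i - 1) (j - 1)"
          unfolding biboundaries_def using k(1-3) by (intro CollectI exI[of _ "bd Y j \<cdot> k"]) simp
      next
        assume "u' \<in> biboundaries C X Y (i - 1) (j - 1)"
        then obtain v where v: "u' = v \<cdot> bd X (i - 1)" "v \<in> Arr C" "Dom C v = ob X (i - 2)" "Cod C v = ob Y (j - 1)"
          "bd Y (j - 1) \<cdot> v = Zer C (ob X (i - 2)) (ob Y (j - 1 - 1))" unfolding biboundaries_def by auto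
        obtain k where k: "k \<in> Arr C" "Dom C k = ob X (i - 2)" "Cod C k = ob Y j" "bd Y j \<cdot> k = v"
          using from_exE[OF lift(2) v(2-5)] by auto
        \<comment> \<open>Correcting \<open>g\<close> by means of the lift \<open>k\<close> of
          \<open>v\<close> leaves its composite with \<open>bd X i\<close> unchanged and makes
          \<open>bd Y j \<cdot> g'\<close> vanish.\<close>
        define g' where "g' = Sub g (k \<cdot> bd X (i - 1))"
        have g': "g' \<in> Arr C" "Dom C g' = ob X (i - 1)" "Cod C g' = ob Y j" unfolding g'_def using g k by simp_all
        have "bd Y j \<cdot> (k \<cdot> bd X (i - 1)) = u'" using Comp_extend[OF k(4), of "bd X (i - 1)"] k v(1) by simp
        then have "bd Y j \<cdot> g' = Sub u' u'" unfolding g'_def using g k by simp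
        also have "\<dots> = Zer C (ob X (i - 1)) (ob Y (j - 1))" unfolding g(5)[symmetric] using g(1-3) by simp
        finally have "bd Y j \<cdot> g' = Zer C (ob X (i - 1)) (ob Y (j - 1))" .
        moreover have "u = g' \<cdot> bd X i"
          unfolding g'_def using g k complexD(5)[OF X, of i] bicyclesD(1-3)[of u X Y i j] R by (auto simp: R_def)
        ultimately show "u \<in> biboundaries C X Y i j" unfolding biboundaries_def using g' by blast
      qed
    qed
  qed
qed

text \<open>Bicycles and boundaries involve the second complex only through its differential in
  degree \<open>j\<close>, so two consecutive invertible components suffice. The one in degree
  \<open>j - 1\<close> shows that the inverse of \<open>\<beta> j\<close> preserves cycles.\<close>

lemma bihom_iso_right:
  assumes X: "is_complex C X" and \<beta>: "chain_map C Q S \<beta>"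
    and iso: "is_isomorphism C (\<beta> j)" "is_isomorphism C (\<beta> (j - 1))"
  shows "bihom C X Q i j \<cong> bihom C X S i j"
proof -
  note Q = chain_mapD(1)[OF \<beta>] and S = chain_mapD(2)[OF \<beta>]
  note XD [simp] = complexD(1-4)[OF X] and QD [simp] = complexD(1-4)[OF Q] and SD [simp] = complexD(1-4)[OF S]
  note \<beta>D [simp] = chain_mapD(3-5)[OF \<beta>]
  have comm: "bd S j \<cdot> (\<beta> j \<cdot> x) = \<beta> (j - 1) \<cdot> (bd Q j \<cdot> x)" if "x \<in> Arr C" "Cod C x = ob Q j" for x
    using Comp_extend[OF chain_mapD(6)[OF \<beta>, of j], of x] that by simp
  obtain b where b [simp]: "b \<in> Arr C" "Dom C b = ob S j" "Cod C b = ob Q j" and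
    bi: "b \<cdot> \<beta> j = Idm C (ob Q j)" "\<beta> j \<cdot> b = Idm C (ob S j)"
    using iso_inverse[OF iso(1)] by (metis \<beta>D(2,3))
  obtain b' where b' [simp]: "b' \<in> Arr C" "Dom C b' = ob S (j - 1)" "Cod C b' = ob Q (j - 1)" and
    bi': "b' \<cdot> \<beta> (j - 1) = Idm C (ob Q (j - 1))"
    using iso_inverse[OF iso(2)] by (metis \<beta>D(2,3))
  have b\<beta>: "b \<cdot> (\<beta> j \<cdot> x) = x" if "x \<in> Arr C" "Cod C x = ob Q j" for x
    using Comp_extend[OF bi(1), of x] that by simp
  have \<beta>b: "\<beta> j \<cdot> (b \<cdot> x) = x" if "x \<in> Arr C" "Cod C x = ob S j" for x
    using Comp_extend[OF bi(2), of x] that by simp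
  have b\<beta>': "b' \<cdot> (\<beta> (j - 1) \<cdot> x) = x" if "x \<in> Arr C" "Cod C x = ob Q (j - 1)" for x
    using Comp_extend[OF bi', of x] that by simp
  have cyc: "bd Q j \<cdot> (b \<cdot> v) = Zer C (Dom C v) (ob Q (j - 1))"
    if v: "v \<in> Arr C" "Cod C v = ob S j" "bd S j \<cdot> v = Zer C (Dom C v) (ob S (j - 1))" for v
  proof -
    have "\<beta> (j - 1) \<cdot> (bd Q j \<cdot> (b \<cdot> v)) = Zer C (Dom C v) (ob S (j - 1))"
      using comm[of "b \<cdot> v"] \<beta>b[of v] v by simp
    then have "b' \<cdot> (\<beta> (j - 1) \<cdot> (bd Q j \<cdot> (b \<cdot> v))) = Zer C (Dom C v) (ob Q (j - 1))" using v(1) by simp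
    then show ?thesis using b\<beta>'[of "bd Q j \<cdot> (b \<cdot> v)"] v by simp
  qed
  define R where "R u u' \<longleftrightarrow> u \<in> bicycles C X Q i j \<and> u' \<in> bicycles C X S i j \<and> u' = \<beta> j \<cdot> u" for u u'
  show ?thesis
  proof (rule bihom_iso[OF X Q X S, of R])
    show "R x y \<Longrightarrow> x \<in> bicycles C X Q i j \<and> y \<in> bicycles C X S i j" for x y unfolding R_def by blast
    show "R (Add C x x') (Add C y y')" if xy: "R x y" "R x' y'" for x y x' y'
    proof -
      have x: "x \<in> bicycles C X Q i j" "x' \<in> bicycles C X Q i j" "y \<in> bicycles C X S i j" "y' \<in> bicycles C X S i j"
        and y: "y = \<beta> j \<cdot> x" "y' = \<beta> j \<cdot> x'" using xy by (auto simp: R_def)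
      have "Add C y y' = \<beta> j \<cdot> Add C x x'"
        unfolding y using bicyclesD(1-3)[OF x(1)] bicyclesD(1-3)[OF x(2)] by simp
      then show ?thesis unfolding R_def using bicycles_Add[OF X Q x(1,2)] bicycles_Add[OF X S x(3,4)] by blast
    qed
    show "\<exists>u'. R u u'" if u: "u \<in> bicycles C X Q i j" for u
    proof -
      note uD = bicyclesD[OF u]
      have "\<beta> j \<cdot> u \<in> bicycles C X S i j"
        using uD comm[of u] by (simp add: bicycles_def)
      then show ?thesis using u by (auto simp: R_def)
    qed
    show "\<exists>u. R u u'" if u': "u' \<in> bicycles C X S i j" for u'
    proof -
      note uD = bicyclesD[OF u']
      have "b \<cdot> u' \<in> bicycles C X Q i j"
        using uD cyc[of u'] by (simp add: bicycles_def)
      then show ?thesis using u' \<beta>b[of u'] uD by (intro exI[of _ "b \<cdot> u'"]) (simp add: R_def)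
    qed
    show "u \<in> biboundaries C X Q i j \<longleftrightarrow> u' \<in> biboundaries C X S i j" if R: "R u u'" for u u'
    proof
      have u: "u \<in> bicycles C X Q i j" and u': "u' = \<beta> j \<cdot> u" using R by (auto simp: R_def)
      note uD = bicyclesD[OF u]
      {
        assume "u \<in> biboundaries C X Q i j"
        then obtain v where v: "u = v \<cdot> bd X i" "v \<in> Arr C" "Dom C v = ob X (i - 1)" "Cod C v = ob Q j"
          "bd Q j \<cdot> v = Zer C (ob X (i - 1)) (ob Q (j - 1))" unfolding biboundaries_def by blast
        then show "u' \<in> biboundaries C X S i j"
          unfolding biboundaries_def u' using comm[of v] by (intro CollectI exI[of _ "\<beta> j \<cdot> v"]) simp
      next
        assume "u' \<in> biboundaries C X S i j"
        then obtain v where v: "u' = v \<cdot> bd X i" "v \<in> Arr C" "Dom C v = ob X (i - 1)" "Cod C v = ob S j"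
          "bd S j \<cdot> v = Zer C (ob X (i - 1)) (ob S (j - 1))" unfolding biboundaries_def by blast
        have "u = b \<cdot> u'" unfolding u' using b\<beta>[of u] uD by simp
        also have "\<dots> = (b \<cdot> v) \<cdot> bd X i" unfolding v(1) using v(2-4) by simp
        finally show "u \<in> biboundaries C X Q i j"
          unfolding biboundaries_def using cyc[of v] v(2-5) by (intro CollectI exI[of _ "b \<cdot> v"]) simp
      }
    qed
  qed
qed

text \<open>Both kinds of boundaries are the composites
  \<open>bd Y (j + 1) \<cdot> k \<cdot> bd X i\<close>: one condition extends along the differential
  of \<open>X\<close>, the other lifts along that of \<open>Y\<close>. Since hom-groups are
  literally the same in \<open>opcat C\<close>, the result is an equality.\<close>

lemma bihom_opcat:
  assumes X: "is_complex C X" and Y: "is_complex C Y"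
    and into: "into_ex C (ob Y (j + 1)) X i" and lift: "from_ex C (ob X (i - 1)) Y j"
  shows "bihom (opcat C) (opcx Y) (opcx X) (- j) (- i) = bihom C X Y i j"
proof -
  note XD [simp] = complexD(1-4)[OF X] and YD [simp] = complexD(1-4)[OF Y]
  have "bicycles (opcat C) (opcx Y) (opcx X) (- j) (- i) = bicycles C X Y i j"
    unfolding bicycles_def by (auto simp: add.commute)
  moreover have "biboundaries (opcat C) (opcx Y) (opcx X) (- j) (- i) =
     {bd Y (j + 1) \<cdot> v | v. v \<in> Arr C \<and> Cod C v = ob Y (j + 1) \<and> Dom C v = ob X i \<and>
       v \<cdot> bd X (i + 1) = Zer C (ob X (i + 1)) (ob Y (j + 1))}"
    unfolding biboundaries_def by (simp add: add.commute)
  moreover have "\<dots> = biboundaries C X Y i j"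
  proof (intro equalityI subsetI)
    fix u assume "u \<in> {bd Y (j + 1) \<cdot> v | v. v \<in> Arr C \<and> Cod C v = ob Y (j + 1) \<and> Dom C v = ob X i \<and>
       v \<cdot> bd X (i + 1) = Zer C (ob X (i + 1)) (ob Y (j + 1))}"
    then obtain v where v: "u = bd Y (j + 1) \<cdot> v" "v \<in> Arr C" "Cod C v = ob Y (j + 1)" "Dom C v = ob X i"
       "v \<cdot> bd X (i + 1) = Zer C (ob X (i + 1)) (ob Y (j + 1))" by blast
    obtain k where k: "k \<in> Arr C" "Dom C k = ob X (i - 1)" "Cod C k = ob Y (j + 1)" "k \<cdot> bd X i = v"
      by (rule into_exE[OF into v(2,4,3,5)])
    have "u = (bd Y (j + 1) \<cdot> k) \<cdot> bd X i" unfolding v(1) k(4)[symmetric] using k(1-3) by simp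
    moreover have "bd Y j \<cdot> (bd Y (j + 1) \<cdot> k) = Zer C (ob X (i - 1)) (ob Y (j - 1))"
      using Comp_extend[OF complexD(6)[OF Y, of j], of k] k(1-3) by simp
    ultimately show "u \<in> biboundaries C X Y i j"
      unfolding biboundaries_def using k(1-3) by (intro CollectI exI[of _ "bd Y (j + 1) \<cdot> k"]) simp
  next
    fix u assume "u \<in> biboundaries C X Y i j"
    then obtain v where v: "u = v \<cdot> bd X i" "v \<in> Arr C" "Dom C v = ob X (i - 1)" "Cod C v = ob Y j"
      "bd Y j \<cdot> v = Zer C (ob X (i - 1)) (ob Y (j - 1))" unfolding biboundaries_def by blast
    obtain k where k: "k \<in> Arr C" "Dom C k = ob X (i - 1)" "Cod C k = ob Y (j + 1)" "bd Y (j + 1) \<cdot> k = v"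
      by (rule from_exE[OF lift v(2-5)])
    have "u = bd Y (j + 1) \<cdot> (k \<cdot> bd X i)" unfolding v(1) k(4)[symmetric] using k(1-3) by simp
    moreover have "(k \<cdot> bd X i) \<cdot> bd X (i + 1) = Zer C (ob X (i + 1)) (ob Y (j + 1))"
      using complexD(6)[OF X, of i] k(1-3) by simp
    ultimately show "u \<in> {bd Y (j + 1) \<cdot> v | v. v \<in> Arr C \<and> Cod C v = ob Y (j + 1) \<and> Dom C v = ob X i \<and>
       v \<cdot> bd X (i + 1) = Zer C (ob X (i + 1)) (ob Y (j + 1))}"
      using k(1-3) by (intro CollectI exI[of _ "k \<cdot> bd X i"]) simp
  qed
  ultimately show ?thesis unfolding bihom_def by simp
qed

end

section \<open>Comparison of the Tate cohomology groups\<close>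

context abelian_category
begin

section \<open>Cohomology of Hom-complexes as subquotients of abelian groups\<close>

lemma hom_cplx_comm_group:
  assumes "is_complex C X" "is_complex C Y"
  shows "comm_group (hom_cplx C X Y n)"
proof (rule comm_groupI)
  note XD [simp] = complexD(1-4)[OF assms(1)] and YD [simp] = complexD(1-4)[OF assms(2)]
  have m: "(x \<otimes>\<^bsub>hom_cplx C X Y n\<^esub> y) = (\<lambda>p. Add C (x p) (y p))" for x y by (simp add: hom_cplx_def)
  show "\<one>\<^bsub>hom_cplx C X Y n\<^esub> \<in> carrier (hom_cplx C X Y n)" by (simp add: hom_cplx_carrier hom_cplx_one)
  fix x assume x: "x \<in> carrier (hom_cplx C X Y n)"
  show "\<one>\<^bsub>hom_cplx C X Y n\<^esub> \<otimes>\<^bsub>hom_cplx C X Y n\<^esub> x = x" by (rule hom_cplx_one_mult[OF x])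
  show "\<exists>y \<in> carrier (hom_cplx C X Y n). y \<otimes>\<^bsub>hom_cplx C X Y n\<^esub> x = \<one>\<^bsub>hom_cplx C X Y n\<^esub>"
    by (rule bexI[of _ "\<lambda>p. Neg (x p)"]) (use x in \<open>simp_all add: hom_cplx_carrier hom_cplx_one m\<close>)
  fix y assume y: "y \<in> carrier (hom_cplx C X Y n)"
  show "x \<otimes>\<^bsub>hom_cplx C X Y n\<^esub> y \<in> carrier (hom_cplx C X Y n)" using x y by (simp add: hom_cplx_carrier m)
  show "x \<otimes>\<^bsub>hom_cplx C X Y n\<^esub> y = y \<otimes>\<^bsub>hom_cplx C X Y n\<^esub> x"
    using x y by (auto simp add: hom_cplx_carrier m intro!: Add_commute)
  fix z assume z: "z \<in> carrier (hom_cplx C X Y n)"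
  show "x \<otimes>\<^bsub>hom_cplx C X Y n\<^esub> y \<otimes>\<^bsub>hom_cplx C X Y n\<^esub> z = x \<otimes>\<^bsub>hom_cplx C X Y n\<^esub> (y \<otimes>\<^bsub>hom_cplx C X Y n\<^esub> z)"
    using x y z by (auto simp add: hom_cplx_carrier m intro!: Add_assoc)
qed

lemma hom_cplx_subgroupI:
  assumes "is_complex C X" "is_complex C Y" and H: "H \<subseteq> carrier (hom_cplx C X Y n)"
    and one: "\<one>\<^bsub>hom_cplx C X Y n\<^esub> \<in> H" and add: "\<And>f g. f \<in> H \<Longrightarrow> g \<in> H \<Longrightarrow> (\<lambda>p. Add C (f p) (g p)) \<in> H"
    and neg: "\<And>f. f \<in> H \<Longrightarrow> (\<lambda>p. Neg (f p)) \<in> H"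
  shows "subgroup H (hom_cplx C X Y n)"
proof -
  interpret comm_group "hom_cplx C X Y n" by (rule hom_cplx_comm_group) fact+
  have m: "(x \<otimes>\<^bsub>hom_cplx C X Y n\<^esub> y) = (\<lambda>p. Add C (x p) (y p))" for x y by (simp add: hom_cplx_def)
  show ?thesis
  proof (rule subgroupI[OF H])
    show "H \<noteq> {}" using one by blast
    fix a assume a: "a \<in> H"
    have aC: "a \<in> carrier (hom_cplx C X Y n)" and nC: "(\<lambda>p. Neg (a p)) \<in> carrier (hom_cplx C X Y n)"
      using H a neg[OF a] by auto
    have "(\<lambda>p. Neg (a p)) \<otimes>\<^bsub>hom_cplx C X Y n\<^esub> a = \<one>\<^bsub>hom_cplx C X Y n\<^esub>"
      using aC by (simp add: m hom_cplx_carrier hom_cplx_one)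
    then have "inv\<^bsub>hom_cplx C X Y n\<^esub> a = (\<lambda>p. Neg (a p))" using aC nC by (rule inv_equality)
    then show "inv\<^bsub>hom_cplx C X Y n\<^esub> a \<in> H" using neg[OF a] by simp
    fix b assume b: "b \<in> H"
    show "a \<otimes>\<^bsub>hom_cplx C X Y n\<^esub> b \<in> H" unfolding m by (rule add[OF a b])
  qed
qed

lemma hom_into_subgroups:
  assumes X: "is_complex C X" and Y: "Y \<in> Obj C"
  shows "subgroup (hom_cycles C X (conc C Y) n) (hom_cplx C X (conc C Y) n)"
    "subgroup (hom_boundaries C X (conc C Y) n) (hom_cplx C X (conc C Y) n)"
proof -
  note XD [simp] = complexD(1-4)[OF X] and cY = conc_complex[OF Y]
  have cO: "ob (conc C Y) q \<in> Obj C" for q using Y by simp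
  have one: "\<one>\<^bsub>hom_cplx C X (conc C Y) n\<^esub> \<in> carrier (hom_cplx C X (conc C Y) n)"
    unfolding hom_cplx_carrier hom_cplx_one using cO by (simp del: conc_sel)
  have one': "\<one>\<^bsub>hom_cplx C X (conc C Y) n\<^esub> (- n) = Zer C (ob X (- n)) Y" by (simp add: hom_cplx_one)
  have at: "f (- n) \<in> Arr C \<and> Dom C (f (- n)) = ob X (- n) \<and> Cod C (f (- n)) = Y"
    if "f \<in> carrier (hom_cplx C X (conc C Y) n)" for f
    using that[unfolded hom_cplx_carrier, rule_format, of "- n"] by simp
  have add: "(\<lambda>p. Add C (f p) (g p)) \<in> carrier (hom_cplx C X (conc C Y) n)"
    if "f \<in> carrier (hom_cplx C X (conc C Y) n)" "g \<in> carrier (hom_cplx C X (conc C Y) n)" for f g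
    using that unfolding hom_cplx_carrier by (simp del: conc_sel)
  have neg: "(\<lambda>p. Neg (f p)) \<in> carrier (hom_cplx C X (conc C Y) n)"
    if "f \<in> carrier (hom_cplx C X (conc C Y) n)" for f
    using that unfolding hom_cplx_carrier by (simp del: conc_sel)
  show "subgroup (hom_cycles C X (conc C Y) n) (hom_cplx C X (conc C Y) n)"
  proof (rule hom_cplx_subgroupI[OF X cY])
    show "\<one>\<^bsub>hom_cplx C X (conc C Y) n\<^esub> \<in> hom_cycles C X (conc C Y) n"
      unfolding hom_cycles_into[OF X Y] one' using one Y by simp
  qed (use add neg at Y in \<open>auto simp: hom_cycles_into[OF X Y]\<close>)
  show "subgroup (hom_boundaries C X (conc C Y) n) (hom_cplx C X (conc C Y) n)"
  proof (rule hom_cplx_subgroupI[OF X cY])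
    show "\<one>\<^bsub>hom_cplx C X (conc C Y) n\<^esub> \<in> hom_boundaries C X (conc C Y) n"
      unfolding hom_boundaries_into[OF X Y] one' using one Y by (intro conjI exI[of _ "Zer C (ob X (- n - 1)) Y"]) simp_all
    fix f assume "f \<in> hom_boundaries C X (conc C Y) n"
    then obtain v where f: "f \<in> carrier (hom_cplx C X (conc C Y) n)"
      and v: "v \<in> Arr C" "Cod C v = Y" "Dom C v = ob X (- n - 1)" "v \<cdot> bd X (- n) = f (- n)"
      unfolding hom_boundaries_into[OF X Y] by blast
    show "(\<lambda>p. Neg (f p)) \<in> hom_boundaries C X (conc C Y) n"
      unfolding hom_boundaries_into[OF X Y] using neg[OF f] v by (intro conjI exI[of _ "Neg v"]) simp_all
    fix g assume "g \<in> hom_boundaries C X (conc C Y) n"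
    then obtain w where g: "g \<in> carrier (hom_cplx C X (conc C Y) n)"
      and w: "w \<in> Arr C" "Cod C w = Y" "Dom C w = ob X (- n - 1)" "w \<cdot> bd X (- n) = g (- n)"
      unfolding hom_boundaries_into[OF X Y] by blast
    show "(\<lambda>p. Add C (f p) (g p)) \<in> hom_boundaries C X (conc C Y) n"
      unfolding hom_boundaries_into[OF X Y] using add[OF f g] v w by (intro conjI exI[of _ "Add C v w"]) simp_all
  qed (auto simp: hom_boundaries_into[OF X Y])
qed

lemma hom_from_subgroups:
  assumes Z: "is_complex C Z" and X: "X \<in> Obj C"
  shows "subgroup (hom_cycles C (conc C X) Z n) (hom_cplx C (conc C X) Z n)"
    "subgroup (hom_boundaries C (conc C X) Z n) (hom_cplx C (conc C X) Z n)"
proof -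
  note ZD [simp] = complexD(1-4)[OF Z] and cX = conc_complex[OF X]
  have cO: "ob (conc C X) q \<in> Obj C" for q using X by simp
  have one: "\<one>\<^bsub>hom_cplx C (conc C X) Z n\<^esub> \<in> carrier (hom_cplx C (conc C X) Z n)"
    unfolding hom_cplx_carrier hom_cplx_one using cO by (simp del: conc_sel)
  have one': "\<one>\<^bsub>hom_cplx C (conc C X) Z n\<^esub> 0 = Zer C X (ob Z n)" by (simp add: hom_cplx_one)
  have at: "f 0 \<in> Arr C \<and> Dom C (f 0) = X \<and> Cod C (f 0) = ob Z n"
    if "f \<in> carrier (hom_cplx C (conc C X) Z n)" for f
    using that[unfolded hom_cplx_carrier, rule_format, of 0] by simp
  have add: "(\<lambda>p. Add C (f p) (g p)) \<in> carrier (hom_cplx C (conc C X) Z n)"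
    if "f \<in> carrier (hom_cplx C (conc C X) Z n)" "g \<in> carrier (hom_cplx C (conc C X) Z n)" for f g
    using that unfolding hom_cplx_carrier by (simp del: conc_sel)
  have neg: "(\<lambda>p. Neg (f p)) \<in> carrier (hom_cplx C (conc C X) Z n)"
    if "f \<in> carrier (hom_cplx C (conc C X) Z n)" for f
    using that unfolding hom_cplx_carrier by (simp del: conc_sel)
  show "subgroup (hom_cycles C (conc C X) Z n) (hom_cplx C (conc C X) Z n)"
  proof (rule hom_cplx_subgroupI[OF cX Z])
    show "\<one>\<^bsub>hom_cplx C (conc C X) Z n\<^esub> \<in> hom_cycles C (conc C X) Z n"
      unfolding hom_cycles_from[OF Z X] one' using one X by simp
  qed (use add neg at X in \<open>auto simp: hom_cycles_from[OF Z X]\<close>)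
  show "subgroup (hom_boundaries C (conc C X) Z n) (hom_cplx C (conc C X) Z n)"
  proof (rule hom_cplx_subgroupI[OF cX Z])
    show "\<one>\<^bsub>hom_cplx C (conc C X) Z n\<^esub> \<in> hom_boundaries C (conc C X) Z n"
      unfolding hom_boundaries_from[OF Z X] one' using one X by (intro conjI exI[of _ "Zer C X (ob Z (n + 1))"]) simp_all
    fix f assume "f \<in> hom_boundaries C (conc C X) Z n"
    then obtain v where f: "f \<in> carrier (hom_cplx C (conc C X) Z n)"
      and v: "v \<in> Arr C" "Dom C v = X" "Cod C v = ob Z (n + 1)" "bd Z (n + 1) \<cdot> v = f 0"
      unfolding hom_boundaries_from[OF Z X] by blast
    show "(\<lambda>p. Neg (f p)) \<in> hom_boundaries C (conc C X) Z n"
      unfolding hom_boundaries_from[OF Z X] using neg[OF f] v by (intro conjI exI[of _ "Neg v"]) simp_all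
    fix g assume "g \<in> hom_boundaries C (conc C X) Z n"
    then obtain w where g: "g \<in> carrier (hom_cplx C (conc C X) Z n)"
      and w: "w \<in> Arr C" "Dom C w = X" "Cod C w = ob Z (n + 1)" "bd Z (n + 1) \<cdot> w = g 0"
      unfolding hom_boundaries_from[OF Z X] by blast
    show "(\<lambda>p. Add C (f p) (g p)) \<in> hom_boundaries C (conc C X) Z n"
      unfolding hom_boundaries_from[OF Z X] using add[OF f g] v w by (intro conjI exI[of _ "Add C v w"]) simp_all
  qed (auto simp: hom_boundaries_from[OF Z X])
qed

text \<open>\<open>\<iota>\<close> is a kernel of \<open>bd Y 0\<close>, so composition with it
  identifies morphisms into its source with morphisms into \<open>ob Y 0\<close> killed by
  \<open>bd Y 0\<close>. In a family \<open>f\<close> of the Hom-complex all components except the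
  one in degree \<open>n\<close> are forced to be zero.\<close>

lemma Ext_res_iso_bihom:
  assumes X: "is_complex C X" and Y: "is_complex C Y" and \<iota>: "exact_at C \<iota> (bd Y 0)" "is_mono C \<iota>"
  shows "Ext_res C X (Dom C \<iota>) n \<cong> bihom C X Y n 0"
proof -
  note XD [simp] = complexD(1-4)[OF X] and YD [simp] = complexD(1-4)[OF Y]
  let ?N = "Dom C \<iota>"
  have \<iota>D [simp]: "\<iota> \<in> Arr C" "Cod C \<iota> = ob Y 0" and \<iota>0: "bd Y 0 \<cdot> \<iota> = Zer C ?N (ob Y (-1))"
    using exact_atD[OF \<iota>(1)] by simp_all
  have N: "?N \<in> Obj C" by simp
  have cO: "ob (conc C ?N) q \<in> Obj C" for q by simp
  have \<iota>x: "bd Y 0 \<cdot> (\<iota> \<cdot> x) = Zer C (Dom C x) (ob Y (-1))" if "x \<in> Arr C" "Cod C x = ?N" for x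
    using Comp_extend[OF \<iota>0, of x] that by simp
  have cyc: "f \<in> hom_cycles C X (conc C ?N) (- n) \<longleftrightarrow> f \<in> carrier (hom_cplx C X (conc C ?N) (- n)) \<and>
      f n \<cdot> bd X (n + 1) = Zer C (ob X (n + 1)) ?N" for f
    unfolding hom_cycles_into[OF X N] by (simp add: add.commute)
  have bnd: "f \<in> hom_boundaries C X (conc C ?N) (- n) \<longleftrightarrow> f \<in> carrier (hom_cplx C X (conc C ?N) (- n)) \<and>
      (\<exists>g. g \<in> Arr C \<and> Cod C g = ?N \<and> Dom C g = ob X (n - 1) \<and> g \<cdot> bd X n = f n)" for f
    unfolding hom_boundaries_into[OF X N] by simp
  have at: "f n \<in> Arr C" "Dom C (f n) = ob X n" "Cod C (f n) = ?N" if "f \<in> carrier (hom_cplx C X (conc C ?N) (- n))" for f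
    using that[unfolded hom_cplx_carrier, rule_format, of n] by simp_all
  define R where "R f u \<longleftrightarrow> f \<in> hom_cycles C X (conc C ?N) (- n) \<and> u \<in> bicycles C X Y n 0 \<and> u = \<iota> \<cdot> f n" for f u
  show ?thesis unfolding Ext_res_def hom_homology_def bihom_def
  proof (rule subquotient_iso[of _ _ _ _ _ _ R])
    show "comm_group (hom_cplx C X (conc C ?N) (- n))" by (rule hom_cplx_comm_group[OF X conc_complex[OF N]])
    show "comm_group (hom_group C (ob X n) (ob Y 0))" by (rule hom_comm_group) simp_all
    show "R x y \<Longrightarrow> x \<in> hom_cycles C X (conc C ?N) (- n) \<and> y \<in> bicycles C X Y n 0" for x y unfolding R_def by blast
    show "R (f \<otimes>\<^bsub>hom_cplx C X (conc C ?N) (- n)\<^esub> f') (u \<otimes>\<^bsub>hom_group C (ob X n) (ob Y 0)\<^esub> u')"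
      if R: "R f u" "R f' u'" for f u f' u'
    proof -
      have f: "f \<in> hom_cycles C X (conc C ?N) (- n)" "f' \<in> hom_cycles C X (conc C ?N) (- n)"
        and u: "u \<in> bicycles C X Y n 0" "u' \<in> bicycles C X Y n 0" and eq: "u = \<iota> \<cdot> f n" "u' = \<iota> \<cdot> f' n"
        using R unfolding R_def by blast+
      have fc: "f \<in> carrier (hom_cplx C X (conc C ?N) (- n))" "f' \<in> carrier (hom_cplx C X (conc C ?N) (- n))"
        using f cyc by blast+
      have "Add C u u' = \<iota> \<cdot> (f \<otimes>\<^bsub>hom_cplx C X (conc C ?N) (- n)\<^esub> f') n"
        unfolding eq using at[OF fc(1)] at[OF fc(2)] by (simp add: hom_cplx_def)
      moreover have "f \<otimes>\<^bsub>hom_cplx C X (conc C ?N) (- n)\<^esub> f' \<in> hom_cycles C X (conc C ?N) (- n)"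
        by (rule subgroup.m_closed[OF hom_into_subgroups(1)[OF X N] f])
      ultimately show ?thesis unfolding R_def using bicycles_Add[OF X Y u] by simp
    qed
    show "\<exists>u. R f u" if f: "f \<in> hom_cycles C X (conc C ?N) (- n)" for f
    proof -
      have fc: "f \<in> carrier (hom_cplx C X (conc C ?N) (- n))" and f0: "f n \<cdot> bd X (n + 1) = Zer C (ob X (n + 1)) ?N"
        using f cyc by blast+
      have "\<iota> \<cdot> f n \<in> bicycles C X Y n 0"
        unfolding bicycles_def using at[OF fc] f0 \<iota>x[of "f n"] by simp
      then show ?thesis using f unfolding R_def by blast
    qed
    show "\<exists>f. R f u" if u: "u \<in> bicycles C X Y n 0" for u
    proof -
      note uD = bicyclesD[OF u]
      obtain v where v: "v \<in> Arr C" "Dom C v = ob X n" "Cod C v = ?N" "\<iota> \<cdot> v = u"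
        using mono_lift_of_exact[OF \<iota>, of u] uD by auto
      have "\<iota> \<cdot> (v \<cdot> bd X (n + 1)) = \<iota> \<cdot> Zer C (ob X (n + 1)) ?N"
        using Comp_extend[OF v(4), of "bd X (n + 1)"] v(1-3) uD(4) by simp
      then have v0: "v \<cdot> bd X (n + 1) = Zer C (ob X (n + 1)) ?N"
        by (rule mono_cancel[OF \<iota>(2), rotated -1]) (use v(1-3) in simp_all)
      define F where "F p = (if p = n then v else Zer C (ob X p) (ob (conc C ?N) (p + - n)))" for p
      have "F \<in> carrier (hom_cplx C X (conc C ?N) (- n))"
        unfolding hom_cplx_carrier F_def using v(1-3) cO by (auto simp del: conc_sel) (simp_all)
      then have "F \<in> hom_cycles C X (conc C ?N) (- n)" unfolding cyc using v0 by (simp add: F_def)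
      then show ?thesis unfolding R_def using u v(4) by (intro exI[of _ F]) (simp add: F_def)
    qed
    show "f \<in> hom_boundaries C X (conc C ?N) (- n) \<longleftrightarrow> u \<in> biboundaries C X Y n 0" if R: "R f u" for f u
    proof
      have fc: "f \<in> carrier (hom_cplx C X (conc C ?N) (- n))" and eq: "u = \<iota> \<cdot> f n"
        using R cyc unfolding R_def by blast+
      {
        assume "f \<in> hom_boundaries C X (conc C ?N) (- n)"
        then obtain g where g: "g \<in> Arr C" "Cod C g = ?N" "Dom C g = ob X (n - 1)" "g \<cdot> bd X n = f n"
          unfolding bnd by blast
        then show "u \<in> biboundaries C X Y n 0"
          unfolding biboundaries_def eq g(4)[symmetric] using \<iota>x[of g] g(1-3) by (intro CollectI exI[of _ "\<iota> \<cdot> g"]) simp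
      next
        assume "u \<in> biboundaries C X Y n 0"
        then obtain v where v: "u = v \<cdot> bd X n" "v \<in> Arr C" "Dom C v = ob X (n - 1)" "Cod C v = ob Y 0"
          "bd Y 0 \<cdot> v = Zer C (ob X (n - 1)) (ob Y (0 - 1))" unfolding biboundaries_def by blast
        obtain g where g: "g \<in> Arr C" "Dom C g = ob X (n - 1)" "Cod C g = ?N" "\<iota> \<cdot> g = v"
          using mono_lift_of_exact[OF \<iota>, of v] v by auto
        have "\<iota> \<cdot> (g \<cdot> bd X n) = \<iota> \<cdot> f n"
          using Comp_extend[OF g(4), of "bd X n"] g(1-3) v(1) eq by simp
        then have "g \<cdot> bd X n = f n"
          by (rule mono_cancel[OF \<iota>(2), rotated -1]) (use g(1-3) at[OF fc] in simp_all)
        then show "f \<in> hom_boundaries C X (conc C ?N) (- n)" unfolding bnd using fc g(1-3) by blast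
      }
    qed
  qed (use hom_into_subgroups[OF X N] hom_exact_into_iff(2)[OF X N] bicycles_subgroup[OF X Y] biboundaries_subgroup[OF X Y] in auto)
qed

text \<open>The two Hom-complexes place the same morphism differently, as component 0 on one side
  and as component \<open>n\<close> on the other, so their homology groups are related by an
  isomorphism, not an equality. As cycles and boundaries have been described without signs, the
  correspondence compares these components directly.\<close>

lemma Ext_cores_iso_opcat:
  assumes S: "is_complex C S" and M: "M \<in> Obj C"
  shows "Ext_cores C M S n \<cong> Ext_res (opcat C) (opcx S) M n"
proof -
  interpret D: abelian_category "opcat C" by (rule abelian_opcat)
  note SD [simp] = complexD(1-4)[OF S]
  have S': "is_complex (opcat C) (opcx S)" using S by (simp add: is_complex_opcx)
  have M': "M \<in> Obj (opcat C)" using M by simp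
  have cO: "ob (conc C M) q \<in> Obj C" for q using M by simp
  let ?A = "hom_cplx C (conc C M) S (- n)" and ?B = "hom_cplx (opcat C) (opcx S) (conc (opcat C) M) (- n)"
  let ?Z = "hom_cycles C (conc C M) S (- n)" and ?Z' = "hom_cycles (opcat C) (opcx S) (conc (opcat C) M) (- n)"
  have e: "- n - 1 = - 1 - n" by simp
  have cyc: "f \<in> ?Z \<longleftrightarrow> f \<in> carrier ?A \<and> bd S (- n) \<cdot> f 0 = Zer C M (ob S (- 1 - n))" for f
    unfolding hom_cycles_from[OF S M] e ..
  have cyc': "f \<in> ?Z' \<longleftrightarrow> f \<in> carrier ?B \<and> bd S (- n) \<cdot> f n = Zer C M (ob S (- 1 - n))" for f
    unfolding D.hom_cycles_into[OF S' M'] by simp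
  have bnd: "f \<in> hom_boundaries C (conc C M) S (- n) \<longleftrightarrow> f \<in> carrier ?A \<and>
     (\<exists>g. g \<in> Arr C \<and> Dom C g = M \<and> Cod C g = ob S (1 - n) \<and> bd S (1 - n) \<cdot> g = f 0)" for f
    unfolding hom_boundaries_from[OF S M] by simp
  have bnd': "f \<in> hom_boundaries (opcat C) (opcx S) (conc (opcat C) M) (- n) \<longleftrightarrow> f \<in> carrier ?B \<and>
     (\<exists>g. g \<in> Arr C \<and> Dom C g = M \<and> Cod C g = ob S (1 - n) \<and> bd S (1 - n) \<cdot> g = f n)" for f
    unfolding D.hom_boundaries_into[OF S' M'] by simp
  have at: "f 0 \<in> Arr C" "Dom C (f 0) = M" "Cod C (f 0) = ob S (- n)" if "f \<in> carrier ?A" for f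
    using that[unfolded hom_cplx_carrier, rule_format, of 0] by simp_all
  have at': "f n \<in> Arr C" "Dom C (f n) = M" "Cod C (f n) = ob S (- n)" if "f \<in> carrier ?B" for f
    using that[unfolded D.hom_cplx_carrier, rule_format, of n] by simp_all
  define R where "R f f' \<longleftrightarrow> f \<in> ?Z \<and> f' \<in> ?Z' \<and> f 0 = f' n" for f f'
  show ?thesis unfolding Ext_res_def Ext_cores_def hom_homology_def
  proof (rule subquotient_iso[of _ _ _ _ _ _ R])
    show "comm_group ?A" by (rule hom_cplx_comm_group[OF conc_complex[OF M] S])
    show "comm_group ?B" by (rule D.hom_cplx_comm_group[OF S' D.conc_complex[OF M']])
    show "R x y \<Longrightarrow> x \<in> ?Z \<and> y \<in> ?Z'" for x y unfolding R_def by blast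
    show "R (f \<otimes>\<^bsub>?A\<^esub> g) (f' \<otimes>\<^bsub>?B\<^esub> g')" if "R f f'" "R g g'" for f f' g g'
    proof -
      have "f \<otimes>\<^bsub>?A\<^esub> g \<in> ?Z" "f' \<otimes>\<^bsub>?B\<^esub> g' \<in> ?Z'"
        using that subgroup.m_closed[OF hom_from_subgroups(1)[OF S M]]
          subgroup.m_closed[OF D.hom_into_subgroups(1)[OF S' M']] unfolding R_def by blast+
      moreover have "(f \<otimes>\<^bsub>?A\<^esub> g) 0 = (f' \<otimes>\<^bsub>?B\<^esub> g') n"
        using that unfolding R_def by (simp add: hom_cplx_def)
      ultimately show ?thesis unfolding R_def by blast
    qed
    show "\<exists>f'. R f f'" if f: "f \<in> ?Z" for f
    proof -
      have fc: "f \<in> carrier ?A" and f0: "bd S (- n) \<cdot> f 0 = Zer C M (ob S (- 1 - n))" using f cyc by blast+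
      define F where "F p = (if p = n then f 0 else Zer C (ob (conc C M) (p + - n)) (ob S (- p)))" for p
      have "F \<in> carrier ?B"
        unfolding D.hom_cplx_carrier F_def using at[OF fc] cO by (auto simp: conc_opcat simp del: conc_sel) (simp_all)
      then have "F \<in> ?Z'" unfolding cyc' using f0 by (simp add: F_def)
      then show ?thesis unfolding R_def using f by (intro exI[of _ F]) (simp add: F_def)
    qed
    show "\<exists>f. R f f'" if f': "f' \<in> ?Z'" for f'
    proof -
      have fc: "f' \<in> carrier ?B" and f0: "bd S (- n) \<cdot> f' n = Zer C M (ob S (- 1 - n))" using f' cyc' by blast+
      define F where "F p = (if p = 0 then f' n else Zer C (ob (conc C M) p) (ob S (p + - n)))" for p
      have "F \<in> carrier ?A"
        unfolding hom_cplx_carrier F_def using at'[OF fc] cO by (auto simp del: conc_sel) (simp_all)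
      then have "F \<in> ?Z" unfolding cyc using f0 by (simp add: F_def)
      then show ?thesis unfolding R_def using f' by (intro exI[of _ F]) (simp add: F_def)
    qed
    show "f \<in> hom_boundaries C (conc C M) S (- n) \<longleftrightarrow>
        f' \<in> hom_boundaries (opcat C) (opcx S) (conc (opcat C) M) (- n)" if "R f f'" for f f'
      using that unfolding R_def bnd bnd' cyc cyc' by simp
  qed (use hom_from_subgroups[OF S M] hom_exact_from_iff(2)[OF S M] D.hom_into_subgroups[OF S' M']
      D.hom_exact_into_iff(2)[OF S' M'] in auto)
qed

text \<open>Inverting an isomorphism by \<open>iso_sym\<close> requires its source to be a
  group.\<close>

lemma Ext_cores_group:
  assumes S: "is_complex C S" and M: "M \<in> Obj C"
  shows "group (Ext_cores C M S n)"
proof -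
  let ?A = "hom_cplx C (conc C M) S (- n)" and ?Z = "hom_cycles C (conc C M) S (- n)"
  interpret A: comm_group ?A by (rule hom_cplx_comm_group[OF conc_complex[OF M] S])
  note Z = hom_from_subgroups(1)[OF S M, of "- n"] and B = hom_from_subgroups(2)[OF S M, of "- n"]
  interpret Z: group "?A\<lparr>carrier := ?Z\<rparr>" by (rule subgroup.subgroup_is_group[OF Z A.is_group])
  have "comm_group (?A\<lparr>carrier := ?Z\<rparr>)"
    by (rule Z.group_comm_groupI) (use subgroup.mem_carrier[OF Z] A.m_comm in simp)
  then have "normal (hom_boundaries C (conc C M) S (- n)) (?A\<lparr>carrier := ?Z\<rparr>)"
    using comm_group.subgroup_imp_normal A.subgroup_incl[OF B Z hom_exact_from_iff(2)[OF S M]] by blast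
  then show ?thesis unfolding Ext_cores_def hom_homology_def by (rule normal.factorgroup_is_group)
qed

text \<open>The condition \<open>into\<close> is limited to objects of \<open>Y\<close> in degrees
  at most \<open>j\<close>, because in the augmented coresolution the object in degree 1 is
  \<open>N\<close>, which is not assumed to lie in \<open>\<V>\<close>.\<close>

lemma bihom_shift_iterate:
  assumes "is_complex C X" "is_complex C Y"
    and into: "\<And>k m. k \<le> j \<Longrightarrow> into_ex C (ob Y k) X m"
    and lift: "\<And>k m. m < j \<Longrightarrow> from_ex C (ob X k) Y m"
  shows "bihom C X Y i j \<cong> bihom C X Y (i - int k) (j - int k)"
proof (induction k)
  case 0
  then show ?case using iso_refl by simp
next
  case (Suc k)
  have "bihom C X Y (i - int k) (j - int k) \<cong> bihom C X Y (i - int k - 1) (j - int k - 1)"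
    by (rule bihom_shift) (use assms in simp_all)
  then show ?case using iso_trans[OF Suc] by (simp add: algebra_simps)
qed

text \<open>The isomorphism is stated for all large \<open>D\<close>, so that its use in the
  opposite category can choose \<open>D\<close> large relative to \<open>n\<close>.\<close>

lemma Ext_res_iso_tate_bihom:
  assumes V: "\<V> \<subseteq> Obj C" and T: "is_complex C T" and TV: "\<And>Y m. Y \<in> \<V> \<Longrightarrow> into_ex C Y T m"
    and TQ: "\<And>k m. from_ex C (ob T k) (augmented_cores C N Q \<delta>) m"
    and tate: "tate_coresolution C \<V> N Q \<delta> S \<beta>"
  shows "\<exists>D0. \<forall>D \<ge> D0. Ext_res C T N n \<cong> bihom C T S (n - int D) (- int D)"
proof -
  let ?A = "augmented_cores C N Q \<delta>"
  obtain n0 where n0: "\<And>n. n \<le> n0 \<Longrightarrow> is_isomorphism C (\<beta> n)" using tate by (auto simp: tate_coresolution_def)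
  have res: "coresolution C \<V> N Q \<delta>" and ch: "chain_map C Q S \<beta>"
    using tate by (auto simp: tate_coresolution_def proper_coresolution_def)
  have A: "is_complex C ?A" and ex: "\<And>n. exact_at C (bd ?A (n + 1)) (bd ?A n)" and obQ: "\<And>n. ob Q n \<in> \<V>"
    and ch\<delta>: "chain_map C (conc C N) Q \<delta>"
    using res by (auto simp: coresolution_iff exact_complex_iff)
  have N: "N \<in> Obj C" using complexD(1)[OF chain_mapD(1)[OF ch\<delta>], of 0] by simp
  have \<delta>0: "\<delta> 0 \<in> Arr C" "Dom C (\<delta> 0) = N" "Cod C (\<delta> 0) = ob Q 0" using chain_mapD(3-5)[OF ch\<delta>, of 0] by simp_all
  have mono: "is_mono C (\<delta> 0)" using mono_if_exact_at_zero[OF ex[of 1]] N by simp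
  have "exact_at C (\<delta> 0) (bd ?A 0)" using ex[of 0] by simp
  then have 1: "Ext_res C T N n \<cong> bihom C T ?A n 0"
    using Ext_res_iso_bihom[OF T A _ mono] \<delta>0 by simp
  \<comment> \<open>From this bound on, \<open>- int D\<close> and \<open>- int D - 1\<close> are
    degrees in which \<open>\<beta>\<close> is invertible.\<close>
  have "Ext_res C T N n \<cong> bihom C T S (n - int D) (- int D)" if D: "D \<ge> nat (- n0)" for D
  proof -
    have "bihom C T ?A n 0 \<cong> bihom C T ?A (n - int D) (0 - int D)"
      by (rule bihom_shift_iterate[OF T A]) (use TV obQ TQ in simp_all)
    \<comment> \<open>In degrees at most 0 the augmented complex coincides with
      \<open>Q\<close>.\<close>
    moreover have "bihom C T ?A (n - int D) (0 - int D) = bihom C T Q (n - int D) (- int D)"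
      by (simp add: bihom_def bicycles_def biboundaries_def)
    moreover have "bihom C T Q (n - int D) (- int D) \<cong> bihom C T S (n - int D) (- int D)"
      by (rule bihom_iso_right[OF T ch]) (use n0 D in simp_all)
    ultimately show ?thesis using iso_trans[OF 1] iso_trans by metis
  qed
  then show ?thesis by blast
qed

theorem tate_balance:
  assumes subW: "subcategory C \<W>" and subV: "subcategory C \<V>"
    and perpV: "perp C (Gor C \<W>) \<V>" and perpW: "perp C \<W> (Gor C \<V>)"
    and vanW: "Ext_WA_vanishes C \<W> (res_hat C \<W>) \<V>" and vanV: "Ext_AV_vanishes C \<V> \<W> (cores_hat C \<V>)"
    and tateM: "tate_resolution C \<W> M T \<alpha> P \<gamma>" and tateN: "tate_coresolution C \<V> N Q \<delta> S \<beta>"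
  shows "Ext_res C T N n \<cong> Ext_cores C M S n"
proof -
  have W: "\<W> \<subseteq> Obj C" and V: "\<V> \<subseteq> Obj C" using subW subV by (auto simp: subcategory_def)
  have taT: "totally_acyclic C \<W> T" and taS: "totally_acyclic C \<V> S"
    using tateM tateN by (auto simp: tate_resolution_def tate_coresolution_def)
  have T: "is_complex C T" and S: "is_complex C S" using taT taS by (auto simp: totally_acyclic_def exact_complex_def)
  have obT: "\<And>n. ob T n \<in> \<W>" and obS: "\<And>n. ob S n \<in> \<V>" using taT taS by (auto simp: totally_acyclic_def)
  have TV: "into_ex C Y T m" if "Y \<in> \<V>" for Y m
    by (rule totally_acyclic_into_ex[OF W taT perpV that V])
  have SW: "from_ex C X S m" if "X \<in> \<W>" for X m
    by (rule totally_acyclic_from_ex[OF V taS perpW that W])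
  have WQ: "from_ex C X (augmented_cores C N Q \<delta>) m" if "X \<in> \<W>" for X m
  proof (rule tate_coresolution_from_exact[OF subV W _ tateN SW that])
    fix X L Q \<delta> and n :: int
    assume *: "X \<in> \<W>" "L \<in> cores_hat C \<V>" "proper_coresolution C \<V> L Q \<delta>" "1 \<le> n"
    then have "trivial_group (Ext_cores C X Q n)" "is_complex C Q" "X \<in> Obj C"
      using vanV W unfolding Ext_AV_vanishes_def proper_coresolution_def coresolution_def by blast+
    then show "from_ex C X Q (- n)" by (rule Ext_cores_trivialD)
  qed
  have VP: "into_ex C Y (augmented_res C M P \<gamma>) m" if "Y \<in> \<V>" for Y m
  proof (rule tate_resolution_into_exact[OF subW V _ tateM TV that])
    fix Y L P \<gamma> and n :: int
    assume *: "Y \<in> \<V>" "L \<in> res_hat C \<W>" "proper_resolution C \<W> L P \<gamma>" "1 \<le> n"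
    then have "trivial_group (Ext_res C P Y n)" "is_complex C P" "Y \<in> Obj C"
      using vanW V unfolding Ext_WA_vanishes_def proper_resolution_def resolution_def by blast+
    then show "into_ex C Y P n" by (rule Ext_res_trivialD)
  qed
  have ch: "chain_map C P (conc C M) \<gamma>"
    using tateM by (simp add: tate_resolution_def proper_resolution_def resolution_iff)
  then have M: "M \<in> Obj C" using complexD(1)[OF chain_mapD(2)[OF ch], of 0] by simp
  obtain D where D: "Ext_res C T N n \<cong> bihom C T S (n - int D) (- int D)"
    using Ext_res_iso_tate_bihom[OF V T TV WQ[OF obT] tateN, of n] by blast
  \<comment> \<open>The same comparison in \<open>opcat C\<close>, with \<open>S\<close> and
    \<open>T\<close> exchanged, computes the cohomology of \<open>Hom(M, S)\<close>.\<close>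
  have "\<exists>D0. \<forall>D \<ge> D0. Ext_res (opcat C) (opcx S) M n \<cong> bihom (opcat C) (opcx S) (opcx T) (n - int D) (- int D)"
  proof (rule abelian_category.Ext_res_iso_tate_bihom[OF abelian_opcat _ _ _ _ tate_coresolution_opcat[OF W tateM]])
    show "from_ex (opcat C) (ob (opcx S) k) (augmented_cores (opcat C) M (opcx P) (\<lambda>n. \<gamma> (- n))) m" for k m
      unfolding augmented_cores_opcat from_ex_opcat using VP obS by simp
  qed (use W S SW in \<open>simp_all add: is_complex_opcx into_ex_opcat\<close>)
  then obtain D0 where D0: "\<And>D. D \<ge> D0 \<Longrightarrow>
      Ext_res (opcat C) (opcx S) M n \<cong> bihom (opcat C) (opcx S) (opcx T) (n - int D) (- int D)" by blast
  \<comment> \<open>With \<open>D'\<close> at least \<open>n\<close>, the integer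
    \<open>D' + D - n\<close> is a natural number: it counts the shifts from position
    \<open>(D', D' - n)\<close> to position \<open>(n - D, - D)\<close>, both of which have
    difference \<open>n\<close>.\<close>
  define D' where "D' = max D0 (nat n)"
  have "nat n \<le> D'" by (simp add: D'_def)
  have "bihom (opcat C) (opcx S) (opcx T) (- (int D' - n)) (- int D') = bihom C T S (int D') (int D' - n)"
    by (rule bihom_opcat[OF T S TV[OF obS] SW[OF obT]])
  then have M1: "Ext_cores C M S n \<cong> bihom C T S (int D') (int D' - n)"
    using iso_trans[OF Ext_cores_iso_opcat[OF S M, of n] D0[of D']] by (simp add: D'_def)
  have e: "int D' - int (nat (int D' + int D - n)) = n - int D" "int D' - n - int (nat (int D' + int D - n)) = - int D"
    using \<open>nat n \<le> D'\<close> by simp_all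
  have "bihom C T S (int D') (int D' - n) \<cong> bihom C T S (n - int D) (- int D)"
    using bihom_shift_iterate[OF T S TV[OF obS] SW[OF obT], of "int D'" "int D' - n" "nat (int D' + int D - n)"] unfolding e .
  with M1 have "Ext_cores C M S n \<cong> bihom C T S (n - int D) (- int D)" by (rule iso_trans)
  then have "bihom C T S (n - int D) (- int D) \<cong> Ext_cores C M S n"
    by (rule group.iso_sym[OF Ext_cores_group[OF S M]])
  with D show ?thesis by (rule iso_trans)
qed

end

theorem theorem6p1:
  fixes C :: "('o, 'm) cat" and \<W> \<V> :: "'o set"
  assumes "abelian_category C"
    and "subcategory C \<W>" and "subcategory C \<V>"
    and "perp C \<W> \<W>" and "perp C \<V> \<V>"
    and "perp C (Gor C \<W>) \<V>" and "perp C \<W> (Gor C \<V>)"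
    and "closed_under_kernels_of_epis C \<W>" and "closed_under_direct_summands C \<W>"
    and "closed_under_cokernels_of_monos C \<V>" and "closed_under_direct_summands C \<V>"
    and "Ext_WA_vanishes C \<W> (res_hat C \<W>) \<V>"
    and "Ext_AV_vanishes C \<V> \<W> (cores_hat C \<V>)"
  shows "(\<forall>M \<in> res_hat C (Gor C \<W>). \<forall>N \<in> cores_hat C (Gor C \<V>). \<forall>n \<ge> 1. \<forall>G H.
            tate_Ext_WA C \<W> M N n G \<longrightarrow> tate_Ext_AV C \<V> M N n H \<longrightarrow> G \<cong> H) \<and>
         (res_hat C \<W> = cores_hat C \<V> \<longrightarrow>
          (\<forall>M \<in> res_hat C (Gor C \<W>). \<forall>N \<in> cores_hat C (Gor C \<V>). \<forall>n. \<forall>G H.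
            tate_Ext_WA C \<W> M N n G \<longrightarrow> tate_Ext_AV C \<V> M N n H \<longrightarrow> G \<cong> H))"
proof -
  have "G \<cong> H" if "tate_Ext_WA C \<W> M N n G" "tate_Ext_AV C \<V> M N n H" for M N n G H
    using that abelian_category.tate_balance[OF assms(1-3,6,7,12,13)]
    unfolding tate_Ext_WA_def tate_Ext_AV_def by blast
  then show ?thesis by blast
qed

end
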